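(* Let $0<\zeta<\frac\pi2$ and let $N$ be an arbitrary non-negative integer. Let $\nu,\alpha,\beta$ be complex numbers with $\Re(2\nu+\alpha+\beta+1)>N$. Write $\sigma=2\nu+\alpha+\beta$, $G_N=\dfrac{\Gamma(\Re(\sigma)-N+1)}{|\Gamma(\sigma+2)|}$, and for non-negative integers $n,\ell$ $$\zeta^{(1)}_{\nu,n,\ell}=(\sigma-n+1)\zeta-\left(\alpha-\ell+\tfrac12\right)\tfrac\pi2,\qquad \zeta^{(2)}_{\nu,n,\ell}=(\sigma-n+1)\zeta+\left(\alpha+\ell+\tfrac12\right)\tfrac\pi2 .$$ Define the remainders $R_N^{(P)},R_N^{(\mathrm Q)},R_N^{(\mathsf Q)}$ (functions of $\nu,\zeta,\alpha,\beta$) by $$2^{\sigma}B(\nu+1,\nu+\alpha+\beta+1)P_\nu^{(\alpha,\beta)}(\cos(2\zeta))=\frac{1}{\sin^{\alpha+1/2}\zeta\cos^{\beta+1/2}\zeta}\left(\sum_{n=0}^{N-1}\left(\sum_{\ell=0}^n\frac{a_\ell(\alpha)a_{n-\ell}(\beta)}{\sin^\ell\zeta\cos^{n-\ell}\zeta}\cos\left(\zeta^{(1)}_{\nu,n,\ell}\right)\right)\frac{\Gamma(\sigma-n+1)}{\Gamma(\sigma+2)}+R_N^{(P)}\right),$$ $$\frac{2^{\sigma+1}}{\pi}B(\nu+1,\nu+\alpha+\beta+1)\mathrm Q_\nu^{(\alpha,\beta)}(\cos(2\zeta))=\frac{1}{\sin^{\alpha+1/2}\zeta\cos^{\beta+1/2}\zeta}\left(\sum_{n=0}^{N-1}\left(\sum_{\ell=0}^n\frac{a_\ell(\alpha)a_{n-\ell}(\beta)}{\sin^\ell\zeta\cos^{n-\ell}\zeta}\cos\left(\zeta^{(2)}_{\nu,n,\ell}\right)\right)\frac{\Gamma(\sigma-n+1)}{\Gamma(\sigma+2)}+R_N^{(\mathrm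 Q)}\right),$$ $$\frac{2^{\sigma+1}}{\pi}B(\nu+1,\nu+\alpha+\beta+1)\mathsf Q_\nu^{(\alpha,\beta)}(\cos(2\zeta))=\frac{-1}{\sin^{\alpha+1/2}\zeta\cos^{\beta+1/2}\zeta}\left(\sum_{n=0}^{N-1}\left(\sum_{\ell=0}^n\frac{a_\ell(\alpha)a_{n-\ell}(\beta)}{\sin^\ell\zeta\cos^{n-\ell}\zeta}\sin\left(\zeta^{(1)}_{\nu,n,\ell}\right)\right)\frac{\Gamma(\sigma-n+1)}{\Gamma(\sigma+2)}+R_N^{(\mathsf Q)}\right).$$ Then $|R_N^{(P)}|$ and $|R_N^{(\mathsf Q)}|$ are both bounded by: (i) if $|\Re\alpha|<N+\frac12$ and $|\Re\beta|<\frac12$, $$\left(\frac{\hat a_N(\alpha)\hat a_0(\beta)}{\sin^N\zeta}\cosh\left(\Im\zeta^{(1)}_{\nu,N,N}\right)+\sum_{\ell=0}^{N-1}\frac{|a_\ell(\alpha)|\,\hat a_{N-\ell}(\beta)}{\sin^\ell\zeta\cos^{N-\ell}\zeta}\cosh\left(\Im\zeta^{(1)}_{\nu,N,\ell}\right)\right)G_N;$$ (ii) if $|\Re\alpha|<\frac12$ and $|\Re\beta|<N+\frac12$, $$\left(\frac{\hat a_0(\alpha)\hat a_N(\beta)}{\cos^N\zeta}\cosh\left(\Im\zeta^{(1)}_{\nu,N,0}\right)+\sum_{\ell=1}^{N}\frac{\hat a_\ell(\alpha)|a_{N-\ell}(\beta)|}{\sin^\ell\zeta\cos^{N-\ell}\zeta}\cosh\left(\Im\zeta^{(1)}_{\nu,N,\ell}\right)\right)G_N;$$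 (iii) if $|\Re\alpha|,|\Re\beta|<\frac12$, $$\left(\sum_{\ell=0}^{N}\frac{\hat a_\ell(\alpha)\hat a_{N-\ell}(\beta)}{\sin^\ell\zeta\cos^{N-\ell}\zeta}\cosh\left(\Im\zeta^{(1)}_{\nu,N,\ell}\right)\right)G_N.$$ Moreover, $|R_N^{(\mathrm Q)}|$ satisfies the bounds (i), (ii), (iii), under the same respective conditions, with each $\zeta^{(1)}_{\nu,N,\ell}$ ($0\le\ell\le N$) replaced by $\zeta^{(2)}_{\nu,N,\ell}$.
   Context: $\mathbf F\left({a,b\atop c};x\right)$ is the regularised hypergeometric function, $\sum_{n\ge0}\frac{(a)_n(b)_n}{\Gamma(c+n)\,n!}x^n$ for $|x|<1$, continued analytically to $x\in\mathbb C\setminus[1,\infty)$; $(w)_n=w(w+1)\cdots(w+n-1)$, $(w)_0=1$; $B$ is the beta function; $\mathbb Z^-=\{-1,-2,\dots\}$. The Jacobi functions are $$P_\nu^{(\alpha,\beta)}(z)=\frac{\Gamma(\nu+\alpha+1)}{\Gamma(\nu+1)}\mathbf F\left({-\nu,\nu+\alpha+\beta+1\atop \alpha+1};\frac{1-z}{2}\right),\quad z\in\mathbb C\setminus(-\infty,-1],\ \nu+\alpha\notin\mathbb Z^-,$$ $$Q_\nu^{(\alpha,\beta)}(z)=\frac{2^{\nu+\alpha+\beta}\Gamma(\nu+\alpha+1)\Gamma(\nu+\beta+1)}{(z-1)^{\nu+\alpha+1}(z+1)^\beta}\mathbf F\left({\nu+1,\nu+\alpha+1\atop 2\nu+\alpha+\beta+2};\frac{2}{1-z}\right),\quad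 z\in\mathbb C\setminus(-\infty,1],\ \nu+\alpha,\nu+\beta\notin\mathbb Z^-,$$ with principal powers. For $-1<x<1$ and $\nu+\alpha,\nu+\beta\notin\mathbb Z^-$ the associated functions are $$\mathrm Q_\nu^{(\alpha,\beta)}(x)=\lim_{\eta\to0^+}\tfrac12\left(Q_\nu^{(\alpha,\beta)}(x+i\eta)+Q_\nu^{(\alpha,\beta)}(x-i\eta)\right),$$ $$\mathsf Q_\nu^{(\alpha,\beta)}(x)=\lim_{\eta\to0^+}\tfrac12\left(e^{\pi\alpha i}Q_\nu^{(\alpha,\beta)}(x+i\eta)+e^{-\pi\alpha i}Q_\nu^{(\alpha,\beta)}(x-i\eta)\right).$$ Parameters are understood to be such that the functions appearing are defined. Also $$a_n(\mu)=\frac{(\frac12+\mu)_n(\frac12-\mu)_n}{(-2)^n n!},\qquad \hat a_n(\mu)=\left|\frac{\cos(\pi\mu)}{\cos(\pi\Re\mu)}\,a_n(\Re\mu)\right|,$$ where, if $2\Re\mu$ is an odd integer, $a_n(\Re\mu)/\cos(\pi\Re\mu)$ in $\hat a_n(\mu)$ is replaced by its limiting value $\lim_{x\to\Re\mu}a_n(x)/\cos(\pi x)$ (used only for $|\Re\mu|<n+\frac12$). *)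

theory Defs
  imports "HOL-Complex_Analysis.Complex_Analysis"
begin

text \<open>
  The regularised hypergeometric function is the holomorphic function on the slit plane
  \<open>\<complex> \<setminus> [1,\<infinity>)\<close> that extends the hypergeometric series; by the identity theorem it is
  unique there. Its values on the slit are unspecified and never used.
\<close>

definition hyp_slit_plane :: "complex set" where
  "hyp_slit_plane = - (complex_of_real ` {1..})"

definition hypergeo_reg :: "complex \<Rightarrow> complex \<Rightarrow> complex \<Rightarrow> complex \<Rightarrow> complex" where
  "hypergeo_reg a b c =
     (SOME f. f holomorphic_on hyp_slit_plane \<and>
        (\<forall>x. norm x < 1 \<longrightarrow>
           (\<lambda>n. pochhammer a n * pochhammer b n * rGamma (c + of_nat n) / fact n * x ^ n)
             sums f x))"

definition jacobi_P :: "complex \<Rightarrow> complex \<Rightarrow> complex \<Rightarrow> complex \<Rightarrow> complex" where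
  "jacobi_P \<nu> \<alpha> \<beta> z =
     Gamma (\<nu> + \<alpha> + 1) * rGamma (\<nu> + 1) *
     hypergeo_reg (- \<nu>) (\<nu> + \<alpha> + \<beta> + 1) (\<alpha> + 1) ((1 - z) / 2)"

definition jacobi_Q :: "complex \<Rightarrow> complex \<Rightarrow> complex \<Rightarrow> complex \<Rightarrow> complex" where
  "jacobi_Q \<nu> \<alpha> \<beta> z =
     2 powr (\<nu> + \<alpha> + \<beta>) * Gamma (\<nu> + \<alpha> + 1) * Gamma (\<nu> + \<beta> + 1) /
       ((z - 1) powr (\<nu> + \<alpha> + 1) * (z + 1) powr \<beta>) *
     hypergeo_reg (\<nu> + 1) (\<nu> + \<alpha> + 1) (2 * \<nu> + \<alpha> + \<beta> + 2) (2 / (1 - z))"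

text \<open>
  The two associated functions on the cut \<open>-1 < x < 1\<close>: \<open>jacobi_Q_mean\<close> is the plain average
  of the boundary values (upright roman Q), \<open>jacobi_Q_cut\<close> is the average weighted with
  \<open>exp (\<plusminus>\<pi>\<alpha>\<i>)\<close> (sans-serif Q).
\<close>

definition jacobi_Q_mean :: "complex \<Rightarrow> complex \<Rightarrow> complex \<Rightarrow> real \<Rightarrow> complex" where
  "jacobi_Q_mean \<nu> \<alpha> \<beta> x =
     Lim (at_right 0) (\<lambda>\<eta>::real. 1 / 2 *
       (jacobi_Q \<nu> \<alpha> \<beta> (of_real x + \<i> * of_real \<eta>) +
        jacobi_Q \<nu> \<alpha> \<beta> (of_real x - \<i> * of_real \<eta>)))"

definition jacobi_Q_cut :: "complex \<Rightarrow> complex \<Rightarrow> complex \<Rightarrow> real \<Rightarrow> complex" where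
  "jacobi_Q_cut \<nu> \<alpha> \<beta> x =
     Lim (at_right 0) (\<lambda>\<eta>::real. 1 / 2 *
       (exp (of_real pi * \<alpha> * \<i>) * jacobi_Q \<nu> \<alpha> \<beta> (of_real x + \<i> * of_real \<eta>) +
        exp (- (of_real pi * \<alpha> * \<i>)) * jacobi_Q \<nu> \<alpha> \<beta> (of_real x - \<i> * of_real \<eta>)))"

definition acoeff :: "nat \<Rightarrow> 'a \<Rightarrow> 'a::field_char_0" where
  "acoeff n \<mu> = pochhammer (1 / 2 + \<mu>) n * pochhammer (1 / 2 - \<mu>) n / ((- 2) ^ n * fact n)"

definition acoeff_over_cos :: "nat \<Rightarrow> real \<Rightarrow> real" where
  "acoeff_over_cos n x =
     (if \<exists>k::int. odd k \<and> 2 * x = of_int k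
      then Lim (at x) (\<lambda>t. acoeff n t / cos (pi * t))
      else acoeff n x / cos (pi * x))"

definition ahat :: "nat \<Rightarrow> complex \<Rightarrow> real" where
  "ahat n \<mu> = norm (cos (of_real pi * \<mu>) * of_real (acoeff_over_cos n (Re \<mu>)))"

definition zeta1 :: "complex \<Rightarrow> complex \<Rightarrow> real \<Rightarrow> complex \<Rightarrow> nat \<Rightarrow> nat \<Rightarrow> complex" where
  "zeta1 \<alpha> \<beta> \<zeta> \<nu> n l =
     (2 * \<nu> + \<alpha> + \<beta> - of_nat n + 1) * of_real \<zeta> - (\<alpha> - of_nat l + 1 / 2) * (of_real pi / 2)"

definition zeta2 :: "complex \<Rightarrow> complex \<Rightarrow> real \<Rightarrow> complex \<Rightarrow> nat \<Rightarrow> nat \<Rightarrow> complex" where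
  "zeta2 \<alpha> \<beta> \<zeta> \<nu> n l =
     (2 * \<nu> + \<alpha> + \<beta> - of_nat n + 1) * of_real \<zeta> + (\<alpha> + of_nat l + 1 / 2) * (of_real pi / 2)"

definition Gfactor :: "nat \<Rightarrow> complex \<Rightarrow> real" where
  "Gfactor N \<sigma> = Gamma (Re \<sigma> - of_nat N + 1) / norm (Gamma (\<sigma> + 2))"

text \<open>
  The three bounds. The argument \<open>Z\<close> stands for \<open>\<lambda>l. \<zeta>\<^bsub>\<nu>,N,l\<^esub>\<close>, in either of its two versions
  \<open>zeta1 \<alpha> \<beta> \<zeta> \<nu> N\<close> and \<open>zeta2 \<alpha> \<beta> \<zeta> \<nu> N\<close>.
\<close>

definition bound_i ::
    "nat \<Rightarrow> complex \<Rightarrow> complex \<Rightarrow> complex \<Rightarrow> real \<Rightarrow> (nat \<Rightarrow> complex) \<Rightarrow> real" where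
  "bound_i N \<nu> \<alpha> \<beta> \<zeta> Z =
     (ahat N \<alpha> * ahat 0 \<beta> / sin \<zeta> ^ N * cosh (Im (Z N)) +
      (\<Sum>l<N. norm (acoeff l \<alpha>) * ahat (N - l) \<beta> / (sin \<zeta> ^ l * cos \<zeta> ^ (N - l)) *
        cosh (Im (Z l)))) * Gfactor N (2 * \<nu> + \<alpha> + \<beta>)"

definition bound_ii ::
    "nat \<Rightarrow> complex \<Rightarrow> complex \<Rightarrow> complex \<Rightarrow> real \<Rightarrow> (nat \<Rightarrow> complex) \<Rightarrow> real" where
  "bound_ii N \<nu> \<alpha> \<beta> \<zeta> Z =
     (ahat 0 \<alpha> * ahat N \<beta> / cos \<zeta> ^ N * cosh (Im (Z 0)) +
      (\<Sum>l=1..N. ahat l \<alpha> * norm (acoeff (N - l) \<beta>) / (sin \<zeta> ^ l * cos \<zeta> ^ (N - l)) *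
        cosh (Im (Z l)))) * Gfactor N (2 * \<nu> + \<alpha> + \<beta>)"

definition bound_iii ::
    "nat \<Rightarrow> complex \<Rightarrow> complex \<Rightarrow> complex \<Rightarrow> real \<Rightarrow> (nat \<Rightarrow> complex) \<Rightarrow> real" where
  "bound_iii N \<nu> \<alpha> \<beta> \<zeta> Z =
     (\<Sum>l\<le>N. ahat l \<alpha> * ahat (N - l) \<beta> / (sin \<zeta> ^ l * cos \<zeta> ^ (N - l)) *
        cosh (Im (Z l))) * Gfactor N (2 * \<nu> + \<alpha> + \<beta>)"

text \<open>
  Under the hypotheses of each of the three cases, all gamma and beta functions involved are
  evaluated away from their poles, so no separate assumption such as \<open>\<nu> + \<alpha> \<notin> {-1, -2, \<dots>}\<close>
  is needed for the functions to be defined.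
\<close>

lemma parameters_admissible:
  fixes \<nu> \<alpha> \<beta> :: complex and N :: nat
  assumes "Re (2 * \<nu> + \<alpha> + \<beta> + 1) > real N"
    and "(\<bar>Re \<alpha>\<bar> < real N + 1 / 2 \<and> \<bar>Re \<beta>\<bar> < 1 / 2) \<or>
         (\<bar>Re \<alpha>\<bar> < 1 / 2 \<and> \<bar>Re \<beta>\<bar> < real N + 1 / 2)"
  shows "Re (\<nu> + 1) > 0" "Re (\<nu> + \<alpha> + 1) > 0" "Re (\<nu> + \<beta> + 1) > 0"
    "Re (\<nu> + \<alpha> + \<beta> + 1) > 0" "Re (2 * \<nu> + \<alpha> + \<beta> + 2) > 0"
  using assms by (auto simp: abs_less_iff)

end

theory Submission
  imports Defs "HOL-Real_Asymp.Real_Asymp"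
begin

text \<open>
  Let \<open>kap \<mu> z = sqrt (2 z / \<pi>) e\<^sup>z K\<^sub>\<mu>(z)\<close> be the normalised Macdonald function. Its asymptotic series has the
  coefficients \<open>a\<^sub>n(\<mu>)\<close>, and its \<open>N\<close>-th remainder is a double integral of
  \<open>u powr (\<mu> - 1/2) v powr (-\<mu> - 1/2) e\<^sup>-\<^sup>u\<^sup>-\<^sup>v\<close> against the Taylor remainder of \<open>exp\<close> at
  \<open>-u v / (2 z)\<close>. For \<open>Re z > 0\<close> that Taylor remainder is at most its first omitted term, so the remainder
  of \<open>kap\<close> is at most \<open>ahat N \<mu> / |z| ^ N\<close>.

  All three Jacobi functions at \<open>cos (2 \<zeta>)\<close> are combinations of the two values of
  \<open>J(p) = \<integral> s powr \<sigma> e\<^sup>-\<^sup>s kap \<beta> (s p) kap \<alpha> (s (1 - p)) ds\<close> at \<open>p = cos \<zeta> exp (\<plusminus>i \<zeta>)\<close>,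
  where \<open>1 - p = sin \<zeta> exp (\<plusminus>i (\<zeta> - \<pi>/2))\<close>. Expanding the product of the two \<open>kap\<close> factors under the integral
  gives the main terms as gamma integrals, and the remainder bounds for \<open>kap\<close> give the claimed estimates.

  For \<open>Q\<close> the representation comes from evaluating \<open>J\<close> on \<open>(0, 1)\<close> as Euler's integral: it continues to the
  disc \<open>|p - 1/2| < 1/2\<close>, and the two values of \<open>p\<close> are boundary points of the disc that correspond to the
  two sides of the cut. For \<open>P\<close> the two boundary values of Euler's integral are combined so that the contributions
  from beyond the branch point cancel; what is left is Euler's integral for \<open>P\<close>. This requires \<open>Re \<nu> < 0\<close> and
  \<open>|Re \<alpha>|, |Re \<beta>| < 1/2\<close>, and the identity extends to all parameters by analytic continuation.
\<close>

section \<open>Integrals over the positive half-line\<close>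

text \<open>The shape of the bounds comes from the way a product of two expansions is truncated: one
  factor is expanded to order N, and its l-th term is multiplied by the other factor truncated at
  order N - l, so that every error term has total order N. The remainder of the first factor is
  multiplied by the whole second factor, whose order-0 bound requires an order with |Re| < 1/2. This
  is the source of the asymmetric hypotheses of (i) and (ii); bound (iii) is (i) combined with |a_l|
  <= ahat l.

  Two features decide the definitions. \<open>kap\<close> is a single integral that is entire in the
  order, whereas the double integral of \<open>krem N\<close> lives only on |Re \<mu>| < N + 1/2;
  the two are compared where both make sense and then continued. The expansion of a factor with |Re
  \<mu>| < M + 1/2 controls it near s = 0 by a multiple of s^(-M), so the Laplace integral over s
  has an integrable majorant as soon as Re \<sigma> + 1 > M + M'. The pairs (M, M') = (N, 0) and (0,
  N) then give exactly the hypothesis of the theorem.\<close>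

definition lpos :: "real measure" where
  "lpos = restrict_space lborel {0<..}"

text \<open>Written with the real logarithm, so that no branch question arises: on positive bases
  the power is multiplicative in the base, and it is entire in the exponent and Borel measurable in
  the base.\<close>

definition cpow :: "real \<Rightarrow> complex \<Rightarrow> complex" where
  "cpow x c = exp (c * of_real (ln x))"

lemma space_lpos [simp]: "space lpos = {0<..}"
  by (simp add: lpos_def space_restrict_space)

lemma lpos_measurable_real: "(\<lambda>x. x) \<in> borel_measurable lpos"
  unfolding lpos_def by (intro measurable_restrict_space1) simp

lemma lpos_measurableI: "f \<in> borel_measurable borel \<Longrightarrow> f \<in> borel_measurable lpos"
  unfolding lpos_def by (intro measurable_restrict_space1) simp

lemma lpos_measurable_fst [measurable]: "fst \<in> borel_measurable (lpos \<Otimes>\<^sub>M M)"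
  using measurable_compose[OF measurable_fst lpos_measurable_real] .

lemma lpos_measurable_snd [measurable]: "snd \<in> borel_measurable (M \<Otimes>\<^sub>M lpos)"
  using measurable_compose[OF measurable_snd lpos_measurable_real] .

lemma sigma_finite_lpos: "sigma_finite_measure lpos"
  unfolding lpos_def by (intro sigma_finite_measure_restrict_space) (auto intro: sigma_finite_lborel)

interpretation lpos: sigma_finite_measure lpos by (rule sigma_finite_lpos)
interpretation lpos2: pair_sigma_finite lpos lpos ..
interpretation lpos12: pair_sigma_finite lpos "lpos \<Otimes>\<^sub>M lpos"
  by (simp add: pair_sigma_finite_def sigma_finite_lpos lpos2.sigma_finite_measure_axioms)

section \<open>Change of variables on the half-line\<close>

lemma integrable_lpos_iff:
  fixes f :: "real \<Rightarrow> 'a::euclidean_space"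
  assumes [measurable]: "f \<in> borel_measurable borel"
  shows "integrable lpos f \<longleftrightarrow> f absolutely_integrable_on {0<..}"
  unfolding lpos_def set_integrable_def
  by (subst integrable_restrict_space) (auto simp: integrable_completion)

lemma integral_lpos:
  fixes f :: "real \<Rightarrow> 'a::euclidean_space"
  assumes [measurable]: "f \<in> borel_measurable borel" and "integrable lpos f"
  shows "integral\<^sup>L lpos f = integral {0<..} f"
proof -
  have "integral\<^sup>L lpos f = (LINT x:{0<..}|lebesgue. f x)"
    unfolding lpos_def set_lebesgue_integral_def
    by (subst integral_restrict_space) (auto simp: integral_completion)
  also have "\<dots> = integral {0<..} f"
    using assms integrable_lpos_iff by (intro set_lebesgue_integral_eq_integral) blast
  finally show ?thesis .
qed

text \<open>The image T may be a proper part of the half-line, which is why an indicator appears.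
  That generality serves the integrals over (0, t) and (t, \<infinity>) on the two sides of a branch
  point.\<close>

lemma lpos_change_of_variables_image:
  fixes f :: "real \<Rightarrow> 'a::euclidean_space" and g :: "real \<Rightarrow> real"
  assumes f [measurable]: "f \<in> borel_measurable borel"
    and g [measurable]: "g \<in> borel_measurable borel" and h [measurable]: "h \<in> borel_measurable borel"
    and der: "\<And>x. x > 0 \<Longrightarrow> (g has_field_derivative h x) (at x)"
    and inj: "inj_on g {0<..}" and img: "g ` {0<..} = T" and T: "T \<subseteq> {0<..}" and [measurable]: "T \<in> sets borel"
  shows "integrable lpos (\<lambda>x. \<bar>h x\<bar> *\<^sub>R f (g x)) \<longleftrightarrow> integrable lpos (\<lambda>y. indicator T y *\<^sub>R f y)"
    and "(\<integral>x. \<bar>h x\<bar> *\<^sub>R f (g x) \<partial>lpos) = (\<integral>y. indicator T y *\<^sub>R f y \<partial>lpos)"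
proof -
  have 1: "(\<lambda>x. \<bar>h x\<bar> *\<^sub>R f (g x)) \<in> borel_measurable borel" by measurable
  have 2: "(\<lambda>y. indicator T y *\<^sub>R f y) \<in> borel_measurable borel" by measurable
  have der': "\<And>x. x \<in> {0<..} \<Longrightarrow> (g has_field_derivative h x) (at x within {0<..})"
    using der by (auto intro: has_field_derivative_at_within)
  have ai: "(\<lambda>y. indicator T y *\<^sub>R f y) absolutely_integrable_on {0<..} \<longleftrightarrow> f absolutely_integrable_on T"
    unfolding set_integrable_def using T by (intro Bochner_Integration.integrable_cong refl) (auto simp: indicator_def)
  have ii: "integral {0<..} (\<lambda>y. indicator T y *\<^sub>R f y) = integral T f"
  proof -
    have "integral {0<..} (\<lambda>y. indicator T y *\<^sub>R f y) = integral {0<..} (\<lambda>y. if y \<in> T then f y else 0)"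
      by (intro integral_cong) (auto simp: indicator_def)
    also have "\<dots> = integral T f" using T by (simp add: integral_restrict_Int Int_absorb2 Int_commute inf.absorb1)
    finally show ?thesis .
  qed
  note * = has_absolute_integral_change_of_variables_real[OF _ der' inj, of f, unfolded img]
  show iff: "integrable lpos (\<lambda>x. \<bar>h x\<bar> *\<^sub>R f (g x)) \<longleftrightarrow> integrable lpos (\<lambda>y. indicator T y *\<^sub>R f y)"
    unfolding integrable_lpos_iff[OF 1] integrable_lpos_iff[OF 2] ai using * by (auto simp: lebesgue_measurable_vimage_borel)
  show "(\<integral>x. \<bar>h x\<bar> *\<^sub>R f (g x) \<partial>lpos) = (\<integral>y. indicator T y *\<^sub>R f y \<partial>lpos)"
  proof (cases "integrable lpos (\<lambda>y. indicator T y *\<^sub>R f y)")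
    case True
    with iff have i: "integrable lpos (\<lambda>x. \<bar>h x\<bar> *\<^sub>R f (g x))" by simp
    have "f absolutely_integrable_on T" using True unfolding integrable_lpos_iff[OF 2] ai .
    hence "integral {0<..} (\<lambda>x. \<bar>h x\<bar> *\<^sub>R f (g x)) = integral T f"
      using * by auto
    thus ?thesis using integral_lpos[OF 1 i] integral_lpos[OF 2 True] ii by simp
  next
    \<comment> \<open>Integrability transfers in both directions, so here neither side is integrable
      and both integrals have the default value 0.\<close>
    case False
    with iff have "\<not> integrable lpos (\<lambda>x. \<bar>h x\<bar> *\<^sub>R f (g x))" by simp
    with False show ?thesis by (simp add: not_integrable_integral_eq)
  qed
qed

lemma lpos_change_of_variables:
  fixes f :: "real \<Rightarrow> 'a::euclidean_space" and g :: "real \<Rightarrow> real"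
  assumes f: "f \<in> borel_measurable borel" and g: "g \<in> borel_measurable borel" and h: "h \<in> borel_measurable borel"
    and der: "\<And>x. x > 0 \<Longrightarrow> (g has_field_derivative h x) (at x)"
    and inj: "inj_on g {0<..}" and img: "g ` {0<..} = {0<..}"
  shows "integrable lpos (\<lambda>x. \<bar>h x\<bar> *\<^sub>R f (g x)) \<longleftrightarrow> integrable lpos f"
    and "(\<integral>x. \<bar>h x\<bar> *\<^sub>R f (g x) \<partial>lpos) = integral\<^sup>L lpos f"
proof -
  have c: "integrable lpos (\<lambda>y. indicator {0<..} y *\<^sub>R f y) \<longleftrightarrow> integrable lpos f"
    by (intro Bochner_Integration.integrable_cong refl) (simp add: indicator_def)
  have e: "(\<integral>y. indicator {0<..} y *\<^sub>R f y \<partial>lpos) = integral\<^sup>L lpos f"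
    by (intro Bochner_Integration.integral_cong refl) (simp add: indicator_def)
  show "integrable lpos (\<lambda>x. \<bar>h x\<bar> *\<^sub>R f (g x)) \<longleftrightarrow> integrable lpos f"
    "(\<integral>x. \<bar>h x\<bar> *\<^sub>R f (g x) \<partial>lpos) = integral\<^sup>L lpos f"
    using lpos_change_of_variables_image[OF f g h der inj img order_refl] by (simp_all add: c e)
qed

lemma lpos_scale:
  fixes f :: "real \<Rightarrow> 'a::euclidean_space"
  assumes [measurable]: "f \<in> borel_measurable borel" and "c > 0"
  shows "integrable lpos (\<lambda>x. c *\<^sub>R f (c * x)) \<longleftrightarrow> integrable lpos f"
    and "(\<integral>x. c *\<^sub>R f (c * x) \<partial>lpos) = integral\<^sup>L lpos f"
proof -
  have img: "(\<lambda>x. c * x) ` {0<..} = {0<..}"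
  proof (intro equalityI subsetI)
    fix x :: real assume "x \<in> {0<..}"
    thus "x \<in> (\<lambda>x. c * x) ` {0<..}" using assms(2) by (intro image_eqI[of _ _ "x / c"]) auto
  qed (use assms(2) in auto)
  have inj: "inj_on (\<lambda>x. c * x) {0<..}" using assms(2) by (auto simp: inj_on_def)
  note * = lpos_change_of_variables[of f "\<lambda>x. c * x" "\<lambda>_. c", OF assms(1) _ _ _ inj img]
  show "integrable lpos (\<lambda>x. c *\<^sub>R f (c * x)) \<longleftrightarrow> integrable lpos f"
    using *(1) assms(2) by (auto intro!: derivative_eq_intros)
  show "(\<integral>x. c *\<^sub>R f (c * x) \<partial>lpos) = integral\<^sup>L lpos f"
    using *(2) assms(2) by (auto intro!: derivative_eq_intros)
qed

section \<open>Complex powers of positive numbers and the gamma integral\<close>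

lemma cpow_measurable [measurable (raw)]:
  "f \<in> borel_measurable M \<Longrightarrow> (\<lambda>x. cpow (f x) c) \<in> borel_measurable M"
  unfolding cpow_def by measurable

lemma cpow_powr: "x > 0 \<Longrightarrow> cpow x c = of_real x powr c"
  by (simp add: cpow_def powr_def Ln_of_real)

lemma norm_cpow: "x > 0 \<Longrightarrow> norm (cpow x c) = x powr Re c"
  by (simp add: cpow_def powr_def)

lemma cpow_add: "cpow x (a + b) = cpow x a * cpow x b"
  by (simp add: cpow_def ring_distribs exp_add)

lemma cpow_mult: "x > 0 \<Longrightarrow> y > 0 \<Longrightarrow> cpow (x * y) a = cpow x a * cpow y a"
  by (simp add: cpow_def ln_mult ring_distribs exp_add)

lemma cpow_of_nat: "x > 0 \<Longrightarrow> cpow x (of_nat n) = of_real x ^ n"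
  by (metis cpow_powr linorder_not_less of_real_eq_0_iff order_refl powr_nat')

lemma cpow_1 [simp]: "x > 0 \<Longrightarrow> cpow x 1 = of_real x"
  by (simp add: cpow_powr)

lemma cpow_of_real: "x > 0 \<Longrightarrow> cpow x (of_real a) = of_real (x powr a)"
  by (simp add: cpow_powr powr_of_real)

lemma cpow_minus: "cpow x (- a) = inverse (cpow x a)"
  by (simp add: cpow_def exp_minus)

lemma cpow_diff: "cpow x (a - b) = cpow x a / cpow x b"
  by (simp add: cpow_def exp_diff ring_distribs)

lemma cpow_nonzero [simp]: "cpow x a \<noteq> 0"
  by (simp add: cpow_def)

lemma cpow_divide: "x > 0 \<Longrightarrow> y > 0 \<Longrightarrow> cpow (x / y) a = cpow x a / cpow y a"
  by (simp add: cpow_def ln_div ring_distribs exp_diff)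

lemma holomorphic_cpow [holomorphic_intros]:
  "f holomorphic_on S \<Longrightarrow> (\<lambda>z. cpow x (f z)) holomorphic_on S"
  unfolding cpow_def by (intro holomorphic_intros)

text \<open>The case l = 1 is Euler's gamma integral. The substitution of l x for x contributes a
  factor l, which merges with the power l^(c - 1) into l^c.\<close>

lemma lpos_Gamma:
  assumes "Re c > 0" "l > 0"
  shows "integrable lpos (\<lambda>x. cpow x (c - 1) * exp (- of_real (l * x)))"
    and "(\<integral>x. cpow x (c - 1) * exp (- of_real (l * x)) \<partial>lpos) = Gamma c * cpow l (- c)"
proof -
  define f where "f = (\<lambda>x. cpow x (c - 1) * exp (- of_real x))"
  have f [measurable]: "f \<in> borel_measurable borel" unfolding f_def by measurable
  have eq: "f t = of_real t powr (c - 1) / of_real (exp t)" if "t \<in> {0<..}" for t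
    using that by (simp add: f_def cpow_powr exp_of_real exp_minus field_simps)
  have fi: "f absolutely_integrable_on {0<..}"
    using absolutely_integrable_Gamma_integral'[OF assms(1)]
    by (rule set_integrable_cong[THEN iffD1, rotated -1]) (auto simp: eq)
  hence i: "integrable lpos f" by (simp add: integrable_lpos_iff)
  have "(f has_integral Gamma c) {0<..}"
    using Gamma_integral_complex'[OF assms(1)]
    by (rule has_integral_cong[THEN iffD1, rotated -1]) (auto simp: eq)
  hence I: "integral\<^sup>L lpos f = Gamma c" using i by (simp add: integral_lpos integral_unique)
  have feq: "l *\<^sub>R f (l * x) = cpow l c * (cpow x (c - 1) * exp (- of_real (l * x)))" if "x > 0" for x
  proof -
    have "cpow l c = of_real l * cpow l (c - 1)"
      using cpow_add[of l 1 "c - 1"] assms by simp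
    thus ?thesis using that assms by (simp add: f_def scaleR_conv_of_real cpow_mult)
  qed
  have "integrable lpos (\<lambda>x. cpow l c * (cpow x (c - 1) * exp (- of_real (l * x))))"
    using lpos_scale(1)[OF f assms(2)] i by (subst (asm) Bochner_Integration.integrable_cong[OF refl feq]) auto
  from integrable_mult_right[OF this, of "inverse (cpow l c)"]
  show "integrable lpos (\<lambda>x. cpow x (c - 1) * exp (- of_real (l * x)))"
    by (simp add: mult.assoc[symmetric] del: of_real_mult)
  have "cpow l c * (\<integral>x. (cpow x (c - 1) * exp (- of_real (l * x))) \<partial>lpos) = Gamma c"
    using lpos_scale(2)[OF f assms(2)] I
    by (subst (asm) Bochner_Integration.integral_cong[OF refl feq]) auto
  thus "(\<integral>x. cpow x (c - 1) * exp (- of_real (l * x)) \<partial>lpos) = Gamma c * cpow l (- c)"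
    by (simp add: cpow_minus field_simps)
qed

lemma lpos_Gamma_real:
  assumes "a > 0" "l > 0"
  shows "integrable lpos (\<lambda>x. x powr (a - 1) * exp (- (l * x)))"
    and "(\<integral>x. x powr (a - 1) * exp (- (l * x)) \<partial>lpos) = Gamma a * l powr (- a)"
proof -
  have eq: "cpow x (of_real a - 1) * exp (- of_real (l * x)) = of_real (x powr (a - 1) * exp (- (l * x)))"
    if "x \<in> space lpos" for x
    using that cpow_of_real[of x "a - 1"] by (simp flip: exp_of_real)
  note * = lpos_Gamma[of "of_real a" l, simplified, OF assms]
  have "integrable lpos (\<lambda>x. complex_of_real (x powr (a - 1) * exp (- (l * x))))"
    using *(1) eq by (subst (asm) Bochner_Integration.integrable_cong[OF refl]) auto
  thus "integrable lpos (\<lambda>x. x powr (a - 1) * exp (- (l * x)))"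
    by (simp only: complex_of_real_integrable_eq)
  have "(\<integral>x. complex_of_real (x powr (a - 1) * exp (- (l * x))) \<partial>lpos) = of_real (Gamma a * l powr (- a))"
    using *(2) eq assms
    by (subst (asm) Bochner_Integration.integral_cong[OF refl])
       (auto simp: Gamma_complex_of_real cpow_of_real[of l "-a", simplified])
  thus "(\<integral>x. x powr (a - 1) * exp (- (l * x)) \<partial>lpos) = Gamma a * l powr (- a)"
    by (simp only: integral_complex_of_real of_real_eq_iff)
qed

section \<open>Parameter-dependent integrals\<close>

text \<open>Dominated convergence is a statement about sequences; first countability reduces the
  limit in t to sequences that avoid a. One such sequence also yields the measurability of the limit
  function.\<close>

lemma integral_tendsto_dominated:
  fixes f :: "'b::first_countable_topology \<Rightarrow> 'a \<Rightarrow> 'c::{banach, second_countable_topology}"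
  assumes lim: "\<And>x. x \<in> space M \<Longrightarrow> ((\<lambda>t. f t x) \<longlongrightarrow> g x) (at a within T)"
    and meas: "\<And>t. t \<in> T \<Longrightarrow> f t \<in> borel_measurable M"
    and w: "integrable M w"
    and bound: "\<And>t x. t \<in> T \<Longrightarrow> t \<noteq> a \<Longrightarrow> x \<in> space M \<Longrightarrow> norm (f t x) \<le> w x"
    and "at a within T \<noteq> bot"
  shows "((\<lambda>t. integral\<^sup>L M (f t)) \<longlongrightarrow> integral\<^sup>L M g) (at a within T)"
    and "g \<in> borel_measurable M"
proof -
  have seq: "(\<lambda>n. f (X n) x) \<longlonglongrightarrow> g x" if "\<forall>n. X n \<in> T - {a}" "X \<longlonglongrightarrow> a" "x \<in> space M" for X x
    using lim[OF that(3)] that(1,2) unfolding tendsto_at_iff_sequentially comp_def by blast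
  obtain X0 where X0: "\<forall>n. X0 n \<in> T - {a}" "X0 \<longlonglongrightarrow> a"
    using assms(5) by (auto simp: trivial_limit_within islimpt_sequential)
  show g: "g \<in> borel_measurable M"
    by (rule borel_measurable_LIMSEQ_metric[of "\<lambda>n. f (X0 n)"]) (use X0 seq meas in auto)
  show "((\<lambda>t. integral\<^sup>L M (f t)) \<longlongrightarrow> integral\<^sup>L M g) (at a within T)"
    unfolding tendsto_at_iff_sequentially comp_def
  proof safe
    fix X assume X: "\<forall>n. X n \<in> T - {a}" "X \<longlonglongrightarrow> a"
    show "(\<lambda>n. integral\<^sup>L M (f (X n))) \<longlonglongrightarrow> integral\<^sup>L M g"
      by (rule integral_dominated_convergence[where w = w])
         (use X seq[OF X] meas w bound g in auto)
  qed
qed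

text \<open>Only a local majorant of f itself is assumed. Cauchy's inequality turns it into a
  majorant of the z-derivative and hence of the difference quotients, to which dominated convergence
  applies.\<close>

theorem holomorphic_integral:
  fixes f :: "complex \<Rightarrow> 'a \<Rightarrow> complex"
  assumes S: "open S"
    and meas: "\<And>z. z \<in> S \<Longrightarrow> f z \<in> borel_measurable M"
    and hol: "\<And>x. x \<in> space M \<Longrightarrow> (\<lambda>z. f z x) holomorphic_on S"
    and dom: "\<And>z. z \<in> S \<Longrightarrow> \<exists>r>0. \<exists>w. integrable M w \<and>
                (\<forall>z'\<in>ball z r \<inter> S. \<forall>x\<in>space M. norm (f z' x) \<le> w x)"
  shows "(\<lambda>z. \<integral>x. f z x \<partial>M) holomorphic_on S"
proof -
  have "(\<lambda>z. \<integral>x. f z x \<partial>M) field_differentiable at z0" if z0: "z0 \<in> S" for z0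
  proof -
    obtain r1 w where r1: "r1 > 0" and w: "integrable M w"
      and bnd1: "\<And>z x. z \<in> ball z0 r1 \<inter> S \<Longrightarrow> x \<in> space M \<Longrightarrow> norm (f z x) \<le> w x"
      using dom[OF z0] by auto
    obtain r2 where r2: "r2 > 0" "ball z0 r2 \<subseteq> S"
      using S z0 openE by blast
    \<comment> \<open>A closed disc of radius r around a point of the r-ball at z0 stays inside the
      3r-ball, where the majorant is valid.\<close>
    define r where "r = min r1 r2 / 3"
    have r: "r > 0" "ball z0 (3 * r) \<subseteq> S" using r1 r2 by (auto simp: r_def)
    have bnd: "norm (f z x) \<le> w x" if "z \<in> ball z0 (3 * r)" "x \<in> space M" for z x
      using bnd1[of z x] that r r1 r2 by (auto simp: r_def)
    have derb: "norm (deriv (\<lambda>z. f z x) z) \<le> w x / r" if "z \<in> ball z0 r" "x \<in> space M" for z x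
    proof -
      have sub: "cball z r \<subseteq> ball z0 (3 * r)"
      proof
        fix y assume "y \<in> cball z r"
        thus "y \<in> ball z0 (3 * r)" using that(1) r(1) dist_triangle[of z0 y z] by auto
      qed
      have h: "(\<lambda>z. f z x) holomorphic_on cball z r"
        using hol[OF that(2)] sub r(2) by (meson holomorphic_on_subset order_trans)
      have "norm ((deriv ^^ 1) (\<lambda>z. f z x) z) \<le> fact 1 * w x / r ^ 1"
      proof (rule Cauchy_inequality)
        show "(\<lambda>z. f z x) holomorphic_on ball z r" using h holomorphic_on_subset by fastforce
        show "continuous_on (cball z r) (\<lambda>z. f z x)" using h by (rule holomorphic_on_imp_continuous_on)
        fix y assume "norm (z - y) = r"
        hence "y \<in> cball z r" by (simp add: dist_norm)
        thus "norm (f y x) \<le> w x" using sub that bnd by blast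
      qed (use r in auto)
      thus ?thesis by simp
    qed
    define q where "q = (\<lambda>z x. (f z x - f z0 x) / (z - z0))"
    have der: "((\<lambda>z. f z x) has_field_derivative deriv (\<lambda>z. f z x) z) (at z)"
      if "z \<in> S" "x \<in> space M" for z x
      using hol[OF that(2)] that S holomorphic_derivI by blast
    have qb: "norm (q z x) \<le> w x / r" if "z \<in> ball z0 r" "z \<noteq> z0" "x \<in> space M" for z x
    proof -
      \<comment> \<open>Mean value estimate on the convex ball with the derivative bound w /
        r.\<close>
      have "norm (f z x - f z0 x) \<le> w x / r * norm (z - z0)"
      proof (rule field_differentiable_bound[OF convex_ball[of z0 r]])
        fix y assume y: "y \<in> ball z0 r"
        hence "y \<in> S" using r by auto
        from der[OF this that(3)]
        show "((\<lambda>z. f z x) has_field_derivative deriv (\<lambda>z. f z x) y) (at y within ball z0 r)"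
          by (rule has_field_derivative_at_within)
      qed (use derb that r in auto)
      thus ?thesis using that by (simp add: q_def norm_divide field_simps)
    qed
    have lim: "((\<lambda>z. q z x) \<longlongrightarrow> deriv (\<lambda>z. f z x) z0) (at z0 within ball z0 r)" if "x \<in> space M" for x
      using der[OF z0 that] unfolding has_field_derivative_iff q_def
      by (rule tendsto_within_subset) auto
    have int: "integrable M (f z)" if "z \<in> ball z0 r" for z
    proof (rule Bochner_Integration.integrable_bound[OF w])
      show "AE x in M. norm (f z x) \<le> norm (w x)"
        using bnd[of z] that r(1) by (intro AE_I2) (fastforce intro: order_trans[OF _ abs_ge_self])
      show "f z \<in> borel_measurable M" using that r by (intro meas) auto
    qed
    have "((\<lambda>z. integral\<^sup>L M (q z)) \<longlongrightarrow> (\<integral>x. deriv (\<lambda>z. f z x) z0 \<partial>M)) (at z0 within ball z0 r)"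
    proof (rule integral_tendsto_dominated(1)[OF lim])
      show "q z \<in> borel_measurable M" if "z \<in> ball z0 r" for z
      proof -
        have [measurable]: "f z \<in> borel_measurable M" "f z0 \<in> borel_measurable M"
          using int[OF that] int[of z0] r by auto
        show ?thesis unfolding q_def by measurable
      qed
      show "integrable M (\<lambda>x. w x / r)" using w by simp
      show "at z0 within ball z0 r \<noteq> bot" using r by (simp add: at_within_open[of z0 "ball z0 r"])
    qed (use qb in auto)
    hence "((\<lambda>z. integral\<^sup>L M (q z)) \<longlongrightarrow> (\<integral>x. deriv (\<lambda>z. f z x) z0 \<partial>M)) (at z0)"
      using r by (simp add: at_within_open[of z0 "ball z0 r"])
    moreover have "\<forall>\<^sub>F z in at z0. z \<in> ball z0 r"
      using r by (intro eventually_at_in_open') auto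
    hence "\<forall>\<^sub>F z in at z0. integral\<^sup>L M (q z) = (integral\<^sup>L M (f z) - integral\<^sup>L M (f z0)) / (z - z0)"
    proof eventually_elim
      case (elim z)
      show ?case unfolding q_def using int[OF elim] int[of z0] r by simp
    qed
    ultimately have "((\<lambda>z. (integral\<^sup>L M (f z) - integral\<^sup>L M (f z0)) / (z - z0)) \<longlongrightarrow>
        (\<integral>x. deriv (\<lambda>z. f z x) z0 \<partial>M)) (at z0)"
      by (rule Lim_transform_eventually)
    thus ?thesis unfolding field_differentiable_def has_field_derivative_iff by blast
  qed
  thus ?thesis
    by (auto simp: holomorphic_on_def intro: field_differentiable_at_within)
qed

lemma integrable_lpos_prod:
  fixes f g :: "real \<Rightarrow> 'a::{real_normed_field, banach, second_countable_topology}"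
  assumes f: "integrable lpos f" and g: "integrable lpos g"
  shows "integrable (lpos \<Otimes>\<^sub>M lpos) (\<lambda>(x, y). f x * g y)"
    and "(\<integral>(x, y). f x * g y \<partial>(lpos \<Otimes>\<^sub>M lpos)) = integral\<^sup>L lpos f * integral\<^sup>L lpos g"
proof -
  have [measurable]: "f \<in> borel_measurable lpos" "g \<in> borel_measurable lpos" using f g by auto
  show i: "integrable (lpos \<Otimes>\<^sub>M lpos) (\<lambda>(x, y). f x * g y)"
  proof (rule lpos2.Fubini_integrable)
    show "(\<lambda>(x, y). f x * g y) \<in> borel_measurable (lpos \<Otimes>\<^sub>M lpos)" by measurable
    show "integrable lpos (\<lambda>x. \<integral>y. norm (case (x, y) of (x, y) \<Rightarrow> f x * g y) \<partial>lpos)"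
      using f g by (simp add: norm_mult)
  qed (use g in auto)
  from lpos2.integral_fst'[OF i] show "(\<integral>(x, y). f x * g y \<partial>(lpos \<Otimes>\<^sub>M lpos)) = integral\<^sup>L lpos f * integral\<^sup>L lpos g"
    using f g by simp
qed

section \<open>Taylor remainders of the exponential function\<close>

definition exp_rem :: "nat \<Rightarrow> complex \<Rightarrow> complex" where
  "exp_rem N w = exp (- w) - (\<Sum>n<N. (- w) ^ n / fact n)"

lemma exp_rem_measurable [measurable (raw)]:
  "f \<in> borel_measurable M \<Longrightarrow> (\<lambda>x. exp_rem N (f x)) \<in> borel_measurable M"
  unfolding exp_rem_def
  by (intro borel_measurable_diff borel_measurable_sum borel_measurable_divide borel_measurable_power
      borel_measurable_const borel_measurable_uminus measurable_compose[OF _ borel_measurable_exp])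

lemma exp_rem_holomorphic [holomorphic_intros]:
  "f holomorphic_on S \<Longrightarrow> (\<lambda>x. exp_rem N (f x)) holomorphic_on S"
  unfolding exp_rem_def by (intro holomorphic_intros) auto

lemma exp_rem_derivative: "(exp_rem (Suc N) has_field_derivative - exp_rem N w) (at w)"
proof -
  have *: "(\<Sum>n<Suc N. of_nat n * (- w) ^ (n - Suc 0) / fact n) = (\<Sum>n<N. (- w) ^ n / fact n)"
    by (subst sum.lessThan_Suc_shift) (auto intro!: sum.cong simp: field_simps simp flip: of_nat_Suc)
  have "((\<lambda>w. exp (- w) - (\<Sum>n<Suc N. (- w) ^ n / fact n)) has_field_derivative
       - exp (- w) + (\<Sum>n<Suc N. of_nat n * (- w) ^ (n - Suc 0) / fact n)) (at w)"
    by (auto intro!: derivative_eq_intros sum.cong simp: sum_negf[symmetric] simp del: sum.lessThan_Suc)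
  thus ?thesis unfolding exp_rem_def[abs_def] * by simp
qed

lemma exp_rem_0: "exp_rem (Suc N) 0 = 0"
  unfolding exp_rem_def by (subst sum.lessThan_Suc_shift) auto

text \<open>For Re w >= 0 the exponential itself has modulus at most 1. Differentiation lowers the
  order of the remainder by one up to sign, and the remainder of positive order vanishes at 0, so
  integrating along the segment from 0 to w raises the order by one and builds up the factor w^N /
  N!.\<close>

lemma norm_exp_rem_le:
  assumes "Re w \<ge> 0"
  shows "norm (exp_rem N w) \<le> norm w ^ N / fact N"
  using assms
proof (induction N arbitrary: w)
  case 0
  thus ?case by (simp add: exp_rem_def)
next
  case (Suc N)
  define f where "f = (\<lambda>t::real. exp_rem (Suc N) (of_real t * w))"
  have der: "(f has_vector_derivative (- exp_rem N (of_real t * w) * w)) (at t)" for t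
    unfolding f_def
    by (rule has_vector_derivative_eq_rhs, rule field_vector_diff_chain_at[unfolded o_def, OF _ exp_rem_derivative])
       (auto intro!: derivative_eq_intros)
  have "norm (f 1 - f 0) \<le> (\<lambda>t. t ^ Suc N * norm w ^ Suc N / fact (Suc N)) 1 - (\<lambda>t. t ^ Suc N * norm w ^ Suc N / fact (Suc N)) 0"
  proof (rule differentiable_bound_general[where f' = "\<lambda>t. - exp_rem N (of_real t * w) * w" and \<phi>' = "\<lambda>t. t ^ N * norm w ^ Suc N / fact N"])
    show "continuous_on {0..1} f" using der
      by (meson continuous_at_imp_continuous_on has_vector_derivative_continuous)
    fix t :: real assume t: "0 < t" "t < 1"
    have "norm (exp_rem N (of_real t * w)) \<le> norm (of_real t * w) ^ N / fact N"
      using Suc.prems t by (intro Suc.IH) auto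
    hence "norm (exp_rem N (of_real t * w)) * norm w \<le> norm (of_real t * w) ^ N / fact N * norm w"
      by (intro mult_right_mono) auto
    thus "norm (- exp_rem N (of_real t * w) * w) \<le> t ^ N * norm w ^ Suc N / fact N"
      using t by (simp add: norm_mult power_mult_distrib mult_ac)
    show "((\<lambda>t. t ^ Suc N * norm w ^ Suc N / fact (Suc N)) has_vector_derivative t ^ N * norm w ^ Suc N / fact N) (at t)"
      unfolding has_real_derivative_iff_has_vector_derivative[symmetric]
      by (auto intro!: derivative_eq_intros simp del: power_Suc)
    show "(f has_vector_derivative (- exp_rem N (of_real t * w) * w)) (at t)" by (rule der)
  qed (auto intro!: continuous_intros)
  thus ?case by (simp add: f_def exp_rem_0)
qed

text \<open>The midpoint of the segment is a limit point of the segment inside the domain, which is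
  all the identity theorem asks for.\<close>

lemma identity_theorem_segment:
  assumes "f holomorphic_on S" "g holomorphic_on S" "open S" "connected S"
    and "a < b" "of_real ` {a<..<b} \<subseteq> S" and eq: "\<And>x. a < x \<Longrightarrow> x < b \<Longrightarrow> f (of_real x) = g (of_real x)"
    and "z \<in> S"
  shows "f z = g z"
proof -
  define c where "c = (a + b) / 2"
  have c: "a < c" "c < b" using assms(5) by (auto simp: c_def)
  have "c islimpt {a<..<b}" using c by (intro interior_limit_point) (auto simp: interior_open)
  hence "of_real c islimpt (complex_of_real ` {a<..<b})"
    by (subst islimpt_isCont_image) (auto simp: eventually_at_filter)
  with c have "f z - g z = 0"
    using assms by (intro analytic_continuation[of "\<lambda>z. f z - g z" S "of_real ` {a<..<b}" "of_real c" z])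
      (auto intro!: holomorphic_intros)
  thus ?thesis by simp
qed

text \<open>A majorant that is uniform in the exponent and covers x < 1 and x >= 1 at once. It is
  the standard local domination for integrals that depend analytically on an exponent.\<close>

lemma powr_between:
  assumes "(x::real) > 0" "a \<le> t" "t \<le> b"
  shows "x powr t \<le> x powr a + x powr b"
proof (cases "x \<ge> 1")
  case True
  hence "x powr t \<le> x powr b" using assms by (intro powr_mono) auto
  thus ?thesis by (smt (verit) powr_ge_zero)
next
  case False
  hence "x powr t \<le> x powr a" using assms by (intro powr_mono') auto
  thus ?thesis by (smt (verit) powr_ge_zero)
qed

section \<open>Interchange of integrals and the beta integral\<close>

lemma lpos_swap:
  fixes f :: "real \<Rightarrow> real \<Rightarrow> complex"
  assumes [measurable]: "case_prod f \<in> borel_measurable (lpos \<Otimes>\<^sub>M lpos)"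
    and inner: "\<And>x. x > 0 \<Longrightarrow> integrable lpos (f x)"
    and outer: "integrable lpos (\<lambda>x. \<integral>y. norm (f x y) \<partial>lpos)"
  shows "integrable (lpos \<Otimes>\<^sub>M lpos) (case_prod f)"
    and "integrable lpos (\<lambda>x. \<integral>y. f x y \<partial>lpos)"
    and "integrable lpos (\<lambda>y. \<integral>x. f x y \<partial>lpos)"
    and "integral\<^sup>L (lpos \<Otimes>\<^sub>M lpos) (case_prod f) = (\<integral>x. \<integral>y. f x y \<partial>lpos \<partial>lpos)"
    and "(\<integral>x. \<integral>y. f x y \<partial>lpos \<partial>lpos) = (\<integral>y. \<integral>x. f x y \<partial>lpos \<partial>lpos)"
proof -
  show i: "integrable (lpos \<Otimes>\<^sub>M lpos) (case_prod f)"
    by (rule lpos2.Fubini_integrable) (use inner outer in auto)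
  show "integrable lpos (\<lambda>x. \<integral>y. f x y \<partial>lpos)" using lpos2.integrable_fst[OF i] .
  show "integrable lpos (\<lambda>y. \<integral>x. f x y \<partial>lpos)" using lpos2.integrable_snd[OF i] .
  show "integral\<^sup>L (lpos \<Otimes>\<^sub>M lpos) (case_prod f) = (\<integral>x. \<integral>y. f x y \<partial>lpos \<partial>lpos)"
    using lpos2.integral_fst[OF i] by simp
  show "(\<integral>x. \<integral>y. f x y \<partial>lpos \<partial>lpos) = (\<integral>y. \<integral>x. f x y \<partial>lpos \<partial>lpos)"
    using lpos2.Fubini_integral[OF i] by simp
qed

lemma lpos_cong_integrable:
  "(\<And>x. x > 0 \<Longrightarrow> f x = g x) \<Longrightarrow> integrable lpos f \<longleftrightarrow> integrable lpos g"
  by (intro Bochner_Integration.integrable_cong) auto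

lemma lpos_cong_integral:
  "(\<And>x. x > 0 \<Longrightarrow> f x = g x) \<Longrightarrow> integral\<^sup>L lpos f = integral\<^sup>L lpos g"
  by (intro Bochner_Integration.integral_cong) auto

lemma lpos_Gamma_norm:
  assumes "Re c > 0" "l > 0"
  shows "integrable lpos (\<lambda>x. norm (cpow x (c - 1) * exp (- of_real (l * x))))"
    and "(\<integral>x. norm (cpow x (c - 1) * exp (- of_real (l * x))) \<partial>lpos) = Gamma (Re c) * l powr (- Re c)"
proof -
  have eq: "norm (cpow x (c - 1) * exp (- of_real (l * x))) = x powr (Re c - 1) * exp (- (l * x))" if "x > 0" for x
    using that by (simp add: norm_mult norm_cpow)
  show "integrable lpos (\<lambda>x. norm (cpow x (c - 1) * exp (- of_real (l * x))))"
    using lpos_Gamma(1)[OF assms] by (rule integrable_norm)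
  show "(\<integral>x. norm (cpow x (c - 1) * exp (- of_real (l * x))) \<partial>lpos) = Gamma (Re c) * l powr (- Re c)"
    using lpos_Gamma_real(2)[OF assms] by (simp only: lpos_cong_integral[OF eq])
qed

text \<open>The integrand r^(c-1) e^(-r) k^(b-1) e^(-r k) is integrated in both orders. With k
  first, two gamma integrals appear; with r first, Gamma c times the beta integral over the
  half-line.\<close>

lemma lpos_Beta:
  assumes b: "Re b > 0" and cb: "Re (c - b) > 0"
  shows "integrable lpos (\<lambda>k. cpow k (b - 1) * cpow (1 + k) (- c))"
    and "(\<integral>k. cpow k (b - 1) * cpow (1 + k) (- c) \<partial>lpos) = Gamma b * Gamma (c - b) / Gamma c"
proof -
  have c: "Re c > 0" using b cb by simp
  define f where "f = (\<lambda>r k. cpow r (c - 1) * exp (- of_real r) * (cpow k (b - 1) * exp (- of_real (r * k))))"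
  have [measurable]: "case_prod f \<in> borel_measurable (lpos \<Otimes>\<^sub>M lpos)"
    unfolding f_def by measurable
  have inner: "integrable lpos (f r)" if "r > 0" for r
    unfolding f_def by (intro integrable_mult_right lpos_Gamma(1) b that)
  have norm_eq: "(\<integral>k. norm (f r k) \<partial>lpos) = Gamma (Re b) * norm (cpow r ((c - b) - 1) * exp (- of_real (1 * r)))"
    if "r > 0" for r
  proof -
    have "(\<integral>k. norm (f r k) \<partial>lpos) = norm (cpow r (c - 1) * exp (- of_real r)) * (Gamma (Re b) * r powr (- Re b))"
      unfolding f_def norm_mult[of "cpow r (c - 1) * exp (- of_real r)"]
      using lpos_Gamma_norm(2)[OF b that] by simp
    thus ?thesis using that by (simp add: norm_mult norm_cpow powr_diff powr_add powr_minus field_simps)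
  qed
  have outer: "integrable lpos (\<lambda>r. \<integral>k. norm (f r k) \<partial>lpos)"
    by (rule iffD2[OF lpos_cong_integrable[OF norm_eq]], assumption)
       (intro integrable_mult_right lpos_Gamma_norm(1) cb, simp)
  note * = lpos_swap[OF _ inner outer]
  have left: "(\<integral>k. f r k \<partial>lpos) = Gamma b * (cpow r ((c - b) - 1) * exp (- of_real (1 * r)))" if "r > 0" for r
    unfolding f_def using that
    by (simp only: integral_mult_right_zero lpos_Gamma(2)[OF b that])
       (simp add: cpow_diff cpow_minus cpow_add field_simps)
  have right: "(\<integral>r. f r k \<partial>lpos) = Gamma c * (cpow k (b - 1) * cpow (1 + k) (- c))" if "k > 0" for k
  proof -
    have "f r k = cpow k (b - 1) * (cpow r (c - 1) * exp (- of_real ((1 + k) * r)))" for r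
      by (simp add: f_def exp_add[symmetric] ring_distribs exp_diff exp_minus field_simps)
    thus ?thesis using lpos_Gamma(2)[OF c, of "1 + k"] that by (simp del: of_real_mult)
  qed
  have nz: "Gamma c \<noteq> 0" using c by (intro Gamma_nonzero) (auto elim!: nonpos_Ints_cases)
  have "integrable lpos (\<lambda>k. Gamma c * (cpow k (b - 1) * cpow (1 + k) (- c)))"
    by (rule iffD1[OF lpos_cong_integrable[OF right]], assumption) (use *(3) in simp)
  from integrable_mult_right[OF this, of "inverse (Gamma c)"]
  show "integrable lpos (\<lambda>k. cpow k (b - 1) * cpow (1 + k) (- c))"
    using nz by (simp add: mult.assoc[symmetric])
  have "(\<integral>r. \<integral>k. f r k \<partial>lpos \<partial>lpos) = Gamma b * Gamma (c - b)"
    by (rule trans[OF lpos_cong_integral[OF left]], assumption)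
       (use lpos_Gamma(2)[OF cb, of 1] in \<open>simp add: cpow_def\<close>)
  moreover have "(\<integral>k. \<integral>r. f r k \<partial>lpos \<partial>lpos) = Gamma c * (\<integral>k. cpow k (b - 1) * cpow (1 + k) (- c) \<partial>lpos)"
    by (rule trans[OF lpos_cong_integral[OF right]], assumption) simp
  ultimately show "(\<integral>k. cpow k (b - 1) * cpow (1 + k) (- c) \<partial>lpos) = Gamma b * Gamma (c - b) / Gamma c"
    using *(5) nz by (simp add: field_simps)
qed

lemma lpos_square:
  fixes f :: "real \<Rightarrow> 'a::euclidean_space"
  assumes [measurable]: "f \<in> borel_measurable borel"
  shows "integrable lpos (\<lambda>x. (2 * x) *\<^sub>R f (x\<^sup>2)) \<longleftrightarrow> integrable lpos f"
    and "(\<integral>x. (2 * x) *\<^sub>R f (x\<^sup>2) \<partial>lpos) = integral\<^sup>L lpos f"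
proof -
  have img: "(\<lambda>x::real. x\<^sup>2) ` {0<..} = {0<..}"
  proof (intro equalityI subsetI)
    fix x :: real assume "x \<in> {0<..}"
    thus "x \<in> (\<lambda>x. x\<^sup>2) ` {0<..}" by (intro image_eqI[of _ _ "sqrt x"]) auto
  qed auto
  have inj: "inj_on (\<lambda>x::real. x\<^sup>2) {0<..}" by (auto simp: inj_on_def power2_eq_iff)
  have *: "((\<lambda>x::real. x\<^sup>2) has_field_derivative 2 * x) (at x)" for x
    by (auto intro!: derivative_eq_intros)
  have 1: "\<bar>2 * x\<bar> *\<^sub>R f (x\<^sup>2) = (2 * x) *\<^sub>R f (x\<^sup>2)" if "x > 0" for x using that by simp
  show "integrable lpos (\<lambda>x. (2 * x) *\<^sub>R f (x\<^sup>2)) \<longleftrightarrow> integrable lpos f"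
    by (rule trans[OF lpos_cong_integrable[OF 1, symmetric] lpos_change_of_variables(1)[OF assms _ _ * inj img]]) auto
  show "(\<integral>x. (2 * x) *\<^sub>R f (x\<^sup>2) \<partial>lpos) = integral\<^sup>L lpos f"
    by (rule trans[OF lpos_cong_integral[OF 1, symmetric] lpos_change_of_variables(2)[OF assms _ _ * inj img]]) auto
qed

lemma lpos_inverse:
  fixes f :: "real \<Rightarrow> 'a::euclidean_space"
  assumes [measurable]: "f \<in> borel_measurable borel" and c: "c > 0"
  shows "integrable lpos (\<lambda>x. (c / x\<^sup>2) *\<^sub>R f (c / x)) \<longleftrightarrow> integrable lpos f"
    and "(\<integral>x. (c / x\<^sup>2) *\<^sub>R f (c / x) \<partial>lpos) = integral\<^sup>L lpos f"
proof -
  have img: "(\<lambda>x::real. c / x) ` {0<..} = {0<..}"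
  proof (intro equalityI subsetI)
    fix x :: real assume "x \<in> {0<..}"
    thus "x \<in> (\<lambda>x. c / x) ` {0<..}" using c by (intro image_eqI[of _ _ "c / x"]) auto
  qed (use c in auto)
  have inj: "inj_on (\<lambda>x::real. c / x) {0<..}" using c by (auto simp: inj_on_def field_simps)
  have *: "((\<lambda>x::real. c / x) has_field_derivative - (c / x\<^sup>2)) (at x)" if "x > 0" for x
    using that by (auto intro!: derivative_eq_intros simp: power2_eq_square)
  have 1: "\<bar>- (c / x\<^sup>2)\<bar> *\<^sub>R f (c / x) = (c / x\<^sup>2) *\<^sub>R f (c / x)" if "x > 0" for x using that c by simp
  show "integrable lpos (\<lambda>x. (c / x\<^sup>2) *\<^sub>R f (c / x)) \<longleftrightarrow> integrable lpos f"
    by (rule trans[OF lpos_cong_integrable[OF 1, symmetric] lpos_change_of_variables(1)[OF assms(1) _ _ * inj img]]) auto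
  show "(\<integral>x. (c / x\<^sup>2) *\<^sub>R f (c / x) \<partial>lpos) = integral\<^sup>L lpos f"
    by (rule trans[OF lpos_cong_integral[OF 1, symmetric] lpos_change_of_variables(2)[OF assms(1) _ _ * inj img]]) auto
qed

section \<open>The Gaussian integral and subordination\<close>

text \<open>The substitution t^2 in the gamma integral for Gamma (1/2) gives twice the integral over
  the positive half-line; reflection at 0 supplies the other half.\<close>

lemma integral_gaussian:
  "(\<lambda>t::real. exp (- t\<^sup>2)) absolutely_integrable_on UNIV" "integral UNIV (\<lambda>t::real. exp (- t\<^sup>2)) = sqrt pi"
proof -
  let ?f = "\<lambda>t::real. exp (- t\<^sup>2)"
  have eq: "(2 * t) *\<^sub>R (t\<^sup>2 powr (1/2 - 1) * exp (- (1 * t\<^sup>2))) = 2 * ?f t" if "t > 0" for t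
    using that by (simp add: powr_minus powr_half_sqrt)
  have "integrable lpos (\<lambda>t. 2 * ?f t)" "(\<integral>t. 2 * ?f t \<partial>lpos) = sqrt pi"
    using lpos_square[of "\<lambda>x. x powr (1/2 - 1) * exp (- (1 * x))"] lpos_Gamma_real[of "1/2" 1]
      lpos_cong_integrable[OF eq] lpos_cong_integral[OF eq] by (simp_all add: Gamma_one_half_real)
  hence 1: "integrable lpos ?f" "integral\<^sup>L lpos ?f = sqrt pi / 2" by auto
  hence a: "?f absolutely_integrable_on {0<..}" and hi: "(?f has_integral (sqrt pi / 2)) {0<..}"
    by (simp_all add: integrable_lpos_iff integral_lpos has_integral_iff set_lebesgue_integral_eq_integral(1))
  have "?f absolutely_integrable_on (uminus ` {0<..}) \<and> integral (uminus ` {0<..}) ?f = sqrt pi / 2"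
    using a hi by (subst has_absolute_integral_change_of_variables_real[where h = "\<lambda>_. -1", symmetric])
      (auto intro!: derivative_eq_intros simp: integral_unique lebesgue_measurable_vimage_borel)
  hence neg: "(?f has_integral (sqrt pi / 2)) {..<0}"
    by (simp add: has_integral_iff set_lebesgue_integral_eq_integral(1))
  have "(?f has_integral (sqrt pi / 2 + sqrt pi / 2)) ({0<..} \<union> {..<0})"
    by (intro has_integral_Un hi neg) (auto intro: negligible_subset[of "{0}"])
  hence "(?f has_integral sqrt pi) UNIV"
    by (subst (asm) has_integral_spike_set_eq[of _ UNIV]) (auto intro: negligible_subset[of "{0}"])
  thus "?f absolutely_integrable_on UNIV" "integral UNIV ?f = sqrt pi"
    by (auto intro!: nonnegative_absolutely_integrable_1 simp: integral_unique integrable_on_def)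
qed

lemma exp_ge_power_over_fact:
  assumes "(x::real) \<ge> 0"
  shows "x ^ k / fact k \<le> exp x"
proof -
  have "(\<Sum>n\<in>{k}. x ^ n /\<^sub>R fact n) \<le> (\<Sum>n. x ^ n /\<^sub>R fact n)"
    using assms summable_exp_generic[of x] by (intro sum_le_suminf) auto
  thus ?thesis by (simp add: exp_def field_simps)
qed

lemma subordination_integrable:
  assumes "c > 0" "d > 0"
  shows "integrable lpos (\<lambda>w. w powr a * exp (- (d * w) - c / w))"
proof -
  \<comment> \<open>Since exp (-c / w) <= k! (w / c)^k for every k, a large k raises the exponent a
    above -1 and leaves a gamma integrand as majorant.\<close>
  define k where "k = nat \<lceil>\<bar>a\<bar>\<rceil>"
  have k: "a + k + 1 > 0" unfolding k_def by linarith
  show ?thesis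
  proof (rule Bochner_Integration.integrable_bound)
    show "integrable lpos (\<lambda>w. fact k / c ^ k * (w powr (a + k + 1 - 1) * exp (- (d * w))))"
      by (intro integrable_mult_right lpos_Gamma_real k assms)
    show "AE w in lpos. norm (w powr a * exp (- (d * w) - c / w)) \<le> norm (fact k / c ^ k * (w powr (a + k + 1 - 1) * exp (- (d * w))))"
    proof (rule AE_I2)
      fix w :: real assume "w \<in> space lpos" hence w: "w > 0" by simp
      have "(c / w) ^ k / fact k \<le> exp (c / w)"
        using exp_ge_power_over_fact w assms by simp
      hence "exp (- (c / w)) \<le> fact k * w ^ k / c ^ k"
        using w assms by (simp add: exp_minus power_divide field_simps)
      hence "w powr a * exp (- (d * w)) * exp (- (c / w)) \<le> w powr a * exp (- (d * w)) * (fact k * w ^ k / c ^ k)"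
        by (intro mult_left_mono) auto
      moreover have "exp (- (d * w) - c / w) = exp (- (d * w)) * exp (- (c / w))"
        by (simp flip: exp_add)
      ultimately have X: "w powr a * exp (- (d * w) - c / w) \<le> fact k / c ^ k * (w powr (a + k + 1 - 1) * exp (- (d * w)))"
        using w by (simp add: powr_add powr_realpow mult_ac)
      show "norm (w powr a * exp (- (d * w) - c / w)) \<le> norm (fact k / c ^ k * (w powr (a + k + 1 - 1) * exp (- (d * w))))"
        using X w assms by simp
    qed
    show "(\<lambda>w. w powr a * exp (- (d * w) - c / w)) \<in> borel_measurable lpos"
      by (intro lpos_measurableI) measurable
  qed
qed

text \<open>This is Macdonald's integral of order 1/2, the elementary case. The map g w = sqrt w - c
  / sqrt w carries the half-line onto the real line and (g w)^2 = w + c^2 / w - 2 c, so the Gaussian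
  integral becomes a combination of the integrals with exponents -1/2 and -3/2; the inversion w to
  c^2 / w shows that both contribute equally.\<close>

lemma subordination:
  assumes c: "c > 0"
  shows "(\<integral>w. w powr (- (3/2)) * exp (- w - c\<^sup>2 / w) \<partial>lpos) = sqrt pi * exp (- 2 * c) / c"
proof -
  define g where "g = (\<lambda>w. sqrt w - c / sqrt w)"
  define h where "h = (\<lambda>w. (w powr (- (1/2)) + c * w powr (- (3/2))) / 2)"
  let ?f = "\<lambda>t::real. exp (- t\<^sup>2)"
  have h: "h w > 0" if "w > 0" for w using that c unfolding h_def by (intro divide_pos_pos add_pos_pos mult_pos_pos) auto
  have p: "w powr (- (1/2)) = 1 / sqrt w" "w powr (- (3/2)) = 1 / (w * sqrt w)" if "w > 0" for w
    using that powr_add[of w 1 "1/2"] by (simp_all add: powr_minus powr_half_sqrt field_simps)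
  have der: "(g has_field_derivative h w) (at w within {0<..})" if "w \<in> {0<..}" for w
    using that c unfolding g_def h_def
    by (auto intro!: derivative_eq_intros simp: p field_simps power2_eq_square)
  have mono: "strict_mono_on {0<..} g"
  proof (rule strict_mono_onI)
    fix r s :: real assume "r \<in> {0<..}" "s \<in> {0<..}" "r < s"
    hence rs: "0 < sqrt r" "sqrt r < sqrt s" by auto
    hence "c / sqrt s < c / sqrt r" using c by (intro divide_strict_left_mono) auto
    thus "g r < g s" using rs unfolding g_def by linarith
  qed
  have img: "g ` {0<..} = UNIV"
  proof -
    have "t \<in> g ` {0<..}" for t
    proof (rule image_eqI)
      \<comment> \<open>The positive root of y^2 - t y - c = 0, that is, the solution y = sqrt w of
        t = y - c / y.\<close>
      define y where "y = (t + sqrt (t\<^sup>2 + 4 * c)) / 2"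
      have "\<bar>t\<bar> < sqrt (t\<^sup>2 + 4 * c)" using c by (metis real_sqrt_abs real_sqrt_less_mono less_add_same_cancel1 mult_pos_pos zero_less_numeral)
      hence y: "y > 0" using \<open>\<bar>t\<bar> < _\<close> unfolding y_def by (simp add: abs_less_iff)
      have "y\<^sup>2 - t * y - c = 0" unfolding y_def using c
        by (simp add: power2_eq_square field_simps)
      moreover have "sqrt (y\<^sup>2) = y" using y by simp
      ultimately show "t = g (y\<^sup>2)" using y unfolding g_def by (simp only:) (simp add: field_simps power2_eq_square)
      show "y\<^sup>2 \<in> {0<..}" using y by simp
    qed
    thus ?thesis by blast
  qed
  note cv = has_absolute_integral_change_of_variables_real[OF _ der strict_mono_on_imp_inj_on[OF mono], of ?f "sqrt pi", unfolded img]
  have ai: "(\<lambda>x. \<bar>h x\<bar> *\<^sub>R ?f (g x)) absolutely_integrable_on {0<..}"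
    and int: "integral {0<..} (\<lambda>x. \<bar>h x\<bar> *\<^sub>R ?f (g x)) = sqrt pi"
    using cv integral_gaussian by auto
  have meas [measurable]: "(\<lambda>x. \<bar>h x\<bar> *\<^sub>R ?f (g x)) \<in> borel_measurable borel"
    unfolding h_def g_def by measurable
  have I: "(\<integral>x. \<bar>h x\<bar> *\<^sub>R ?f (g x) \<partial>lpos) = sqrt pi"
    using ai int integral_lpos[OF meas] integrable_lpos_iff[OF meas] by simp
  let ?A = "\<lambda>w. w powr (- (1/2)) * exp (- (1 * w) - c\<^sup>2 / w)"
  let ?B = "\<lambda>w. w powr (- (3/2)) * exp (- (1 * w) - c\<^sup>2 / w)"
  have eq: "\<bar>h w\<bar> *\<^sub>R ?f (g w) = exp (2 * c) / 2 * (?A w + c * ?B w)" if "w > 0" for w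
  proof -
    have "- (g w)\<^sup>2 = 2 * c + (- (1 * w) - c\<^sup>2 / w)" using that
      unfolding g_def power2_diff by (simp add: power_divide)
    hence "?f (g w) = exp (2 * c) * exp (- (1 * w) - c\<^sup>2 / w)" by (simp only: exp_add)
    thus ?thesis using h[OF that] by (simp add: h_def field_simps)
  qed
  have iA: "integrable lpos ?A" and iB: "integrable lpos ?B"
    using subordination_integrable[of "c\<^sup>2" 1] c by simp_all
  \<comment> \<open>The exponent is invariant under the inversion, and the Jacobian c^2 / x^2
    changes the power -1/2 into -3/2.\<close>
  have eqA: "(c\<^sup>2 / x\<^sup>2) *\<^sub>R ?A (c\<^sup>2 / x) = c * ?B x" if "x > 0" for x
  proof -
    have e: "- (1 * (c\<^sup>2 / x)) - c\<^sup>2 / (c\<^sup>2 / x) = - (1 * x) - c\<^sup>2 / x" using c by simp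
    have "(c\<^sup>2 / x) powr (- (1/2)) = sqrt x / c" using that c by (simp add: p real_sqrt_divide)
    moreover have "c\<^sup>2 / x\<^sup>2 * (sqrt x / c) = c * x powr (- (3/2))"
      using that c by (simp add: p field_simps power2_eq_square)
    ultimately show ?thesis unfolding e real_scaleR_def by (metis mult.assoc)
  qed
  have "integral\<^sup>L lpos ?A = c * integral\<^sup>L lpos ?B"
  proof -
    have "integral\<^sup>L lpos ?A = (\<integral>x. (c\<^sup>2 / x\<^sup>2) *\<^sub>R ?A (c\<^sup>2 / x) \<partial>lpos)"
      using c by (intro lpos_inverse(2)[symmetric]) auto
    also have "\<dots> = (\<integral>x. c * ?B x \<partial>lpos)"
      by (rule lpos_cong_integral[OF eqA])
    finally show ?thesis by (simp only: integral_mult_right_zero)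
  qed
  moreover have "exp (2 * c) / 2 * (integral\<^sup>L lpos ?A + c * integral\<^sup>L lpos ?B) = sqrt pi"
  proof -
    have "sqrt pi = (\<integral>w. exp (2 * c) / 2 * (?A w + c * ?B w) \<partial>lpos)"
      unfolding I[symmetric] by (rule lpos_cong_integral[OF eq])
    also have "\<dots> = exp (2 * c) / 2 * (integral\<^sup>L lpos ?A + c * integral\<^sup>L lpos ?B)"
      by (simp only: integral_mult_right_zero Bochner_Integration.integral_add[OF iA integrable_mult_right[OF iB]])
    finally show ?thesis ..
  qed
  ultimately have "exp (2 * c) * c * integral\<^sup>L lpos ?B = sqrt pi" by simp
  thus ?thesis using c by (simp add: exp_minus field_simps)
qed

section \<open>The normalised Macdonald function and its remainder\<close>

text \<open>The Macdonald function is half the integral of w^(\<mu> - 1) exp (-z (w + 1/w) / 2). The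
  factor e^z completes the square, because (w + 1/w) / 2 - 1 = (w - 1)^2 / (2 w), and sqrt (2 z /
  \<pi>) / 2 equals sqrt (z / (2 \<pi>)).\<close>

definition kap :: "complex \<Rightarrow> complex \<Rightarrow> complex" where
  "kap \<mu> z = csqrt (z / (2 * of_real pi)) *
     (\<integral>w. cpow w (\<mu> - 1) * exp (- z * of_real ((w - 1)\<^sup>2 / (2 * w))) \<partial>lpos)"

text \<open>The prefactor is the reciprocal of Gamma (1/2 + \<mu>) Gamma (1/2 - \<mu>), which
  normalises the leading coefficient to 1. Written as a cosine it is visibly entire in
  \<mu>.\<close>

definition krem :: "nat \<Rightarrow> complex \<Rightarrow> complex \<Rightarrow> complex" where
  "krem N \<mu> z = cos (of_real pi * \<mu>) / of_real pi *
     (\<integral>(u, v). cpow u (\<mu> - 1/2) * cpow v (- \<mu> - 1/2) * exp (- of_real (u + v)) *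
        exp_rem N (of_real (u * v) / (2 * z)) \<partial>(lpos \<Otimes>\<^sub>M lpos))"

text \<open>What remains of the double integral when every factor is replaced by its modulus: the
  gamma functions see only Re \<mu>, while the cosine keeps the complex \<mu>.
  \<open>ahat_eq_kbound\<close> identifies it with \<open>ahat\<close>.\<close>

definition kbound :: "nat \<Rightarrow> complex \<Rightarrow> real" where
  "kbound N \<mu> = norm (cos (of_real pi * \<mu>)) / pi *
     (Gamma (real N + 1/2 + Re \<mu>) * Gamma (real N + 1/2 - Re \<mu>)) / (2 ^ N * fact N)"

lemma kap_kernel_integrable:
  assumes "x > 0"
  shows "integrable lpos (\<lambda>w. w powr a * exp (- x * ((w - 1)\<^sup>2 / (2 * w))))"
proof -
  have eq: "w powr a * exp (- x * ((w - 1)\<^sup>2 / (2 * w))) = exp x * (w powr a * exp (- (x / 2 * w) - (x / 2) / w))"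
    if "w > 0" for w
  proof -
    have "- x * ((w - 1)\<^sup>2 / (2 * w)) = x + (- (x / 2 * w) - (x / 2) / w)"
      using that by (simp add: power2_eq_square field_simps)
    thus ?thesis by (simp only: exp_add mult_ac)
  qed
  show ?thesis
    by (rule iffD2[OF lpos_cong_integrable[OF eq]], assumption)
       (intro integrable_mult_right subordination_integrable, use assms in auto)
qed

lemma kap_kernel_norm:
  assumes "w > 0"
  shows "norm (cpow w (\<mu> - 1) * exp (- z * of_real ((w - 1)\<^sup>2 / (2 * w)))) =
      w powr (Re \<mu> - 1) * exp (- Re z * ((w - 1)\<^sup>2 / (2 * w)))"
  using assms by (simp add: norm_mult norm_cpow)

lemma kap_kernel_integrable_complex:
  assumes "Re z > 0"
  shows "integrable lpos (\<lambda>w. cpow w (\<mu> - 1) * exp (- z * of_real ((w - 1)\<^sup>2 / (2 * w))))"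
  by (rule Bochner_Integration.integrable_bound[OF kap_kernel_integrable[OF assms, of "Re \<mu> - 1"]])
     (use kap_kernel_norm in \<open>auto intro!: lpos_measurableI\<close>)

lemma kap_holomorphic:
  "(\<lambda>z. kap \<mu> z) holomorphic_on {z. Re z > 0}"
  unfolding kap_def
proof (intro holomorphic_on_mult holomorphic_integral)
  show "(\<lambda>z. csqrt (z / (2 * of_real pi))) holomorphic_on {z. Re z > 0}"
    by (intro holomorphic_intros) (auto simp: complex_nonpos_Reals_iff divide_le_0_iff simp flip: of_real_mult dest: order.strict_trans2[OF pi_gt_zero])
  show "open {z. Re z > 0}" by (rule open_halfspace_Re_gt)
  fix z assume z: "z \<in> {z. Re z > 0}"
  show "\<exists>r>0. \<exists>w. integrable lpos w \<and> (\<forall>z'\<in>ball z r \<inter> {z. Re z > 0}. \<forall>x\<in>space lpos.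
     norm (cpow x (\<mu> - 1) * exp (- z' * of_real ((x - 1)\<^sup>2 / (2 * x)))) \<le> w x)"
  proof (intro exI conjI ballI)
    \<comment> \<open>On this disc the real part stays above Re z / 2, so the kernel at the real
      point Re z / 2 dominates.\<close>
    show "0 < Re z / 2" using z by simp
    show "integrable lpos (\<lambda>w. w powr (Re \<mu> - 1) * exp (- (Re z / 2) * ((w - 1)\<^sup>2 / (2 * w))))"
      using z by (intro kap_kernel_integrable) simp
    fix z' x assume z': "z' \<in> ball z (Re z / 2) \<inter> {z. Re z > 0}" and x: "x \<in> space lpos"
    have "Re z - Re z' \<le> norm (z - z')" by (metis complex_Re_le_cmod minus_complex.simps(1))
    hence "Re z / 2 \<le> Re z'" using z' by (auto simp: dist_norm)
    hence "Re z / 2 * ((x - 1)\<^sup>2 / (2 * x)) \<le> Re z' * ((x - 1)\<^sup>2 / (2 * x))"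
      using x by (intro mult_right_mono) auto
    thus "norm (cpow x (\<mu> - 1) * exp (- z' * of_real ((x - 1)\<^sup>2 / (2 * x)))) \<le>
       x powr (Re \<mu> - 1) * exp (- (Re z / 2) * ((x - 1)\<^sup>2 / (2 * x)))"
      using x by (subst kap_kernel_norm) auto
  qed
qed (auto intro!: holomorphic_intros lpos_measurableI)

lemma kap_holomorphic_order:
  assumes z: "Re z > 0"
  shows "(\<lambda>\<mu>. kap \<mu> z) holomorphic_on UNIV"
  unfolding kap_def
proof (intro holomorphic_on_mult holomorphic_integral)
  fix \<mu>
  show "\<exists>r>0. \<exists>w. integrable lpos w \<and> (\<forall>\<mu>'\<in>ball \<mu> r \<inter> UNIV. \<forall>x\<in>space lpos.
     norm (cpow x (\<mu>' - 1) * exp (- z * of_real ((x - 1)\<^sup>2 / (2 * x)))) \<le> w x)"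
  proof (intro exI conjI ballI)
    show "(0::real) < 1" by simp
    \<comment> \<open>The order moves by less than 1, hence the exponents Re \<mu> - 2 and Re \<mu>
      bracket every exponent Re \<mu>' - 1.\<close>
    show "integrable lpos (\<lambda>w. w powr (Re \<mu> - 2) * exp (- Re z * ((w - 1)\<^sup>2 / (2 * w))) +
        w powr (Re \<mu>) * exp (- Re z * ((w - 1)\<^sup>2 / (2 * w))))"
      using z by (intro Bochner_Integration.integrable_add kap_kernel_integrable) simp_all
    fix \<mu>' x assume m: "\<mu>' \<in> ball \<mu> 1 \<inter> UNIV" and x: "x \<in> space lpos"
    have "\<bar>Re \<mu> - Re \<mu>'\<bar> \<le> norm (\<mu> - \<mu>')" using abs_Re_le_cmod[of "\<mu> - \<mu>'"] by simp
    hence "\<bar>Re \<mu> - Re \<mu>'\<bar> < 1" using m by (auto simp: dist_norm)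
    hence "x powr (Re \<mu>' - 1) \<le> x powr (Re \<mu> - 2) + x powr Re \<mu>"
      using x by (intro powr_between) auto
    hence "x powr (Re \<mu>' - 1) * exp (- Re z * ((x - 1)\<^sup>2 / (2 * x))) \<le>
       (x powr (Re \<mu> - 2) + x powr Re \<mu>) * exp (- Re z * ((x - 1)\<^sup>2 / (2 * x)))"
      by (intro mult_right_mono) auto
    thus "norm (cpow x (\<mu>' - 1) * exp (- z * of_real ((x - 1)\<^sup>2 / (2 * x)))) \<le>
       x powr (Re \<mu> - 2) * exp (- Re z * ((x - 1)\<^sup>2 / (2 * x))) +
        x powr (Re \<mu>) * exp (- Re z * ((x - 1)\<^sup>2 / (2 * x)))"
      using x by (subst kap_kernel_norm) (auto simp: ring_distribs)
  qed
qed (auto intro!: holomorphic_intros lpos_measurableI)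

lemma krem_kernel_measurable [measurable]:
  "(\<lambda>(u, v). cpow u a * cpow v b * exp (- of_real (u + v)) *
        exp_rem N (of_real (u * v) / (2 * z))) \<in> borel_measurable (lpos \<Otimes>\<^sub>M lpos)"
proof -
  have [measurable]: "exp_rem N \<in> borel_measurable borel" by (rule exp_rem_measurable) simp
  show ?thesis by measurable
qed

section \<open>Convergence and analyticity of the remainder integral\<close>

text \<open>The first omitted Taylor term contributes (u v)^N, which shifts both exponents by N. The
  product form lets the double integral split into two gamma integrals, convergent for |m| < N +
  1/2.\<close>

definition krem_dom :: "nat \<Rightarrow> real \<Rightarrow> real \<times> real \<Rightarrow> real" where
  "krem_dom N m = (\<lambda>(u, v). (u powr (real N + 1/2 + m - 1) * exp (- (1 * u))) *
      (v powr (real N + 1/2 - m - 1) * exp (- (1 * v))))"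

lemma krem_dom:
  assumes "\<bar>m\<bar> < real N + 1/2"
  shows "integrable (lpos \<Otimes>\<^sub>M lpos) (krem_dom N m)"
    and "integral\<^sup>L (lpos \<Otimes>\<^sub>M lpos) (krem_dom N m) = Gamma (real N + 1/2 + m) * Gamma (real N + 1/2 - m)"
  unfolding krem_dom_def
  by (subst integrable_lpos_prod | use assms lpos_Gamma_real[of "real N + 1/2 + m" 1] lpos_Gamma_real[of "real N + 1/2 - m" 1] in force)+

lemma krem_kernel_norm:
  assumes "u > 0" "v > 0" "Re z > 0"
  shows "norm (cpow u (\<mu> - 1/2) * cpow v (- \<mu> - 1/2) * exp (- of_real (u + v)) *
        exp_rem N (of_real (u * v) / (2 * z))) \<le> krem_dom N (Re \<mu>) (u, v) / ((2 * norm z) ^ N * fact N)"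
proof -
  have "of_real (u * v) / (2 * z) = of_real (u * v / 2) * (1 / z)" by simp
  hence eq: "Re (of_real (u * v) / (2 * z)) = u * v / 2 * Re (1 / z)"
    by (simp only: times_complex.sel Re_complex_of_real Im_complex_of_real mult_zero_left diff_zero)
  moreover have "u * v / 2 \<ge> 0" using assms by simp
  moreover have "Re (1 / z) \<ge> 0" using assms by (simp add: Re_divide)
  ultimately have "Re (of_real (u * v) / (2 * z)) \<ge> 0"
    using assms unfolding eq by (intro mult_nonneg_nonneg) auto
  from norm_exp_rem_le[OF this, of N]
  have "norm (exp_rem N (of_real (u * v) / (2 * z))) \<le> (u * v) ^ N / ((2 * norm z) ^ N * fact N)"
    using assms by (simp add: norm_divide norm_mult power_divide)
  hence "u powr (Re \<mu> - 1/2) * v powr (- Re \<mu> - 1/2) * exp (- (u + v)) * norm (exp_rem N (of_real (u * v) / (2 * z)))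
    \<le> u powr (Re \<mu> - 1/2) * v powr (- Re \<mu> - 1/2) * exp (- (u + v)) * ((u * v) ^ N / ((2 * norm z) ^ N * fact N))"
    by (intro mult_left_mono) auto
  also have "\<dots> = krem_dom N (Re \<mu>) (u, v) / ((2 * norm z) ^ N * fact N)"
  proof -
    have "real N + 1/2 + Re \<mu> - 1 = (Re \<mu> - 1/2) + real N" "real N + 1/2 - Re \<mu> - 1 = (- Re \<mu> - 1/2) + real N"
      by simp_all
    thus ?thesis unfolding krem_dom_def prod.case
      using assms by (simp only: powr_add powr_realpow) (simp add: exp_add exp_diff exp_minus power_mult_distrib field_simps)
  qed
  finally show ?thesis using assms by (simp add: norm_mult norm_cpow)
qed

lemma krem_kernel_integrable:
  assumes "Re z > 0" "\<bar>Re \<mu>\<bar> < real N + 1/2"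
  shows "integrable (lpos \<Otimes>\<^sub>M lpos) (\<lambda>(u, v). cpow u (\<mu> - 1/2) * cpow v (- \<mu> - 1/2) * exp (- of_real (u + v)) *
        exp_rem N (of_real (u * v) / (2 * z)))"
proof (rule Bochner_Integration.integrable_bound)
  show "integrable (lpos \<Otimes>\<^sub>M lpos) (\<lambda>p. krem_dom N (Re \<mu>) p / ((2 * norm z) ^ N * fact N))"
    using krem_dom(1)[OF assms(2)] by simp
  show "AE p in lpos \<Otimes>\<^sub>M lpos. norm (case p of (u, v) \<Rightarrow> cpow u (\<mu> - 1/2) * cpow v (- \<mu> - 1/2) * exp (- of_real (u + v)) *
        exp_rem N (of_real (u * v) / (2 * z))) \<le> norm (krem_dom N (Re \<mu>) p / ((2 * norm z) ^ N * fact N))"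
  proof (rule AE_I2)
    fix p assume "p \<in> space (lpos \<Otimes>\<^sub>M lpos)"
    then obtain u v where p: "p = (u, v)" "u > 0" "v > 0" by (auto simp: space_pair_measure)
    show "norm (case p of (u, v) \<Rightarrow> cpow u (\<mu> - 1/2) * cpow v (- \<mu> - 1/2) * exp (- of_real (u + v)) *
        exp_rem N (of_real (u * v) / (2 * z))) \<le> norm (krem_dom N (Re \<mu>) p / ((2 * norm z) ^ N * fact N))"
      using krem_kernel_norm[OF p(2,3) assms(1), of \<mu> N] unfolding p(1) prod.case real_norm_def by linarith
  qed
qed (rule krem_kernel_measurable)

lemma krem_bound:
  assumes "Re z > 0" "\<bar>Re \<mu>\<bar> < real N + 1/2"
  shows "norm (krem N \<mu> z) \<le> kbound N \<mu> / norm z ^ N"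
proof -
  let ?f = "\<lambda>(u, v). cpow u (\<mu> - 1/2) * cpow v (- \<mu> - 1/2) * exp (- of_real (u + v)) *
        exp_rem N (of_real (u * v) / (2 * z))"
  have "norm (integral\<^sup>L (lpos \<Otimes>\<^sub>M lpos) ?f) \<le> (\<integral>p. krem_dom N (Re \<mu>) p / ((2 * norm z) ^ N * fact N) \<partial>(lpos \<Otimes>\<^sub>M lpos))"
    by (rule order_trans[OF integral_norm_bound integral_mono])
       (use krem_kernel_norm assms krem_dom(1)[OF assms(2)] krem_kernel_integrable[OF assms] in
         \<open>auto simp: space_pair_measure intro!: integrable_norm\<close>)
  also have "\<dots> = Gamma (real N + 1/2 + Re \<mu>) * Gamma (real N + 1/2 - Re \<mu>) / ((2 * norm z) ^ N * fact N)"
    using krem_dom[OF assms(2)] by simp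
  finally have "norm (cos (of_real pi * \<mu>)) / pi * norm (integral\<^sup>L (lpos \<Otimes>\<^sub>M lpos) ?f) \<le>
     norm (cos (of_real pi * \<mu>)) / pi * (Gamma (real N + 1/2 + Re \<mu>) * Gamma (real N + 1/2 - Re \<mu>) / ((2 * norm z) ^ N * fact N))"
    by (intro mult_left_mono) auto
  thus ?thesis unfolding krem_def kbound_def norm_mult norm_divide by (simp add: power_mult_distrib mult_ac)
qed

lemma krem_holomorphic:
  assumes m: "\<bar>Re \<mu>\<bar> < real N + 1/2"
  shows "(\<lambda>z. krem N \<mu> z) holomorphic_on {z. Re z > 0}"
  unfolding krem_def
proof (intro holomorphic_on_mult holomorphic_on_const holomorphic_integral)
  show "open {z. Re z > 0}" by (rule open_halfspace_Re_gt)
  fix z assume z: "z \<in> {z. Re z > 0}"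
  show "\<exists>r>0. \<exists>w. integrable (lpos \<Otimes>\<^sub>M lpos) w \<and> (\<forall>z'\<in>ball z r \<inter> {z. Re z > 0}. \<forall>x\<in>space (lpos \<Otimes>\<^sub>M lpos).
     norm (case x of (u, v) \<Rightarrow> cpow u (\<mu> - 1/2) * cpow v (- \<mu> - 1/2) * exp (- of_real (u + v)) *
        exp_rem N (of_real (u * v) / (2 * z'))) \<le> w x)"
  proof (intro exI conjI ballI)
    show "0 < Re z / 2" using z by simp
    show "integrable (lpos \<Otimes>\<^sub>M lpos) (\<lambda>p. krem_dom N (Re \<mu>) p / (Re z ^ N * fact N))"
      using krem_dom(1)[OF m] by simp
    fix z' x assume z': "z' \<in> ball z (Re z / 2) \<inter> {z. Re z > 0}" and x: "x \<in> space (lpos \<Otimes>\<^sub>M lpos)"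
    obtain u v where uv: "x = (u, v)" "u > 0" "v > 0" using x by (auto simp: space_pair_measure)
    have "Re z - Re z' \<le> norm (z - z')" by (metis complex_Re_le_cmod minus_complex.simps(1))
    hence "Re z / 2 \<le> Re z'" using z' by (auto simp: dist_norm)
    hence "Re z \<le> 2 * norm z'" using complex_Re_le_cmod[of z'] by linarith
    hence "Re z ^ N * fact N \<le> (2 * norm z') ^ N * fact N" using z by (intro mult_right_mono power_mono) auto
    hence "krem_dom N (Re \<mu>) (u, v) / ((2 * norm z') ^ N * fact N) \<le> krem_dom N (Re \<mu>) (u, v) / (Re z ^ N * fact N)"
      using z z' by (intro divide_left_mono mult_pos_pos zero_less_power) (auto simp: krem_dom_def)
    moreover note krem_kernel_norm[OF uv(2,3), of z' \<mu> N]
    ultimately show "norm (case x of (u, v) \<Rightarrow> cpow u (\<mu> - 1/2) * cpow v (- \<mu> - 1/2) * exp (- of_real (u + v)) *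
        exp_rem N (of_real (u * v) / (2 * z'))) \<le> krem_dom N (Re \<mu>) x / (Re z ^ N * fact N)"
      using uv z' by auto
  qed
qed (auto intro!: holomorphic_intros)

lemma krem_holomorphic_order:
  assumes z: "Re z > 0"
  shows "(\<lambda>\<mu>. krem N \<mu> z) holomorphic_on {\<mu>. \<bar>Re \<mu>\<bar> < real N + 1/2}"
  unfolding krem_def
proof (intro holomorphic_on_mult holomorphic_integral)
  have eq: "{\<mu>. \<bar>Re \<mu>\<bar> < real N + 1/2} = {\<mu>. Re \<mu> < real N + 1/2} \<inter> {\<mu>. Re \<mu> > - (real N + 1/2)}" by auto
  show "open {\<mu>. \<bar>Re \<mu>\<bar> < real N + 1/2}" unfolding eq
    by (intro open_Int open_halfspace_Re_gt open_halfspace_Re_lt)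
  fix \<mu> assume m: "\<mu> \<in> {\<mu>. \<bar>Re \<mu>\<bar> < real N + 1/2}"
  \<comment> \<open>Half the distance to the edge of the strip, so that the orders shifted by r in
    either direction still give integrable majorants.\<close>
  define r where "r = (real N + 1/2 - \<bar>Re \<mu>\<bar>) / 2"
  have r: "r > 0" using m by (auto simp: r_def)
  have r': "\<bar>Re \<mu> + r\<bar> < real N + 1/2" "\<bar>Re \<mu> - r\<bar> < real N + 1/2" using m by (auto simp: r_def abs_if field_simps)
  show "\<exists>r>0. \<exists>w. integrable (lpos \<Otimes>\<^sub>M lpos) w \<and> (\<forall>\<mu>'\<in>ball \<mu> r \<inter> {\<mu>. \<bar>Re \<mu>\<bar> < real N + 1/2}. \<forall>x\<in>space (lpos \<Otimes>\<^sub>M lpos).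
     norm (case x of (u, v) \<Rightarrow> cpow u (\<mu>' - 1/2) * cpow v (- \<mu>' - 1/2) * exp (- of_real (u + v)) *
        exp_rem N (of_real (u * v) / (2 * z))) \<le> w x)"
  proof (intro exI conjI ballI)
    show "0 < r" by (rule r)
    show "integrable (lpos \<Otimes>\<^sub>M lpos) (\<lambda>p. (krem_dom N (Re \<mu> + r) p + krem_dom N (Re \<mu> - r) p) / ((2 * norm z) ^ N * fact N))"
      using krem_dom(1)[OF r'(1)] krem_dom(1)[OF r'(2)] by simp
    fix \<mu>' x assume m': "\<mu>' \<in> ball \<mu> r \<inter> {\<mu>. \<bar>Re \<mu>\<bar> < real N + 1/2}" and x: "x \<in> space (lpos \<Otimes>\<^sub>M lpos)"
    obtain u v where uv: "x = (u, v)" "u > 0" "v > 0" using x by (auto simp: space_pair_measure)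
    have "\<bar>Re \<mu> - Re \<mu>'\<bar> \<le> norm (\<mu> - \<mu>')" using abs_Re_le_cmod[of "\<mu> - \<mu>'"] by simp
    hence d: "\<bar>Re \<mu> - Re \<mu>'\<bar> < r" using m' by (auto simp: dist_norm)
    \<comment> \<open>The order enters only through the power (u / v)^m, so the two extreme orders
      of the disc dominate all others.\<close>
    have eq: "krem_dom N m (u, v) = (u / v) powr m * krem_dom N 0 (u, v)" for m
    proof -
      have "real N + 1/2 + m - 1 = m + (real N - 1/2)" "real N + 1/2 - m - 1 = (real N - 1/2) - m"
        "real N + 1/2 + 0 - 1 = real N - 1/2" "real N + 1/2 - 0 - 1 = real N - 1/2" by simp_all
      thus ?thesis using uv unfolding krem_dom_def prod.case
        by (simp only: powr_divide powr_diff powr_add) (simp add: powr_divide mult_ac)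
    qed
    have "(u / v) powr Re \<mu>' \<le> (u / v) powr (Re \<mu> - r) + (u / v) powr (Re \<mu> + r)"
      using uv d by (intro powr_between) auto
    hence "(u / v) powr Re \<mu>' * krem_dom N 0 (u, v) \<le> ((u / v) powr (Re \<mu> - r) + (u / v) powr (Re \<mu> + r)) * krem_dom N 0 (u, v)"
      by (intro mult_right_mono) (auto simp: krem_dom_def)
    hence "krem_dom N (Re \<mu>') (u, v) \<le> krem_dom N (Re \<mu> + r) (u, v) + krem_dom N (Re \<mu> - r) (u, v)"
      unfolding eq[of "Re \<mu>'"] eq[of "Re \<mu> + r"] eq[of "Re \<mu> - r"] by (simp add: algebra_simps)
    hence "krem_dom N (Re \<mu>') (u, v) / ((2 * norm z) ^ N * fact N) \<le> (krem_dom N (Re \<mu> + r) (u, v) + krem_dom N (Re \<mu> - r) (u, v)) / ((2 * norm z) ^ N * fact N)"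
      by (intro divide_right_mono) auto
    moreover note krem_kernel_norm[OF uv(2,3) z, of \<mu>' N]
    ultimately show "norm (case x of (u, v) \<Rightarrow> cpow u (\<mu>' - 1/2) * cpow v (- \<mu>' - 1/2) * exp (- of_real (u + v)) *
        exp_rem N (of_real (u * v) / (2 * z))) \<le> (krem_dom N (Re \<mu> + r) x + krem_dom N (Re \<mu> - r) x) / ((2 * norm z) ^ N * fact N)"
      using uv by auto
  qed
qed (auto intro!: holomorphic_intros)

section \<open>The asymptotic expansion with its remainder\<close>

text \<open>With reciprocal gamma functions the reflection formula holds for every \<mu>, including
  the zeros of the cosine.\<close>

lemma Gamma_half_reflection:
  "cos (of_real pi * \<mu>) = of_real pi * (rGamma (1/2 + \<mu>) * rGamma (1/2 - \<mu> :: complex))"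
proof -
  have "sin (of_real pi * (1/2 + \<mu>)) = cos (of_real pi * \<mu>)"
    by (simp add: ring_distribs sin_add cos_of_real sin_of_real[symmetric] flip: cos_of_real)
  moreover have "1 - (1/2 + \<mu>) = 1/2 - \<mu>" by (simp add: field_simps)
  ultimately show ?thesis using rGamma_reflection_complex[of "1/2 + \<mu>"] by (simp add: field_simps)
qed

lemma Re_pos_not_nonpos_Int: "Re z > 0 \<Longrightarrow> z \<notin> \<int>\<^sub>\<le>\<^sub>0"
  by (auto elim!: nonpos_Ints_cases)

lemma Gamma_Re_pos_nonzero: "Re z > 0 \<Longrightarrow> Gamma z \<noteq> 0"
  by (intro Gamma_nonzero Re_pos_not_nonpos_Int)

lemma pochhammer_half:
  assumes "\<bar>Re \<mu>\<bar> < 1/2"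
  shows "cos (of_real pi * \<mu>) / of_real pi * (Gamma (of_nat n + 1/2 + \<mu>) * Gamma (of_nat n + 1/2 - \<mu>)) =
     pochhammer (1/2 + \<mu>) n * pochhammer (1/2 - \<mu>) n"
proof -
  have nz: "Gamma (1/2 + \<mu>) \<noteq> 0" "Gamma (1/2 - \<mu>) \<noteq> 0" using assms by (auto intro!: Gamma_Re_pos_nonzero)
  have "pochhammer (1/2 + \<mu>) n = Gamma (1/2 + \<mu> + of_nat n) / Gamma (1/2 + \<mu>)"
    "pochhammer (1/2 - \<mu>) n = Gamma (1/2 - \<mu> + of_nat n) / Gamma (1/2 - \<mu>)"
    using assms by (auto intro!: pochhammer_Gamma Re_pos_not_nonpos_Int)
  hence "Gamma (1/2 + \<mu> + of_nat n) = pochhammer (1/2 + \<mu>) n * Gamma (1/2 + \<mu>)"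
    "Gamma (1/2 - \<mu> + of_nat n) = pochhammer (1/2 - \<mu>) n * Gamma (1/2 - \<mu>)" using nz by simp_all
  moreover have "of_nat n + 1/2 + \<mu> = 1/2 + \<mu> + of_nat n" "of_nat n + 1/2 - \<mu> = 1/2 - \<mu> + of_nat n" by simp_all
  ultimately have "cos (of_real pi * \<mu>) / of_real pi * (Gamma (of_nat n + 1/2 + \<mu>) * Gamma (of_nat n + 1/2 - \<mu>)) =
     pochhammer (1/2 + \<mu>) n * pochhammer (1/2 - \<mu>) n * ((inverse (Gamma (1/2 + \<mu>)) * Gamma (1/2 + \<mu>)) *
     (inverse (Gamma (1/2 - \<mu>)) * Gamma (1/2 - \<mu>)))"
    by (simp only: Gamma_half_reflection rGamma_inverse_Gamma) simp
  thus ?thesis using nz by simp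
qed

lemma krem_monomial:
  fixes \<mu> :: complex and n :: nat
  assumes m: "\<bar>Re \<mu>\<bar> < 1/2"
  defines "f \<equiv> (\<lambda>(u, v). cpow u (\<mu> - 1/2) * cpow v (- \<mu> - 1/2) * exp (- of_real (u + v)) * of_real (u * v) ^ n)"
  shows "integrable (lpos \<Otimes>\<^sub>M lpos) f"
    and "integral\<^sup>L (lpos \<Otimes>\<^sub>M lpos) f = Gamma (of_nat n + 1/2 + \<mu>) * Gamma (of_nat n + 1/2 - \<mu>)"
proof -
  define a where "a = of_nat n + 1/2 + \<mu>"
  define b where "b = of_nat n + 1/2 - \<mu>"
  have ab: "Re a > 0" "Re b > 0" using m by (auto simp: a_def b_def)
  define g where "g = (\<lambda>(u, v). (cpow u (a - 1) * exp (- of_real (1 * u))) * (cpow v (b - 1) * exp (- of_real (1 * v))))"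
  have eq: "f p = g p" if sp: "p \<in> space (lpos \<Otimes>\<^sub>M lpos)" for p
  proof -
    obtain u v where p: "p = (u, v)" "u > 0" "v > 0" using sp by (auto simp: space_pair_measure)
    have ab': "a - 1 = (\<mu> - 1/2) + of_nat n" "b - 1 = (- \<mu> - 1/2) + of_nat n" by (simp_all add: a_def b_def)
    show ?thesis using p(2,3) unfolding p(1) f_def g_def prod.case ab'
      by (simp only: cpow_add cpow_of_nat) (simp add: exp_add exp_diff exp_minus power_mult_distrib field_simps)
  qed
  have "integrable (lpos \<Otimes>\<^sub>M lpos) g" "integral\<^sup>L (lpos \<Otimes>\<^sub>M lpos) g = Gamma a * Gamma b"
    unfolding g_def by (subst integrable_lpos_prod | use lpos_Gamma[OF ab(1), of 1] lpos_Gamma[OF ab(2), of 1] in \<open>force simp: cpow_def\<close>)+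
  thus "integrable (lpos \<Otimes>\<^sub>M lpos) f" "integral\<^sup>L (lpos \<Otimes>\<^sub>M lpos) f = Gamma (of_nat n + 1/2 + \<mu>) * Gamma (of_nat n + 1/2 - \<mu>)"
    using Bochner_Integration.integrable_cong[of _ _ f g, OF refl eq] Bochner_Integration.integral_cong[of _ _ f g, OF refl eq]
    by (simp_all add: a_def b_def)
qed

text \<open>On the strip |Re \<mu>| < 1/2 every moment of u v converges, so the Taylor polynomial
  may be integrated term by term. Each moment is a product of two gamma functions, and the
  reflection formula turns it into the Pochhammer products of a_n.\<close>

lemma krem_split:
  assumes m: "\<bar>Re \<mu>\<bar> < 1/2" and z: "Re z > 0"
  shows "krem 0 \<mu> z = (\<Sum>n<N. acoeff n \<mu> / z ^ n) + krem N \<mu> z"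
proof -
  let ?w = "\<lambda>u v. cpow u (\<mu> - 1/2) * cpow v (- \<mu> - 1/2) * exp (- of_real (u + v))"
  have m': "\<bar>Re \<mu>\<bar> < real N + 1/2" using m by simp
  have eq: "(case p of (u, v) \<Rightarrow> ?w u v * exp_rem 0 (of_real (u * v) / (2 * z))) =
    (\<Sum>n<N. (- 1 / (2 * z)) ^ n / fact n * (case p of (u, v) \<Rightarrow> ?w u v * of_real (u * v) ^ n)) +
    (case p of (u, v) \<Rightarrow> ?w u v * exp_rem N (of_real (u * v) / (2 * z)))" for p
  proof -
    obtain u v where p: "p = (u, v)" by force
    have "exp_rem 0 (of_real (u * v) / (2 * z)) =
       (\<Sum>n<N. (- (of_real (u * v) / (2 * z))) ^ n / fact n) + exp_rem N (of_real (u * v) / (2 * z))"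
      by (simp add: exp_rem_def)
    also have "(\<Sum>n<N. (- (of_real (u * v) / (2 * z))) ^ n / fact n) =
       (\<Sum>n<N. (- 1 / (2 * z)) ^ n / fact n * of_real (u * v) ^ n)"
    proof (intro sum.cong refl)
      fix n
      have "- (of_real (u * v) / (2 * z)) = (- 1 / (2 * z)) * of_real (u * v)" by simp
      thus "(- (of_real (u * v) / (2 * z))) ^ n / fact n = (- 1 / (2 * z)) ^ n / fact n * of_real (u * v) ^ n"
        by (simp only: power_mult_distrib) simp
    qed
    finally show ?thesis unfolding p prod.case by (simp only: ring_distribs sum_distrib_left mult_ac)
  qed
  have "krem 0 \<mu> z = cos (of_real pi * \<mu>) / of_real pi *
      ((\<Sum>n<N. (- 1 / (2 * z)) ^ n / fact n * (Gamma (of_nat n + 1/2 + \<mu>) * Gamma (of_nat n + 1/2 - \<mu>))) +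
       (\<integral>(u, v). ?w u v * exp_rem N (of_real (u * v) / (2 * z)) \<partial>(lpos \<Otimes>\<^sub>M lpos)))"
    unfolding krem_def eq
    by (subst Bochner_Integration.integral_add Bochner_Integration.integral_sum |
         (intro Bochner_Integration.integrable_sum integrable_mult_right krem_monomial krem_kernel_integrable m m' z))+
       (simp only: krem_monomial(2)[OF m] integral_mult_right_zero)
  also have "\<dots> = (\<Sum>n<N. (- 1 / (2 * z)) ^ n / fact n *
       (cos (of_real pi * \<mu>) / of_real pi * (Gamma (of_nat n + 1/2 + \<mu>) * Gamma (of_nat n + 1/2 - \<mu>)))) + krem N \<mu> z"
    unfolding krem_def by (simp only: ring_distribs sum_distrib_left mult_ac)
  also have "(\<Sum>n<N. (- 1 / (2 * z)) ^ n / fact n *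
       (cos (of_real pi * \<mu>) / of_real pi * (Gamma (of_nat n + 1/2 + \<mu>) * Gamma (of_nat n + 1/2 - \<mu>)))) =
       (\<Sum>n<N. acoeff n \<mu> / z ^ n)"
  proof (intro sum.cong refl)
    fix n
    \<comment> \<open>The origin of the factor (-2)^n in the denominator of a_n.\<close>
    have "(- 1 / (2 * z)) ^ n = 1 / ((-2) ^ n * z ^ n)"
      by (metis divide_minus_left minus_divide_right mult_minus_left power_mult_distrib power_one_over)
    thus "(- 1 / (2 * z)) ^ n / fact n *
       (cos (of_real pi * \<mu>) / of_real pi * (Gamma (of_nat n + 1/2 + \<mu>) * Gamma (of_nat n + 1/2 - \<mu>))) = acoeff n \<mu> / z ^ n"
      unfolding pochhammer_half[OF m] acoeff_def by simp
  qed
  finally show ?thesis .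
qed

text \<open>Both sides reduce to the one-dimensional integral X. Integrating out v leads from
  \<open>krem\<close> to X. From X, a quadratic substitution produces exp (-2 c) / c with c = sqrt
  (y + x^2 / 4); subordination makes this exponential in y, the y-integral becomes a gamma integral,
  and what is left is the kernel of \<open>kap\<close> up to scaling.\<close>

lemma krem_0_eq_kap:
  assumes m: "\<bar>Re \<mu>\<bar> < 1/2" and x: "x > (0::real)"
  shows "krem 0 \<mu> (of_real x) = kap \<mu> (of_real x)"
proof -
  define X where "X = (\<integral>u. cpow u (\<mu> - 1/2) * exp (- of_real u) * cpow (1 + u / (2 * x)) (\<mu> - 1/2) \<partial>lpos)"
  define I where "I = (\<integral>w. cpow w (\<mu> - 1) * exp (- of_real x * of_real ((w - 1)\<^sup>2 / (2 * w))) \<partial>lpos)"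
  have ab: "Re (1/2 + \<mu>) > 0" "Re (1/2 - \<mu>) > 0" using m by auto
  \<comment> \<open>the integral over \<open>v\<close> is a gamma integral\<close>
  have 1: "krem 0 \<mu> (of_real x) = cos (of_real pi * \<mu>) / of_real pi * Gamma (1/2 - \<mu>) * X"
  proof -
    define F where "F = (\<lambda>u v. cpow u (\<mu> - 1/2) * cpow v (- \<mu> - 1/2) * exp (- of_real (u + v)) *
        exp_rem 0 (of_real (u * v) / (2 * of_real x)))"
    have "integrable (lpos \<Otimes>\<^sub>M lpos) (case_prod F)"
      unfolding F_def by (rule krem_kernel_integrable) (use m x in auto)
    from lpos2.integral_fst'[OF this]
    have "krem 0 \<mu> (of_real x) = cos (of_real pi * \<mu>) / of_real pi * (\<integral>u. \<integral>v. F u v \<partial>lpos \<partial>lpos)"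
      by (simp add: krem_def F_def)
    also have "(\<integral>u. \<integral>v. F u v \<partial>lpos \<partial>lpos) =
       (\<integral>u. Gamma (1/2 - \<mu>) * (cpow u (\<mu> - 1/2) * exp (- of_real u) * cpow (1 + u / (2 * x)) (\<mu> - 1/2)) \<partial>lpos)"
    proof (rule lpos_cong_integral)
      fix u :: real assume u: "u > 0"
      have l: "1 + u / (2 * x) > 0" using u x by (simp add: add_pos_pos)
      have "F u v = cpow u (\<mu> - 1/2) * exp (- of_real u) *
         (cpow v ((1/2 - \<mu>) - 1) * exp (- of_real ((1 + u / (2 * x)) * v)))" for v
      proof -
        have e: "exp (- of_real (u + v)) * exp (- (of_real (u * v) / (2 * of_real x))) =
           exp (- of_real u) * exp (- complex_of_real ((1 + u / (2 * x)) * v))"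
        proof -
          have "- complex_of_real (u + v) + - (of_real (u * v) / (2 * of_real x)) =
             - of_real u + - complex_of_real ((1 + u / (2 * x)) * v)" by (simp add: ring_distribs)
          thus ?thesis by (simp only: exp_add[symmetric])
        qed
        have "(1/2 - \<mu>) - 1 = - \<mu> - 1/2" by simp
        thus ?thesis unfolding F_def exp_rem_def using e by (simp only: lessThan_0 sum.empty diff_0_right mult_ac) (simp add: mult_ac)
      qed
      hence "(\<integral>v. F u v \<partial>lpos) = cpow u (\<mu> - 1/2) * exp (- of_real u) * (Gamma (1/2 - \<mu>) * cpow (1 + u / (2 * x)) (- (1/2 - \<mu>)))"
        using lpos_Gamma(2)[OF ab(2) l] by (simp only: integral_mult_right_zero)
      thus "(\<integral>v. F u v \<partial>lpos) = Gamma (1/2 - \<mu>) * (cpow u (\<mu> - 1/2) * exp (- of_real u) * cpow (1 + u / (2 * x)) (\<mu> - 1/2))"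
        by (simp add: mult_ac)
    qed
    finally show ?thesis unfolding X_def by (simp only: integral_mult_right_zero mult.assoc)
  qed
  define c where "c = (\<lambda>y. sqrt (y + x\<^sup>2 / 4))"
  define f where "f = (\<lambda>y. cpow y (\<mu> - 1/2) * of_real (exp (x - 2 * c y) / c y))"
  have c_pos: "c y > 0" if "y > 0" for y using that by (simp add: c_def add_pos_nonneg)
  have 2: "integral\<^sup>L lpos f = cpow (x / 2) (\<mu> - 1/2) * X"
  proof -
    \<comment> \<open>Chosen so that g u + x^2 / 4 is the square of (u + x) / 2: the square root in
      c disappears, and its value is also the derivative h of g, which cancels the denominator
      c.\<close>
    define g where "g = (\<lambda>u. u * (u + 2 * x) / 4)"
    define h where "h = (\<lambda>u. (u + x) / 2)"
    have der: "(g has_field_derivative h u) (at u)" for u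
      unfolding g_def h_def by (auto intro!: derivative_eq_intros simp: field_simps)
    have cg: "c (g u) = h u" if "u > 0" for u
    proof -
      have "g u + x\<^sup>2 / 4 = (h u)\<^sup>2" by (simp add: g_def h_def power2_eq_square field_simps)
      thus ?thesis using that x by (simp add: c_def h_def)
    qed
    have inj: "inj_on g {0<..}"
    proof (rule inj_onI)
      fix u v assume uv: "u \<in> {0<..}" "v \<in> {0<..}" "g u = g v"
      hence "h u = h v" using cg by (metis greaterThan_iff)
      thus "u = v" by (simp add: h_def)
    qed
    have img: "g ` {0<..} = {0<..}"
    proof (intro equalityI subsetI)
      fix y :: real assume y: "y \<in> {0<..}"
      have "sqrt (x\<^sup>2 / 4) < c y" using y unfolding c_def by (intro real_sqrt_less_mono) auto
      hence "2 * c y - x > 0" using x by (simp add: real_sqrt_divide)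
      moreover have "y = g (2 * c y - x)"
      proof -
        have "g (2 * c y - x) = (c y)\<^sup>2 - x\<^sup>2 / 4" by (simp add: g_def power2_eq_square field_simps)
        thus ?thesis using y by (simp add: c_def)
      qed
      ultimately show "y \<in> g ` {0<..}" by blast
    qed (use x in \<open>auto simp: g_def\<close>)
    have "integral\<^sup>L lpos f = (\<integral>u. \<bar>h u\<bar> *\<^sub>R f (g u) \<partial>lpos)"
    proof (rule lpos_change_of_variables(2)[symmetric, OF _ _ _ der inj img])
      show "f \<in> borel_measurable borel" unfolding f_def c_def by measurable
    qed (unfold g_def h_def, measurable)
    also have "\<dots> = (\<integral>u. cpow (x / 2) (\<mu> - 1/2) * (cpow u (\<mu> - 1/2) * exp (- of_real u) * cpow (1 + u / (2 * x)) (\<mu> - 1/2)) \<partial>lpos)"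
    proof (rule lpos_cong_integral)
      fix u :: real assume u: "u > 0"
      have h: "h u > 0" using u x by (simp add: h_def)
      have "g u = (x / 2) * (u * (1 + u / (2 * x)))" using x by (simp add: g_def field_simps)
      moreover have "1 + u / (2 * x) > 0" using u x by (simp add: add_pos_pos)
      ultimately have "cpow (g u) (\<mu> - 1/2) = cpow (x / 2) (\<mu> - 1/2) * (cpow u (\<mu> - 1/2) * cpow (1 + u / (2 * x)) (\<mu> - 1/2))"
        using u x by (simp only: cpow_mult[of "x / 2"] cpow_mult[of u] mult_pos_pos half_gt_zero)
      moreover have "\<bar>h u\<bar> * (exp (x - 2 * c (g u)) / c (g u)) = exp (- u)"
        using h by (simp add: cg[OF u]) (simp add: h_def field_simps)
      hence "of_real \<bar>h u\<bar> * of_real (exp (x - 2 * c (g u)) / c (g u)) = exp (- complex_of_real u)"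
        by (metis of_real_mult of_real_minus exp_of_real)
      ultimately show "\<bar>h u\<bar> *\<^sub>R f (g u) = cpow (x / 2) (\<mu> - 1/2) * (cpow u (\<mu> - 1/2) * exp (- of_real u) * cpow (1 + u / (2 * x)) (\<mu> - 1/2))"
        unfolding f_def scaleR_conv_of_real mult.left_commute[of "of_real \<bar>h u\<bar>"] by (simp only: mult_ac)
    qed
    finally show ?thesis unfolding X_def by (simp only: integral_mult_right_zero)
  qed
  \<comment> \<open>subordination turns \<open>exp (- 2 c) / c\<close> into a Gaussian-type integral\<close>
  have 3: "integral\<^sup>L lpos f = of_real (exp x / sqrt pi) * Gamma (1/2 + \<mu>) *
     (\<integral>w. cpow w (\<mu> - 1) * of_real (exp (- (1 * w) - x\<^sup>2 / 4 / w)) \<partial>lpos)"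
  proof -
    define F where "F = (\<lambda>w y. of_real (w powr (- (3/2)) * exp (- (1 * w) - x\<^sup>2 / 4 / w)) *
       (cpow y ((1/2 + \<mu>) - 1) * exp (- of_real (1 / w * y))))"
    have meas: "case_prod F \<in> borel_measurable (lpos \<Otimes>\<^sub>M lpos)" unfolding F_def by measurable
    have inner: "integrable lpos (F w)" if "w > 0" for w
      unfolding F_def using that ab by (intro integrable_mult_right lpos_Gamma(1)) auto
    have pw: "w powr (- (3/2)) * (1 / w) powr (- Re (1/2 + \<mu>)) = w powr (Re \<mu> - 1)" if "w > 0" for w
    proof -
      have "(1 / w) powr (- Re (1/2 + \<mu>)) = w powr (1/2 + Re \<mu>)"
        using that by (simp add: powr_def ln_div algebra_simps)
      thus ?thesis by (simp only: powr_add[symmetric]) (simp add: algebra_simps)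
    qed
    have norm_eq: "(\<integral>y. norm (F w y) \<partial>lpos) = Gamma (Re (1/2 + \<mu>)) * (w powr (Re \<mu> - 1) * exp (- (1 * w) - x\<^sup>2 / 4 / w))" if "w > 0" for w
    proof -
      have "(\<integral>y. norm (F w y) \<partial>lpos) = (w powr (- (3/2)) * exp (- (1 * w) - x\<^sup>2 / 4 / w)) * (Gamma (Re (1/2 + \<mu>)) * (1 / w) powr (- Re (1/2 + \<mu>)))"
        unfolding F_def norm_mult[of "of_real _"] integral_mult_right_zero using that ab(1)
        by (subst lpos_Gamma_norm(2)) (auto simp: norm_mult)
      thus ?thesis unfolding pw[OF that, symmetric] by (simp only: mult_ac)
    qed
    have outer: "integrable lpos (\<lambda>w. \<integral>y. norm (F w y) \<partial>lpos)"
      by (rule iffD2[OF lpos_cong_integrable[OF norm_eq]], assumption)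
         (intro integrable_mult_right subordination_integrable, use x in auto)
    note sw = lpos_swap(5)[OF meas inner outer]
    have left: "(\<integral>y. F w y \<partial>lpos) = Gamma (1/2 + \<mu>) * (cpow w (\<mu> - 1) * of_real (exp (- (1 * w) - x\<^sup>2 / 4 / w)))" if "w > 0" for w
    proof -
      have "(\<integral>y. F w y \<partial>lpos) = of_real (w powr (- (3/2)) * exp (- (1 * w) - x\<^sup>2 / 4 / w)) * (Gamma (1/2 + \<mu>) * cpow (1 / w) (- (1/2 + \<mu>)))"
        unfolding F_def integral_mult_right_zero using that ab(1) by (subst lpos_Gamma(2)) auto
      moreover have e: "of_real (w powr (- (3/2))) * cpow (1 / w) (- (1/2 + \<mu>)) = cpow w (\<mu> - 1)"
      proof -
        have "cpow (1 / w) (- (1/2 + \<mu>)) = cpow w (1/2 + \<mu>)"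
          using that by (simp add: cpow_def ln_div algebra_simps)
        moreover have "of_real (w powr (- (3/2))) = cpow w (of_real (- (3/2)))" using that by (simp only: cpow_of_real)
        ultimately show ?thesis by (simp only: cpow_add[symmetric]) (simp add: algebra_simps)
      qed
      ultimately show ?thesis unfolding e[symmetric] by (simp only: of_real_mult mult_ac)
    qed
    have right: "of_real (exp x / sqrt pi) * (\<integral>w. F w y \<partial>lpos) = f y" if "y > 0" for y
    proof -
      have "F w y = cpow y (\<mu> - 1/2) * of_real (w powr (- (3/2)) * exp (- w - (c y)\<^sup>2 / w))" if "w > 0" for w
      proof -
        have "exp (- (1 * w) - x\<^sup>2 / 4 / w) * exp (- (1 / w * y)) = exp (- w - (c y)\<^sup>2 / w)"
          using \<open>y > 0\<close> by (simp add: c_def exp_add[symmetric] add_divide_distrib)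
        hence e: "of_real (exp (- (1 * w) - x\<^sup>2 / 4 / w)) * exp (- complex_of_real (1 / w * y)) = of_real (exp (- w - (c y)\<^sup>2 / w))"
          by (metis of_real_mult of_real_minus exp_of_real)
        have e': "(1/2 + \<mu>) - 1 = \<mu> - 1/2" by simp
        show ?thesis unfolding F_def e' of_real_mult e[symmetric] by (simp only: mult_ac of_real_mult)
      qed
      hence "(\<integral>w. F w y \<partial>lpos) = (\<integral>w. cpow y (\<mu> - 1/2) * of_real (w powr (- (3/2)) * exp (- w - (c y)\<^sup>2 / w)) \<partial>lpos)"
        by (rule lpos_cong_integral)
      also have "\<dots> = cpow y (\<mu> - 1/2) * of_real (sqrt pi * exp (- 2 * c y) / c y)"
        by (simp only: integral_mult_right_zero integral_complex_of_real subordination[OF c_pos[OF that]])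
      finally show ?thesis by (simp add: f_def exp_diff exp_minus field_simps flip: of_real_mult)
    qed
    have "integral\<^sup>L lpos f = of_real (exp x / sqrt pi) * (\<integral>y. \<integral>w. F w y \<partial>lpos \<partial>lpos)"
      by (rule trans[OF lpos_cong_integral[OF right[symmetric]] integral_mult_right_zero])
    also have "(\<integral>y. \<integral>w. F w y \<partial>lpos \<partial>lpos) = Gamma (1/2 + \<mu>) * (\<integral>w. cpow w (\<mu> - 1) * of_real (exp (- (1 * w) - x\<^sup>2 / 4 / w)) \<partial>lpos)"
      by (rule trans[OF sw[symmetric] trans[OF lpos_cong_integral[OF left] integral_mult_right_zero]])
    finally show ?thesis by (simp only: mult.assoc)
  qed
  \<comment> \<open>The scaling by x / 2 makes the exponent symmetric under w to 1 / w: -w - x^2 /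
    (4 w) becomes -(x / 2) (w + 1 / w).\<close>
  have 4: "(\<integral>w. cpow w (\<mu> - 1) * of_real (exp (- (1 * w) - x\<^sup>2 / 4 / w)) \<partial>lpos) = cpow (x / 2) \<mu> * of_real (exp (- x)) * I"
  proof -
    let ?f = "\<lambda>w. cpow w (\<mu> - 1) * of_real (exp (- (1 * w) - x\<^sup>2 / 4 / w))"
    have "integral\<^sup>L lpos ?f = (\<integral>w. (x / 2) *\<^sub>R ?f (x / 2 * w) \<partial>lpos)"
      by (rule lpos_scale(2)[symmetric]) (use x in auto)
    also have "\<dots> = (\<integral>w. cpow (x / 2) \<mu> * of_real (exp (- x)) * (cpow w (\<mu> - 1) * exp (- of_real x * of_real ((w - 1)\<^sup>2 / (2 * w)))) \<partial>lpos)"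
    proof (rule lpos_cong_integral)
      fix w :: real assume w: "w > 0"
      have "- (1 * (x / 2 * w)) - x\<^sup>2 / 4 / (x / 2 * w) = - x + - x * ((w - 1)\<^sup>2 / (2 * w))"
        using w x by (simp add: field_simps power2_eq_square)
      hence e1: "exp (- (1 * (x / 2 * w)) - x\<^sup>2 / 4 / (x / 2 * w)) = exp (- x) * exp (- x * ((w - 1)\<^sup>2 / (2 * w)))"
        by (simp only: exp_add)
      have e2: "of_real (x / 2) * cpow (x / 2 * w) (\<mu> - 1) = cpow (x / 2) \<mu> * cpow w (\<mu> - 1)"
      proof -
        have "cpow (x / 2) \<mu> = of_real (x / 2) * cpow (x / 2) (\<mu> - 1)"
          using cpow_add[of "x / 2" 1 "\<mu> - 1"] x by simp
        moreover have "cpow (x / 2 * w) (\<mu> - 1) = cpow (x / 2) (\<mu> - 1) * cpow w (\<mu> - 1)"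
          using x w by (intro cpow_mult) auto
        ultimately show ?thesis by (simp only: mult_ac)
      qed
      have e3: "exp (- of_real x * of_real ((w - 1)\<^sup>2 / (2 * w))) = complex_of_real (exp (- x * ((w - 1)\<^sup>2 / (2 * w))))"
        by (simp add: exp_of_real[symmetric])
      show "(x / 2) *\<^sub>R ?f (x / 2 * w) = cpow (x / 2) \<mu> * of_real (exp (- x)) * (cpow w (\<mu> - 1) * exp (- of_real x * of_real ((w - 1)\<^sup>2 / (2 * w))))"
        unfolding scaleR_conv_of_real e1 e3 of_real_mult
      proof -
        have regroup: "p * (q * (m * n)) = r * m * (s * n)" if "p * q = r * s" for p q r s m n :: complex
        proof -
          have "p * (q * (m * n)) = (p * q) * (m * n)" by (simp only: mult.assoc)
          thus ?thesis unfolding that by (simp only: mult_ac)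
        qed
        show "of_real (x / 2) * (cpow (x / 2 * w) (\<mu> - 1) * (of_real (exp (- x)) * of_real (exp (- x * ((w - 1)\<^sup>2 / (2 * w)))))) =
           cpow (x / 2) \<mu> * of_real (exp (- x)) * (cpow w (\<mu> - 1) * of_real (exp (- x * ((w - 1)\<^sup>2 / (2 * w)))))"
          by (rule regroup[OF e2])
      qed
    qed
    finally show ?thesis by (simp only: I_def integral_mult_right_zero)
  qed
  have "cpow (x / 2) (\<mu> - 1/2) * X = of_real (exp x / sqrt pi) * Gamma (1/2 + \<mu>) * (cpow (x / 2) \<mu> * of_real (exp (- x)) * I)"
    using 2 3 4 by simp
  also have "\<dots> = cpow (x / 2) \<mu> * (Gamma (1/2 + \<mu>) * I / of_real (sqrt pi))"
    by (simp add: exp_minus field_simps flip: of_real_mult)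
  also have "cpow (x / 2) \<mu> = cpow (x / 2) (\<mu> - 1/2) * of_real (sqrt (x / 2))"
  proof -
    have "cpow (x / 2) \<mu> = cpow (x / 2) (\<mu> - 1/2) * cpow (x / 2) (of_real (1/2))"
      by (simp add: cpow_add[symmetric])
    thus ?thesis using x by (simp add: cpow_of_real powr_half_sqrt del: of_real_divide)
  qed
  finally have "cpow (x / 2) (\<mu> - 1/2) * X = cpow (x / 2) (\<mu> - 1/2) * (of_real (sqrt (x / 2)) * (Gamma (1/2 + \<mu>) * I / of_real (sqrt pi)))"
    by (simp only: mult.assoc)
  hence "X = of_real (sqrt (x / 2)) * (Gamma (1/2 + \<mu>) * I / of_real (sqrt pi))"
    by (rule iffD1[OF mult_left_cancel[OF cpow_nonzero]])
  moreover have "kap \<mu> (of_real x) = of_real (sqrt (x / 2) / sqrt pi) * I"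
  proof -
    have "csqrt (of_real x / (2 * of_real pi)) = of_real (sqrt (x / 2) / sqrt pi)"
      using of_real_sqrt[of "x / (2 * pi)"] x by (simp add: real_sqrt_divide real_sqrt_mult)
    thus ?thesis by (simp add: kap_def I_def)
  qed
  ultimately have "X = Gamma (1/2 + \<mu>) * kap \<mu> (of_real x)" by simp
  moreover have "rGamma (1/2 + \<mu>) * Gamma (1/2 + \<mu>) = 1" "rGamma (1/2 - \<mu>) * Gamma (1/2 - \<mu>) = 1"
    using Gamma_Re_pos_nonzero[OF ab(1)] Gamma_Re_pos_nonzero[OF ab(2)] by (simp_all add: rGamma_inverse_Gamma)
  ultimately show ?thesis unfolding 1 Gamma_half_reflection by (simp add: field_simps)
qed

lemma acoeff_holomorphic: "(\<lambda>\<mu>. acoeff n \<mu>) holomorphic_on (S :: complex set)"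
  unfolding acoeff_def pochhammer_prod by (intro holomorphic_intros) auto

text \<open>Two continuations, one variable at a time. For positive z the identity extends in the
  order from |Re \<mu>| < 1/2 to the strip on which \<open>krem N\<close> converges; then it extends
  in z from the positive axis to the right half-plane.\<close>

theorem kap_expansion:
  assumes m: "\<bar>Re \<mu>\<bar> < real N + 1/2" and z: "Re z > 0"
  shows "kap \<mu> z = (\<Sum>n<N. acoeff n \<mu> / z ^ n) + krem N \<mu> z"
proof -
  have "kap \<mu> (of_real x) = (\<Sum>n<N. acoeff n \<mu> / of_real x ^ n) + krem N \<mu> (of_real x)" if x: "x > 0" for x
  proof (rule analytic_continuation_open[where z = \<mu> and f = "\<lambda>\<mu>. kap \<mu> (of_real x)" and
       g = "\<lambda>\<mu>. (\<Sum>n<N. acoeff n \<mu> / of_real x ^ n) + krem N \<mu> (of_real x)" and s = "{\<mu>. \<bar>Re \<mu>\<bar> < 1/2}" and s' = "{\<mu>. \<bar>Re \<mu>\<bar> < real N + 1/2}"])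
    have eq: "{\<mu>. \<bar>Re \<mu>\<bar> < r} = {\<mu>. Re \<mu> < r} \<inter> {\<mu>. Re \<mu> > - r}" for r by auto
    show "open {\<mu>. \<bar>Re \<mu>\<bar> < 1/2}" "open {\<mu>. \<bar>Re \<mu>\<bar> < real N + 1/2}" unfolding eq
      by (intro open_Int open_halfspace_Re_gt open_halfspace_Re_lt)+
    show "connected {\<mu>. \<bar>Re \<mu>\<bar> < real N + 1/2}" unfolding eq
      by (intro convex_connected convex_Int convex_halfspace_Re_gt convex_halfspace_Re_lt)
    have "0 \<in> {\<mu>. \<bar>Re \<mu>\<bar> < 1/2}" by simp
    thus "{\<mu>. \<bar>Re \<mu>\<bar> < 1/2} \<noteq> {}" by blast
    show "(\<lambda>\<mu>. kap \<mu> (of_real x)) holomorphic_on {\<mu>. \<bar>Re \<mu>\<bar> < real N + 1/2}"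
      using kap_holomorphic_order[of "of_real x"] x holomorphic_on_subset by auto
    show "(\<lambda>\<mu>. (\<Sum>n<N. acoeff n \<mu> / of_real x ^ n) + krem N \<mu> (of_real x)) holomorphic_on {\<mu>. \<bar>Re \<mu>\<bar> < real N + 1/2}"
      using x by (intro holomorphic_intros acoeff_holomorphic krem_holomorphic_order) auto
    show "kap \<mu> (of_real x) = (\<Sum>n<N. acoeff n \<mu> / of_real x ^ n) + krem N \<mu> (of_real x)" if "\<mu> \<in> {\<mu>. \<bar>Re \<mu>\<bar> < 1/2}" for \<mu>
      using that x krem_split[of \<mu> "of_real x" N] krem_0_eq_kap[of \<mu> x] by simp
  qed (use m in auto)
  moreover have "(\<lambda>z. (\<Sum>n<N. acoeff n \<mu> / z ^ n) + krem N \<mu> z) holomorphic_on {z. Re z > 0}"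
    by (intro holomorphic_on_add holomorphic_on_sum holomorphic_on_divide holomorphic_intros krem_holomorphic m) auto
  ultimately show ?thesis
    using z by (intro identity_theorem_segment[where S = "{z. Re z > 0}" and a = 0 and b = 1 and f = "kap \<mu>" and z = z
        and g = "\<lambda>z. (\<Sum>n<N. acoeff n \<mu> / z ^ n) + krem N \<mu> z"] kap_holomorphic open_halfspace_Re_gt
        convex_connected convex_halfspace_Re_gt) auto
qed

section \<open>Euler's integral\<close>

lemma hyp_slit_plane_iff: "x \<in> hyp_slit_plane \<longleftrightarrow> \<not> (Im x = 0 \<and> Re x \<ge> 1)"
proof -
  have "x \<in> complex_of_real ` {1..} \<longleftrightarrow> Im x = 0 \<and> Re x \<ge> 1"
    by (auto simp: complex_eq_iff intro!: image_eqI[of _ _ "Re x"])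
  thus ?thesis by (simp add: hyp_slit_plane_def)
qed

lemma mult_less_one:
  fixes u r :: real
  assumes "0 \<le> u" "u \<le> 1" "r < 1"
  shows "u * r < 1"
proof (cases "r \<le> 0")
  case True
  hence "u * r \<le> 0" using assms by (intro mult_nonneg_nonpos)
  thus ?thesis by simp
next
  case False
  hence "u * r \<le> 1 * r" using assms by (intro mult_right_mono) auto
  thus ?thesis using assms by simp
qed

lemma open_hyp_slit_plane: "open hyp_slit_plane"
proof -
  have eq: "- hyp_slit_plane = {x. Im x = 0} \<inter> {x. Re x \<ge> 1}" by (auto simp: hyp_slit_plane_iff)
  show ?thesis unfolding open_closed eq
    by (intro closed_Int closed_Collect_eq closed_Collect_le continuous_intros)
qed

lemma connected_hyp_slit_plane: "connected hyp_slit_plane"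
proof -
  have "starlike hyp_slit_plane"
    unfolding starlike_def
  proof (intro bexI ballI subsetI)
    show "0 \<in> hyp_slit_plane" by (simp add: hyp_slit_plane_iff)
    fix x y assume x: "x \<in> hyp_slit_plane" and y: "y \<in> closed_segment 0 x"
    then obtain u where u: "0 \<le> u" "u \<le> 1" "y = u *\<^sub>R x" by (auto simp: in_segment)
    show "y \<in> hyp_slit_plane"
    proof (rule ccontr)
      assume "y \<notin> hyp_slit_plane"
      hence *: "u * Im x = 0" "u * Re x \<ge> 1" using u by (auto simp: hyp_slit_plane_iff)
      hence "Im x = 0" by auto
      hence "Re x < 1" using x by (auto simp: hyp_slit_plane_iff)
      hence "u * Re x < 1" using u by (intro mult_less_one)
      thus False using *(2) by simp
    qed
  qed
  thus ?thesis by (rule starlike_imp_connected)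
qed

lemma ball_subset_hyp_slit_plane: "norm x < 1 \<Longrightarrow> x \<in> hyp_slit_plane"
  using complex_Re_le_cmod[of x] by (auto simp: hyp_slit_plane_iff)

lemma lpos_measurable_continuous:
  fixes f :: "real \<Rightarrow> 'a::euclidean_space"
  assumes "continuous_on {0<..} f"
  shows "f \<in> borel_measurable lpos"
  using borel_measurable_continuous_on_restrict[OF assms] unfolding lpos_def
  by (simp add: measurable_def space_restrict_space sets_restrict_space)

text \<open>Euler's integral over (0, 1) in the variable k / (1 + k), without its gamma
  factors.\<close>

definition Eint :: "complex \<Rightarrow> complex \<Rightarrow> complex \<Rightarrow> complex \<Rightarrow> complex" where
  "Eint a b c x = (\<integral>k. cpow k (b - 1) * cpow (1 + k) (- c) * (1 - x * of_real (k / (1 + k))) powr (- a) \<partial>lpos)"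

lemma one_minus_slit:
  assumes x: "x \<in> hyp_slit_plane" and y: "0 \<le> y" "y \<le> 1"
  shows "1 - x * of_real y \<notin> \<real>\<^sub>\<le>\<^sub>0"
proof
  assume "1 - x * of_real y \<in> \<real>\<^sub>\<le>\<^sub>0"
  hence *: "Im x * y = 0" "Re x * y \<ge> 1" by (auto simp: complex_nonpos_Reals_iff)
  hence "y \<noteq> 0" by auto
  with * have "Im x = 0" by simp
  hence "Re x < 1" using x by (auto simp: hyp_slit_plane_iff)
  hence "Re x * y < 1" using mult_less_one[OF y, of "Re x"] by (simp only: mult.commute)
  thus False using *(2) by simp
qed

lemma Eint_kernel_measurable:
  assumes x: "x \<in> hyp_slit_plane"
  shows "(\<lambda>k. cpow k (b - 1) * cpow (1 + k) (- c) * (1 - x * of_real (k / (1 + k))) powr (- a)) \<in> borel_measurable lpos"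
proof (intro borel_measurable_times)
  show "(\<lambda>k. (1 - x * of_real (k / (1 + k))) powr (- a)) \<in> borel_measurable lpos"
  proof (rule lpos_measurable_continuous, rule continuous_on_powr_complex)
    show "{0<..} \<subseteq> {k. Re (1 - x * of_real (k / (1 + k))) \<ge> 0 \<or> Im (1 - x * of_real (k / (1 + k))) \<noteq> 0}"
    proof
      fix k :: real assume "k \<in> {0<..}"
      hence "1 - x * of_real (k / (1 + k)) \<notin> \<real>\<^sub>\<le>\<^sub>0" by (intro one_minus_slit x) auto
      thus "k \<in> {k. Re (1 - x * of_real (k / (1 + k))) \<ge> 0 \<or> Im (1 - x * of_real (k / (1 + k))) \<noteq> 0}"
        by (auto simp: complex_nonpos_Reals_iff)
    qed
    show "continuous_on {0<..} (\<lambda>k. 1 - x * of_real (k / (1 + k)))" by (intro continuous_intros) auto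
    fix k :: real assume "k \<in> {0<..}" "1 - x * of_real (k / (1 + k)) = 0"
    thus "0 < Re (- a)" using one_minus_slit[OF x, of "k / (1 + k)"] by auto
  qed (intro continuous_intros)
qed (intro lpos_measurableI, measurable)+

text \<open>For x off the slit the base 1 - x y avoids the nonpositive axis for all y in [0, 1],
  both endpoints included. Compactness therefore bounds the power uniformly in the integration
  variable, leaving a beta integrand as majorant.\<close>

lemma Eint_kernel_bounded:
  assumes x0: "x0 \<in> hyp_slit_plane"
  obtains r B where "r > 0" "cball x0 r \<subseteq> hyp_slit_plane"
    "\<And>x y. x \<in> cball x0 r \<Longrightarrow> 0 \<le> y \<Longrightarrow> y \<le> 1 \<Longrightarrow> norm ((1 - x * of_real y) powr (- a)) \<le> B"
proof -
  obtain r where r: "r > 0" "cball x0 r \<subseteq> hyp_slit_plane"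
    using open_hyp_slit_plane x0 open_contains_cball by blast
  let ?f = "\<lambda>(y, x). (1 - x * of_real y) powr (- a)"
  have "continuous_on ({0..1::real} \<times> cball x0 r) ?f"
    unfolding case_prod_unfold
  proof (rule continuous_on_powr_complex)
    have *: "1 - snd p * of_real (fst p) \<notin> \<real>\<^sub>\<le>\<^sub>0" if "p \<in> {0..1::real} \<times> cball x0 r" for p
      using that r by (intro one_minus_slit) auto
    show "{0..1::real} \<times> cball x0 r \<subseteq> {p. Re (1 - snd p * of_real (fst p)) \<ge> 0 \<or> Im (1 - snd p * of_real (fst p)) \<noteq> 0}"
      using * by (fastforce simp: complex_nonpos_Reals_iff)
    show "0 < Re (- a)" if "p \<in> {0..1::real} \<times> cball x0 r" "1 - snd p * of_real (fst p) = 0" for p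
      using *[OF that(1)] that(2) by simp
  qed (intro continuous_intros)+
  hence "bounded (?f ` ({0..1::real} \<times> cball x0 r))"
    by (intro compact_imp_bounded compact_continuous_image compact_Times) auto
  then obtain B where "\<forall>z\<in>?f ` ({0..1::real} \<times> cball x0 r). norm z \<le> B" by (auto simp: bounded_iff)
  thus ?thesis using that[OF r, of B] by force
qed

lemma Eint_holomorphic:
  assumes b: "Re b > 0" and cb: "Re (c - b) > 0"
  shows "Eint a b c holomorphic_on hyp_slit_plane"
  unfolding Eint_def[abs_def]
proof (rule holomorphic_integral[OF open_hyp_slit_plane])
  fix x0 assume x0: "x0 \<in> hyp_slit_plane"
  then obtain r B where r: "r > 0" "cball x0 r \<subseteq> hyp_slit_plane"
    and B: "\<And>x y. x \<in> cball x0 r \<Longrightarrow> 0 \<le> y \<Longrightarrow> y \<le> 1 \<Longrightarrow> norm ((1 - x * of_real y) powr (- a)) \<le> B"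
    using Eint_kernel_bounded[of x0 a] by metis
  show "\<exists>r>0. \<exists>w. integrable lpos w \<and> (\<forall>x\<in>ball x0 r \<inter> hyp_slit_plane. \<forall>k\<in>space lpos.
     norm (cpow k (b - 1) * cpow (1 + k) (- c) * (1 - x * of_real (k / (1 + k))) powr (- a)) \<le> w k)"
  proof (intro exI conjI ballI)
    show "integrable lpos (\<lambda>k. norm (cpow k (b - 1) * cpow (1 + k) (- c)) * B)"
      by (intro integrable_mult_left integrable_norm lpos_Beta b cb)
    fix x k assume "x \<in> ball x0 r \<inter> hyp_slit_plane" "k \<in> space lpos"
    thus "norm (cpow k (b - 1) * cpow (1 + k) (- c) * (1 - x * of_real (k / (1 + k))) powr (- a)) \<le>
       norm (cpow k (b - 1) * cpow (1 + k) (- c)) * B"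
      unfolding norm_mult[of "_ * _" "_ powr _"] by (intro mult_left_mono B) auto
  qed (use r in auto)
next
  fix x assume "x \<in> hyp_slit_plane"
  thus "(\<lambda>k. cpow k (b - 1) * cpow (1 + k) (- c) * (1 - x * of_real (k / (1 + k))) powr (- a)) \<in> borel_measurable lpos"
    by (rule Eint_kernel_measurable)
next
  fix k assume "k \<in> space lpos"
  hence k: "0 \<le> k / (1 + k)" "k / (1 + k) \<le> 1" by auto
  show "(\<lambda>x. cpow k (b - 1) * cpow (1 + k) (- c) * (1 - x * of_real (k / (1 + k))) powr (- a)) holomorphic_on hyp_slit_plane"
    using one_minus_slit[OF _ k] by (intro holomorphic_intros) auto
qed

lemma binomial_pochhammer_sums:
  assumes "norm (w::complex) < 1"
  shows "(\<lambda>n. pochhammer a n / fact n * w ^ n) sums (1 - w) powr (- a)"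
proof -
  have "(- a gchoose n) * (- w) ^ n = pochhammer a n / fact n * w ^ n" for n
    by (simp add: gbinomial_pochhammer power_minus[of w] mult_ac)
  thus ?thesis using gen_binomial_complex[of "- w" "- a"] assms by simp
qed

text \<open>The binomial series is integrated term by term; the factor (k / (1 + k))^n raises both b
  and c by n in the beta integral.\<close>

lemma Eint_sums:
  assumes b: "Re b > 0" and cb: "Re (c - b) > 0" and x: "norm x < 1"
  shows "(\<lambda>n. pochhammer a n * pochhammer b n * rGamma (c + of_nat n) / fact n * x ^ n) sums
           (rGamma b * rGamma (c - b) * Eint a b c x)"
proof -
  define g where "g = (\<lambda>k. cpow k (b - 1) * cpow (1 + k) (- c))"
  define f where "f = (\<lambda>n k. pochhammer a n / fact n * x ^ n * (g k * of_real (k / (1 + k)) ^ n))"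
  have int_eq: "g k * of_real (k / (1 + k)) ^ n = cpow k ((b + of_nat n) - 1) * cpow (1 + k) (- (c + of_nat n))"
    if "k > 0" for k n
  proof -
    have e: "(b + of_nat n) - 1 = (b - 1) + of_nat n" "- (c + of_nat n) = - c - of_nat n" by simp_all
    have "cpow k (B + of_nat n) * cpow (1 + k) (C - of_nat n) = cpow k B * cpow (1 + k) C * of_real (k / (1 + k)) ^ n" for B C
      unfolding cpow_add cpow_diff using that by (simp add: cpow_of_nat power_divide)
    thus ?thesis unfolding e g_def by simp
  qed
  have bn: "Re (b + of_nat n) > 0" and cbn: "Re ((c + of_nat n) - (b + of_nat n)) > 0" for n using b cb by auto
  have int: "integrable lpos (\<lambda>k. g k * of_real (k / (1 + k)) ^ n)" for n
    by (rule iffD2[OF lpos_cong_integrable[OF int_eq] lpos_Beta(1)[OF bn cbn]])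
  have val: "(\<integral>k. g k * of_real (k / (1 + k)) ^ n \<partial>lpos) = Gamma (b + of_nat n) * Gamma (c - b) / Gamma (c + of_nat n)" for n
    using trans[OF lpos_cong_integral[OF int_eq] lpos_Beta(2)[OF bn[of n] cbn[of n]]] by simp
  have sumn: "summable (\<lambda>n. norm (pochhammer a n / fact n * x ^ n))"
  proof -
    \<comment> \<open>The binomial series converges at a point of modulus strictly between |x| and
      1, hence absolutely at x.\<close>
    define K where "K = (norm x + 1) / 2"
    have "K \<ge> 0" "K < 1" "norm x < K" using x by (simp_all add: K_def)
    hence "norm (complex_of_real K) < 1" "norm x < norm (complex_of_real K)" by simp_all
    thus ?thesis using powser_insidea[of "\<lambda>n. pochhammer a n / fact n" "of_real K" x]
      binomial_pochhammer_sums[of "of_real K" a] by (auto simp: sums_iff)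
  qed
  have bnd: "norm (f n k) \<le> norm (pochhammer a n / fact n * x ^ n) * norm (g k)" if "k > 0" for n k
  proof -
    have "(k / (1 + k)) ^ n \<le> 1" using that by (intro power_le_one) auto
    hence "norm (g k * of_real (k / (1 + k)) ^ n) \<le> norm (g k)"
      using that mult_left_le[of "(k / (1 + k)) ^ n" "norm (g k)"] by (simp add: norm_mult norm_power del: of_real_divide)
    thus ?thesis unfolding f_def norm_mult[of "_ * x ^ n"] by (intro mult_left_mono) auto
  qed
  have g: "integrable lpos g" unfolding g_def using b cb by (rule lpos_Beta)
  have "(\<lambda>n. integral\<^sup>L lpos (f n)) sums (\<integral>k. (\<Sum>n. f n k) \<partial>lpos)"
  proof (rule sums_integral)
    show fi: "integrable lpos (f n)" for n unfolding f_def by (intro integrable_mult_right int)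
    show "AE k in lpos. summable (\<lambda>n. norm (f n k))"
    proof (rule AE_I2)
      fix k assume "k \<in> space lpos"
      thus "summable (\<lambda>n. norm (f n k))"
        using bnd by (intro summable_comparison_test'[OF summable_mult2[OF sumn, of "norm (g k)"], of 0]) auto
    qed
    have "norm (\<integral>k. norm (f n k) \<partial>lpos) \<le> norm (pochhammer a n / fact n * x ^ n) * (\<integral>k. norm (g k) \<partial>lpos)" for n
    proof -
      have "(\<integral>k. norm (f n k) \<partial>lpos) \<le> (\<integral>k. norm (pochhammer a n / fact n * x ^ n) * norm (g k) \<partial>lpos)"
        using bnd by (intro integral_mono integrable_norm fi integrable_mult_right g) auto
      moreover have "(\<integral>k. norm (f n k) \<partial>lpos) \<ge> 0" by simp
      ultimately show ?thesis by simp
    qed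
    thus "summable (\<lambda>n. \<integral>k. norm (f n k) \<partial>lpos)"
      by (intro summable_comparison_test'[OF summable_mult2[OF sumn], of 0]) auto
  qed
  also have "(\<integral>k. (\<Sum>n. f n k) \<partial>lpos) = Eint a b c x"
    unfolding Eint_def
  proof (rule lpos_cong_integral)
    fix k :: real assume k: "k > 0"
    have "norm (x * of_real (k / (1 + k))) = norm x * (k / (1 + k))" using k by (simp add: norm_mult del: of_real_divide)
    also have "\<dots> \<le> norm x" using k by (intro mult_left_le) auto
    finally have "norm (x * of_real (k / (1 + k))) < 1" using x by simp
    from sums_mult[OF binomial_pochhammer_sums[OF this], of "g k" a]
    have "(\<lambda>n. f n k) sums (g k * (1 - x * of_real (k / (1 + k))) powr (- a))"
      by (simp add: f_def power_mult_distrib mult_ac del: of_real_divide)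
    thus "(\<Sum>n. f n k) = cpow k (b - 1) * cpow (1 + k) (- c) * (1 - x * of_real (k / (1 + k))) powr (- a)"
      by (simp add: sums_iff g_def)
  qed
  finally have "(\<lambda>n. rGamma b * rGamma (c - b) * integral\<^sup>L lpos (f n)) sums (rGamma b * rGamma (c - b) * Eint a b c x)"
    by (rule sums_mult)
  moreover have "rGamma b * rGamma (c - b) * integral\<^sup>L lpos (f n) =
      pochhammer a n * pochhammer b n * rGamma (c + of_nat n) / fact n * x ^ n" for n
  proof -
    have "pochhammer b n = Gamma (b + of_nat n) / Gamma b" using b by (intro pochhammer_Gamma Re_pos_not_nonpos_Int)
    moreover have nz: "Gamma (c - b) \<noteq> 0" "Gamma b \<noteq> 0" using b cb by (auto intro!: Gamma_Re_pos_nonzero)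
    ultimately have "Gamma (b + of_nat n) = pochhammer b n * Gamma b" by simp
    thus ?thesis unfolding f_def integral_mult_right_zero val using nz by (simp add: rGamma_inverse_Gamma divide_inverse) (simp add: field_simps)
  qed
  ultimately show ?thesis by simp
qed

section \<open>Existence and uniqueness of the regularised hypergeometric function\<close>

text \<open>The specification under the choice operator of \<open>hypergeo_reg\<close>, isolated so
  that explicit witnesses can be exhibited.\<close>

definition is_hypergeo_reg :: "complex \<Rightarrow> complex \<Rightarrow> complex \<Rightarrow> (complex \<Rightarrow> complex) \<Rightarrow> bool" where
  "is_hypergeo_reg a b c f \<longleftrightarrow> f holomorphic_on hyp_slit_plane \<and>
     (\<forall>x. norm x < 1 \<longrightarrow> (\<lambda>n. pochhammer a n * pochhammer b n * rGamma (c + of_nat n) / fact n * x ^ n) sums f x)"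

lemma is_hypergeo_reg_Eint:
  assumes "Re b > 0" "Re (c - b) > 0"
  shows "is_hypergeo_reg a b c (\<lambda>x. rGamma b * rGamma (c - b) * Eint a b c x)"
  unfolding is_hypergeo_reg_def
  by (intro conjI allI impI holomorphic_intros Eint_holomorphic Eint_sums assms)

text \<open>The operator x d/dx + c multiplies the n-th coefficient by c + n, and (c + n) / Gamma (c
  + 1 + n) = 1 / Gamma (c + n). It leads out of the range Re c > Re b of Euler's integral.\<close>

lemma is_hypergeo_reg_lower:
  assumes f: "is_hypergeo_reg a b (c + 1) f"
  shows "is_hypergeo_reg a b c (\<lambda>x. x * deriv f x + c * f x)"
  unfolding is_hypergeo_reg_def
proof (intro conjI allI impI)
  have hol: "f holomorphic_on hyp_slit_plane" using f by (simp add: is_hypergeo_reg_def)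
  thus "(\<lambda>x. x * deriv f x + c * f x) holomorphic_on hyp_slit_plane"
    by (intro holomorphic_intros holomorphic_deriv open_hyp_slit_plane)
  define A where "A = (\<lambda>n. pochhammer a n * pochhammer b n * rGamma (c + 1 + of_nat n) / fact n)"
  have A: "(\<lambda>n. A n * x ^ n) sums f x" if "norm x < 1" for x
    using f that by (simp add: is_hypergeo_reg_def A_def)
  fix x :: complex assume x: "norm x < 1"
  have "(f has_field_derivative deriv f x) (at x)"
    using hol open_hyp_slit_plane ball_subset_hyp_slit_plane[OF x] by (rule holomorphic_derivI)
  from termdiffs_sums_strong[OF A this x] have "(\<lambda>n. x * (diffs A n * x ^ n)) sums (x * deriv f x)"
    by (intro sums_mult) auto
  hence "(\<lambda>n. of_nat (Suc n) * A (Suc n) * x ^ Suc n) sums (x * deriv f x)"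
    by (simp add: diffs_def mult_ac)
  from sums_Suc_imp[OF _ this] have "(\<lambda>n. of_nat n * A n * x ^ n) sums (x * deriv f x)" by simp
  from sums_add[OF this sums_mult[OF A[OF x], of c]]
  have "(\<lambda>n. (c + of_nat n) * A n * x ^ n) sums (x * deriv f x + c * f x)"
    by (simp add: algebra_simps)
  moreover have "(c + of_nat n) * A n = pochhammer a n * pochhammer b n * rGamma (c + of_nat n) / fact n" for n
    using rGamma_plus1[of "c + of_nat n"] by (simp add: A_def add_ac mult_ac)
  ultimately show "(\<lambda>n. pochhammer a n * pochhammer b n * rGamma (c + of_nat n) / fact n * x ^ n) sums (x * deriv f x + c * f x)"
    by simp
qed

text \<open>Induction on the number of unit steps that bring c into Euler's range. The function P
  needs this: there b = \<nu> + \<alpha> + \<beta> + 1 has positive real part, but c - b = -\<nu> -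
  \<beta> may have any sign.\<close>

lemma hypergeo_reg_exists:
  assumes b: "Re b > 0"
  shows "\<exists>f. is_hypergeo_reg a b c f"
proof -
  have "\<exists>f. is_hypergeo_reg a b c f" if "Re (c - b) + real n > 0" for n
    using that
  proof (induction n arbitrary: c)
    case 0
    thus ?case using is_hypergeo_reg_Eint[OF b] by auto
  next
    case (Suc n)
    hence "\<exists>f. is_hypergeo_reg a b (c + 1) f" by (intro Suc.IH) simp
    thus ?case using is_hypergeo_reg_lower by blast
  qed
  moreover obtain n where "- Re (c - b) < real n" using reals_Archimedean2 by blast
  hence "Re (c - b) + real n > 0" by simp
  ultimately show ?thesis by blast
qed

lemma hypergeo_reg_eqI:
  assumes f: "is_hypergeo_reg a b c f" and x: "x \<in> hyp_slit_plane"
  shows "hypergeo_reg a b c x = f x"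
proof -
  have "\<exists>f. is_hypergeo_reg a b c f" using f by blast
  hence F: "is_hypergeo_reg a b c (hypergeo_reg a b c)"
    unfolding is_hypergeo_reg_def hypergeo_reg_def by (rule someI_ex)
  show ?thesis
  proof (rule analytic_continuation_open[of "ball 0 1" hyp_slit_plane "hypergeo_reg a b c" f])
    show "hypergeo_reg a b c x = f x" if "x \<in> ball 0 1" for x
      using F f that unfolding is_hypergeo_reg_def by (auto intro: sums_unique2)
  qed (use F f x open_hyp_slit_plane connected_hyp_slit_plane ball_subset_hyp_slit_plane in
       \<open>auto simp: is_hypergeo_reg_def\<close>)
qed

lemma hypergeo_reg_Eint:
  assumes "Re b > 0" "Re (c - b) > 0" "x \<in> hyp_slit_plane"
  shows "hypergeo_reg a b c x = rGamma b * rGamma (c - b) * Eint a b c x"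
  by (rule hypergeo_reg_eqI[OF is_hypergeo_reg_Eint]) fact+

lemma hypergeo_reg_sums:
  assumes "Re b > 0" "norm x < 1"
  shows "(\<lambda>n. pochhammer a n * pochhammer b n * rGamma (c + of_nat n) / fact n * x ^ n) sums hypergeo_reg a b c x"
proof -
  obtain f where f: "is_hypergeo_reg a b c f" using hypergeo_reg_exists[OF assms(1)] by blast
  show ?thesis using hypergeo_reg_eqI[OF f ball_subset_hyp_slit_plane[OF assms(2)]] f assms(2)
    by (simp add: is_hypergeo_reg_def)
qed

section \<open>The Laplace transform of a product of two Macdonald functions\<close>

definition kap_const :: "nat \<Rightarrow> complex \<Rightarrow> real" where
  "kap_const M \<mu> = (\<Sum>n<M. norm (acoeff n \<mu>)) + kbound M \<mu>"

lemma kbound_nonneg: "\<bar>Re \<mu>\<bar> < real M + 1/2 \<Longrightarrow> kbound M \<mu> \<ge> 0"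
  unfolding kbound_def by (intro divide_nonneg_nonneg mult_nonneg_nonneg Gamma_real_nonneg) auto

text \<open>The power (1 + 1/|z|)^M dominates every 1/|z|^n with n <= M, so a single expression
  covers both the boundedness at infinity and the growth at 0.\<close>

lemma kap_bound:
  assumes m: "\<bar>Re \<mu>\<bar> < real M + 1/2" and z: "Re z > 0"
  shows "norm (kap \<mu> z) \<le> kap_const M \<mu> * (1 + 1 / norm z) ^ M"
proof -
  have z0: "norm z > 0" using z by auto
  have pow: "1 / norm z ^ n \<le> (1 + 1 / norm z) ^ M" if "n \<le> M" for n
  proof -
    have "(1 / norm z) ^ n \<le> (1 + 1 / norm z) ^ n" by (intro power_mono) auto
    also have "\<dots> \<le> (1 + 1 / norm z) ^ M" using that by (intro power_increasing) auto
    finally show ?thesis by (simp add: power_one_over)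
  qed
  have "norm (kap \<mu> z) \<le> (\<Sum>n<M. norm (acoeff n \<mu> / z ^ n)) + norm (krem M \<mu> z)"
    unfolding kap_expansion[OF m z] by (intro order_trans[OF norm_triangle_ineq] add_mono norm_sum order_refl)
  also have "\<dots> \<le> (\<Sum>n<M. norm (acoeff n \<mu>) * (1 + 1 / norm z) ^ M) + kbound M \<mu> * (1 + 1 / norm z) ^ M"
  proof (intro add_mono sum_mono)
    fix n assume "n \<in> {..<M}"
    thus "norm (acoeff n \<mu> / z ^ n) \<le> norm (acoeff n \<mu>) * (1 + 1 / norm z) ^ M"
      using mult_left_mono[OF pow[of n], of "norm (acoeff n \<mu>)"] by (simp add: norm_divide norm_power)
  next
    show "norm (krem M \<mu> z) \<le> kbound M \<mu> * (1 + 1 / norm z) ^ M"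
      using krem_bound[OF z m] mult_left_mono[OF pow[of M] kbound_nonneg[OF m]] by simp
  qed
  finally show ?thesis by (simp add: kap_const_def sum_distrib_right ring_distribs)
qed

lemma kap_const_nonneg: "\<bar>Re \<mu>\<bar> < real M + 1/2 \<Longrightarrow> kap_const M \<mu> \<ge> 0"
  unfolding kap_const_def by (intro add_nonneg_nonneg sum_nonneg kbound_nonneg) auto

definition Jfun :: "complex \<Rightarrow> complex \<Rightarrow> complex \<Rightarrow> complex \<Rightarrow> real \<Rightarrow> complex" where
  "Jfun \<sigma> \<alpha> \<beta> p s = cpow s \<sigma> * of_real (exp (- s)) * kap \<beta> (of_real s * p) * kap \<alpha> (of_real s * (1 - p))"

definition Jint :: "complex \<Rightarrow> complex \<Rightarrow> complex \<Rightarrow> complex \<Rightarrow> complex" where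
  "Jint \<sigma> \<alpha> \<beta> p = integral\<^sup>L lpos (Jfun \<sigma> \<alpha> \<beta> p)"

definition Jdom :: "real \<Rightarrow> nat \<Rightarrow> real \<Rightarrow> real" where
  "Jdom a N s = s powr a * exp (- s) * (1 + 1 / s) ^ N"

lemma Jdom_nonneg: "s > 0 \<Longrightarrow> Jdom a N s \<ge> 0"
  by (simp add: Jdom_def)

lemma Jdom_integrable:
  assumes "a + 1 > real N"
  shows "integrable lpos (Jdom a N)"
proof (rule Bochner_Integration.integrable_bound)
  show "integrable lpos (\<lambda>s. 2 ^ N * (s powr (a + 1 - 1) * exp (- (1 * s))) + 2 ^ N * (s powr (a + 1 - N - 1) * exp (- (1 * s))))"
    using assms by (intro Bochner_Integration.integrable_add integrable_mult_right lpos_Gamma_real) auto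
  show "Jdom a N \<in> borel_measurable lpos" unfolding Jdom_def by (intro lpos_measurableI) measurable
  show "AE s in lpos. norm (Jdom a N s) \<le> norm (2 ^ N * (s powr (a + 1 - 1) * exp (- (1 * s))) + 2 ^ N * (s powr (a + 1 - N - 1) * exp (- (1 * s))))"
  proof (rule AE_I2)
    fix s :: real assume "s \<in> space lpos"
    hence s: "s > 0" by simp
    \<comment> \<open>The first term takes care of s >= 1 and the second of s < 1; the latter lowers
      the exponent to a - N, and a + 1 > N makes it integrable.\<close>
    have "(1 + 1 / s) ^ N \<le> 2 ^ N + 2 ^ N * (1 / s) ^ N"
    proof (cases "s \<ge> 1")
      case True
      hence "(1 + 1 / s) ^ N \<le> 2 ^ N" by (intro power_mono) auto
      also have "\<dots> \<le> 2 ^ N + 2 ^ N * (1 / s) ^ N" using s by simp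
      finally show ?thesis .
    next
      case False
      hence "(1 + 1 / s) ^ N \<le> (2 * (1 / s)) ^ N" using s by (intro power_mono) (auto simp: field_simps)
      also have "\<dots> = 2 ^ N * (1 / s) ^ N" by (rule power_mult_distrib)
      also have "\<dots> \<le> 2 ^ N + 2 ^ N * (1 / s) ^ N" by simp
      finally show ?thesis .
    qed
    hence "s powr a * exp (- s) * (1 + 1 / s) ^ N \<le> s powr a * exp (- s) * (2 ^ N + 2 ^ N * (1 / s) ^ N)"
      by (intro mult_left_mono) auto
    thus "norm (Jdom a N s) \<le> norm (2 ^ N * (s powr (a + 1 - 1) * exp (- (1 * s))) + 2 ^ N * (s powr (a + 1 - N - 1) * exp (- (1 * s))))"
      using s by (simp add: Jdom_def powr_diff powr_realpow power_one_over field_simps)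
  qed
qed

lemma Jfun_bound:
  assumes s: "s > 0" and p: "Re p > 0" "Re p < 1"
    and A: "\<bar>Re \<alpha>\<bar> < real M + 1/2" and B: "\<bar>Re \<beta>\<bar> < real M' + 1/2"
  shows "norm (Jfun \<sigma> \<alpha> \<beta> p s) \<le>
    (kap_const M \<alpha> * kap_const M' \<beta>) * ((1 + 1 / (1 - Re p)) ^ M * (1 + 1 / Re p) ^ M') * Jdom (Re \<sigma>) (M + M') s"
proof -
  have k: "norm (kap \<mu> (of_real s * z)) \<le> kap_const L \<mu> * ((1 + 1 / Re z) ^ L * (1 + 1 / s) ^ L)"
    if "\<bar>Re \<mu>\<bar> < real L + 1/2" "Re z > 0" for \<mu> z L
  proof -
    have "1 / (s * norm z) \<le> 1 / (s * Re z)" using that s complex_Re_le_cmod[of z]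
      by (intro divide_left_mono mult_left_mono mult_pos_pos) auto
    \<comment> \<open>Separates the dependence on p from the dependence on s, so that the integrable
      majorant in s is the same for all p.\<close>
    hence "1 + 1 / norm (of_real s * z) \<le> (1 + 1 / Re z) * (1 + 1 / s)"
    proof -
      assume le: "1 / (s * norm z) \<le> 1 / (s * Re z)"
      have "(1 + 1 / Re z) * (1 + 1 / s) = 1 + 1 / (s * Re z) + (1 / Re z + 1 / s)"
        by (simp add: ring_distribs mult.commute)
      moreover have "1 / Re z + 1 / s \<ge> 0" using s that(2) by simp
      moreover have "norm (of_real s * z) = s * norm z" using s by (simp add: norm_mult)
      ultimately show ?thesis using le by simp
    qed
    hence "(1 + 1 / norm (of_real s * z)) ^ L \<le> ((1 + 1 / Re z) * (1 + 1 / s)) ^ L"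
      by (intro power_mono) auto
    hence "kap_const L \<mu> * (1 + 1 / norm (of_real s * z)) ^ L \<le> kap_const L \<mu> * ((1 + 1 / Re z) ^ L * (1 + 1 / s) ^ L)"
      unfolding power_mult_distrib using kap_const_nonneg[OF that(1)] by (rule mult_left_mono)
    thus ?thesis using kap_bound[OF that(1), of "of_real s * z"] that(2) s by simp
  qed
  have "norm (kap \<beta> (of_real s * p)) * norm (kap \<alpha> (of_real s * (1 - p))) \<le>
     (kap_const M' \<beta> * ((1 + 1 / Re p) ^ M' * (1 + 1 / s) ^ M')) * (kap_const M \<alpha> * ((1 + 1 / (1 - Re p)) ^ M * (1 + 1 / s) ^ M))"
    using k[OF B, of p] k[OF A, of "1 - p"] p s kap_const_nonneg[OF B] by (intro mult_mono) auto
  hence "s powr Re \<sigma> * exp (- s) * (norm (kap \<beta> (of_real s * p)) * norm (kap \<alpha> (of_real s * (1 - p)))) \<le>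
     s powr Re \<sigma> * exp (- s) * ((kap_const M' \<beta> * ((1 + 1 / Re p) ^ M' * (1 + 1 / s) ^ M')) * (kap_const M \<alpha> * ((1 + 1 / (1 - Re p)) ^ M * (1 + 1 / s) ^ M)))"
    by (intro mult_left_mono) auto
  also have "\<dots> = (kap_const M \<alpha> * kap_const M' \<beta>) * ((1 + 1 / (1 - Re p)) ^ M * (1 + 1 / Re p) ^ M') * Jdom (Re \<sigma>) (M + M') s"
    by (simp only: Jdom_def power_add mult_ac)
  finally show ?thesis using s by (simp add: Jfun_def norm_mult norm_cpow mult.assoc)
qed

lemma Jfun_measurable:
  assumes p: "Re p > 0" "Re p < 1"
  shows "Jfun \<sigma> \<alpha> \<beta> p \<in> borel_measurable lpos"
proof -
  have "continuous_on {0<..} (\<lambda>s::real. kap \<mu> (of_real s * z))" if "Re z > 0" for \<mu> z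
    by (rule continuous_on_compose2[OF holomorphic_on_imp_continuous_on[OF kap_holomorphic]])
       (use that in \<open>auto intro!: continuous_intros\<close>)
  hence kap: "(\<lambda>s::real. kap \<mu> (of_real s * z)) \<in> borel_measurable lpos" if "Re z > 0" for \<mu> z
    using that by (intro lpos_measurable_continuous)
  have "(\<lambda>s. cpow s \<sigma>) \<in> borel_measurable lpos" "(\<lambda>s. complex_of_real (exp (- s))) \<in> borel_measurable lpos"
    by (intro lpos_measurableI; measurable)+
  thus ?thesis unfolding Jfun_def[abs_def] using p by (intro borel_measurable_times kap) auto
qed

lemma Jfun_integrable:
  assumes p: "Re p > 0" "Re p < 1" and A: "\<bar>Re \<alpha>\<bar> < real M + 1/2" and B: "\<bar>Re \<beta>\<bar> < real M' + 1/2"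
    and S: "Re \<sigma> + 1 > real (M + M')"
  shows "integrable lpos (Jfun \<sigma> \<alpha> \<beta> p)"
proof (rule Bochner_Integration.integrable_bound[OF integrable_mult_right[OF Jdom_integrable[OF S]] Jfun_measurable[OF p]])
  show "AE s in lpos. norm (Jfun \<sigma> \<alpha> \<beta> p s) \<le> norm ((kap_const M \<alpha> * kap_const M' \<beta>) *
      ((1 + 1 / (1 - Re p)) ^ M * (1 + 1 / Re p) ^ M') * Jdom (Re \<sigma>) (M + M') s)"
    using order_trans[OF Jfun_bound[OF _ p A B] abs_ge_self] by (intro AE_I2) simp
qed

lemma open_strip: "open {p. 0 < Re p \<and> Re p < 1}"
  unfolding Collect_conj_eq by (intro open_Int open_halfspace_Re_gt open_halfspace_Re_lt)

lemma Jint_holomorphic: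
  assumes A: "\<bar>Re \<alpha>\<bar> < real M + 1/2" and B: "\<bar>Re \<beta>\<bar> < real M' + 1/2"
    and S: "Re \<sigma> + 1 > real (M + M')"
  shows "Jint \<sigma> \<alpha> \<beta> holomorphic_on {p. 0 < Re p \<and> Re p < 1}"
  unfolding Jint_def[abs_def]
proof (rule holomorphic_integral[OF open_strip])
  fix s assume "s \<in> space lpos"
  hence s: "s > 0" by simp
  have "(\<lambda>p. kap \<mu> (of_real s * f p)) holomorphic_on {p. 0 < Re p \<and> Re p < 1}"
    if f: "(f :: complex \<Rightarrow> complex) holomorphic_on {p. 0 < Re p \<and> Re p < 1}" "\<And>p. 0 < Re p \<Longrightarrow> Re p < 1 \<Longrightarrow> Re (f p) > 0" for f \<mu>
  proof (rule holomorphic_on_compose_gen[of "\<lambda>p. of_real s * f p" _ "kap \<mu>", unfolded o_def])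
    show "(\<lambda>p. of_real s * f p) holomorphic_on {p. 0 < Re p \<and> Re p < 1}" by (intro holomorphic_intros f)
  qed (use s f(2) kap_holomorphic in auto)
  moreover have "(\<lambda>p::complex. 1 - p) holomorphic_on {p. 0 < Re p \<and> Re p < 1}" by (intro holomorphic_intros)
  ultimately have "(\<lambda>p. kap \<alpha> (of_real s * (1 - p))) holomorphic_on {p. 0 < Re p \<and> Re p < 1}"
    "(\<lambda>p. kap \<beta> (of_real s * p)) holomorphic_on {p. 0 < Re p \<and> Re p < 1}" by auto
  thus"(\<lambda>p. Jfun \<sigma> \<alpha> \<beta> p s) holomorphic_on {p. 0 < Re p \<and> Re p < 1}"
    unfolding Jfun_def by (auto intro!: holomorphic_intros)
next
  fix p0 assume p0: "p0 \<in> {p. 0 < Re p \<and> Re p < 1}"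
  \<comment> \<open>On the disc of this radius both Re p and 1 - Re p stay at least r.\<close>
  define r where "r = min (Re p0) (1 - Re p0) / 2"
  have r: "r > 0" "r < 1" using p0 by (auto simp: r_def min_def)
  show "\<exists>r>0. \<exists>w. integrable lpos w \<and> (\<forall>p\<in>ball p0 r \<inter> {p. 0 < Re p \<and> Re p < 1}. \<forall>s\<in>space lpos. norm (Jfun \<sigma> \<alpha> \<beta> p s) \<le> w s)"
  proof (intro exI conjI ballI)
    show "r > 0" by (rule r)
    show "integrable lpos (\<lambda>s. (kap_const M \<alpha> * kap_const M' \<beta>) * ((1 + 1 / r) ^ M * (1 + 1 / r) ^ M') * Jdom (Re \<sigma>) (M + M') s)"
      by (intro integrable_mult_right Jdom_integrable S)
    fix p s assume p: "p \<in> ball p0 r \<inter> {p. 0 < Re p \<and> Re p < 1}" and s: "s \<in> space lpos"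
    have "\<bar>Re p0 - Re p\<bar> \<le> norm (p0 - p)" using abs_Re_le_cmod[of "p0 - p"] by simp
    hence "\<bar>Re p0 - Re p\<bar> < r" using p by (auto simp: dist_norm)
    moreover have "2 * r \<le> Re p0" "2 * r \<le> 1 - Re p0" by (simp_all add: r_def)
    ultimately have rp: "r \<le> Re p" "r \<le> 1 - Re p" by linarith+
    have "(1 + 1 / (1 - Re p)) ^ M * (1 + 1 / Re p) ^ M' \<le> (1 + 1 / r) ^ M * (1 + 1 / r) ^ M'"
      using rp r by (intro mult_mono power_mono add_left_mono divide_left_mono mult_pos_pos) auto
    hence "(kap_const M \<alpha> * kap_const M' \<beta>) * ((1 + 1 / (1 - Re p)) ^ M * (1 + 1 / Re p) ^ M') * Jdom (Re \<sigma>) (M + M') s \<le>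
       (kap_const M \<alpha> * kap_const M' \<beta>) * ((1 + 1 / r) ^ M * (1 + 1 / r) ^ M') * Jdom (Re \<sigma>) (M + M') s"
      using kap_const_nonneg[OF A] kap_const_nonneg[OF B] Jdom_nonneg s
      by (intro mult_right_mono mult_left_mono) auto
    thus "norm (Jfun \<sigma> \<alpha> \<beta> p s) \<le> (kap_const M \<alpha> * kap_const M' \<beta>) * ((1 + 1 / r) ^ M * (1 + 1 / r) ^ M') * Jdom (Re \<sigma>) (M + M') s"
      using Jfun_bound[OF _ _ _ A B, of s p \<sigma>] p s by force
  qed
qed (use Jfun_measurable in auto)

lemma continuous_kap_const:
  assumes "continuous_on T f" "\<And>t. t \<in> T \<Longrightarrow> \<bar>Re (f t)\<bar> < real M + 1/2"
  shows "continuous_on T (\<lambda>t. kap_const M (f t))"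
proof -
  have a: "continuous_on T (\<lambda>t. acoeff n (f t))" for n
    by (rule continuous_on_compose2[OF holomorphic_on_imp_continuous_on[OF acoeff_holomorphic] assms(1) subset_UNIV])
  have pos: "real M + 1/2 + Re (f t) > 0" "real M + 1/2 - Re (f t) > 0" if "t \<in> T" for t
    using assms(2)[OF that] by auto
  have g: "continuous_on T (\<lambda>t. Gamma (real M + 1/2 + Re (f t)))" "continuous_on T (\<lambda>t. Gamma (real M + 1/2 - Re (f t)))"
    by (rule continuous_on_compose2[OF continuous_on_Gamma[of "{0::real<..}"]], force elim!: nonpos_Ints_cases,
        (intro continuous_intros assms), use pos in force)+
  have c: "continuous_on T (\<lambda>t. cos (of_real pi * f t))"
    by (rule continuous_on_compose2[OF _ assms(1), of UNIV "\<lambda>z. cos (of_real pi * z)"])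
       (auto intro!: holomorphic_on_imp_continuous_on holomorphic_intros)
  show ?thesis unfolding kap_const_def kbound_def
    by (intro continuous_on_add continuous_on_sum continuous_on_norm continuous_on_divide continuous_on_mult
        continuous_on_const a g c) auto
qed

text \<open>All three parameters run along one complex variable t, so that continuation in several
  parameters reduces to the identity theorem in one variable.\<close>

lemma Jint_holomorphic_params:
  fixes S A B :: "complex \<Rightarrow> complex"
  assumes T: "open T" and hol: "S holomorphic_on T" "A holomorphic_on T" "B holomorphic_on T"
    and A: "\<And>t. t \<in> T \<Longrightarrow> \<bar>Re (A t)\<bar> < real M + 1/2" and B: "\<And>t. t \<in> T \<Longrightarrow> \<bar>Re (B t)\<bar> < real M' + 1/2"
    and S: "\<And>t. t \<in> T \<Longrightarrow> Re (S t) + 1 > real (M + M')" and p: "0 < Re p" "Re p < 1"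
  shows "(\<lambda>t. Jint (S t) (A t) (B t) p) holomorphic_on T"
  unfolding Jint_def
proof (rule holomorphic_integral[OF T])
  fix s assume "s \<in> space lpos"
  hence s: "s > 0" by simp
  have "(\<lambda>t. kap (f t) (of_real s * z)) holomorphic_on T"
    if "f holomorphic_on T" "Re z > 0" for f z
    using holomorphic_on_compose_gen[OF that(1) kap_holomorphic_order, of "of_real s * z"] s that(2)
    by (auto simp: o_def)
  thus "(\<lambda>t. Jfun (S t) (A t) (B t) p s) holomorphic_on T"
    unfolding Jfun_def using hol p by (intro holomorphic_intros) auto
next
  fix t0 assume t0: "t0 \<in> T"
  obtain r where r: "r > 0" "cball t0 r \<subseteq> T" using T t0 open_contains_cball by blast
  have cont: "continuous_on (cball t0 r) (\<lambda>t. kap_const M (A t) * kap_const M' (B t))"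
    using hol r A B by (intro continuous_intros continuous_kap_const)
      (auto intro: holomorphic_on_imp_continuous_on holomorphic_on_subset)
  have "bounded ((\<lambda>t. kap_const M (A t) * kap_const M' (B t)) ` cball t0 r)"
    by (intro compact_imp_bounded compact_continuous_image cont) auto
  then obtain C where "\<forall>x\<in>(\<lambda>t. kap_const M (A t) * kap_const M' (B t)) ` cball t0 r. norm x \<le> C"
    unfolding bounded_iff by blast
  hence C: "\<bar>kap_const M (A t) * kap_const M' (B t)\<bar> \<le> C" if "t \<in> cball t0 r" for t
    using that by simp
  have contS: "continuous_on (cball t0 r) (\<lambda>t. Re (S t))"
    using hol r by (intro continuous_intros) (auto intro: holomorphic_on_imp_continuous_on holomorphic_on_subset)
  \<comment> \<open>The least and the greatest value of Re S on the compact disc give two exponents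
    that bracket all others, and the integrability condition holds at both.\<close>
  obtain t1 where t1: "t1 \<in> cball t0 r" "\<And>t. t \<in> cball t0 r \<Longrightarrow> Re (S t1) \<le> Re (S t)"
    using continuous_attains_inf[OF compact_cball _ contS] r by auto
  obtain t2 where t2: "t2 \<in> cball t0 r" "\<And>t. t \<in> cball t0 r \<Longrightarrow> Re (S t) \<le> Re (S t2)"
    using continuous_attains_sup[OF compact_cball _ contS] r by auto
  let ?P = "(1 + 1 / (1 - Re p)) ^ M * (1 + 1 / Re p) ^ M'"
  show "\<exists>r>0. \<exists>w. integrable lpos w \<and> (\<forall>t\<in>ball t0 r \<inter> T. \<forall>s\<in>space lpos. norm (Jfun (S t) (A t) (B t) p s) \<le> w s)"
  proof (intro exI conjI ballI)
    show "r > 0" by (rule r)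
    show "integrable lpos (\<lambda>s. C * ?P * (Jdom (Re (S t1)) (M + M') s + Jdom (Re (S t2)) (M + M') s))"
      using t1 t2 r S by (intro integrable_mult_right Bochner_Integration.integrable_add Jdom_integrable) auto
    fix t s assume t: "t \<in> ball t0 r \<inter> T" and s: "s \<in> space lpos"
    have "s powr Re (S t) \<le> s powr Re (S t1) + s powr Re (S t2)"
      using t s t1 t2 by (intro powr_between) auto
    hence "s powr Re (S t) * (exp (- s) * (1 + 1 / s) ^ (M + M')) \<le> (s powr Re (S t1) + s powr Re (S t2)) * (exp (- s) * (1 + 1 / s) ^ (M + M'))"
      using s by (intro mult_right_mono) auto
    hence J: "Jdom (Re (S t)) (M + M') s \<le> Jdom (Re (S t1)) (M + M') s + Jdom (Re (S t2)) (M + M') s"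
      by (simp add: Jdom_def ring_distribs mult.assoc)
    have P: "(1 + 1 / (1 - Re p)) ^ M \<ge> 0" "(1 + 1 / Re p) ^ M' \<ge> 0" using p by auto
    have "norm (Jfun (S t) (A t) (B t) p s) \<le> (kap_const M (A t) * kap_const M' (B t)) * ?P * Jdom (Re (S t)) (M + M') s"
      using t s p by (intro Jfun_bound A B) auto
    also have "\<dots> \<le> C * ?P * (Jdom (Re (S t1)) (M + M') s + Jdom (Re (S t2)) (M + M') s)"
      using C[of t] t s J P Jdom_nonneg[of s] by (intro mult_mono mult_right_mono mult_nonneg_nonneg) auto
    finally show "norm (Jfun (S t) (A t) (B t) p s) \<le> C * ?P * (Jdom (Re (S t1)) (M + M') s + Jdom (Re (S t2)) (M + M') s)" .
  qed
qed (use Jfun_measurable p in auto)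

lemma params_pos:
  fixes \<nu> \<alpha> \<beta> :: complex
  assumes "\<bar>Re \<alpha>\<bar> < real M + 1/2" "\<bar>Re \<beta>\<bar> < real M' + 1/2" "Re (2 * \<nu> + \<alpha> + \<beta>) + 1 > real (M + M')"
  shows "Re (\<nu> + 1) > 0" "Re (\<nu> + \<alpha> + 1) > 0" "Re (\<nu> + \<beta> + 1) > 0" "Re (\<nu> + \<alpha> + \<beta> + 1) > 0"
    "Re (2 * \<nu> + \<alpha> + \<beta> + 2) > 0"
  using assms by auto

section \<open>Reduction of J to Euler's integral\<close>

text \<open>Integration along rays through the origin: y = x k for fixed x, with Jacobian x,
  followed by an interchange of the order.\<close>

lemma lpos_ray:
  fixes g :: "real \<Rightarrow> real \<Rightarrow> complex"
  assumes [measurable]: "case_prod g \<in> borel_measurable (borel \<Otimes>\<^sub>M borel)"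
    and int: "integrable (lpos \<Otimes>\<^sub>M lpos) (case_prod g)"
  shows "integral\<^sup>L (lpos \<Otimes>\<^sub>M lpos) (case_prod g) = (\<integral>k. \<integral>x. of_real x * g x (x * k) \<partial>lpos \<partial>lpos)"
proof -
  define f where "f = (\<lambda>x k. x *\<^sub>R g x (x * k))"
  have [measurable]: "g x \<in> borel_measurable borel" for x
    using measurable_Pair2[OF assms(1)] by simp
  have m: "(\<lambda>(x, k). f x k) \<in> borel_measurable (lpos \<Otimes>\<^sub>M lpos)"
    unfolding f_def by measurable
  have sc: "(\<integral>k. f x k \<partial>lpos) = integral\<^sup>L lpos (g x)" "(\<integral>k. norm (f x k) \<partial>lpos) = (\<integral>y. norm (g x y) \<partial>lpos)"
    "integrable lpos (f x) \<longleftrightarrow> integrable lpos (g x)" if "x > 0" for x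
    using lpos_scale[of "g x" x] lpos_scale[of "\<lambda>y. norm (g x y)" x] that by (simp_all add: f_def)
  have i: "integrable (lpos \<Otimes>\<^sub>M lpos) (case_prod f)"
  proof (rule lpos2.Fubini_integrable)
    show "case_prod f \<in> borel_measurable (lpos \<Otimes>\<^sub>M lpos)" using m .
    have "integrable lpos (\<lambda>x. \<integral>y. norm (g x y) \<partial>lpos)"
      using lpos2.integrable_fst[of "\<lambda>x y. norm (g x y)"] integrable_norm[OF int] by (simp add: case_prod_unfold)
    thus "integrable lpos (\<lambda>x. \<integral>y. norm (case (x, y) of (x, y) \<Rightarrow> f x y) \<partial>lpos)"
      by (subst lpos_cong_integrable[of _ "\<lambda>x. \<integral>y. norm (g x y) \<partial>lpos"]) (auto simp: sc)
    have "AE x in lpos. integrable lpos (g x)" using lpos2.AE_integrable_fst[OF int] .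
    thus "AE x in lpos. integrable lpos (\<lambda>y. case (x, y) of (x, y) \<Rightarrow> f x y)"
      using AE_space by eventually_elim (simp add: sc(3)[symmetric])
  qed
  have "integral\<^sup>L (lpos \<Otimes>\<^sub>M lpos) (case_prod g) = (\<integral>x. \<integral>y. g x y \<partial>lpos \<partial>lpos)"
    using lpos2.integral_fst[OF int] by simp
  also have "\<dots> = (\<integral>x. \<integral>k. f x k \<partial>lpos \<partial>lpos)"
    by (rule lpos_cong_integral) (simp add: sc)
  also have "\<dots> = (\<integral>k. \<integral>x. f x k \<partial>lpos \<partial>lpos)"
    using lpos2.Fubini_integral[OF i] by simp
  finally show ?thesis by (simp add: f_def scaleR_conv_of_real)
qed

text \<open>The substitutions y = w^2 and y = (B / A) k bring this to the beta integral.\<close>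

lemma lpos_Beta_quadratic:
  assumes "A > 0" "B > 0" and b: "Re b > 0" and cb: "Re (c - b) > 0"
  shows "(\<integral>w. cpow w (2 * b - 1) * cpow (w\<^sup>2 * A + B) (- c) \<partial>lpos) =
     Gamma b * Gamma (c - b) / (2 * Gamma c) * cpow A (- b) * cpow B (- (c - b))"
proof -
  let ?f = "\<lambda>y. cpow y (b - 1) * cpow (y * A + B) (- c)"
  have eq: "cpow w (2 * b - 1) * cpow (w\<^sup>2 * A + B) (- c) = 1/2 * ((2 * w) *\<^sub>R ?f (w\<^sup>2))" if w: "w > 0" for w
  proof -
    have "cpow w (2 * b - 1) = cpow w 1 * (cpow w (b - 1) * cpow w (b - 1))"
      by (simp only: cpow_add[symmetric]) (simp add: algebra_simps)
    also have "cpow w (b - 1) * cpow w (b - 1) = cpow (w\<^sup>2) (b - 1)"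
      using w by (simp add: power2_eq_square cpow_mult)
    finally show ?thesis using w by (simp add: scaleR_conv_of_real)
  qed
  have "(\<integral>w. cpow w (2 * b - 1) * cpow (w\<^sup>2 * A + B) (- c) \<partial>lpos) = 1/2 * (\<integral>w. (2 * w) *\<^sub>R ?f (w\<^sup>2) \<partial>lpos)"
    by (rule trans[OF lpos_cong_integral[OF eq] integral_mult_right_zero])
  also have "(\<integral>w. (2 * w) *\<^sub>R ?f (w\<^sup>2) \<partial>lpos) = integral\<^sup>L lpos ?f"
    by (rule lpos_square(2)) measurable
  also have "\<dots> = (\<integral>k. (B / A) *\<^sub>R ?f (B / A * k) \<partial>lpos)"
    by (rule lpos_scale(2)[symmetric]) (use assms in \<open>auto intro: measurable\<close>, measurable)
  also have "\<dots> = (\<integral>k. cpow A (- b) * cpow B (- (c - b)) * (cpow k (b - 1) * cpow (1 + k) (- c)) \<partial>lpos)"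
  proof (rule lpos_cong_integral)
    fix k :: real assume k: "k > 0"
    have "B / A * k * A + B = B * (1 + k)" using assms by (simp add: field_simps)
    hence f1: "cpow (B / A * k * A + B) (- c) = cpow B (- c) * cpow (1 + k) (- c)" using assms k by (simp add: cpow_mult)
    have f2: "of_real (B / A) * cpow (B / A * k) (b - 1) = cpow B b * cpow A (- b) * cpow k (b - 1)"
    proof -
      have g1: "cpow (B / A * k) (b - 1) = cpow (B / A) (b - 1) * cpow k (b - 1)" using assms k by (intro cpow_mult) auto
      have g2: "of_real (B / A) * cpow (B / A) (b - 1) = cpow (B / A) b"
        using cpow_add[of "B / A" 1 "b - 1"] assms by simp
      have "cpow (B / A) b = cpow B b * cpow A (- b)" using assms by (simp add: cpow_divide cpow_minus field_simps)
      thus ?thesis unfolding g1 mult.assoc[symmetric] g2 by simp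
    qed
    have f3: "cpow B (- (c - b)) = cpow B b * cpow B (- c)" by (simp add: cpow_add[symmetric])
    show "(B / A) *\<^sub>R ?f (B / A * k) = cpow A (- b) * cpow B (- (c - b)) * (cpow k (b - 1) * cpow (1 + k) (- c))"
      unfolding scaleR_conv_of_real mult.assoc[symmetric] f2 f1 f3 by (simp only: mult_ac)
  qed
  also have "\<dots> = cpow A (- b) * cpow B (- (c - b)) * (Gamma b * Gamma (c - b) / Gamma c)"
    by (simp only: integral_mult_right_zero lpos_Beta(2)[OF b cb])
  finally show ?thesis by simp
qed

text \<open>The integrand of J for real p with both \<open>kap\<close> factors written out. Since p
  + (1 - p) = 1, the normalising exponentials of the two factors multiply to e^s and cancel e^(-s);
  the two square roots contribute the extra power of s.\<close>

definition Gker :: "complex \<Rightarrow> complex \<Rightarrow> complex \<Rightarrow> real \<Rightarrow> real \<Rightarrow> real \<times> real \<Rightarrow> complex" where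
  "Gker \<sigma> \<alpha> \<beta> p s = (\<lambda>(w, v). cpow s (\<sigma> + 1) * exp (- of_real (s * ((p * (w + 1 / w) + (1 - p) * (v + 1 / v)) / 2))) *
     (cpow w (\<beta> - 1) * cpow v (\<alpha> - 1)))"

lemma Jfun_Gker:
  assumes s: "s > 0" and p: "0 < p" "p < 1"
  shows "integrable (lpos \<Otimes>\<^sub>M lpos) (Gker \<sigma> \<alpha> \<beta> p s)"
    and "Jfun \<sigma> \<alpha> \<beta> (of_real p) s = of_real (sqrt (p * (1 - p)) / (2 * pi)) * integral\<^sup>L (lpos \<Otimes>\<^sub>M lpos) (Gker \<sigma> \<alpha> \<beta> p s)"
proof -
  let ?k = "\<lambda>\<mu> x w. cpow w (\<mu> - 1) * exp (- complex_of_real x * of_real ((w - 1)\<^sup>2 / (2 * w)))"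
  have eq: "Gker \<sigma> \<alpha> \<beta> p s z = cpow s (\<sigma> + 1) * exp (- of_real s) * (case z of (w, v) \<Rightarrow> ?k \<beta> (s * p) w * ?k \<alpha> (s * (1 - p)) v)"
    if z: "z \<in> space (lpos \<Otimes>\<^sub>M lpos)" for z
  proof -
    obtain w v where wv: "z = (w, v)" "w > 0" "v > 0" using z by (auto simp: space_pair_measure)
    have q: "(x - 1)\<^sup>2 / (2 * x) = (x + 1 / x) / 2 - 1" if "x > 0" for x :: real
      using that by (simp add: power2_eq_square field_simps)
    have "- (s * ((p * (w + 1 / w) + (1 - p) * (v + 1 / v)) / 2)) = - s + - (s * p) * ((w - 1)\<^sup>2 / (2 * w)) + - (s * (1 - p)) * ((v - 1)\<^sup>2 / (2 * v))"
    proof -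
      have "- (s * ((p * P + (1 - p) * V) / 2)) = - s + - (s * p) * (P / 2 - 1) + - (s * (1 - p)) * (V / 2 - 1)" for P V
        by (simp add: field_simps)
      thus ?thesis unfolding q[OF wv(2)] q[OF wv(3)] .
    qed
    hence "exp (- complex_of_real (s * ((p * (w + 1 / w) + (1 - p) * (v + 1 / v)) / 2))) =
       exp (- of_real s) * exp (- complex_of_real (s * p) * of_real ((w - 1)\<^sup>2 / (2 * w))) *
       exp (- complex_of_real (s * (1 - p)) * of_real ((v - 1)\<^sup>2 / (2 * v)))"
      unfolding exp_add[symmetric] of_real_minus[symmetric] of_real_mult[symmetric] of_real_add[symmetric] by simp
    thus ?thesis unfolding Gker_def wv(1) prod.case by (simp only: mult_ac)
  qed
  have k1: "integrable lpos (?k \<beta> (s * p))" and k2: "integrable lpos (?k \<alpha> (s * (1 - p)))"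
    using kap_kernel_integrable_complex[of "of_real (s * p)" \<beta>] kap_kernel_integrable_complex[of "of_real (s * (1 - p))" \<alpha>] s p by simp_all
  show "integrable (lpos \<Otimes>\<^sub>M lpos) (Gker \<sigma> \<alpha> \<beta> p s)"
    by (rule iffD2[OF Bochner_Integration.integrable_cong[OF refl eq]]) (assumption, intro integrable_mult_right integrable_lpos_prod(1) k1 k2)
  have I: "integral\<^sup>L (lpos \<Otimes>\<^sub>M lpos) (Gker \<sigma> \<alpha> \<beta> p s) =
     cpow s (\<sigma> + 1) * exp (- of_real s) * (integral\<^sup>L lpos (?k \<beta> (s * p)) * integral\<^sup>L lpos (?k \<alpha> (s * (1 - p))))"
    by (rule trans[OF Bochner_Integration.integral_cong[OF refl eq]])
       (simp_all only: integral_mult_right_zero integrable_lpos_prod(2)[OF k1 k2])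
  have cs: "csqrt (of_real x / (2 * of_real pi)) = of_real (sqrt (x / (2 * pi)))" if "x > 0" for x
    using of_real_sqrt[of "x / (2 * pi)"] that by simp
  have "sqrt (s * p / (2 * pi)) * sqrt (s * (1 - p) / (2 * pi)) = s * (sqrt (p * (1 - p)) / (2 * pi))"
  proof -
    have "s * p / (2 * pi) * (s * (1 - p) / (2 * pi)) = (s / (2 * pi))\<^sup>2 * (p * (1 - p))"
      by (simp add: power2_eq_square)
    thus ?thesis using s unfolding real_sqrt_mult[symmetric] by (simp only: real_sqrt_mult real_sqrt_abs2) (simp add: real_sqrt_mult)
  qed
  hence c: "of_real (sqrt (s * p / (2 * pi))) * of_real (sqrt (s * (1 - p) / (2 * pi))) = complex_of_real s * of_real (sqrt (p * (1 - p)) / (2 * pi))"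
    by (metis of_real_mult)
  have k: "kap \<mu> (of_real s * of_real x) = of_real (sqrt (s * x / (2 * pi))) * integral\<^sup>L lpos (?k \<mu> (s * x))" if "x > 0" for x \<mu>
    using cs[of "s * x"] s that unfolding kap_def by simp
  have sg: "cpow s (\<sigma> + 1) = cpow s \<sigma> * of_real s" using s by (simp add: cpow_add)
  have e: "complex_of_real (exp (- s)) = exp (- of_real s)" by (simp add: exp_of_real[symmetric])
  have "Jfun \<sigma> \<alpha> \<beta> (of_real p) s = cpow s \<sigma> * exp (- of_real s) *
      ((of_real (sqrt (s * p / (2 * pi))) * of_real (sqrt (s * (1 - p) / (2 * pi)))) *
      (integral\<^sup>L lpos (?k \<beta> (s * p)) * integral\<^sup>L lpos (?k \<alpha> (s * (1 - p)))))"
    using k[of p \<beta>] k[of "1 - p" \<alpha>] p unfolding Jfun_def e by (simp only: of_real_diff of_real_1 diff_gt_0_iff_gt mult_ac)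
  thus "Jfun \<sigma> \<alpha> \<beta> (of_real p) s = of_real (sqrt (p * (1 - p)) / (2 * pi)) * integral\<^sup>L (lpos \<Otimes>\<^sub>M lpos) (Gker \<sigma> \<alpha> \<beta> p s)"
    unfolding I c sg by (simp only: mult_ac)
qed

text \<open>The modulus of the kernel is the kernel with the real parts of the parameters. Absolute
  convergence of the triple integral thus follows from the integrability of \<open>Jfun\<close> at
  real parameters.\<close>

lemma Gker_norm:
  assumes "s > 0" "z \<in> space (lpos \<Otimes>\<^sub>M lpos)"
  shows "Gker (of_real (Re \<sigma>)) (of_real (Re \<alpha>)) (of_real (Re \<beta>)) p s z = of_real (norm (Gker \<sigma> \<alpha> \<beta> p s z))"
proof -
  obtain w v where wv: "z = (w, v)" "w > 0" "v > 0" using assms(2) by (auto simp: space_pair_measure)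
  have "cpow x (of_real (Re c) + d) = of_real (norm (cpow x (c + d)))" if "x > 0" "d = of_real e" for x c d e
    using cpow_of_real[of x "Re c + e"] that by (simp add: norm_cpow)
  from this[of _ 1 1] this[of _ "-1" "-1"] show ?thesis
    using assms(1) wv by (simp add: Gker_def norm_mult exp_of_real[symmetric])
qed

text \<open>For real p the exponent H is positive and the triple integral may be rearranged. The
  s-integral is a gamma integral. On the ray v = w k the form H is a quadratic in w divided by 2 w,
  so the w-integral is of the type \<open>lpos_Beta_quadratic\<close>. The remaining integral over k
  is Euler's, at 1 - p^2 / (1 - p)^2.\<close>

lemma Jint_real:
  assumes p: "0 < p" "p < 1"
    and A: "\<bar>Re \<alpha>\<bar> < real M + 1/2" and B: "\<bar>Re \<beta>\<bar> < real M' + 1/2"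
    and S: "Re (2 * \<nu> + \<alpha> + \<beta>) + 1 > real (M + M')"
  shows "Jint (2 * \<nu> + \<alpha> + \<beta>) \<alpha> \<beta> (of_real p) =
     cpow 2 (2 * \<nu> + \<alpha> + \<beta>) / of_real pi * Gamma (\<nu> + \<alpha> + \<beta> + 1) * Gamma (\<nu> + 1) *
     cpow p (1/2 - \<beta>) * cpow (1 - p) (- \<alpha> - 2 * \<nu> - 3/2) *
     Eint (\<nu> + 1) (\<nu> + \<alpha> + 1) (2 * \<nu> + \<alpha> + \<beta> + 2) (of_real (1 - p\<^sup>2 / (1 - p)\<^sup>2))"
proof -
  note pos = params_pos[OF A B S]
  define \<sigma> where "\<sigma> = 2 * \<nu> + \<alpha> + \<beta>"
  define q where "q = 1 - p"
  have q: "q > 0" using p by (simp add: q_def)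
  define H where "H = (\<lambda>w v. (p * (w + 1 / w) + q * (v + 1 / v)) / 2)"
  have H: "H w v > 0" if "w > 0" "v > 0" for w v using that p q by (simp add: H_def add_pos_pos)
  define C where "C = complex_of_real (sqrt (p * q) / (2 * pi))"
  have C: "C \<noteq> 0" using p q by (simp add: C_def)
  let ?R = "\<lambda>s. Jfun (of_real (Re \<sigma>)) (of_real (Re \<alpha>)) (of_real (Re \<beta>)) (of_real p) s"
  let ?G = "Gker \<sigma> \<alpha> \<beta> p"
  have nG: "complex_of_real (\<integral>z. norm (?G s z) \<partial>(lpos \<Otimes>\<^sub>M lpos)) = inverse C * ?R s" if s: "s > 0" for s
  proof -
    have "(\<integral>z. complex_of_real (norm (?G s z)) \<partial>(lpos \<Otimes>\<^sub>M lpos)) =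
       integral\<^sup>L (lpos \<Otimes>\<^sub>M lpos) (Gker (of_real (Re \<sigma>)) (of_real (Re \<alpha>)) (of_real (Re \<beta>)) p s)"
      by (rule Bochner_Integration.integral_cong[OF refl]) (rule Gker_norm[OF s, symmetric])
    moreover have "?R s = C * integral\<^sup>L (lpos \<Otimes>\<^sub>M lpos) (Gker (of_real (Re \<sigma>)) (of_real (Re \<alpha>)) (of_real (Re \<beta>)) p s)"
      unfolding C_def q_def by (rule Jfun_Gker(2)[OF s p])
    ultimately show ?thesis using C by simp
  qed
  have "integrable lpos ?R"
    by (rule Jfun_integrable[of _ _ M _ M']) (use p A B S in \<open>auto simp: \<sigma>_def\<close>)
  hence "integrable lpos (\<lambda>s. inverse C * ?R s)" by (rule integrable_mult_right)
  hence "integrable lpos (\<lambda>s. complex_of_real (\<integral>z. norm (?G s z) \<partial>(lpos \<Otimes>\<^sub>M lpos)))"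
    by - (rule iffD2[OF lpos_cong_integrable[OF nG]]; assumption)
  hence outer: "integrable lpos (\<lambda>s. \<integral>z. norm (?G s z) \<partial>(lpos \<Otimes>\<^sub>M lpos))"
    by (simp only: complex_of_real_integrable_eq)
  have meas: "case_prod ?G \<in> borel_measurable (lpos \<Otimes>\<^sub>M (lpos \<Otimes>\<^sub>M lpos))"
    unfolding Gker_def by measurable
  have int3: "integrable (lpos \<Otimes>\<^sub>M (lpos \<Otimes>\<^sub>M lpos)) (case_prod ?G)"
    by (rule lpos12.Fubini_integrable) (use meas outer Jfun_Gker(1)[OF _ p] in auto)
  define g where "g = (\<lambda>w v. cpow w (\<beta> - 1) * cpow v (\<alpha> - 1) * (Gamma (\<sigma> + 2) * cpow (H w v) (- (\<sigma> + 2))))"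
  have gm: "case_prod g \<in> borel_measurable (borel \<Otimes>\<^sub>M borel)" unfolding g_def H_def by measurable
  have sint: "(\<integral>s. ?G s z \<partial>lpos) = case_prod g z" if z: "z \<in> space (lpos \<Otimes>\<^sub>M lpos)" for z
  proof -
    obtain w v where wv: "z = (w, v)" "w > 0" "v > 0" using z by (auto simp: space_pair_measure)
    have "?G s z = cpow w (\<beta> - 1) * cpow v (\<alpha> - 1) * (cpow s ((\<sigma> + 2) - 1) * exp (- of_real (H w v * s)))" for s
    proof -
      have "(\<sigma> + 2) - 1 = \<sigma> + 1" by simp
      thus ?thesis unfolding Gker_def wv(1) prod.case H_def q_def by (simp only: mult_ac)
    qed
    thus ?thesis using lpos_Gamma(2)[of "\<sigma> + 2" "H w v"] H[OF wv(2,3)] pos(5)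
      by (simp only: integral_mult_right_zero) (simp add: wv(1) g_def \<sigma>_def)
  qed
  have "Jint \<sigma> \<alpha> \<beta> (of_real p) = C * (\<integral>s. integral\<^sup>L (lpos \<Otimes>\<^sub>M lpos) (?G s) \<partial>lpos)"
    unfolding Jint_def C_def q_def by (rule trans[OF lpos_cong_integral[OF Jfun_Gker(2)[OF _ p]] integral_mult_right_zero])
  also have "(\<integral>s. integral\<^sup>L (lpos \<Otimes>\<^sub>M lpos) (?G s) \<partial>lpos) = (\<integral>z. (\<integral>s. ?G s z \<partial>lpos) \<partial>(lpos \<Otimes>\<^sub>M lpos))"
    using lpos12.Fubini_integral[OF int3] by simp
  also have "\<dots> = integral\<^sup>L (lpos \<Otimes>\<^sub>M lpos) (case_prod g)"
    by (rule Bochner_Integration.integral_cong[OF refl sint])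
  also have "\<dots> = (\<integral>k. \<integral>x. of_real x * g x (x * k) \<partial>lpos \<partial>lpos)"
  proof (rule lpos_ray[OF gm])
    show "integrable (lpos \<Otimes>\<^sub>M lpos) (case_prod g)"
      by (rule iffD1[OF Bochner_Integration.integrable_cong[OF refl sint]]) (use lpos12.integrable_snd[OF int3] in auto)
  qed
  also have "\<dots> = (\<integral>k. Gamma (\<sigma> + 2) * cpow 2 (\<sigma> + 2) * (cpow k (\<alpha> - 1) * (Gamma (\<nu> + \<alpha> + \<beta> + 1) * Gamma (\<nu> + 1) / (2 * Gamma (\<sigma> + 2)) *
      cpow (p + q * k) (- (\<nu> + \<alpha> + \<beta> + 1)) * cpow (p + q / k) (- (\<nu> + 1)))) \<partial>lpos)"
  proof (rule lpos_cong_integral)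
    fix k :: real assume k: "k > 0"
    let ?b = "\<nu> + \<alpha> + \<beta> + 1"
    have cb: "(\<sigma> + 2) - ?b = \<nu> + 1" by (simp add: \<sigma>_def)
    have pw: "of_real x * g x (x * k) = Gamma (\<sigma> + 2) * cpow 2 (\<sigma> + 2) * cpow k (\<alpha> - 1) * (cpow x (2 * ?b - 1) * cpow (x\<^sup>2 * (p + q * k) + (p + q / k)) (- (\<sigma> + 2)))"
      if x: "x > 0" for x
    \<comment> \<open>Numerator and denominator split: the 2 and the x in the denominator produce
      powers of exponent \<sigma> + 2, and the x-powers add up to the exponent 2 b - 1.\<close>
    proof -
      have "H x (x * k) = (x\<^sup>2 * (p + q * k) + (p + q / k)) / (2 * x)"
        using x k by (simp add: H_def power2_eq_square field_simps)
      moreover have "x\<^sup>2 * (p + q * k) + (p + q / k) > 0" using x k p q by (intro add_pos_pos mult_pos_pos) auto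
      ultimately have "cpow (H x (x * k)) (- (\<sigma> + 2)) = cpow (x\<^sup>2 * (p + q * k) + (p + q / k)) (- (\<sigma> + 2)) * (cpow 2 (\<sigma> + 2) * cpow x (\<sigma> + 2))"
        using x by (simp only: cpow_divide cpow_mult cpow_minus mult_pos_pos zero_less_numeral) (simp add: cpow_minus field_simps)
      moreover have "cpow (x * k) (\<alpha> - 1) = cpow x (\<alpha> - 1) * cpow k (\<alpha> - 1)" using x k by (intro cpow_mult)
      moreover have "cpow x (2 * ?b - 1) = of_real x * cpow x (\<beta> - 1) * cpow x (\<alpha> - 1) * cpow x (\<sigma> + 2)"
      proof -
        have "2 * ?b - 1 = 1 + (\<beta> - 1) + (\<alpha> - 1) + (\<sigma> + 2)" by (simp add: \<sigma>_def)
        thus ?thesis using x by (simp only: cpow_add cpow_1)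
      qed
      ultimately show ?thesis unfolding g_def by (simp only: mult_ac)
    qed
    have "(\<integral>x. of_real x * g x (x * k) \<partial>lpos) = Gamma (\<sigma> + 2) * cpow 2 (\<sigma> + 2) * cpow k (\<alpha> - 1) *
       (\<integral>x. cpow x (2 * ?b - 1) * cpow (x\<^sup>2 * (p + q * k) + (p + q / k)) (- (\<sigma> + 2)) \<partial>lpos)"
      by (rule trans[OF lpos_cong_integral[OF pw] integral_mult_right_zero])
    also have "(\<integral>x. cpow x (2 * ?b - 1) * cpow (x\<^sup>2 * (p + q * k) + (p + q / k)) (- (\<sigma> + 2)) \<partial>lpos) =
        Gamma ?b * Gamma (\<nu> + 1) / (2 * Gamma (\<sigma> + 2)) * cpow (p + q * k) (- ?b) * cpow (p + q / k) (- (\<nu> + 1))"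
      using lpos_Beta_quadratic[of "p + q * k" "p + q / k" ?b "\<sigma> + 2", unfolded cb] pos k p q by (simp add: add_pos_pos)
    finally show "(\<integral>x. of_real x * g x (x * k) \<partial>lpos) = Gamma (\<sigma> + 2) * cpow 2 (\<sigma> + 2) * (cpow k (\<alpha> - 1) * (Gamma ?b * Gamma (\<nu> + 1) / (2 * Gamma (\<sigma> + 2)) *
      cpow (p + q * k) (- ?b) * cpow (p + q / k) (- (\<nu> + 1))))" by (simp only: mult.assoc)
  qed
  also have "\<dots> = (\<integral>k. cpow 2 (\<sigma> + 1) * Gamma (\<nu> + \<alpha> + \<beta> + 1) * Gamma (\<nu> + 1) * (cpow k (\<alpha> - 1) *
      cpow (p + q * k) (- (\<nu> + \<alpha> + \<beta> + 1)) * cpow (p + q / k) (- (\<nu> + 1))) \<partial>lpos)"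
  proof (rule lpos_cong_integral)
    fix k :: real
    have "Gamma (\<sigma> + 2) \<noteq> 0" using pos(5) by (intro Gamma_Re_pos_nonzero) (simp add: \<sigma>_def)
    moreover have "cpow 2 (\<sigma> + 2) = cpow 2 (\<sigma> + 1) * 2"
      using cpow_add[of 2 "\<sigma> + 1" 1] by (simp add: add.assoc)
    ultimately show "Gamma (\<sigma> + 2) * cpow 2 (\<sigma> + 2) * (cpow k (\<alpha> - 1) * (Gamma (\<nu> + \<alpha> + \<beta> + 1) * Gamma (\<nu> + 1) / (2 * Gamma (\<sigma> + 2)) *
      cpow (p + q * k) (- (\<nu> + \<alpha> + \<beta> + 1)) * cpow (p + q / k) (- (\<nu> + 1)))) =
      cpow 2 (\<sigma> + 1) * Gamma (\<nu> + \<alpha> + \<beta> + 1) * Gamma (\<nu> + 1) * (cpow k (\<alpha> - 1) *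
      cpow (p + q * k) (- (\<nu> + \<alpha> + \<beta> + 1)) * cpow (p + q / k) (- (\<nu> + 1)))" by (simp add: field_simps)
  qed
  also have "\<dots> = cpow 2 (\<sigma> + 1) * Gamma (\<nu> + \<alpha> + \<beta> + 1) * Gamma (\<nu> + 1) *
     (\<integral>k. cpow k (\<alpha> - 1) * cpow (p + q * k) (- (\<nu> + \<alpha> + \<beta> + 1)) * cpow (p + q / k) (- (\<nu> + 1)) \<partial>lpos)"
    by (rule integral_mult_right_zero)
  \<comment> \<open>The scaling by p / q turns p + q k into p (1 + k), the factor in Euler's
    kernel.\<close>
  also have "(\<integral>k. cpow k (\<alpha> - 1) * cpow (p + q * k) (- (\<nu> + \<alpha> + \<beta> + 1)) * cpow (p + q / k) (- (\<nu> + 1)) \<partial>lpos) =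
     (\<integral>k. (p / q) *\<^sub>R (cpow (p / q * k) (\<alpha> - 1) * cpow (p + q * (p / q * k)) (- (\<nu> + \<alpha> + \<beta> + 1)) * cpow (p + q / (p / q * k)) (- (\<nu> + 1))) \<partial>lpos)"
    by (rule lpos_scale(2)[symmetric]) (use p q in auto)
  also have "\<dots> = (\<integral>k. cpow p (- \<beta>) * cpow q (- \<alpha> - 2 * \<nu> - 2) *
      (cpow k ((\<nu> + \<alpha> + 1) - 1) * cpow (1 + k) (- (2 * \<nu> + \<alpha> + \<beta> + 2)) * (1 - of_real (1 - p\<^sup>2 / q\<^sup>2) * of_real (k / (1 + k))) powr (- (\<nu> + 1))) \<partial>lpos)"
  proof (rule lpos_cong_integral)
    fix k :: real assume k: "k > 0"
    \<comment> \<open>X / (1 + k) is the base 1 - x k / (1 + k) of Euler's integrand at x = 1 - p^2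
      / q^2.\<close>
    define X where "X = 1 + k * p\<^sup>2 / q\<^sup>2"
    have X: "X > 0" using k by (simp add: X_def add_pos_nonneg)
    have "1 - (1 - p\<^sup>2 / q\<^sup>2) * (k / (1 + k)) = X / (1 + k)" using k by (simp add: X_def field_simps)
    hence e1: "(1 - of_real (1 - p\<^sup>2 / q\<^sup>2) * of_real (k / (1 + k))) powr (- (\<nu> + 1)) = cpow X (- (\<nu> + 1)) * cpow (1 + k) (\<nu> + 1)"
    proof -
      assume a: "1 - (1 - p\<^sup>2 / q\<^sup>2) * (k / (1 + k)) = X / (1 + k)"
      have "1 - complex_of_real (1 - p\<^sup>2 / q\<^sup>2) * of_real (k / (1 + k)) = of_real (X / (1 + k))"
        unfolding a[symmetric] by simp
      hence "(1 - of_real (1 - p\<^sup>2 / q\<^sup>2) * of_real (k / (1 + k))) powr (- (\<nu> + 1)) = cpow (X / (1 + k)) (- (\<nu> + 1))"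
        using X k by (simp only: cpow_powr divide_pos_pos add_pos_pos zero_less_one)
      moreover have "cpow (X / (1 + k)) (- c) = cpow X (- c) * cpow (1 + k) c" for c
        using X k by (simp add: cpow_divide cpow_minus field_simps)
      ultimately show ?thesis by (simp only:)
    qed
    have e2: "p + q * (p / q * k) = p * (1 + k)" "p + q / (p / q * k) = q\<^sup>2 * X / (p * k)"
      using p q k by (simp_all add: X_def field_simps power2_eq_square)
    have e3: "cpow (p * (1 + k)) c = cpow p c * cpow (1 + k) c" for c using p k by (intro cpow_mult) auto
    have e4: "cpow (q\<^sup>2 * X / (p * k)) (- (\<nu> + 1)) = cpow q (- (\<nu> + 1)) * cpow q (- (\<nu> + 1)) * cpow X (- (\<nu> + 1)) * cpow p (\<nu> + 1) * cpow k (\<nu> + 1)"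
    proof -
      have "cpow (q\<^sup>2 * X / (p * k)) c = cpow q c * cpow q c * cpow X c * (cpow p (- c) * cpow k (- c))" for c
        using p q k X by (simp add: cpow_divide cpow_mult power2_eq_square cpow_minus field_simps)
      from this[of "- (\<nu> + 1)"] show ?thesis by (simp only: minus_minus mult.assoc)
    qed
    have e5: "of_real (p / q) * cpow (p / q * k) (\<alpha> - 1) = cpow p \<alpha> * cpow q (- \<alpha>) * cpow k (\<alpha> - 1)"
    proof -
      have g1: "cpow (p / q * k) (\<alpha> - 1) = cpow (p / q) (\<alpha> - 1) * cpow k (\<alpha> - 1)" using p q k by (intro cpow_mult) auto
      have g2: "of_real (p / q) * cpow (p / q) (\<alpha> - 1) = cpow (p / q) \<alpha>"
        using cpow_add[of "p / q" 1 "\<alpha> - 1"] p q by simp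
      have "cpow (p / q) \<alpha> = cpow p \<alpha> * cpow q (- \<alpha>)" using p q by (simp add: cpow_divide cpow_minus field_simps)
      thus ?thesis unfolding g1 mult.assoc[symmetric] g2 by simp
    qed
    have "(p / q) *\<^sub>R (cpow (p / q * k) (\<alpha> - 1) * cpow (p + q * (p / q * k)) (- (\<nu> + \<alpha> + \<beta> + 1)) * cpow (p + q / (p / q * k)) (- (\<nu> + 1))) =
       (of_real (p / q) * cpow (p / q * k) (\<alpha> - 1)) * (cpow (p * (1 + k)) (- (\<nu> + \<alpha> + \<beta> + 1)) * cpow (q\<^sup>2 * X / (p * k)) (- (\<nu> + 1)))"
      unfolding scaleR_conv_of_real e2 by (simp only: mult.assoc)
    also have "\<dots> = (cpow p \<alpha> * cpow p (- (\<nu> + \<alpha> + \<beta> + 1)) * cpow p (\<nu> + 1)) * (cpow q (- \<alpha>) * cpow q (- (\<nu> + 1)) * cpow q (- (\<nu> + 1))) *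
       ((cpow k (\<alpha> - 1) * cpow k (\<nu> + 1)) * cpow (1 + k) (- (\<nu> + \<alpha> + \<beta> + 1)) * cpow X (- (\<nu> + 1)))"
      unfolding e3 e4 e5 by (simp only: mult_ac)
    also have "cpow p \<alpha> * cpow p (- (\<nu> + \<alpha> + \<beta> + 1)) * cpow p (\<nu> + 1) = cpow p (- \<beta>)"
      unfolding cpow_add[symmetric] by (rule arg_cong[of _ _ "cpow _"]) (simp add: algebra_simps)
    also have "cpow q (- \<alpha>) * cpow q (- (\<nu> + 1)) * cpow q (- (\<nu> + 1)) = cpow q (- \<alpha> - 2 * \<nu> - 2)"
      unfolding cpow_add[symmetric] by (rule arg_cong[of _ _ "cpow _"]) (simp add: algebra_simps)
    also have "cpow k (\<alpha> - 1) * cpow k (\<nu> + 1) = cpow k ((\<nu> + \<alpha> + 1) - 1)"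
      unfolding cpow_add[symmetric] by (rule arg_cong[of _ _ "cpow _"]) (simp add: algebra_simps)
    also have "cpow (1 + k) (- (\<nu> + \<alpha> + \<beta> + 1)) = cpow (1 + k) (- (2 * \<nu> + \<alpha> + \<beta> + 2)) * cpow (1 + k) (\<nu> + 1)"
      unfolding cpow_add[symmetric] by (rule arg_cong[of _ _ "cpow _"]) (simp add: algebra_simps)
    finally show "(p / q) *\<^sub>R (cpow (p / q * k) (\<alpha> - 1) * cpow (p + q * (p / q * k)) (- (\<nu> + \<alpha> + \<beta> + 1)) * cpow (p + q / (p / q * k)) (- (\<nu> + 1))) =
      cpow p (- \<beta>) * cpow q (- \<alpha> - 2 * \<nu> - 2) *
      (cpow k ((\<nu> + \<alpha> + 1) - 1) * cpow (1 + k) (- (2 * \<nu> + \<alpha> + \<beta> + 2)) * (1 - of_real (1 - p\<^sup>2 / q\<^sup>2) * of_real (k / (1 + k))) powr (- (\<nu> + 1)))"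
      unfolding e1 by (simp only: mult_ac)
  qed
  also have "\<dots> = cpow p (- \<beta>) * cpow q (- \<alpha> - 2 * \<nu> - 2) * Eint (\<nu> + 1) (\<nu> + \<alpha> + 1) (2 * \<nu> + \<alpha> + \<beta> + 2) (of_real (1 - p\<^sup>2 / q\<^sup>2))"
    unfolding Eint_def by (rule integral_mult_right_zero)
  finally have "Jint \<sigma> \<alpha> \<beta> (of_real p) = C * (cpow 2 (\<sigma> + 1) * Gamma (\<nu> + \<alpha> + \<beta> + 1) * Gamma (\<nu> + 1) *
      (cpow p (- \<beta>) * cpow q (- \<alpha> - 2 * \<nu> - 2) * Eint (\<nu> + 1) (\<nu> + \<alpha> + 1) (2 * \<nu> + \<alpha> + \<beta> + 2) (of_real (1 - p\<^sup>2 / q\<^sup>2))))" .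
  moreover have "C * cpow 2 (\<sigma> + 1) = cpow p (1/2) * cpow q (1/2) * (cpow 2 \<sigma> / of_real pi)"
  proof -
    have "cpow x (1/2) = of_real (sqrt x)" if "x > 0" for x
      using cpow_of_real[OF that, of "1/2"] that by (simp add: powr_half_sqrt)
    moreover have "cpow 2 (\<sigma> + 1) = cpow 2 \<sigma> * 2" by (simp add: cpow_add)
    ultimately show ?thesis using p q by (simp add: C_def real_sqrt_mult)
  qed
  moreover have "cpow p (1/2 - \<beta>) = cpow p (1/2) * cpow p (- \<beta>)" by (simp add: cpow_add[symmetric])
  moreover have "cpow q (- \<alpha> - 2 * \<nu> - 3/2) = cpow q (1/2) * cpow q (- \<alpha> - 2 * \<nu> - 2)"
    unfolding cpow_add[symmetric] by (rule arg_cong[of _ _ "cpow _"]) (simp add: algebra_simps)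
  ultimately show ?thesis unfolding \<sigma>_def[symmetric] q_def[symmetric]
    by (simp only: mult.assoc[symmetric]) (simp add: mult_ac)
qed

text \<open>The condition says that p / (1 - p) has positive real part: this quotient maps the disc
  onto the right half-plane.\<close>

lemma ball_half_iff: "p \<in> ball (1/2) (1/2) \<longleftrightarrow> Re (p * cnj (1 - p)) > 0"
proof -
  have "p \<in> ball (1/2) (1/2) \<longleftrightarrow> (norm (1/2 - p))\<^sup>2 < (1/2)\<^sup>2"
  proof -
    have "a < b \<longleftrightarrow> a\<^sup>2 < b\<^sup>2" if "a \<ge> 0" "b \<ge> 0" for a b :: real
      using that by (meson power2_less_imp_less power_strict_mono zero_less_numeral)
    from this[of "norm (1/2 - p)" "1/2"] show ?thesis by (simp add: dist_norm)
  qed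
  also have "(norm (1/2 - p))\<^sup>2 = (1/2 - Re p)\<^sup>2 + (Im p)\<^sup>2" by (simp add: cmod_power2)
  finally have "p \<in> ball (1/2) (1/2) \<longleftrightarrow> (1/2)\<^sup>2 - ((1/2 - Re p)\<^sup>2 + (Im p)\<^sup>2) > 0" by simp
  also have "(1/2)\<^sup>2 - ((1/2 - Re p)\<^sup>2 + (Im p)\<^sup>2) = Re (p * cnj (1 - p))"
    by (simp add: power2_eq_square algebra_simps)
  finally show ?thesis .
qed

text \<open>With r = p / (1 - p) in the right half-plane, r^2 avoids the nonpositive axis, so 1 -
  r^2 avoids the slit. This is why the disc is the natural domain for Euler's side of the
  identity.\<close>

lemma ball_half_props:
  assumes "p \<in> ball (1/2) (1/2)"
  shows "0 < Re p" "Re p < 1" "1 - p\<^sup>2 / (1 - p)\<^sup>2 \<in> hyp_slit_plane"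
proof -
  have h: "\<bar>1/2 - Re p\<bar> < 1/2"
    using assms abs_Re_le_cmod[of "1/2 - p"] by (simp add: dist_norm)
  thus re: "0 < Re p" "Re p < 1" by linarith+
  define r where "r = p / (1 - p)"
  have q: "norm (1 - p) > 0" using re by auto
  have "r = p * cnj (1 - p) / of_real ((norm (1 - p))\<^sup>2)"
    unfolding r_def by (subst complex_div_cnj) simp
  hence "Re r = Re (p * cnj (1 - p)) / (norm (1 - p))\<^sup>2" by (simp only: Re_divide_of_real)
  hence r: "Re r > 0" using assms q unfolding ball_half_iff by (auto intro!: divide_pos_pos)
  show "1 - p\<^sup>2 / (1 - p)\<^sup>2 \<in> hyp_slit_plane"
  proof (rule ccontr)
    assume "1 - p\<^sup>2 / (1 - p)\<^sup>2 \<notin> hyp_slit_plane"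
    hence "Im (r\<^sup>2) = 0" "Re (r\<^sup>2) \<le> 0" by (auto simp: hyp_slit_plane_iff r_def power_divide)
    hence "Im r = 0" "Re r * Re r \<le> 0" using r by (auto simp: power2_eq_square)
    thus False using r by (simp add: mult_le_0_iff)
  qed
qed

definition Jconst :: "complex \<Rightarrow> complex \<Rightarrow> complex \<Rightarrow> complex" where
  "Jconst \<nu> \<alpha> \<beta> = cpow 2 (2 * \<nu> + \<alpha> + \<beta>) / of_real pi * Gamma (\<nu> + \<alpha> + \<beta> + 1) * Gamma (\<nu> + 1)"

lemma Jint_ball:
  assumes A: "\<bar>Re \<alpha>\<bar> < real M + 1/2" and B: "\<bar>Re \<beta>\<bar> < real M' + 1/2"
    and S: "Re (2 * \<nu> + \<alpha> + \<beta>) + 1 > real (M + M')" and p: "p \<in> ball (1/2) (1/2)"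
  shows "Jint (2 * \<nu> + \<alpha> + \<beta>) \<alpha> \<beta> p = Jconst \<nu> \<alpha> \<beta> * p powr (1/2 - \<beta>) * (1 - p) powr (- \<alpha> - 2 * \<nu> - 3/2) *
     Eint (\<nu> + 1) (\<nu> + \<alpha> + 1) (2 * \<nu> + \<alpha> + \<beta> + 2) (1 - p\<^sup>2 / (1 - p)\<^sup>2)"
proof -
  note pos = params_pos[OF A B S]
  define E where "E = Eint (\<nu> + 1) (\<nu> + \<alpha> + 1) (2 * \<nu> + \<alpha> + \<beta> + 2)"
  have E: "E holomorphic_on hyp_slit_plane" unfolding E_def using pos by (intro Eint_holomorphic) auto
  have "(E \<circ> (\<lambda>p. 1 - p\<^sup>2 / (1 - p)\<^sup>2)) holomorphic_on ball (1/2) (1/2)"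
  proof (rule holomorphic_on_compose_gen[OF _ E])
    show "(\<lambda>p. 1 - p\<^sup>2 / (1 - p)\<^sup>2) holomorphic_on ball (1/2) (1/2)"
    proof -
      have "1 - p \<noteq> 0" if "p \<in> ball (1/2) (1/2)" for p :: complex using ball_half_props(2)[OF that] by auto
      thus ?thesis by (intro holomorphic_intros) auto
    qed
  qed (use ball_half_props(3) in auto)
  hence hE: "(\<lambda>p. E (1 - p\<^sup>2 / (1 - p)\<^sup>2)) holomorphic_on ball (1/2) (1/2)" by (simp add: o_def)
  have nn: "p \<notin> \<real>\<^sub>\<le>\<^sub>0" "1 - p \<notin> \<real>\<^sub>\<le>\<^sub>0" if "p \<in> ball (1/2) (1/2)" for p :: complex
    using ball_half_props[OF that] by (auto simp: complex_nonpos_Reals_iff)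
  show ?thesis unfolding E_def[symmetric]
  proof (rule identity_theorem_segment[where f = "Jint (2 * \<nu> + \<alpha> + \<beta>) \<alpha> \<beta>" and S = "ball (1/2) (1/2)" and a = 0 and b = 1 and z = p and
      g = "\<lambda>p. Jconst \<nu> \<alpha> \<beta> * p powr (1/2 - \<beta>) * (1 - p) powr (- \<alpha> - 2 * \<nu> - 3/2) * E (1 - p\<^sup>2 / (1 - p)\<^sup>2)"])
    show "Jint (2 * \<nu> + \<alpha> + \<beta>) \<alpha> \<beta> holomorphic_on ball (1/2) (1/2)"
      by (rule holomorphic_on_subset[OF Jint_holomorphic[OF A B S]]) (use ball_half_props in auto)
    show "(\<lambda>p. Jconst \<nu> \<alpha> \<beta> * p powr (1/2 - \<beta>) * (1 - p) powr (- \<alpha> - 2 * \<nu> - 3/2) * E (1 - p\<^sup>2 / (1 - p)\<^sup>2)) holomorphic_on ball (1/2) (1/2)"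
    proof -
      have "(\<lambda>p. p powr (1/2 - \<beta>)) holomorphic_on ball (1/2) (1/2)"
        "(\<lambda>p. (1 - p) powr (- \<alpha> - 2 * \<nu> - 3/2)) holomorphic_on ball (1/2) (1/2)"
        by (intro holomorphic_intros; use nn in blast)+
      thus ?thesis by (intro holomorphic_on_mult holomorphic_on_const hE)
    qed
    show "complex_of_real ` {0<..<1} \<subseteq> ball (1/2) (1/2)"
    proof
      fix z assume "z \<in> complex_of_real ` {0<..<1}"
      then obtain x where x: "z = of_real x" "0 < x" "x < 1" by auto
      have "(1/2 :: complex) - of_real x = of_real (1/2 - x)" by simp
      hence "norm ((1/2 :: complex) - z) = \<bar>1/2 - x\<bar>" unfolding x(1) by (simp only: norm_of_real)
      also have "\<dots> < 1/2" using x by linarith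
      finally show "z \<in> ball (1/2) (1/2)" by (simp add: dist_norm)
    qed
    fix x :: real assume x: "0 < x" "x < 1"
    have "(1 - complex_of_real x) = of_real (1 - x)" by simp
    thus "Jint (2 * \<nu> + \<alpha> + \<beta>) \<alpha> \<beta> (of_real x) =
      Jconst \<nu> \<alpha> \<beta> * of_real x powr (1/2 - \<beta>) * (1 - of_real x) powr (- \<alpha> - 2 * \<nu> - 3/2) * E (1 - (of_real x)\<^sup>2 / (1 - of_real x)\<^sup>2)"
      using Jint_real[OF x A B S] x by (simp add: Jconst_def E_def cpow_powr)
  qed (use p in auto)
qed

section \<open>Boundary values on the cut\<close>

definition Jcut :: "complex \<Rightarrow> complex \<Rightarrow> complex \<Rightarrow> real \<Rightarrow> real \<Rightarrow> complex" where
  "Jcut \<sigma> \<alpha> \<beta> \<zeta> e = Jint \<sigma> \<alpha> \<beta> (of_real (cos \<zeta>) * cis (e * \<zeta>))"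

lemma cut_point:
  assumes z: "0 < \<zeta>" "\<zeta> < pi / 2" and e: "e \<in> {1, -1 :: real}"
  defines "p \<equiv> of_real (cos \<zeta>) * cis (e * \<zeta>)"
  shows "1 - p = of_real (sin \<zeta>) * cis (e * (\<zeta> - pi / 2))" "0 < Re p" "Re p < 1"
    "p powr c = cpow (cos \<zeta>) c * exp (\<i> * of_real e * of_real \<zeta> * c)"
    "(1 - p) powr c = cpow (sin \<zeta>) c * exp (\<i> * of_real e * of_real (\<zeta> - pi / 2) * c)"
proof -
  have sc: "sin \<zeta> > 0" "cos \<zeta> > 0" using z by (auto intro!: sin_gt_zero cos_gt_zero)
  show q: "1 - p = of_real (sin \<zeta>) * cis (e * (\<zeta> - pi / 2))"
    using e by (auto simp: p_def complex_eq_iff cos_diff sin_diff right_diff_distrib power2_eq_square[symmetric] sin_squared_eq)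
  have "Re p = (cos \<zeta>)\<^sup>2" "Re (1 - p) = (sin \<zeta>)\<^sup>2" using e by (auto simp: p_def power2_eq_square[symmetric] sin_squared_eq)
  hence "0 < Re p" "0 < Re (1 - p)" using sc by auto
  thus "0 < Re p" "Re p < 1" by auto
  have Ln: "(of_real x * cis y) powr c = cpow x c * exp (\<i> * of_real y * c)" if "x > 0" "\<bar>y\<bar> < pi / 2" for x y
  proof -
    have "of_real x * cis y = exp (of_real (ln x) + \<i> * of_real y)"
      using that by (simp add: exp_add exp_of_real cis_conv_exp)
    moreover have "Ln (exp (of_real (ln x) + \<i> * of_real y)) = of_real (ln x) + \<i> * of_real y"
      using that by (intro Ln_exp) auto
    ultimately have "(of_real x * cis y) powr c = exp (c * (of_real (ln x) + \<i> * of_real y))"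
      by (simp add: powr_def)
    thus ?thesis by (simp add: cpow_def ring_distribs exp_add mult_ac)
  qed
  show "p powr c = cpow (cos \<zeta>) c * exp (\<i> * of_real e * of_real \<zeta> * c)"
    using Ln[of "cos \<zeta>" "e * \<zeta>"] sc z e by (auto simp: p_def mult_ac)
  show "(1 - p) powr c = cpow (sin \<zeta>) c * exp (\<i> * of_real e * of_real (\<zeta> - pi / 2) * c)"
    unfolding q using Ln[of "sin \<zeta>" "e * (\<zeta> - pi / 2)"] sc z e by (auto simp: mult_ac)
qed

text \<open>The values of \<open>zeta1\<close> and, below, \<open>zeta2\<close> at n = l =
  0.\<close>

definition theta1 :: "complex \<Rightarrow> complex \<Rightarrow> real \<Rightarrow> complex" where
  "theta1 \<sigma> \<alpha> \<zeta> = (\<sigma> + 1) * of_real \<zeta> - (\<alpha> + 1/2) * (of_real pi / 2)"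

definition theta2 :: "complex \<Rightarrow> complex \<Rightarrow> real \<Rightarrow> complex" where
  "theta2 \<sigma> \<alpha> \<zeta> = (\<sigma> + 1) * of_real \<zeta> + (\<alpha> + 1/2) * (of_real pi / 2)"

lemma Jconst_nonzero:
  assumes "Re (\<nu> + \<alpha> + \<beta> + 1) > 0" "Re (\<nu> + 1) > 0"
  shows "Jconst \<nu> \<alpha> \<beta> \<noteq> 0"
  using assms by (simp add: Jconst_def Gamma_Re_pos_nonzero)

text \<open>The boundary points lie on the circle around the disc but inside the strip 0 < Re p < 1,
  where J is still holomorphic. The limit of Euler's integral at the cut is therefore obtained from
  J by continuity.\<close>

lemma Eint_cut_limit:
  assumes z: "0 < \<zeta>" "\<zeta> < pi / 2" and e: "e \<in> {1, -1 :: real}"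
    and A: "\<bar>Re \<alpha>\<bar> < real M + 1/2" and B: "\<bar>Re \<beta>\<bar> < real M' + 1/2"
    and S: "Re (2 * \<nu> + \<alpha> + \<beta>) + 1 > real (M + M')"
  defines "\<sigma> \<equiv> 2 * \<nu> + \<alpha> + \<beta>"
  defines "x \<equiv> (\<lambda>\<eta>. 2 / (1 - (of_real (cos (2 * \<zeta>)) + \<i> * of_real (e * \<eta>))))"
  shows "((\<lambda>\<eta>. Eint (\<nu> + 1) (\<nu> + \<alpha> + 1) (\<sigma> + 2) (x \<eta>)) \<longlongrightarrow> Jcut \<sigma> \<alpha> \<beta> \<zeta> (- e) / (Jconst \<nu> \<alpha> \<beta> *
     (cpow (cos \<zeta>) (1/2 - \<beta>) * exp (\<i> * of_real (- e) * of_real \<zeta> * (1/2 - \<beta>))) *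
     (cpow (sin \<zeta>) (- \<alpha> - 2 * \<nu> - 3/2) * exp (\<i> * of_real (- e) * of_real (\<zeta> - pi / 2) * (- \<alpha> - 2 * \<nu> - 3/2))))) (at_right 0)"
    and "\<And>\<eta>. 0 < \<eta> \<Longrightarrow> x \<eta> \<in> hyp_slit_plane"
proof -
  note pos = params_pos[OF A B S]
  have sc: "sin \<zeta> > 0" "cos \<zeta> > 0" using z by (auto intro!: sin_gt_zero cos_gt_zero)
  define zz where "zz = (\<lambda>\<eta>. of_real (cos (2 * \<zeta>)) + \<i> * complex_of_real (e * \<eta>))"
  \<comment> \<open>Solves 1 - r^2 = 2 / (1 - z), that is, r^2 = -(1 + z) / (1 - z); the factor -i e
    selects the root in the right half-plane on the side e of the cut.\<close>
  define r where "r = (\<lambda>\<eta>. - \<i> * of_real e * csqrt ((1 + zz \<eta>) / (1 - zz \<eta>)))"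
  define p where "p = (\<lambda>\<eta>. r \<eta> / (1 + r \<eta>))"
  define F where "F = (\<lambda>\<eta>. Jint \<sigma> \<alpha> \<beta> (p \<eta>) / (Jconst \<nu> \<alpha> \<beta> * p \<eta> powr (1/2 - \<beta>) * (1 - p \<eta>) powr (- \<alpha> - 2 * \<nu> - 3/2)))"
  have zz0: "zz 0 = of_real (cos (2 * \<zeta>))" "1 - zz 0 = of_real (2 * (sin \<zeta>)\<^sup>2)" "1 + zz 0 = of_real (2 * (cos \<zeta>)\<^sup>2)"
  proof -
    show "zz 0 = of_real (cos (2 * \<zeta>))" by (simp add: zz_def)
    hence "1 - zz 0 = of_real (1 - cos (2 * \<zeta>))" "1 + zz 0 = of_real (1 + cos (2 * \<zeta>))" by simp_all
    moreover have "1 - cos (2 * \<zeta>) = 2 * (sin \<zeta>)\<^sup>2" by (simp add: cos_double_sin)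
    moreover have "1 + cos (2 * \<zeta>) = 2 * (cos \<zeta>)\<^sup>2" by (simp add: cos_double_cos)
    ultimately show "1 - zz 0 = of_real (2 * (sin \<zeta>)\<^sup>2)" "1 + zz 0 = of_real (2 * (cos \<zeta>)\<^sup>2)" by simp_all
  qed
  have r0: "r 0 = - \<i> * of_real e * of_real (cos \<zeta> / sin \<zeta>)"
  proof -
    have "(1 + zz 0) / (1 - zz 0) = of_real ((cos \<zeta> / sin \<zeta>)\<^sup>2)" unfolding zz0(2,3) by (simp add: power_divide)
    moreover have "csqrt (of_real ((cos \<zeta> / sin \<zeta>)\<^sup>2)) = of_real (cos \<zeta> / sin \<zeta>)"
      using of_real_sqrt[of "(cos \<zeta> / sin \<zeta>)\<^sup>2"] sc by simp
    ultimately show ?thesis by (simp only: r_def)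
  qed
  \<comment> \<open>At the cut r = -i e cot \<zeta>, and p = r / (1 + r) lands on the boundary point
    of the opposite sign; this is the origin of the argument -e.\<close>
  have p0: "p 0 = of_real (cos \<zeta>) * cis (- e * \<zeta>)"
  proof -
    have "1 + r 0 = (of_real (sin \<zeta>) - \<i> * of_real e * of_real (cos \<zeta>)) / of_real (sin \<zeta>)"
      unfolding r0 using sc by (simp add: field_simps)
    hence f1: "p 0 = - \<i> * of_real e * of_real (cos \<zeta>) / (of_real (sin \<zeta>) - \<i> * of_real e * of_real (cos \<zeta>))"
      unfolding p_def r0 using sc by simp
    have f2: "- \<i> * of_real e * of_real (cos \<zeta>) = of_real (cos \<zeta>) * cis (- e * \<zeta>) * (of_real (sin \<zeta>) - \<i> * of_real e * of_real (cos \<zeta>))"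
    proof -
      have "cos \<zeta> * cos \<zeta> + sin \<zeta> * sin \<zeta> = 1" using sin_cos_squared_add2[of \<zeta>] by (simp add: power2_eq_square)
      hence "cos \<zeta> * (cos \<zeta> * cos \<zeta>) + cos \<zeta> * (sin \<zeta> * sin \<zeta>) = cos \<zeta>" by (metis mult.right_neutral ring_class.ring_distribs(1))
      thus ?thesis using e by (auto simp: complex_eq_iff algebra_simps)
    qed
    have f3: "of_real (sin \<zeta>) - \<i> * of_real e * of_real (cos \<zeta>) \<noteq> 0" using sc by (auto simp: complex_eq_iff)
    show ?thesis unfolding f1 f2 by (rule nonzero_mult_div_cancel_right[OF f3])
  qed
  have e': "- e \<in> {1, -1}" using e by auto
  note cp = cut_point[OF z e', folded p0]
  have F0: "F 0 = Jcut \<sigma> \<alpha> \<beta> \<zeta> (- e) / (Jconst \<nu> \<alpha> \<beta> *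
     (cpow (cos \<zeta>) (1/2 - \<beta>) * exp (\<i> * of_real (- e) * of_real \<zeta> * (1/2 - \<beta>))) *
     (cpow (sin \<zeta>) (- \<alpha> - 2 * \<nu> - 3/2) * exp (\<i> * of_real (- e) * of_real (\<zeta> - pi / 2) * (- \<alpha> - 2 * \<nu> - 3/2))))"
    unfolding F_def cp(4,5) unfolding Jcut_def p0 by (simp only: mult_ac)
  have contz: "isCont zz 0" unfolding zz_def by (intro continuous_intros)
  have nn: "(1 + zz 0) / (1 - zz 0) \<notin> \<real>\<^sub>\<le>\<^sub>0" "1 - zz 0 \<notin> \<real>\<^sub>\<le>\<^sub>0" "zz 0 + 1 \<notin> \<real>\<^sub>\<le>\<^sub>0"
  proof -
    have "(1 + zz 0) / (1 - zz 0) = of_real ((cos \<zeta>)\<^sup>2 / (sin \<zeta>)\<^sup>2)" unfolding zz0(2,3) by simp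
    thus "(1 + zz 0) / (1 - zz 0) \<notin> \<real>\<^sub>\<le>\<^sub>0" using sc by (simp only: nonpos_Reals_of_real_iff) (simp add: not_le)
    show "1 - zz 0 \<notin> \<real>\<^sub>\<le>\<^sub>0" unfolding zz0(2,3) nonpos_Reals_of_real_iff using sc by simp
    show "zz 0 + 1 \<notin> \<real>\<^sub>\<le>\<^sub>0" unfolding add.commute[of "zz 0" 1] zz0(3) nonpos_Reals_of_real_iff using sc by simp
  qed
  have contw: "isCont (\<lambda>\<eta>. (1 + zz \<eta>) / (1 - zz \<eta>)) 0"
    by (rule isCont_divide[OF isCont_add[OF _ contz] isCont_diff[OF _ contz]]) (use nn(2) in auto)
  have "isCont (\<lambda>\<eta>. csqrt ((1 + zz \<eta>) / (1 - zz \<eta>))) 0"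
    by (rule isCont_o2[OF contw continuous_at_csqrt[OF nn(1)]])
  hence contr: "isCont r 0" unfolding r_def by (rule isCont_mult[rotated]) simp
  have "Re (r 0) = 0" using e by (auto simp: r0)
  hence r1: "1 + r 0 \<noteq> 0" by (auto simp: complex_eq_iff)
  have contp: "isCont p 0" unfolding p_def by (rule isCont_divide[OF contr isCont_add[OF _ contr] r1]) simp
  have contJ: "isCont (\<lambda>\<eta>. Jint \<sigma> \<alpha> \<beta> (p \<eta>)) 0"
  proof (rule isCont_o2[OF contp])
    show "isCont (Jint \<sigma> \<alpha> \<beta>) (p 0)"
      using Jint_holomorphic[OF A B S] cp(2,3) open_strip unfolding \<sigma>_def[symmetric]
      by (auto dest!: holomorphic_on_imp_continuous_on simp: continuous_on_eq_continuous_at)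
  qed
  have nz: "p 0 \<notin> \<real>\<^sub>\<le>\<^sub>0" "1 - p 0 \<notin> \<real>\<^sub>\<le>\<^sub>0" using cp(2,3) by (auto simp: complex_nonpos_Reals_iff)
  have cpw: "isCont (\<lambda>\<eta>. f \<eta> powr c) 0" "f 0 powr c \<noteq> 0" if "isCont f 0" "f 0 \<notin> \<real>\<^sub>\<le>\<^sub>0" for f :: "real \<Rightarrow> complex" and c
  proof -
    have "f 0 \<noteq> 0" using that(2) by auto
    thus "f 0 powr c \<noteq> 0" by (simp add: powr_def)
    show "isCont (\<lambda>\<eta>. f \<eta> powr c) 0" by (intro isCont_powr_complex that continuous_const)
  qed
  have c2: "isCont (\<lambda>\<eta>. 1 - p \<eta>) 0" by (intro isCont_diff continuous_const contp)
  have "isCont F 0"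
    unfolding F_def
    by (intro isCont_mult isCont_divide continuous_const contJ cpw(1) c2 contp nz)
       (use Jconst_nonzero[OF pos(4,1)] cpw(2)[OF contp] cpw(2)[OF c2] nz in simp_all)
  hence "(F \<longlongrightarrow> F 0) (at_right 0)" by (simp add: isCont_def filterlim_at_split)
  moreover have ev: "F \<eta> = Eint (\<nu> + 1) (\<nu> + \<alpha> + 1) (\<sigma> + 2) (x \<eta>)" "x \<eta> \<in> hyp_slit_plane" if h: "0 < \<eta>" for \<eta>
  proof -
    have Imz: "Im (zz \<eta>) = e * \<eta>" by (simp add: zz_def)
    have z1: "zz \<eta> \<noteq> 1" "1 - zz \<eta> \<noteq> 0" using Imz h e by (auto simp: complex_eq_iff)
    let ?w = "(1 + zz \<eta>) / (1 - zz \<eta>)"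
    have "Im ?w = 2 * (e * \<eta>) / (norm (1 - zz \<eta>))\<^sup>2"
      unfolding Im_complex_div_eq_0 Im_divide cmod_power2 using Imz by (simp add: field_simps)
    hence Imw: "e * Im ?w > 0" using h e z1 by auto
    \<comment> \<open>The principal root has nonnegative real part, so the sign e of Im ?w passes on
      to its imaginary part. Hence Re r > 0, and p lies in the open disc.\<close>
    have "Re (r \<eta>) = e * Im (csqrt ?w)" by (simp add: r_def)
    moreover have "e * Im (csqrt ?w) > 0"
    proof -
      define c where "c = csqrt ?w"
      have "c\<^sup>2 = ?w" unfolding c_def by (rule power2_csqrt)
      hence "Im ?w = 2 * Re c * Im c" by (metis Im_power2)
      hence "Re c * (e * Im c) > 0" using Imw by (simp add: mult_ac)
      moreover have "Re c \<ge> 0" using csqrt_principal[of ?w] unfolding c_def by auto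
      ultimately show ?thesis unfolding c_def[symmetric] by (simp add: zero_less_mult_iff)
    qed
    ultimately have Rer: "Re (r \<eta>) > 0" by simp
    hence r1: "1 + r \<eta> \<noteq> 0" by (auto simp: complex_eq_iff)
    have q: "1 - p \<eta> = 1 / (1 + r \<eta>)" using r1 by (simp add: p_def field_simps)
    have "p \<eta> * cnj (1 - p \<eta>) = r \<eta> / (norm (1 + r \<eta>))\<^sup>2"
    proof -
      have "p \<eta> * cnj (1 - p \<eta>) = r \<eta> / (1 + r \<eta>) * cnj (1 / (1 + r \<eta>))" unfolding q by (simp only: p_def)
      moreover have "(complex_of_real (norm (1 + r \<eta>)))\<^sup>2 = (1 + r \<eta>) * cnj (1 + r \<eta>)"
        using complex_norm_square[of "1 + r \<eta>"] by simp
      ultimately show ?thesis by simp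
    qed
    hence "Re (p \<eta> * cnj (1 - p \<eta>)) = Re (r \<eta>) / (norm (1 + r \<eta>))\<^sup>2"
      by (simp only: of_real_power[symmetric] Re_divide_of_real)
    hence pb: "p \<eta> \<in> ball (1/2) (1/2)" unfolding ball_half_iff using Rer r1 by simp
    have "p \<eta> / (1 - p \<eta>) = r \<eta>" unfolding q using r1 by (simp add: p_def)
    hence "(p \<eta>)\<^sup>2 / (1 - p \<eta>)\<^sup>2 = (r \<eta>)\<^sup>2" by (simp flip: power_divide)
    also have "\<dots> = - ?w" using e unfolding r_def by (auto simp: power_mult_distrib)
    finally have x': "1 - (p \<eta>)\<^sup>2 / (1 - p \<eta>)\<^sup>2 = 2 / (1 - zz \<eta>)" using z1 by (simp add: field_simps)
    have x: "1 - (p \<eta>)\<^sup>2 / (1 - p \<eta>)\<^sup>2 = x \<eta>" unfolding x' by (simp only: x_def zz_def)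
    show "x \<eta> \<in> hyp_slit_plane" using ball_half_props(3)[OF pb] unfolding x .
    have "Jint \<sigma> \<alpha> \<beta> (p \<eta>) = (Jconst \<nu> \<alpha> \<beta> * p \<eta> powr (1/2 - \<beta>) * (1 - p \<eta>) powr (- \<alpha> - 2 * \<nu> - 3/2)) *
       Eint (\<nu> + 1) (\<nu> + \<alpha> + 1) (\<sigma> + 2) (x \<eta>)"
      using Jint_ball[OF A B S pb] unfolding x \<sigma>_def by simp
    moreover have "Jconst \<nu> \<alpha> \<beta> * p \<eta> powr (1/2 - \<beta>) * (1 - p \<eta>) powr (- \<alpha> - 2 * \<nu> - 3/2) \<noteq> 0"
    proof -
      have "p \<eta> \<noteq> 0" "1 - p \<eta> \<noteq> 0" using ball_half_props(1,2)[OF pb] by auto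
      thus ?thesis using Jconst_nonzero[OF pos(4,1)] by (simp add: powr_def)
    qed
    ultimately show "F \<eta> = Eint (\<nu> + 1) (\<nu> + \<alpha> + 1) (\<sigma> + 2) (x \<eta>)"
      unfolding F_def by (metis nonzero_mult_div_cancel_left)
  qed
  have "\<forall>\<^sub>F \<eta> in at_right 0. F \<eta> = Eint (\<nu> + 1) (\<nu> + \<alpha> + 1) (\<sigma> + 2) (x \<eta>)"
    unfolding eventually_at_right_field using ev(1) by (intro exI[of _ 1]) auto
  ultimately have "((\<lambda>\<eta>. Eint (\<nu> + 1) (\<nu> + \<alpha> + 1) (\<sigma> + 2) (x \<eta>)) \<longlongrightarrow> F 0) (at_right 0)" by (rule Lim_transform_eventually)
  thus "((\<lambda>\<eta>. Eint (\<nu> + 1) (\<nu> + \<alpha> + 1) (\<sigma> + 2) (x \<eta>)) \<longlongrightarrow> Jcut \<sigma> \<alpha> \<beta> \<zeta> (- e) / (Jconst \<nu> \<alpha> \<beta> *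
     (cpow (cos \<zeta>) (1/2 - \<beta>) * exp (\<i> * of_real (- e) * of_real \<zeta> * (1/2 - \<beta>))) *
     (cpow (sin \<zeta>) (- \<alpha> - 2 * \<nu> - 3/2) * exp (\<i> * of_real (- e) * of_real (\<zeta> - pi / 2) * (- \<alpha> - 2 * \<nu> - 3/2))))) (at_right 0)"
    unfolding F0 .
  show "\<And>\<eta>. 0 < \<eta> \<Longrightarrow> x \<eta> \<in> hyp_slit_plane" by (rule ev(2))
qed

text \<open>Besides the hypergeometric factor, only the power of z - 1 jumps across the cut. Its
  phase e^(i e \<pi> (\<nu> + \<alpha> + 1)), together with the phases of p and 1 - p, combines to
  the angle \<open>theta2\<close>.\<close>

lemma jacobi_Q_limit:
  assumes z: "0 < \<zeta>" "\<zeta> < pi / 2" and e: "e \<in> {1, -1 :: real}"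
    and A: "\<bar>Re \<alpha>\<bar> < real M + 1/2" and B: "\<bar>Re \<beta>\<bar> < real M' + 1/2"
    and S: "Re (2 * \<nu> + \<alpha> + \<beta>) + 1 > real (M + M')"
  defines "\<sigma> \<equiv> 2 * \<nu> + \<alpha> + \<beta>"
  shows "((\<lambda>\<eta>. jacobi_Q \<nu> \<alpha> \<beta> (of_real (cos (2 * \<zeta>)) + \<i> * of_real (e * \<eta>))) \<longlongrightarrow>
     exp (- \<i> * of_real e * theta2 \<sigma> \<alpha> \<zeta>) * Jcut \<sigma> \<alpha> \<beta> \<zeta> (- e) /
     (2 * Jconst \<nu> \<alpha> \<beta> * cpow (sin \<zeta>) (\<alpha> + 1/2) * cpow (cos \<zeta>) (\<beta> + 1/2))) (at_right 0)"
proof -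
  note pos = params_pos[OF A B S]
  have sc: "sin \<zeta> > 0" "cos \<zeta> > 0" using z by (auto intro!: sin_gt_zero cos_gt_zero)
  define zz where "zz = (\<lambda>\<eta>. of_real (cos (2 * \<zeta>)) + \<i> * complex_of_real (e * \<eta>))"
  define x where "x = (\<lambda>\<eta>. 2 / (1 - zz \<eta>))"
  define L where "L = Jcut \<sigma> \<alpha> \<beta> \<zeta> (- e) / (Jconst \<nu> \<alpha> \<beta> *
     (cpow (cos \<zeta>) (1/2 - \<beta>) * exp (\<i> * of_real (- e) * of_real \<zeta> * (1/2 - \<beta>))) *
     (cpow (sin \<zeta>) (- \<alpha> - 2 * \<nu> - 3/2) * exp (\<i> * of_real (- e) * of_real (\<zeta> - pi / 2) * (- \<alpha> - 2 * \<nu> - 3/2))))"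
  have lim: "((\<lambda>\<eta>. Eint (\<nu> + 1) (\<nu> + \<alpha> + 1) (\<sigma> + 2) (x \<eta>)) \<longlongrightarrow> L) (at_right 0)"
    and slit: "\<And>\<eta>. 0 < \<eta> \<Longrightarrow> x \<eta> \<in> hyp_slit_plane"
    using Eint_cut_limit[OF z e A B S] unfolding x_def L_def zz_def \<sigma>_def by blast+
  \<comment> \<open>The prefactor with Ln (z - 1) replaced by Ln (1 - z) + i e \<pi>, to which it is
    equal on the side e; in this form it is continuous at \<eta> = 0.\<close>
  define F where "F = (\<lambda>\<eta>. 2 powr (\<nu> + \<alpha> + \<beta>) / (exp ((\<nu> + \<alpha> + 1) * (Ln (1 - zz \<eta>) + \<i> * of_real (e * pi))) * (zz \<eta> + 1) powr \<beta>))"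
  have zz0: "zz 0 = of_real (cos (2 * \<zeta>))" "1 - zz 0 = of_real (2 * (sin \<zeta>)\<^sup>2)" "1 + zz 0 = of_real (2 * (cos \<zeta>)\<^sup>2)"
  proof -
    show "zz 0 = of_real (cos (2 * \<zeta>))" by (simp add: zz_def)
    hence "1 - zz 0 = of_real (1 - cos (2 * \<zeta>))" "1 + zz 0 = of_real (1 + cos (2 * \<zeta>))" by simp_all
    moreover have "1 - cos (2 * \<zeta>) = 2 * (sin \<zeta>)\<^sup>2" by (simp add: cos_double_sin)
    moreover have "1 + cos (2 * \<zeta>) = 2 * (cos \<zeta>)\<^sup>2" by (simp add: cos_double_cos)
    ultimately show "1 - zz 0 = of_real (2 * (sin \<zeta>)\<^sup>2)" "1 + zz 0 = of_real (2 * (cos \<zeta>)\<^sup>2)" by simp_all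
  qed
  have F0: "F 0 * L = exp (- \<i> * of_real e * theta2 \<sigma> \<alpha> \<zeta>) * Jcut \<sigma> \<alpha> \<beta> \<zeta> (- e) /
     (2 * Jconst \<nu> \<alpha> \<beta> * cpow (sin \<zeta>) (\<alpha> + 1/2) * cpow (cos \<zeta>) (\<beta> + 1/2))"
  proof -
    let ?c = "\<nu> + \<alpha> + 1" and ?d = "- \<alpha> - 2 * \<nu> - 3/2"
    have a1: "exp (?c * (Ln (1 - zz 0) + \<i> * of_real (e * pi))) = cpow 2 ?c * cpow (sin \<zeta>) (2 * ?c) * exp (\<i> * of_real e * (of_real pi * ?c))"
    proof -
      have "Ln (1 - zz 0) = of_real (ln (2 * (sin \<zeta>)\<^sup>2))"
        unfolding zz0(2,3) using sc by (intro Ln_of_real) auto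
      also have "ln (2 * (sin \<zeta>)\<^sup>2) = ln 2 + 2 * ln (sin \<zeta>)" using sc by (simp add: ln_mult ln_realpow)
      finally have "Ln (1 - zz 0) = of_real (ln 2 + 2 * ln (sin \<zeta>))" .
      thus ?thesis by (simp add: cpow_def exp_add[symmetric] algebra_simps)
    qed
    have a2: "(zz 0 + 1) powr \<beta> = cpow 2 \<beta> * cpow (cos \<zeta>) (2 * \<beta>)"
    proof -
      have "(zz 0 + 1) powr \<beta> = cpow (2 * (cos \<zeta>)\<^sup>2) \<beta>"
        using zz0(3) sc by (subst cpow_powr) (auto simp: add.commute)
      also have "\<dots> = cpow 2 \<beta> * cpow (cos \<zeta>) (2 * \<beta>)" using sc by (simp add: cpow_def ln_mult ln_realpow exp_add[symmetric] algebra_simps)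
      finally show ?thesis .
    qed
    have a3: "2 powr (\<nu> + \<alpha> + \<beta>) = cpow 2 (\<nu> + \<alpha> + \<beta>)" using cpow_powr[of 2] by simp
    have "F 0 * L = Jcut \<sigma> \<alpha> \<beta> \<zeta> (- e) / Jconst \<nu> \<alpha> \<beta> *
        (cpow 2 (\<nu> + \<alpha> + \<beta>) / (cpow 2 ?c * cpow 2 \<beta>)) *
        (1 / (cpow (sin \<zeta>) (2 * ?c) * cpow (sin \<zeta>) ?d)) * (1 / (cpow (cos \<zeta>) (2 * \<beta>) * cpow (cos \<zeta>) (1/2 - \<beta>))) *
        (1 / (exp (\<i> * of_real e * (of_real pi * ?c)) * exp (\<i> * of_real (- e) * of_real \<zeta> * (1/2 - \<beta>)) * exp (\<i> * of_real (- e) * of_real (\<zeta> - pi / 2) * ?d)))"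
      unfolding F_def L_def a1 a2 a3 by (simp add: mult_ac)
    also have "cpow 2 (\<nu> + \<alpha> + \<beta>) / (cpow 2 ?c * cpow 2 \<beta>) = 1/2"
      unfolding cpow_add[symmetric] cpow_diff[symmetric] using cpow_minus[of 2 1] by simp
    also have "cpow (sin \<zeta>) (2 * ?c) * cpow (sin \<zeta>) ?d = cpow (sin \<zeta>) (\<alpha> + 1/2)"
      unfolding cpow_add[symmetric] by (rule arg_cong[of _ _ "cpow _"]) (simp add: algebra_simps)
    also have "cpow (cos \<zeta>) (2 * \<beta>) * cpow (cos \<zeta>) (1/2 - \<beta>) = cpow (cos \<zeta>) (\<beta> + 1/2)"
      unfolding cpow_add[symmetric] by (rule arg_cong[of _ _ "cpow _"]) (simp add: algebra_simps)
    also have "exp (\<i> * of_real e * (of_real pi * ?c)) * exp (\<i> * of_real (- e) * of_real \<zeta> * (1/2 - \<beta>)) * exp (\<i> * of_real (- e) * of_real (\<zeta> - pi / 2) * ?d) =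
        exp (\<i> * of_real e * theta2 \<sigma> \<alpha> \<zeta>)"
      unfolding exp_add[symmetric] by (rule arg_cong[of _ _ exp]) (simp add: theta2_def \<sigma>_def field_simps)
    finally show ?thesis by (simp add: exp_minus field_simps)
  qed
  have contz: "isCont zz 0" unfolding zz_def by (intro continuous_intros)
  have nn: "1 - zz 0 \<notin> \<real>\<^sub>\<le>\<^sub>0" "zz 0 + 1 \<notin> \<real>\<^sub>\<le>\<^sub>0"
  proof -
    show "1 - zz 0 \<notin> \<real>\<^sub>\<le>\<^sub>0" unfolding zz0(2,3) nonpos_Reals_of_real_iff using sc by simp
    show "zz 0 + 1 \<notin> \<real>\<^sub>\<le>\<^sub>0" unfolding add.commute[of "zz 0" 1] zz0(3) nonpos_Reals_of_real_iff using sc by simp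
  qed
  have c1: "isCont (\<lambda>\<eta>. exp ((\<nu> + \<alpha> + 1) * (Ln (1 - zz \<eta>) + \<i> * of_real (e * pi)))) 0"
  proof -
    have "isCont (\<lambda>\<eta>. Ln (1 - zz \<eta>)) 0"
      by (rule isCont_o2[OF isCont_diff[OF continuous_const contz] continuous_at_Ln[OF nn(1)]])
    hence "isCont (\<lambda>\<eta>. (\<nu> + \<alpha> + 1) * (Ln (1 - zz \<eta>) + \<i> * of_real (e * pi))) 0"
      by (intro isCont_mult isCont_add continuous_const)
    thus ?thesis by (rule isCont_exp')
  qed
  have c2: "isCont (\<lambda>\<eta>. (zz \<eta> + 1) powr \<beta>) 0"
    by (intro isCont_powr_complex isCont_add continuous_const contz nn)
  have "zz 0 + 1 \<noteq> 0" using nn(2) by auto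
  hence "isCont F 0"
    unfolding F_def by (intro isCont_mult isCont_divide continuous_const c1 c2) (simp add: powr_def)
  hence "(F \<longlongrightarrow> F 0) (at_right 0)" by (simp add: isCont_def filterlim_at_split)
  hence "((\<lambda>\<eta>. F \<eta> * Eint (\<nu> + 1) (\<nu> + \<alpha> + 1) (\<sigma> + 2) (x \<eta>)) \<longlongrightarrow> F 0 * L) (at_right 0)"
    by (intro tendsto_mult lim)
  moreover have "\<forall>\<^sub>F \<eta> in at_right 0. F \<eta> * Eint (\<nu> + 1) (\<nu> + \<alpha> + 1) (\<sigma> + 2) (x \<eta>) = jacobi_Q \<nu> \<alpha> \<beta> (zz \<eta>)"
    unfolding eventually_at_right_field
  proof (intro exI[of _ 1] conjI allI impI)
    fix \<eta> :: real assume h: "0 < \<eta>" "\<eta> < 1"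
    have Imz: "Im (zz \<eta>) = e * \<eta>" by (simp add: zz_def)
    have z1: "zz \<eta> \<noteq> 1" "1 - zz \<eta> \<noteq> 0" using Imz h e by (auto simp: complex_eq_iff)
    have pw: "(zz \<eta> - 1) powr c = exp (c * (Ln (1 - zz \<eta>) + \<i> * of_real (e * pi)))" for c
    proof -
      have "Ln (- (1 - zz \<eta>)) = Ln (1 - zz \<eta>) + \<i> * of_real (e * pi)"
        using Ln_minus[OF z1(2)] Imz h e by auto
      thus ?thesis using z1 by (simp add: powr_def)
    qed
    have cb: "(\<sigma> + 2) - (\<nu> + \<alpha> + 1) = \<nu> + \<beta> + 1" by (simp add: \<sigma>_def)
    have "hypergeo_reg (\<nu> + 1) (\<nu> + \<alpha> + 1) (\<sigma> + 2) (x \<eta>) =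
       rGamma (\<nu> + \<alpha> + 1) * rGamma (\<nu> + \<beta> + 1) * Eint (\<nu> + 1) (\<nu> + \<alpha> + 1) (\<sigma> + 2) (x \<eta>)"
      using hypergeo_reg_Eint[of "\<nu> + \<alpha> + 1" "\<sigma> + 2", unfolded cb] pos(2,3) slit[OF h(1)] by blast
    moreover have "Gamma (\<nu> + \<alpha> + 1) \<noteq> 0" "Gamma (\<nu> + \<beta> + 1) \<noteq> 0" using pos by (auto intro!: Gamma_Re_pos_nonzero)
    ultimately have "jacobi_Q \<nu> \<alpha> \<beta> (zz \<eta>) = 2 powr (\<nu> + \<alpha> + \<beta>) / ((zz \<eta> - 1) powr (\<nu> + \<alpha> + 1) * (zz \<eta> + 1) powr \<beta>) *
       Eint (\<nu> + 1) (\<nu> + \<alpha> + 1) (\<sigma> + 2) (x \<eta>)"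
      unfolding jacobi_Q_def x_def \<sigma>_def by (simp add: rGamma_inverse_Gamma field_simps)
    thus "F \<eta> * Eint (\<nu> + 1) (\<nu> + \<alpha> + 1) (\<sigma> + 2) (x \<eta>) = jacobi_Q \<nu> \<alpha> \<beta> (zz \<eta>)" unfolding F_def pw by simp
  qed simp
  ultimately have "((\<lambda>\<eta>. jacobi_Q \<nu> \<alpha> \<beta> (zz \<eta>)) \<longlongrightarrow> F 0 * L) (at_right 0)" by (rule Lim_transform_eventually)
  thus ?thesis unfolding F0 by (simp only: zz_def)
qed

section \<open>Euler's integral across its branch point\<close>

lemma lpos_subst_left:
  fixes f :: "real \<Rightarrow> 'a::euclidean_space"
  assumes f [measurable]: "f \<in> borel_measurable borel" and t: "t > 0"
  shows "integrable lpos (\<lambda>x. (t / (1 + x)\<^sup>2) *\<^sub>R f (t / (1 + x))) \<longleftrightarrow> integrable lpos (\<lambda>y. indicator {0<..<t} y *\<^sub>R f y)"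
    and "(\<integral>x. (t / (1 + x)\<^sup>2) *\<^sub>R f (t / (1 + x)) \<partial>lpos) = (\<integral>y. indicator {0<..<t} y *\<^sub>R f y \<partial>lpos)"
proof -
  have der: "((\<lambda>x. t / (1 + x)) has_field_derivative - (t / (1 + x)\<^sup>2)) (at x)" if "x > 0" for x
    using that by (auto intro!: derivative_eq_intros simp: power2_eq_square)
  have inj: "inj_on (\<lambda>x. t / (1 + x)) {0<..}" using t by (auto simp: inj_on_def field_simps)
  have img: "(\<lambda>x. t / (1 + x)) ` {0<..} = {0<..<t}"
  proof (intro equalityI subsetI)
    fix y assume "y \<in> {0<..<t}"
    thus "y \<in> (\<lambda>x. t / (1 + x)) ` {0<..}" by (intro image_eqI[of _ _ "t / y - 1"]) (auto simp: field_simps)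
  qed (use t in \<open>auto simp: field_simps\<close>)
  have 1: "\<bar>- (t / (1 + x)\<^sup>2)\<bar> *\<^sub>R f (t / (1 + x)) = (t / (1 + x)\<^sup>2) *\<^sub>R f (t / (1 + x))" for x using t by simp
  note * = lpos_change_of_variables_image[OF f _ _ der inj img, unfolded 1]
  show "integrable lpos (\<lambda>x. (t / (1 + x)\<^sup>2) *\<^sub>R f (t / (1 + x))) \<longleftrightarrow> integrable lpos (\<lambda>y. indicator {0<..<t} y *\<^sub>R f y)"
    by (rule *(1)) auto
  show "(\<integral>x. (t / (1 + x)\<^sup>2) *\<^sub>R f (t / (1 + x)) \<partial>lpos) = (\<integral>y. indicator {0<..<t} y *\<^sub>R f y \<partial>lpos)"
    by (rule *(2)) auto
qed

lemma lpos_subst_right: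
  fixes f :: "real \<Rightarrow> 'a::euclidean_space"
  assumes f [measurable]: "f \<in> borel_measurable borel" and t: "t > 0"
  shows "integrable lpos (\<lambda>x. t *\<^sub>R f (t * (1 + x))) \<longleftrightarrow> integrable lpos (\<lambda>y. indicator {t<..} y *\<^sub>R f y)"
proof -
  have der: "((\<lambda>x. t * (1 + x)) has_field_derivative t) (at x)" for x
    by (auto intro!: derivative_eq_intros)
  have inj: "inj_on (\<lambda>x. t * (1 + x)) {0<..}" using t by (auto simp: inj_on_def)
  have img: "(\<lambda>x. t * (1 + x)) ` {0<..} = {t<..}"
  proof (intro equalityI subsetI)
    fix y assume "y \<in> {t<..}"
    thus "y \<in> (\<lambda>x. t * (1 + x)) ` {0<..}" using t by (intro image_eqI[of _ _ "y / t - 1"]) (auto simp: field_simps)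
  qed (use t in \<open>auto simp: field_simps\<close>)
  have 1: "\<bar>t\<bar> *\<^sub>R f (t * (1 + x)) = t *\<^sub>R f (t * (1 + x))" for x using t by simp
  show ?thesis
    by (rule lpos_change_of_variables_image(1)[OF f _ _ der inj img, unfolded 1]) (use t in auto)
qed

lemma powr_base_between:
  assumes "0 < (l::real)" "l \<le> x" "x \<le> u"
  shows "x powr e \<le> l powr e + u powr e"
proof (cases "e \<ge> 0")
  case True
  hence "x powr e \<le> u powr e" using assms by (intro powr_mono2) auto
  thus ?thesis using powr_ge_zero[of l e] by linarith
next
  case False
  hence "x powr e \<le> l powr e" using assms by (intro powr_mono2') auto
  thus ?thesis using powr_ge_zero[of u e] by linarith
qed

lemma lpos_Beta_real:
  assumes "b > 0" "c > b"
  shows "integrable lpos (\<lambda>k. k powr (b - 1) * (1 + k) powr (- c))"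
proof -
  have "integrable lpos (\<lambda>k. norm (cpow k (of_real b - 1) * cpow (1 + k) (- of_real c)))"
    using assms by (intro integrable_norm lpos_Beta) auto
  thus ?thesis by (rule iffD1[OF lpos_cong_integrable, rotated]) (simp add: norm_mult norm_cpow)
qed

text \<open>Up to constants the modulus of Euler's integrand on the cut; k = t is the branch
  point.\<close>

definition cut_weight :: "real \<Rightarrow> real \<Rightarrow> real \<Rightarrow> real \<Rightarrow> real \<Rightarrow> real" where
  "cut_weight t a b c k = k powr (b - 1) * (1 + k) powr (a - c) * \<bar>t - k\<bar> powr (- a)"

lemma AE_lpos_neq: "AE k in lpos. k \<noteq> t"
  unfolding lpos_def by (subst AE_restrict_space_iff) (auto intro: AE_mp[OF AE_lborel_singleton[of t]])

text \<open>Splitting at t and mapping each part to the half-line leaves beta integrands. The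
  condition a < 1 serves the singularity at t, b > 0 the origin and c > b infinity. In the
  application a = Re \<nu> + 1, which is where Re \<nu> < 0 enters.\<close>

lemma cut_weight_integrable:
  assumes t: "t > 0" and a: "0 < a" "a < 1" and b: "b > 0" and c: "c > b"
  shows "integrable lpos (cut_weight t a b c)"
proof -
  let ?W = "cut_weight t a b c"
  have m [measurable]: "?W \<in> borel_measurable borel" unfolding cut_weight_def by measurable
  have left: "integrable lpos (\<lambda>k. indicator {0<..<t} k *\<^sub>R ?W k)"
  proof (subst lpos_subst_left(1)[OF m t, symmetric], rule Bochner_Integration.integrable_bound)
    \<comment> \<open>The factor 1 + t / (1 + x) lies between 1 and 1 + t; adding the two end values
      bounds its power whatever the sign of the exponent.\<close>
    define K where "K = t powr (b - a) * (1 powr (a - c) + (1 + t) powr (a - c))"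
    show "integrable lpos (\<lambda>x. K * (x powr ((1 - a) - 1) * (1 + x) powr (- (b + 1 - a))))"
      by (intro integrable_mult_right lpos_Beta_real) (use a b in auto)
    show "AE x in lpos. norm ((t / (1 + x)\<^sup>2) *\<^sub>R ?W (t / (1 + x))) \<le> norm (K * (x powr ((1 - a) - 1) * (1 + x) powr (- (b + 1 - a))))"
    proof (rule AE_I2)
      fix x :: real assume "x \<in> space lpos"
      hence x: "x > 0" by simp
      have 1: "(1 + t / (1 + x)) powr (a - c) \<le> 1 powr (a - c) + (1 + t) powr (a - c)"
        using t x by (intro powr_base_between) (auto simp: field_simps)
      have "t - t / (1 + x) = t * (x / (1 + x))" using x by (simp add: field_simps)
      hence 2: "\<bar>t - t / (1 + x)\<bar> powr (- a) = t powr (- a) * (x powr (- a) * (1 + x) powr a)"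
        using t x by (simp add: powr_mult powr_divide powr_minus field_simps abs_mult)
      have 3: "(t / (1 + x)) powr (b - 1) = t powr (b - 1) * (1 + x) powr (1 - b)"
        using t x powr_minus[of "1 + x" "b - 1"] by (simp add: powr_divide field_simps)
      have "t / (1 + x)\<^sup>2 = t powr 1 * (1 + x) powr (-2)"
        using t x powr_minus[of "1 + x" 2] by (simp add: divide_inverse)
      hence "(t / (1 + x)\<^sup>2) * ?W (t / (1 + x)) = (t powr 1 * t powr (b - 1) * t powr (- a)) *
          (1 + t / (1 + x)) powr (a - c) * (x powr (- a) * ((1 + x) powr (-2) * (1 + x) powr (1 - b) * (1 + x) powr a))"
        unfolding cut_weight_def 2 3 by (simp only: mult_ac)
      also have "t powr 1 * t powr (b - 1) * t powr (- a) = t powr (b - a)" by (simp only: powr_add[symmetric]) simp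
      also have "(1 + x) powr (-2) * (1 + x) powr (1 - b) * (1 + x) powr a = (1 + x) powr (- (b + 1 - a))"
        by (simp only: powr_add[symmetric]) (simp add: algebra_simps)
      also have "t powr (b - a) * (1 + t / (1 + x)) powr (a - c) * (x powr (- a) * (1 + x) powr (- (b + 1 - a))) \<le>
        K * (x powr (- a) * (1 + x) powr (- (b + 1 - a)))"
        unfolding K_def using 1 by (intro mult_right_mono mult_left_mono) auto
      finally have "(t / (1 + x)\<^sup>2) * ?W (t / (1 + x)) \<le> K * (x powr (- a) * (1 + x) powr (- (b + 1 - a)))" .
      moreover have "(t / (1 + x)\<^sup>2) * ?W (t / (1 + x)) \<ge> 0" using t by (simp add: cut_weight_def)
      ultimately show "norm ((t / (1 + x)\<^sup>2) *\<^sub>R ?W (t / (1 + x))) \<le> norm (K * (x powr ((1 - a) - 1) * (1 + x) powr (- (b + 1 - a))))"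
        by simp
    qed
  qed (intro lpos_measurableI, measurable)
  have right: "integrable lpos (\<lambda>k. indicator {t<..} k *\<^sub>R ?W k)"
  proof (subst lpos_subst_right[OF m t, symmetric], rule Bochner_Integration.integrable_bound)
    define K where "K = t powr (b - a) * (t powr (a - c) + (1 + t) powr (a - c))"
    show "integrable lpos (\<lambda>x. K * (x powr ((1 - a) - 1) * (1 + x) powr (- (c - a - b + 1))))"
      by (intro integrable_mult_right lpos_Beta_real) (use a b c in auto)
    show "AE x in lpos. norm (t *\<^sub>R ?W (t * (1 + x))) \<le> norm (K * (x powr ((1 - a) - 1) * (1 + x) powr (- (c - a - b + 1))))"
    proof (rule AE_I2)
      fix x :: real assume "x \<in> space lpos"
      hence x: "x > 0" by simp
      have "((1 + t * (1 + x)) / (1 + x)) powr (a - c) \<le> t powr (a - c) + (1 + t) powr (a - c)"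
        using t x by (intro powr_base_between) (auto simp: field_simps)
      moreover have "(1 + t * (1 + x)) powr (a - c) = ((1 + t * (1 + x)) / (1 + x)) powr (a - c) * (1 + x) powr (a - c)"
        using t x by (simp add: powr_divide add_pos_pos)
      ultimately have 1: "(1 + t * (1 + x)) powr (a - c) \<le> (t powr (a - c) + (1 + t) powr (a - c)) * (1 + x) powr (a - c)"
        by (simp add: mult_right_mono)
      have "\<bar>t - t * (1 + x)\<bar> = t * x" using t x by (simp add: algebra_simps)
      hence 2: "\<bar>t - t * (1 + x)\<bar> powr (- a) = t powr (- a) * x powr (- a)" using t x by (simp add: powr_mult)
      have 3: "(t * (1 + x)) powr (b - 1) = t powr (b - 1) * (1 + x) powr (b - 1)" using t x by (simp add: powr_mult)
      have "t = t powr 1" using t by simp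
      hence "t * ?W (t * (1 + x)) = (t powr 1 * t powr (b - 1) * t powr (- a)) *
          (1 + t * (1 + x)) powr (a - c) * (x powr (- a) * (1 + x) powr (b - 1))"
        unfolding cut_weight_def 2 3 by (simp only: mult_ac)
      also have "t powr 1 * t powr (b - 1) * t powr (- a) = t powr (b - a)" by (simp only: powr_add[symmetric]) simp
      also have "t powr (b - a) * (1 + t * (1 + x)) powr (a - c) * (x powr (- a) * (1 + x) powr (b - 1)) \<le>
        t powr (b - a) * ((t powr (a - c) + (1 + t) powr (a - c)) * (1 + x) powr (a - c)) * (x powr (- a) * (1 + x) powr (b - 1))"
        using 1 by (intro mult_right_mono mult_left_mono) auto
      also have "\<dots> = K * (x powr (- a) * ((1 + x) powr (a - c) * (1 + x) powr (b - 1)))" unfolding K_def by (simp only: mult_ac)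
      also have "(1 + x) powr (a - c) * (1 + x) powr (b - 1) = (1 + x) powr (- (c - a - b + 1))"
        by (simp only: powr_add[symmetric]) (simp add: algebra_simps)
      finally have "t * ?W (t * (1 + x)) \<le> K * (x powr (- a) * (1 + x) powr (- (c - a - b + 1)))" .
      moreover have "t * ?W (t * (1 + x)) \<ge> 0" using t by (simp add: cut_weight_def)
      ultimately show "norm (t *\<^sub>R ?W (t * (1 + x))) \<le> norm (K * (x powr ((1 - a) - 1) * (1 + x) powr (- (c - a - b + 1))))"
        by simp
    qed
  qed (intro lpos_measurableI, measurable)
  have "integrable lpos (\<lambda>k. indicator {0<..<t} k *\<^sub>R ?W k + indicator {t<..} k *\<^sub>R ?W k)"
    using left right by (rule Bochner_Integration.integrable_add)
  thus ?thesis
  proof (rule integrable_cong_AE_imp)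
    show "AE k in lpos. indicator {0<..<t} k *\<^sub>R ?W k + indicator {t<..} k *\<^sub>R ?W k = ?W k"
      using AE_lpos_neq[of t] AE_space by eventually_elim (auto simp: indicator_def)
  qed (intro lpos_measurableI m)
qed

lemma norm_powr_le:
  assumes "w \<noteq> 0"
  shows "norm (w powr (- a)) \<le> norm w powr (- Re a) * exp (pi * \<bar>Im a\<bar>)"
proof -
  have "norm (w powr (- a)) = exp (- Re a * ln (norm w) + Im a * Im (Ln w))"
    using assms by (simp add: powr_def norm_exp_eq_Re)
  also have "\<dots> = norm w powr (- Re a) * exp (Im a * Im (Ln w))" using assms by (simp add: powr_def mult_exp_exp)
  also have "\<dots> \<le> norm w powr (- Re a) * exp (pi * \<bar>Im a\<bar>)"
  proof -
    have "\<bar>Im (Ln w)\<bar> \<le> pi" using Im_Ln_le_pi[OF assms] mpi_less_Im_Ln[OF assms] by linarith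
    hence "\<bar>Im a\<bar> * \<bar>Im (Ln w)\<bar> \<le> \<bar>Im a\<bar> * pi" by (intro mult_left_mono) auto
    hence "Im a * Im (Ln w) \<le> pi * \<bar>Im a\<bar>" by (metis abs_ge_self abs_mult mult.commute order_trans)
    thus ?thesis by (intro mult_left_mono) auto
  qed
  finally show ?thesis .
qed

text \<open>Pointwise limit of Euler's integrand when the cut is approached from side e. Beyond the
  branch point the base is negative, and its power acquires the phase e^(i e \<pi> a). The value 0
  at k = t concerns a null set.\<close>

definition cutlim :: "complex \<Rightarrow> complex \<Rightarrow> complex \<Rightarrow> real \<Rightarrow> real \<Rightarrow> real \<Rightarrow> complex" where
  "cutlim a b c t e k = indicator (- {t}) k *\<^sub>R (cpow k (b - 1) * cpow (1 + k) (- c) *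
     (cpow (\<bar>t - k\<bar> / (t * (1 + k))) (- a) * (if k < t then 1 else exp (\<i> * of_real e * of_real pi * a))))"

lemma cutlim_integrable:
  assumes t: "t > 0" and a: "0 < Re a" "Re a < 1" and b: "Re b > 0" and cb: "Re (c - b) > 0"
  shows "integrable lpos (cutlim a b c t e)"
proof (rule Bochner_Integration.integrable_bound)
  define K where "K = t powr (Re a) * (1 + norm (exp (\<i> * of_real e * of_real pi * a)))"
  show "integrable lpos (\<lambda>k. K * cut_weight t (Re a) (Re b) (Re c) k)"
    by (intro integrable_mult_right cut_weight_integrable t a b) (use cb in simp)
  show "cutlim a b c t e \<in> borel_measurable lpos"
    unfolding cutlim_def by (intro lpos_measurableI) measurable
  show "AE k in lpos. norm (cutlim a b c t e k) \<le> norm (K * cut_weight t (Re a) (Re b) (Re c) k)"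
  proof (rule AE_I2)
    fix k assume "k \<in> space lpos"
    hence k: "k > 0" by simp
    show "norm (cutlim a b c t e k) \<le> norm (K * cut_weight t (Re a) (Re b) (Re c) k)"
    proof (cases "k = t")
      case False
      let ?E = "norm (if k < t then 1 else exp (\<i> * of_real e * of_real pi * a))"
      have pos: "\<bar>t - k\<bar> / (t * (1 + k)) > 0" using False k t by simp
      have "(\<bar>t - k\<bar> / (t * (1 + k))) powr (- Re a) = t powr Re a * (1 + k) powr Re a * \<bar>t - k\<bar> powr (- Re a)"
      proof -
        have "(x / (t * u)) powr (- r) = t powr r * u powr r * x powr (- r)" if "u > 0" "x \<ge> 0" for x u r :: real
          using that t by (simp add: powr_divide powr_mult powr_minus field_simps)
        from this[of "1 + k" "\<bar>t - k\<bar>"] show ?thesis using k by simp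
      qed
      moreover have "(1 + k) powr (Re a - Re c) = (1 + k) powr Re a * (1 + k) powr (- Re c)"
        by (simp only: powr_add[symmetric]) simp
      ultimately have "norm (cutlim a b c t e k) = t powr Re a * ?E * cut_weight t (Re a) (Re b) (Re c) k"
        using False k pos by (simp add: cutlim_def cut_weight_def norm_mult norm_cpow)
      also have "\<dots> \<le> K * cut_weight t (Re a) (Re b) (Re c) k"
        unfolding K_def by (intro mult_right_mono mult_left_mono) (auto simp: cut_weight_def)
      finally show ?thesis by simp
    qed (simp add: cutlim_def)
  qed
qed

lemma Eint_cut_integral:
  assumes z: "0 < \<zeta>" "\<zeta> < pi / 2" and e: "e \<in> {1, -1 :: real}"
    and a: "0 < Re a" "Re a < 1" and b: "Re b > 0" and cb: "Re (c - b) > 0"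
  defines "x \<equiv> (\<lambda>\<eta>. 2 / (1 - (of_real (cos (2 * \<zeta>)) + \<i> * of_real (e * \<eta>))))"
  assumes slit: "\<And>\<eta>. 0 < \<eta> \<Longrightarrow> x \<eta> \<in> hyp_slit_plane"
  shows "((\<lambda>\<eta>. Eint a b c (x \<eta>)) \<longlongrightarrow> integral\<^sup>L lpos (cutlim a b c ((tan \<zeta>)\<^sup>2) e)) (at_right 0)"
proof -
  have sc: "sin \<zeta> > 0" "cos \<zeta> > 0" using z by (auto intro!: sin_gt_zero cos_gt_zero)
  define t where "t = (tan \<zeta>)\<^sup>2"
  define X where "X = (sin \<zeta>)\<^sup>2"
  define C where "C = (cos \<zeta>)\<^sup>2"
  have XC: "X > 0" "C > 0" "X + C = 1" "X = C * t" "t > 0"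
    using sc by (auto simp: X_def C_def t_def tan_def power_divide)
  define zz where "zz = (\<lambda>\<eta>. of_real (cos (2 * \<zeta>)) + \<i> * complex_of_real (e * \<eta>))"
  have xz: "x \<eta> = 2 / (1 - zz \<eta>)" for \<eta> by (simp add: x_def zz_def)
  have Re1z: "Re (1 - zz \<eta>) = 2 * X" and Im1z: "Im (1 - zz \<eta>) = - (e * \<eta>)" for \<eta>
    by (simp_all add: zz_def X_def cos_double_sin)
  have nz: "1 - zz \<eta> \<noteq> 0" for \<eta> using Re1z[of \<eta>] XC by auto
  define w where "w = (\<lambda>k \<eta>. 1 - x \<eta> * of_real (k / (1 + k)))"
  have w_eq: "w k \<eta> = (1 - zz \<eta> - 2 * of_real (k / (1 + k))) / (1 - zz \<eta>)" for k \<eta>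
  proof -
    have "1 - 2 / Z * Y = (Z - 2 * Y) / Z" if "Z \<noteq> 0" for Z Y :: complex using that by (simp add: field_simps)
    from this[OF nz] show ?thesis unfolding w_def xz .
  qed
  have Xy: "2 * X - 2 * (k / (1 + k)) = 2 * C * (t - k) / (1 + k)" if "k > 0" for k
  proof -
    have "(2 * X - 2 * (k / (1 + k))) * (1 + k) = 2 * X + 2 * X * k - 2 * k" using that by (simp add: field_simps)
    also have "\<dots> = 2 * C * (t - k)"
    proof -
      have "X = 1 - C" using XC(3) by simp
      hence "X * k = k - C * k" by (simp add: left_diff_distrib)
      moreover have "2 * X + 2 * X * k - 2 * k = 2 * X + 2 * (X * k) - 2 * k" by simp
      ultimately show ?thesis using XC(4) by (simp add: right_diff_distrib)
    qed
    finally have E: "(2 * X - 2 * (k / (1 + k))) * (1 + k) = 2 * C * (t - k)" .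
    have "2 * X - 2 * (k / (1 + k)) = (2 * X - 2 * (k / (1 + k))) * (1 + k) / (1 + k)" using that by simp
    thus ?thesis unfolding E .
  qed
  have w0: "w k 0 = of_real ((t - k) / (t * (1 + k)))" if k: "k > 0" for k
  proof -
    have "1 - zz 0 = of_real (2 * X)" using Re1z[of 0] Im1z[of 0] by (simp add: complex_eq_iff)
    hence "w k 0 = of_real ((2 * X - 2 * (k / (1 + k))) / (2 * X))" unfolding w_eq by simp
    also have "(2 * X - 2 * (k / (1 + k))) / (2 * X) = (t - k) / (t * (1 + k))"
      unfolding Xy[OF k] using XC k by simp
    finally show ?thesis .
  qed
  have contw: "isCont (w k) 0" for k
    unfolding w_def xz zz_def using nz[of 0] by (intro continuous_intros) (simp add: zz_def)
  define f where "f = (\<lambda>\<eta> k. indicator (- {t}) k *\<^sub>R (cpow k (b - 1) * cpow (1 + k) (- c) * (1 - x \<eta> * of_real (k / (1 + k))) powr (- a)))"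
  have f_lim: "((\<lambda>\<eta>. f \<eta> k) \<longlongrightarrow> cutlim a b c t e k) (at_right 0)" if k: "k > 0" for k
  proof (cases "k = t")
    case True
    thus ?thesis by (simp add: f_def cutlim_def)
  next
    case False
    have w1: "\<bar>t - k\<bar> / (t * (1 + k)) > 0" using False XC k by simp
    have "((\<lambda>\<eta>. w k \<eta> powr (- a)) \<longlongrightarrow> cpow (\<bar>t - k\<bar> / (t * (1 + k))) (- a) * (if k < t then 1 else exp (\<i> * of_real e * of_real pi * a))) (at_right 0)"
    proof (cases "k < t")
      case True
      hence "w k 0 = of_real (\<bar>t - k\<bar> / (t * (1 + k)))" using w0[OF k] by simp
      moreover from this w1 have "w k 0 \<notin> \<real>\<^sub>\<le>\<^sub>0" by (simp only: nonpos_Reals_of_real_iff not_le)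
      hence "isCont (\<lambda>\<eta>. w k \<eta> powr (- a)) 0" by (intro isCont_powr_complex contw continuous_const)
      ultimately show ?thesis using True w1 by (simp only: cpow_powr if_True mult_1_right) (simp add: isCont_def filterlim_at_split)
    next
      case kt: False
      \<comment> \<open>The limit of w lies on the branch cut of the logarithm, that of -w on the
        positive axis; the sign of Im v decides between the two shifts by \<pi>.\<close>
      define v where "v = (\<lambda>\<eta>. - w k \<eta>)"
      have v0: "v 0 = of_real (\<bar>t - k\<bar> / (t * (1 + k)))" unfolding v_def w0[OF k] of_real_minus[symmetric] using kt by (simp add: abs_if minus_divide_left)
      have "v 0 \<notin> \<real>\<^sub>\<le>\<^sub>0" unfolding v0 nonpos_Reals_of_real_iff not_le by (rule w1)
      hence "isCont (\<lambda>\<eta>. v \<eta> powr (- a)) 0" unfolding v_def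
        by (intro isCont_powr_complex isCont_minus contw continuous_const) (simp add: v_def)
      hence "((\<lambda>\<eta>. v \<eta> powr (- a)) \<longlongrightarrow> cpow (\<bar>t - k\<bar> / (t * (1 + k))) (- a)) (at_right 0)"
        using w1 by (simp only: cpow_powr v0[symmetric]) (simp add: isCont_def filterlim_at_split)
      hence "((\<lambda>\<eta>. v \<eta> powr (- a) * exp (\<i> * of_real e * of_real pi * a)) \<longlongrightarrow> cpow (\<bar>t - k\<bar> / (t * (1 + k))) (- a) * exp (\<i> * of_real e * of_real pi * a)) (at_right 0)"
        by (intro tendsto_intros)
      moreover have "\<forall>\<^sub>F \<eta> in at_right 0. v \<eta> powr (- a) * exp (\<i> * of_real e * of_real pi * a) = w k \<eta> powr (- a)"
        unfolding eventually_at_right_field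
      proof (intro exI[of _ 1] conjI allI impI)
        fix \<eta> :: real assume h: "0 < \<eta>" "\<eta> < 1"
        have "x \<eta> = 2 * cnj (1 - zz \<eta>) / of_real ((norm (1 - zz \<eta>))\<^sup>2)"
          unfolding xz by (subst complex_div_cnj) simp
        hence "Im (x \<eta>) = Im (2 * cnj (1 - zz \<eta>)) / (norm (1 - zz \<eta>))\<^sup>2" by (simp only: Im_divide_of_real)
        also have "Im (2 * cnj (1 - zz \<eta>)) = 2 * (e * \<eta>)" using Im1z[of \<eta>] by simp
        finally have Imx: "Im (x \<eta>) = 2 * (e * \<eta>) / (norm (1 - zz \<eta>))\<^sup>2" .
        have "Im (v \<eta>) = Im (x \<eta>) * (k / (1 + k))" by (simp add: v_def w_def)
        hence "e * Im (v \<eta>) = (e * e) * (2 * \<eta> / (norm (1 - zz \<eta>))\<^sup>2 * (k / (1 + k)))" unfolding Imx by simp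
        also have "e * e = 1" using e by auto
        also have "1 * (2 * \<eta> / (norm (1 - zz \<eta>))\<^sup>2 * (k / (1 + k))) > 0" using h k nz[of \<eta>] by simp
        finally have Imv: "e * Im (v \<eta>) > 0" .
        hence v: "v \<eta> \<noteq> 0" by auto
        have "Ln (- v \<eta>) = Ln (v \<eta>) - \<i> * of_real (e * pi)"
          using Ln_minus[OF v] Imv e by auto
        moreover have "w k \<eta> = - v \<eta>" by (simp add: v_def)
        ultimately have L: "w k \<eta> powr (- a) = exp (- a * (Ln (v \<eta>) - \<i> * of_real (e * pi)))"
          using v by (simp only: powr_def neg_equal_0_iff_equal if_False)
        show "v \<eta> powr (- a) * exp (\<i> * of_real e * of_real pi * a) = w k \<eta> powr (- a)"
          unfolding L using v by (simp add: powr_def mult_exp_exp right_diff_distrib mult_ac)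
      qed simp
      ultimately have "((\<lambda>\<eta>. w k \<eta> powr (- a)) \<longlongrightarrow> cpow (\<bar>t - k\<bar> / (t * (1 + k))) (- a) * exp (\<i> * of_real e * of_real pi * a)) (at_right 0)"
        by (rule Lim_transform_eventually)
      thus ?thesis using kt by (simp only: if_False)
    qed
    thus ?thesis unfolding f_def cutlim_def w_def by (intro tendsto_scaleR tendsto_const tendsto_mult)
  qed
  \<comment> \<open>For \<eta> < 1 the modulus of 1 - z is at most 3, a bound needed for a majorant
    uniform in \<eta>.\<close>
  have at: "at_right (0::real) = at 0 within {0<..<1}"
    by (rule at_within_nhd[of _ "{..<1}"]) auto
  define K where "K = (2 * C / 3) powr (- Re a) * exp (pi * \<bar>Im a\<bar>)"
  have "((\<lambda>\<eta>. integral\<^sup>L lpos (f \<eta>)) \<longlongrightarrow> integral\<^sup>L lpos (cutlim a b c t e)) (at 0 within {0<..<1})"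
  proof (rule integral_tendsto_dominated(1))
    show "((\<lambda>\<eta>. f \<eta> k) \<longlongrightarrow> cutlim a b c t e k) (at 0 within {0<..<1})" if "k \<in> space lpos" for k
      using f_lim that unfolding at by simp
    show "f \<eta> \<in> borel_measurable lpos" if "\<eta> \<in> {0<..<1}" for \<eta>
      unfolding f_def using that slit[of \<eta>]
      by (intro borel_measurable_scaleR Eint_kernel_measurable lpos_measurableI borel_measurable_indicator) auto
    show "integrable lpos (\<lambda>k. K * cut_weight t (Re a) (Re b) (Re c) k)"
      by (intro integrable_mult_right cut_weight_integrable XC a b) (use cb in simp)
    show "norm (f \<eta> k) \<le> K * cut_weight t (Re a) (Re b) (Re c) k" if h: "\<eta> \<in> {0<..<1}" and "k \<in> space lpos" for \<eta> k
    proof (cases "k = t")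
      case True
      thus ?thesis by (simp add: f_def cut_weight_def K_def)
    next
      case False
      have k: "k > 0" using that by simp
      have "norm (1 - zz \<eta>) \<le> \<bar>Re (1 - zz \<eta>)\<bar> + \<bar>Im (1 - zz \<eta>)\<bar>" by (rule cmod_le)
      also have "\<dots> \<le> 3" unfolding Re1z Im1z using XC h e by auto
      finally have n3: "norm (1 - zz \<eta>) \<le> 3" .
      \<comment> \<open>The real part of the numerator of w does not depend on \<eta>; this yields a
        lower bound for |w| that is uniform in \<eta> and vanishes only at the branch point.\<close>
      have "\<bar>2 * C * (t - k) / (1 + k)\<bar> = \<bar>Re (1 - zz \<eta> - 2 * of_real (k / (1 + k)))\<bar>"
        using Xy[OF k] Re1z[of \<eta>] by simp
      also have "\<dots> \<le> norm (1 - zz \<eta> - 2 * of_real (k / (1 + k)))" by (rule abs_Re_le_cmod)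
      also have "\<dots> = norm (w k \<eta>) * norm (1 - zz \<eta>)" unfolding w_eq using nz[of \<eta>] by (simp add: norm_divide)
      also have "\<dots> \<le> norm (w k \<eta>) * 3" using n3 by (intro mult_left_mono) auto
      finally have "\<bar>2 * C * (t - k) / (1 + k)\<bar> \<le> norm (w k \<eta>) * 3" .
      moreover have "\<bar>2 * C * (t - k) / (1 + k)\<bar> = 3 * ((2 * C / 3) * (\<bar>t - k\<bar> / (1 + k)))"
      proof -
        have "3 * ((2 * C / 3) * u) = 2 * C * u" for u by simp
        moreover have "\<bar>2 * C * (t - k) / (1 + k)\<bar> = 2 * C * (\<bar>t - k\<bar> / (1 + k))" using k XC(2) by (simp add: abs_mult)
        ultimately show ?thesis by (simp only:)
      qed
      ultimately have wl: "(2 * C / 3) * (\<bar>t - k\<bar> / (1 + k)) \<le> norm (w k \<eta>)" by linarith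
      have pos: "(2 * C / 3) * (\<bar>t - k\<bar> / (1 + k)) > 0" using False k XC by simp
      hence "w k \<eta> \<noteq> 0" using wl by auto
      hence "norm (w k \<eta> powr (- a)) \<le> norm (w k \<eta>) powr (- Re a) * exp (pi * \<bar>Im a\<bar>)" by (rule norm_powr_le)
      also have "\<dots> \<le> ((2 * C / 3) * (\<bar>t - k\<bar> / (1 + k))) powr (- Re a) * exp (pi * \<bar>Im a\<bar>)"
        using wl pos a by (intro mult_right_mono powr_mono2') auto
      also have "((2 * C / 3) * (\<bar>t - k\<bar> / (1 + k))) powr (- Re a) = (2 * C / 3) powr (- Re a) * (\<bar>t - k\<bar> powr (- Re a) * (1 + k) powr Re a)"
        using XC k powr_minus[of "1 + k" "Re a"] by (subst powr_mult) (simp_all add: powr_divide field_simps)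
      finally have "norm (w k \<eta> powr (- a)) \<le> K * (\<bar>t - k\<bar> powr (- Re a) * (1 + k) powr Re a)"
        by (simp only: K_def mult_ac)
      hence "norm (cpow k (b - 1) * cpow (1 + k) (- c)) * norm (w k \<eta> powr (- a)) \<le>
         norm (cpow k (b - 1) * cpow (1 + k) (- c)) * (K * (\<bar>t - k\<bar> powr (- Re a) * (1 + k) powr Re a))"
        by (rule mult_left_mono) simp
      also have "\<dots> = K * cut_weight t (Re a) (Re b) (Re c) k"
      proof -
        have "(1 + k) powr (Re a - Re c) = (1 + k) powr Re a * (1 + k) powr (- Re c)"
          by (simp only: powr_add[symmetric]) simp
        thus ?thesis using k by (simp add: cut_weight_def norm_mult norm_cpow mult_ac)
      qed
      finally show ?thesis using False by (simp add: f_def w_def norm_mult)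
    qed
    show "at 0 within {0<..<1} \<noteq> (bot :: real filter)" unfolding at[symmetric] by simp
  qed
  moreover have "integral\<^sup>L lpos (f \<eta>) = Eint a b c (x \<eta>)" if "\<eta> \<in> {0<..<1}" for \<eta>
  proof -
    have "AE k in lpos. f \<eta> k = cpow k (b - 1) * cpow (1 + k) (- c) * (1 - x \<eta> * of_real (k / (1 + k))) powr (- a)"
      using AE_lpos_neq[of t] by eventually_elim (simp add: f_def)
    thus ?thesis unfolding Eint_def f_def using that slit[of \<eta>]
      by (intro integral_cong_AE) (auto intro!: borel_measurable_scaleR Eint_kernel_measurable lpos_measurableI borel_measurable_indicator)
  qed
  ultimately have "((\<lambda>\<eta>. Eint a b c (x \<eta>)) \<longlongrightarrow> integral\<^sup>L lpos (cutlim a b c t e)) (at 0 within {0<..<1})"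
    by (subst (asm) tendsto_cong[OF eventually_at_topological[THEN iffD2]]) (auto intro!: exI[of _ UNIV])
  thus ?thesis unfolding at t_def .
qed

text \<open>The substitution of t / (1 + k) for k stretches (0, t) to the half-line and gives
  Euler's integral again, now with the parameters of P: c - a = \<nu> + \<alpha> + \<beta> + 1, 1 -
  a = -\<nu>, b - a + 1 = \<alpha> + 1, and t / (1 + t) is sin^2 \<zeta> for t = tan^2
  \<zeta>.\<close>

lemma cutlim_left:
  assumes t: "t > 0"
  shows "(\<integral>k. indicator {0<..<t} k *\<^sub>R (cpow k (b - 1) * cpow (1 + k) (- c) * cpow ((t - k) / (t * (1 + k))) (- a)) \<partial>lpos) =
     cpow t b * cpow (1 + t) (a - c) * Eint (c - a) (1 - a) (b - a + 1) (of_real (t / (1 + t)))"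
proof -
  let ?f = "\<lambda>k. cpow k (b - 1) * cpow (1 + k) (- c) * cpow ((t - k) / (t * (1 + k))) (- a)"
  have "(\<integral>k. indicator {0<..<t} k *\<^sub>R ?f k \<partial>lpos) = (\<integral>k. (t / (1 + k)\<^sup>2) *\<^sub>R ?f (t / (1 + k)) \<partial>lpos)"
    by (rule lpos_subst_left(2)[symmetric]) (use t in auto)
  also have "\<dots> = (\<integral>k. cpow t b * cpow (1 + t) (a - c) * (cpow k ((1 - a) - 1) * cpow (1 + k) (- (b - a + 1)) *
       (1 - of_real (t / (1 + t)) * of_real (k / (1 + k))) powr (- (c - a))) \<partial>lpos)"
  proof (rule lpos_cong_integral)
    fix k :: real assume k: "k > 0"
    \<comment> \<open>The base of the new Euler integrand; every factor of the old one is a product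
      of powers of t, k, 1 + k, 1 + t and Y.\<close>
    define Y where "Y = 1 - t / (1 + t) * (k / (1 + k))"
    have Y: "Y > 0"
    proof -
      have "t / (1 + t) * (k / (1 + k)) < 1" using t k by (intro mult_less_one) auto
      thus ?thesis by (simp add: Y_def)
    qed
    have e1: "1 + t / (1 + k) = (1 + t) * Y"
    proof -
      have "(1 + t) * Y = 1 + t - (1 + t) * (t / (1 + t)) * (k / (1 + k))" by (simp add: Y_def right_diff_distrib)
      also have "\<dots> = 1 + (t - t * (k / (1 + k)))" using t by simp
      also have "t - t * (k / (1 + k)) = t / (1 + k)" using k by (simp add: field_simps)
      finally show ?thesis ..
    qed
    have e2: "(t - t / (1 + k)) / (t * (1 + t / (1 + k))) = k / ((1 + k) * ((1 + t) * Y))"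
    proof -
      have "t - t / (1 + k) = t * (k / (1 + k))" using k by (simp add: field_simps)
      thus ?thesis unfolding e1 using t by simp
    qed
    have pos: "1 + k > 0" "1 + t > 0" "(1 + t) * Y > 0" using t k Y by auto
    have c1: "cpow (t / (1 + k)) (b - 1) = cpow t (b - 1) * cpow (1 + k) (- (b - 1))"
      unfolding cpow_divide[OF t pos(1)] cpow_minus by (rule divide_inverse)
    have c2: "cpow ((1 + t) * Y) u = cpow (1 + t) u * cpow Y u" for u using pos Y by (intro cpow_mult) auto
    have c3: "cpow (k / ((1 + k) * ((1 + t) * Y))) (- a) = cpow k (- a) * cpow (1 + k) a * (cpow (1 + t) a * cpow Y a)"
    proof -
      have "cpow (k / (A * B)) (- a) = cpow k (- a) * cpow A a * cpow B a" if "A > 0" "B > 0" for A B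
        using that k by (simp add: cpow_divide cpow_mult cpow_minus field_simps)
      from this[OF pos(1,3)] show ?thesis unfolding c2 .
    qed
    have c4: "complex_of_real (t / (1 + k)\<^sup>2) = cpow t 1 * cpow (1 + k) (- 2)"
    proof -
      have "cpow (1 + k) (- of_nat 2) = inverse ((of_real (1 + k))\<^sup>2)" using pos by (simp only: cpow_minus cpow_of_nat)
      thus ?thesis using t by (simp add: divide_inverse)
    qed
    have c5: "(1 - of_real (t / (1 + t)) * of_real (k / (1 + k))) powr (- (c - a)) = cpow Y (- (c - a))"
    proof -
      have "1 - complex_of_real (t / (1 + t)) * of_real (k / (1 + k)) = of_real Y" by (simp add: Y_def)
      thus ?thesis using Y by (simp only: cpow_powr)
    qed
    have "(t / (1 + k)\<^sup>2) *\<^sub>R ?f (t / (1 + k)) = (cpow t 1 * cpow t (b - 1)) * (cpow (1 + t) (- c) * cpow (1 + t) a) *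
       (cpow Y (- c) * cpow Y a) * (cpow k (- a) * (cpow (1 + k) (- 2) * cpow (1 + k) (- (b - 1)) * cpow (1 + k) a))"
      unfolding scaleR_conv_of_real e2 unfolding e1 c1 c2 c3 c4 by (simp only: mult_ac)
    also have "cpow t 1 * cpow t (b - 1) = cpow t b" unfolding cpow_add[symmetric] by simp
    also have "cpow (1 + t) (- c) * cpow (1 + t) a = cpow (1 + t) (a - c)" unfolding cpow_add[symmetric] by simp
    also have "cpow Y (- c) * cpow Y a = cpow Y (- (c - a))" unfolding cpow_add[symmetric] by simp
    also have "cpow (1 + k) (- 2) * cpow (1 + k) (- (b - 1)) * cpow (1 + k) a = cpow (1 + k) (- (b - a + 1))"
      unfolding cpow_add[symmetric] by (rule arg_cong[of _ _ "cpow _"]) (simp add: algebra_simps)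
    finally show "(t / (1 + k)\<^sup>2) *\<^sub>R ?f (t / (1 + k)) = cpow t b * cpow (1 + t) (a - c) * (cpow k ((1 - a) - 1) * cpow (1 + k) (- (b - a + 1)) *
       (1 - of_real (t / (1 + t)) * of_real (k / (1 + k))) powr (- (c - a)))"
      unfolding c5 by (simp add: mult_ac)
  qed
  finally show ?thesis unfolding Eint_def by (simp only: integral_mult_right_zero)
qed

lemma hypergeo_reg_commute:
  assumes "Re a > 0" "Re b > 0" "norm x < 1"
  shows "hypergeo_reg a b c x = hypergeo_reg b a c x"
  using hypergeo_reg_sums[OF assms(2,3), of a c] hypergeo_reg_sums[OF assms(1,3), of b c]
  by (simp add: mult.commute[of "pochhammer b _"] sums_unique2)

section \<open>The function of the first kind\<close>

text \<open>The left side of the formula for P times Gamma (\<sigma> + 2) and the trigonometric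
  weight; Gamma (\<nu> + 1) has cancelled against the denominator of P. It is written in \<sigma>,
  \<alpha>, \<beta> with \<nu> = (\<sigma> - \<alpha> - \<beta>) / 2, so that \<sigma> can be
  continued while \<alpha> and \<beta> stay fixed, and conversely.\<close>

definition Pside :: "real \<Rightarrow> complex \<Rightarrow> complex \<Rightarrow> complex \<Rightarrow> complex" where
  "Pside \<zeta> \<sigma> \<alpha> \<beta> = Gamma ((\<sigma> + \<alpha> - \<beta>) / 2 + 1) * Gamma ((\<sigma> + \<alpha> + \<beta>) / 2 + 1) * cpow 2 \<sigma> *
     hypergeo_reg (- ((\<sigma> - \<alpha> - \<beta>) / 2)) ((\<sigma> + \<alpha> + \<beta>) / 2 + 1) (\<alpha> + 1) (of_real ((sin \<zeta>)\<^sup>2)) *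
     cpow (sin \<zeta>) (\<alpha> + 1/2) * cpow (cos \<zeta>) (\<beta> + 1/2)"

definition Jside :: "real \<Rightarrow> complex \<Rightarrow> complex \<Rightarrow> complex \<Rightarrow> complex" where
  "Jside \<zeta> \<sigma> \<alpha> \<beta> = (exp (\<i> * theta1 \<sigma> \<alpha> \<zeta>) * Jcut \<sigma> \<alpha> \<beta> \<zeta> 1 + exp (- (\<i> * theta1 \<sigma> \<alpha> \<zeta>)) * Jcut \<sigma> \<alpha> \<beta> \<zeta> (- 1)) / 2"

text \<open>The weights exp (+-i \<open>theta1\<close>) reduce, against the phases of p and 1 - p,
  to -+i exp (+-i \<pi> a). Before the branch point the two boundary values agree, and the weights
  add up to 2 sin (\<pi> a); beyond it the phases of the integrand undo those of the weights, and
  the contributions cancel.\<close>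

lemma Jside_eq_Pside_base:
  assumes z: "0 < \<zeta>" "\<zeta> < pi / 2"
    and A: "\<bar>Re \<alpha>\<bar> < 1/2" and B: "\<bar>Re \<beta>\<bar> < 1/2"
    and S: "Re (2 * \<nu> + \<alpha> + \<beta>) + 1 > 0" and \<nu>: "Re \<nu> < 0"
  shows "Jside \<zeta> (2 * \<nu> + \<alpha> + \<beta>) \<alpha> \<beta> = Pside \<zeta> (2 * \<nu> + \<alpha> + \<beta>) \<alpha> \<beta>"
proof -
  define \<sigma> where "\<sigma> = 2 * \<nu> + \<alpha> + \<beta>"
  have A': "\<bar>Re \<alpha>\<bar> < real 0 + 1/2" and B': "\<bar>Re \<beta>\<bar> < real 0 + 1/2"
    and S': "Re (2 * \<nu> + \<alpha> + \<beta>) + 1 > real (0 + 0)" using A B S by simp_all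
  note pos = params_pos[OF A' B' S']
  have sc: "sin \<zeta> > 0" "cos \<zeta> > 0" using z by (auto intro!: sin_gt_zero cos_gt_zero)
  define t where "t = (tan \<zeta>)\<^sup>2"
  have t: "t > 0" using sc by (simp add: t_def tan_def)
  have t1: "1 + t = 1 / (cos \<zeta>)\<^sup>2"
    using sc sin_cos_squared_add[of \<zeta>] by (simp add: t_def tan_def power_divide field_simps)
  have tX: "t / (1 + t) = (sin \<zeta>)\<^sup>2" unfolding t1 using sc by (simp add: t_def tan_def power_divide)
  define a b c where "a = \<nu> + 1" and "b = \<nu> + \<alpha> + 1" and "c = \<sigma> + 2"
  have abc: "0 < Re a" "Re a < 1" "Re b > 0" "Re (c - b) > 0"
    using pos \<nu> by (simp_all add: a_def b_def c_def \<sigma>_def)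
  define W where "W = (\<lambda>e. integral\<^sup>L lpos (cutlim a b c t e))"
  define d where "d = - \<alpha> - 2 * \<nu> - 3/2"
  define K where "K = Jconst \<nu> \<alpha> \<beta> * cpow (cos \<zeta>) (1/2 - \<beta>) * cpow (sin \<zeta>) d"
  have J: "Jcut \<sigma> \<alpha> \<beta> \<zeta> (- e) = K * (exp (\<i> * of_real (- e) * of_real \<zeta> * (1/2 - \<beta>)) * exp (\<i> * of_real (- e) * of_real (\<zeta> - pi / 2) * d)) * W e"
    if e: "e \<in> {1, - 1}" for e
  proof -
    note lim = Eint_cut_limit[OF z e A' B' S', folded \<sigma>_def, folded a_def b_def c_def d_def]
    have "W e = Jcut \<sigma> \<alpha> \<beta> \<zeta> (- e) / (Jconst \<nu> \<alpha> \<beta> * (cpow (cos \<zeta>) (1/2 - \<beta>) * exp (\<i> * of_real (- e) * of_real \<zeta> * (1/2 - \<beta>))) *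
       (cpow (sin \<zeta>) d * exp (\<i> * of_real (- e) * of_real (\<zeta> - pi / 2) * d)))"
      unfolding W_def t_def
      by (rule tendsto_unique[OF _ Eint_cut_integral[OF z e abc lim(2)] lim(1)]) simp_all
    thus ?thesis using Jconst_nonzero[OF pos(4,1)] unfolding K_def by (simp add: field_simps)
  qed
  \<comment> \<open>All dependence on \<zeta> drops out of the phase; only \<pi> a - \<pi> / 2
    remains.\<close>
  have ph: "exp (\<i> * of_real e * theta1 \<sigma> \<alpha> \<zeta>) * (exp (\<i> * of_real e * of_real \<zeta> * (1/2 - \<beta>)) * exp (\<i> * of_real e * of_real (\<zeta> - pi / 2) * d)) =
     exp (\<i> * of_real e * (of_real pi * a)) * exp (- (\<i> * of_real e * (of_real pi / 2)))" for e
    unfolding exp_add[symmetric] by (rule arg_cong[of _ _ exp]) (simp add: theta1_def \<sigma>_def d_def a_def field_simps)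
  have i2: "exp (- (\<i> * (of_real pi / 2))) = - \<i>" "exp (\<i> * (of_real pi / 2)) = \<i>"
    using cis_conv_exp[of "pi / 2"] cis_conv_exp[of "- (pi / 2)"] by (simp_all add: cis.code complex_eq_iff)
  have "Jside \<zeta> \<sigma> \<alpha> \<beta> = K / 2 * ((- \<i>) * exp (\<i> * (of_real pi * a)) * W (- 1) + \<i> * exp (- (\<i> * (of_real pi * a))) * W 1)"
  proof -
    have EJ: "exp (\<i> * of_real e * theta1 \<sigma> \<alpha> \<zeta>) * Jcut \<sigma> \<alpha> \<beta> \<zeta> e =
       K * (exp (\<i> * of_real e * (of_real pi * a)) * exp (- (\<i> * of_real e * (of_real pi / 2)))) * W (- e)" if "e \<in> {1, -1}" for e
    proof -
      have "- e \<in> {1, -1}" using that by auto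
      from J[OF this] show ?thesis unfolding ph[symmetric] minus_minus by (simp only: mult_ac)
    qed
    have "exp (\<i> * theta1 \<sigma> \<alpha> \<zeta>) * Jcut \<sigma> \<alpha> \<beta> \<zeta> 1 = K * (exp (\<i> * (of_real pi * a)) * (- \<i>)) * W (- 1)"
      using EJ[of 1] i2 by simp
    moreover have "exp (- (\<i> * theta1 \<sigma> \<alpha> \<zeta>)) * Jcut \<sigma> \<alpha> \<beta> \<zeta> (- 1) = K * (exp (- (\<i> * (of_real pi * a))) * \<i>) * W 1"
      using EJ[of "- 1"] i2 by simp
    ultimately have "Jside \<zeta> \<sigma> \<alpha> \<beta> = (K * (exp (\<i> * (of_real pi * a)) * (- \<i>)) * W (- 1) + K * (exp (- (\<i> * (of_real pi * a))) * \<i>) * W 1) / 2"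
      unfolding Jside_def by (simp only:)
    moreover have "(K * (E * (- \<i>)) * w + K * (F * \<i>) * v) / 2 = K / 2 * ((- \<i>) * E * w + \<i> * F * v)" for E F w v
      by (simp add: field_simps)
    ultimately show ?thesis by (simp only:)
  qed
  also have "(- \<i>) * exp (\<i> * (of_real pi * a)) * W (- 1) + \<i> * exp (- (\<i> * (of_real pi * a))) * W 1 =
     (\<integral>k. (- \<i>) * exp (\<i> * (of_real pi * a)) * cutlim a b c t (- 1) k + \<i> * exp (- (\<i> * (of_real pi * a))) * cutlim a b c t 1 k \<partial>lpos)"
    unfolding W_def by (simp add: cutlim_integrable[OF t abc])
  also have "\<dots> = (\<integral>k. 2 * sin (of_real pi * a) * (indicator {0<..<t} k *\<^sub>R
      (cpow k (b - 1) * cpow (1 + k) (- c) * cpow ((t - k) / (t * (1 + k))) (- a))) \<partial>lpos)"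
  proof (rule lpos_cong_integral)
    fix k :: real assume k: "k > 0"
    have s: "2 * sin (of_real pi * a) = (- \<i>) * (exp (\<i> * (of_real pi * a)) - exp (- (\<i> * (of_real pi * a))))"
      by (simp add: sin_exp_eq field_simps)
    have inv: "exp (\<i> * (of_real pi * a)) * exp (- (\<i> * (of_real pi * a))) = 1" by (simp add: exp_minus)
    consider "k < t" | "k = t" | "k > t" by linarith
    thus "(- \<i>) * exp (\<i> * (of_real pi * a)) * cutlim a b c t (- 1) k + \<i> * exp (- (\<i> * (of_real pi * a))) * cutlim a b c t 1 k =
       2 * sin (of_real pi * a) * (indicator {0<..<t} k *\<^sub>R (cpow k (b - 1) * cpow (1 + k) (- c) * cpow ((t - k) / (t * (1 + k))) (- a)))"
    proof cases
      case 1
      thus ?thesis using k unfolding s by (simp add: cutlim_def algebra_simps)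
    next
      case 2
      thus ?thesis by (simp add: cutlim_def)
    next
      case 3
      have e: "exp (\<i> * of_real (- 1) * of_real pi * a) = exp (- (\<i> * (of_real pi * a)))"
        "exp (\<i> * of_real 1 * of_real pi * a) = exp (\<i> * (of_real pi * a))" by (simp_all add: mult.assoc)
      let ?V = "cpow k (b - 1) * cpow (1 + k) (- c) * cpow (\<bar>t - k\<bar> / (t * (1 + k))) (- a)"
      have "cutlim a b c t (- 1) k = ?V * exp (- (\<i> * (of_real pi * a)))" "cutlim a b c t 1 k = ?V * exp (\<i> * (of_real pi * a))"
        using 3 unfolding cutlim_def e by (simp_all add: mult_ac)
      hence "(- \<i>) * exp (\<i> * (of_real pi * a)) * cutlim a b c t (- 1) k + \<i> * exp (- (\<i> * (of_real pi * a))) * cutlim a b c t 1 k =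
        \<i> * ?V * (exp (\<i> * (of_real pi * a)) * exp (- (\<i> * (of_real pi * a))) - exp (\<i> * (of_real pi * a)) * exp (- (\<i> * (of_real pi * a))))"
        by (simp only:) (simp add: algebra_simps)
      thus ?thesis using 3 by simp
    qed
  qed
  also have "\<dots> = 2 * sin (of_real pi * a) * (cpow t b * cpow (1 + t) (a - c) * Eint (c - a) (1 - a) (b - a + 1) (of_real (t / (1 + t))))"
    by (simp only: integral_mult_right_zero cutlim_left[OF t])
  also have "Eint (c - a) (1 - a) (b - a + 1) (of_real (t / (1 + t))) =
      Gamma (- \<nu>) * Gamma b * hypergeo_reg (- \<nu>) (\<nu> + \<alpha> + \<beta> + 1) (\<alpha> + 1) (of_real ((sin \<zeta>)\<^sup>2))"
  proof -
    have e: "c - a = \<nu> + \<alpha> + \<beta> + 1" "1 - a = - \<nu>" "b - a + 1 = \<alpha> + 1" "(\<alpha> + 1) - (- \<nu>) = b"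
      by (simp_all add: a_def b_def c_def \<sigma>_def)
    have nX: "norm (complex_of_real ((sin \<zeta>)\<^sup>2)) < 1"
    proof -
      have "(sin \<zeta>)\<^sup>2 < 1" using sin_cos_squared_add[of \<zeta>] sc by (metis less_add_same_cancel1 zero_less_power)
      thus ?thesis unfolding norm_of_real by simp
    qed
    have "hypergeo_reg (- \<nu>) (\<nu> + \<alpha> + \<beta> + 1) (\<alpha> + 1) (of_real ((sin \<zeta>)\<^sup>2)) = hypergeo_reg (\<nu> + \<alpha> + \<beta> + 1) (- \<nu>) (\<alpha> + 1) (of_real ((sin \<zeta>)\<^sup>2))"
      using \<nu> pos nX by (intro hypergeo_reg_commute) auto
    also have "\<dots> = rGamma (- \<nu>) * rGamma b * Eint (\<nu> + \<alpha> + \<beta> + 1) (- \<nu>) (\<alpha> + 1) (of_real ((sin \<zeta>)\<^sup>2))"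
      using hypergeo_reg_Eint[of "- \<nu>" "\<alpha> + 1", unfolded e(4)] \<nu> abc ball_subset_hyp_slit_plane[OF nX] by simp
    finally have h: "hypergeo_reg (- \<nu>) (\<nu> + \<alpha> + \<beta> + 1) (\<alpha> + 1) (of_real ((sin \<zeta>)\<^sup>2)) =
        rGamma (- \<nu>) * rGamma b * Eint (\<nu> + \<alpha> + \<beta> + 1) (- \<nu>) (\<alpha> + 1) (of_real ((sin \<zeta>)\<^sup>2))" .
    have "Gamma (- \<nu>) \<noteq> 0" "Gamma b \<noteq> 0" using \<nu> abc by (auto intro!: Gamma_Re_pos_nonzero)
    thus ?thesis unfolding e(1-3) tX h by (simp add: rGamma_inverse_Gamma field_simps)
  qed
  also have "cpow t b = cpow (sin \<zeta>) (2 * b) * cpow (cos \<zeta>) (- (2 * b))"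
    using sc by (simp add: cpow_def t_def tan_def ln_realpow ln_div exp_add[symmetric] algebra_simps)
  also have "cpow (1 + t) (a - c) = cpow (cos \<zeta>) (2 * (c - a))"
    using sc by (simp add: t1 cpow_def ln_realpow ln_div algebra_simps)
  \<comment> \<open>The reflection formula provides the reciprocals of Gamma (\<nu> + 1) from
    \<open>Jconst\<close> and of Gamma (-\<nu>) from Euler's formula.\<close>
  also have "sin (of_real pi * a) = of_real pi * (rGamma (\<nu> + 1) * rGamma (- \<nu>))"
    using rGamma_reflection_complex[of a] by (simp add: a_def field_simps)
  finally have "Jside \<zeta> \<sigma> \<alpha> \<beta> = (cpow 2 \<sigma> * Gamma (\<nu> + \<alpha> + \<beta> + 1) * Gamma b * hypergeo_reg (- \<nu>) (\<nu> + \<alpha> + \<beta> + 1) (\<alpha> + 1) (of_real ((sin \<zeta>)\<^sup>2))) *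
      (Gamma (\<nu> + 1) * rGamma (\<nu> + 1)) * (Gamma (- \<nu>) * rGamma (- \<nu>)) *
      (cpow (sin \<zeta>) d * cpow (sin \<zeta>) (2 * b)) * (cpow (cos \<zeta>) (1/2 - \<beta>) * cpow (cos \<zeta>) (- (2 * b)) * cpow (cos \<zeta>) (2 * (c - a)))"
    unfolding K_def Jconst_def \<sigma>_def[symmetric] by (simp add: mult_ac)
  also have "Gamma (\<nu> + 1) * rGamma (\<nu> + 1) = 1" using Gamma_Re_pos_nonzero[OF pos(1)] by (simp add: rGamma_inverse_Gamma)
  also have "Gamma (- \<nu>) * rGamma (- \<nu>) = 1" using Gamma_Re_pos_nonzero[of "- \<nu>"] \<nu> by (simp add: rGamma_inverse_Gamma)
  also have "cpow (sin \<zeta>) d * cpow (sin \<zeta>) (2 * b) = cpow (sin \<zeta>) (\<alpha> + 1/2)"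
    unfolding cpow_add[symmetric] by (rule arg_cong[of _ _ "cpow _"]) (simp add: d_def b_def algebra_simps)
  also have "cpow (cos \<zeta>) (1/2 - \<beta>) * cpow (cos \<zeta>) (- (2 * b)) * cpow (cos \<zeta>) (2 * (c - a)) = cpow (cos \<zeta>) (\<beta> + 1/2)"
    unfolding cpow_add[symmetric] by (rule arg_cong[of _ _ "cpow _"]) (simp add: a_def c_def b_def \<sigma>_def algebra_simps)
  finally have main: "Jside \<zeta> \<sigma> \<alpha> \<beta> = (cpow 2 \<sigma> * Gamma (\<nu> + \<alpha> + \<beta> + 1) * Gamma b * hypergeo_reg (- \<nu>) (\<nu> + \<alpha> + \<beta> + 1) (\<alpha> + 1) (of_real ((sin \<zeta>)\<^sup>2))) *
      cpow (sin \<zeta>) (\<alpha> + 1/2) * cpow (cos \<zeta>) (\<beta> + 1/2)" by simp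
  have p: "(\<sigma> + \<alpha> - \<beta>) / 2 + 1 = b" "(\<sigma> + \<alpha> + \<beta>) / 2 + 1 = \<nu> + \<alpha> + \<beta> + 1" "(\<sigma> - \<alpha> - \<beta>) / 2 = \<nu>"
    by (simp_all add: \<sigma>_def b_def field_simps)
  show ?thesis unfolding \<sigma>_def[symmetric] main Pside_def p by (simp only: mult_ac)
qed

section \<open>Analytic dependence of the hypergeometric function on its parameters\<close>

lemma hypergeo_majorant_summable:
  fixes A B x :: real and m :: nat
  assumes "A > 0" "B > 0" "0 \<le> x" "x < 1"
  shows "summable (\<lambda>n. pochhammer A (n + m) * pochhammer B (n + m) / (fact (n + m) * fact n) * x ^ (n + m))"
proof -
  define v where "v = (\<lambda>n. pochhammer A (n + m) * pochhammer B (n + m) / (fact (n + m) * fact n) * x ^ (n + m))"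
  \<comment> \<open>q n * x is the quotient of consecutive terms, with limit x < 1.\<close>
  define q where "q = (\<lambda>n::nat. (A + real n + real m) * (B + real n + real m) / ((real n + real m + 1) * (real n + 1)))"
  have "q \<longlonglongrightarrow> 1" unfolding q_def by real_asymp
  hence "(\<lambda>n. q n * x) \<longlonglongrightarrow> 1 * x" by (intro tendsto_mult tendsto_const)
  hence "\<forall>\<^sub>F n in sequentially. q n * x < (1 + x) / 2" using assms by (intro order_tendstoD(2)) auto
  then obtain N where N: "\<And>n. n \<ge> N \<Longrightarrow> q n * x < (1 + x) / 2" by (auto simp: eventually_sequentially)
  have v0: "v n \<ge> 0" for n unfolding v_def using assms by (intro mult_nonneg_nonneg divide_nonneg_nonneg pochhammer_nonneg) auto
  have vS: "v (Suc n) = q n * x * v n" for n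
  proof -
    have "pochhammer A (Suc n + m) = pochhammer A (n + m) * (A + n + m)" "pochhammer B (Suc n + m) = pochhammer B (n + m) * (B + n + m)"
      by (simp_all add: pochhammer_Suc add_ac)
    moreover have "fact (Suc n + m) = (real n + real m + 1) * fact (n + m)" "fact (Suc n) = (real n + 1) * fact n" by simp_all
    ultimately show ?thesis unfolding v_def q_def by (simp only:) (simp add: mult_ac)
  qed
  have "summable v"
  proof (rule summable_ratio_test[of "(1 + x) / 2" N])
    show "norm (v (Suc n)) \<le> (1 + x) / 2 * norm (v n)" if "n \<ge> N" for n
    proof -
      have "q n * x * v n \<le> (1 + x) / 2 * v n" using N[OF that] v0 by (intro mult_right_mono) auto
      thus ?thesis using v0[of n] v0[of "Suc n"] unfolding vS real_norm_def by (simp only: abs_of_nonneg)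
    qed
  qed (use assms in auto)
  thus ?thesis by (simp add: v_def)
qed

lemma norm_pochhammer_le: "norm (z :: complex) \<le> A \<Longrightarrow> norm (pochhammer z n) \<le> pochhammer A n"
  unfolding pochhammer_prod prod_norm[symmetric]
  by (intro prod_mono) (auto intro: order_trans[OF norm_triangle_ineq])

text \<open>The recurrence divides by z + n at each step, and the modulus of z + n is at least n +
  1.\<close>

lemma norm_rGamma_shift_le:
  assumes "Re z \<ge> 1" "norm (rGamma z) \<le> K"
  shows "norm (rGamma (z + of_nat n)) \<le> K / fact n"
proof (induction n)
  case 0
  thus ?case using assms by simp
next
  case (Suc n)
  have "real n + 1 \<le> Re (z + of_nat n)" using assms by simp
  also have "\<dots> \<le> norm (z + of_nat n)" by (rule complex_Re_le_cmod)
  finally have n: "real n + 1 \<le> norm (z + of_nat n)" .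
  have "(z + of_nat n) * rGamma (z + of_nat (Suc n)) = rGamma (z + of_nat n)"
    using rGamma_plus1[of "z + of_nat n"] by (simp add: add_ac)
  hence "norm (z + of_nat n) * norm (rGamma (z + of_nat (Suc n))) \<le> K / fact n" using Suc by (metis norm_mult)
  moreover have "(real n + 1) * norm (rGamma (z + of_nat (Suc n))) \<le> norm (z + of_nat n) * norm (rGamma (z + of_nat (Suc n)))"
    using n by (intro mult_right_mono) auto
  ultimately have "(real n + 1) * norm (rGamma (z + of_nat (Suc n))) \<le> K / fact n" by linarith
  hence "norm (rGamma (z + of_nat (Suc n))) \<le> K / fact n / (real n + 1)"
    by (subst pos_le_divide_eq) (simp_all add: mult.commute)
  also have "\<dots> = K / fact (Suc n)" by (simp add: mult.commute)
  finally show ?case .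
qed

text \<open>The series is treated as an integral over counting measure, so that
  \<open>holomorphic_integral\<close> applies with a summable majorant.\<close>

lemma hypergeo_reg_holomorphic_params:
  fixes A B C :: "complex \<Rightarrow> complex"
  assumes T: "open T" and hol: "A holomorphic_on T" "B holomorphic_on T" "C holomorphic_on T"
    and B: "\<And>t. t \<in> T \<Longrightarrow> Re (B t) > 0" and x: "norm x < 1"
  shows "(\<lambda>t. hypergeo_reg (A t) (B t) (C t) x) holomorphic_on T"
proof -
  define u where "u = (\<lambda>t n. pochhammer (A t) n * pochhammer (B t) n * rGamma (C t + of_nat n) / fact n * x ^ n)"
  have sums: "u t sums hypergeo_reg (A t) (B t) (C t) x" if "t \<in> T" for t
    unfolding u_def by (rule hypergeo_reg_sums[OF B[OF that] x])
  have hu: "(\<lambda>t. u t n) holomorphic_on T" for n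
    unfolding u_def pochhammer_prod by (intro holomorphic_intros hol) auto
  have "(\<lambda>t. hypergeo_reg (A t) (B t) (C t) x) analytic_on T"
    unfolding analytic_on_def
  proof
    fix t0 assume t0: "t0 \<in> T"
    obtain r where r: "r > 0" "cball t0 r \<subseteq> T" using T t0 open_contains_cball by blast
    have bdd: "\<exists>K>0. \<forall>t\<in>cball t0 r. norm (f t) \<le> K" if "f holomorphic_on T" for f :: "complex \<Rightarrow> complex"
    proof -
      have "continuous_on (cball t0 r) f"
        by (rule holomorphic_on_imp_continuous_on, rule holomorphic_on_subset[OF that r(2)])
      hence "bounded (f ` cball t0 r)" by (intro compact_imp_bounded compact_continuous_image) auto
      thus ?thesis unfolding bounded_pos by auto
    qed
    obtain a where a: "a > 0" "\<And>t. t \<in> cball t0 r \<Longrightarrow> norm (A t) \<le> a" using bdd[OF hol(1)] by blast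
    obtain b where b: "b > 0" "\<And>t. t \<in> cball t0 r \<Longrightarrow> norm (B t) \<le> b" using bdd[OF hol(2)] by blast
    obtain c where c: "c > 0" "\<And>t. t \<in> cball t0 r \<Longrightarrow> norm (C t) \<le> c" using bdd[OF hol(3)] by blast
    \<comment> \<open>After splitting off m terms the third parameter has real part at least 1 on
      the whole disc, and the reciprocal gamma function decays like 1 / n!.\<close>
    obtain m where m: "c + 1 < real m" using reals_Archimedean2 by blast
    have "(\<lambda>t. rGamma (C t + of_nat m)) holomorphic_on T" by (intro holomorphic_intros hol)
    then obtain K where K: "K > 0" "\<And>t. t \<in> cball t0 r \<Longrightarrow> norm (rGamma (C t + of_nat m)) \<le> K" using bdd by blast
    define v where "v = (\<lambda>n. K * (pochhammer a (n + m) * pochhammer b (n + m) / (fact (n + m) * fact n) * norm x ^ (n + m)))"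
    have "summable v" unfolding v_def by (intro summable_mult hypergeo_majorant_summable a b x) auto
    moreover have v0: "v n \<ge> 0" for n unfolding v_def using a b K
      by (intro mult_nonneg_nonneg divide_nonneg_nonneg pochhammer_nonneg) auto
    ultimately have v: "integrable (count_space UNIV) v" by (simp add: integrable_count_space_nat_iff)
    have uv: "norm (u t (n + m)) \<le> v n" if t: "t \<in> cball t0 r" for t n
    proof -
      have "Re (C t + of_nat m) \<ge> 1" using c(2)[OF t] m abs_Re_le_cmod[of "C t"] by simp
      from norm_rGamma_shift_le[OF this K(2)[OF t], of n]
      have g: "norm (rGamma (C t + of_nat (n + m))) \<le> K / fact n" by (simp add: add_ac)
      have "norm (u t (n + m)) = norm (pochhammer (A t) (n + m)) * norm (pochhammer (B t) (n + m)) * norm (rGamma (C t + of_nat (n + m))) / fact (n + m) * norm x ^ (n + m)"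
        unfolding u_def norm_mult norm_divide norm_power norm_fact by simp
      also have "\<dots> \<le> pochhammer a (n + m) * pochhammer b (n + m) * (K / fact n) / fact (n + m) * norm x ^ (n + m)"
        using norm_pochhammer_le[OF a(2)[OF t]] norm_pochhammer_le[OF b(2)[OF t]] g a b K
        by (intro mult_mono divide_right_mono mult_nonneg_nonneg pochhammer_nonneg divide_nonneg_nonneg) auto
      also have "\<dots> = v n" by (simp add: v_def field_simps)
      finally show ?thesis .
    qed
    have "(\<lambda>t. \<integral>n. u t (n + m) \<partial>count_space UNIV) holomorphic_on ball t0 r"
    proof (rule holomorphic_integral)
      show "(\<lambda>t. u t (n + m)) holomorphic_on ball t0 r" for n
        by (rule holomorphic_on_subset[OF hu]) (use r in auto)
      show "\<exists>s>0. \<exists>w. integrable (count_space UNIV) w \<and> (\<forall>t'\<in>ball t s \<inter> ball t0 r. \<forall>n\<in>space (count_space UNIV). norm (u t' (n + m)) \<le> w n)" for t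
        using v uv by (intro exI[of _ "1::real"] conjI exI[of _ v]) auto
    qed auto
    moreover have "(\<lambda>t. \<Sum>n<m. u t n) holomorphic_on ball t0 r"
      by (intro holomorphic_on_sum holomorphic_on_subset[OF hu]) (use r in auto)
    ultimately have "(\<lambda>t. (\<integral>n. u t (n + m) \<partial>count_space UNIV) + (\<Sum>n<m. u t n)) holomorphic_on ball t0 r"
      by (rule holomorphic_on_add)
    moreover have "(\<integral>n. u t (n + m) \<partial>count_space UNIV) + (\<Sum>n<m. u t n) = hypergeo_reg (A t) (B t) (C t) x" if t: "t \<in> ball t0 r" for t
    proof -
      have tc: "t \<in> cball t0 r" "t \<in> T" using t r by auto
      have "integrable (count_space UNIV) (\<lambda>n. u t (n + m))"
        by (rule Bochner_Integration.integrable_bound[OF v]) (use uv[OF tc(1)] v0 in \<open>auto intro!: AE_I2 intro: order_trans[OF _ abs_ge_self]\<close>)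
      from sums_integral_count_space_nat[OF this] have "(\<Sum>n. u t (n + m)) = (\<integral>n. u t (n + m) \<partial>count_space UNIV)" by (simp add: sums_iff)
      thus ?thesis using suminf_split_initial_segment[of "u t" m] sums[OF tc(2)] by (simp add: sums_iff)
    qed
    ultimately have "(\<lambda>t. hypergeo_reg (A t) (B t) (C t) x) holomorphic_on ball t0 r"
      by (rule holomorphic_transform)
    thus "\<exists>e>0. (\<lambda>t. hypergeo_reg (A t) (B t) (C t) x) holomorphic_on ball t0 e" using r by blast
  qed
  thus ?thesis by (rule analytic_imp_holomorphic)
qed

section \<open>Continuation of the identity for P\<close>

lemma Jside_eq_Pside_continue:
  fixes S A B :: "complex \<Rightarrow> complex"
  assumes z: "0 < \<zeta>" "\<zeta> < pi / 2" and T: "open T" "connected T"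
    and hol: "S holomorphic_on T" "A holomorphic_on T" "B holomorphic_on T"
    and A: "\<And>t. t \<in> T \<Longrightarrow> \<bar>Re (A t)\<bar> < real M + 1/2" and B: "\<And>t. t \<in> T \<Longrightarrow> \<bar>Re (B t)\<bar> < real M' + 1/2"
    and S: "\<And>t. t \<in> T \<Longrightarrow> Re (S t) + 1 > real (M + M')"
    and U: "open U" "U \<noteq> {}" "U \<subseteq> T" and eq: "\<And>t. t \<in> U \<Longrightarrow> Jside \<zeta> (S t) (A t) (B t) = Pside \<zeta> (S t) (A t) (B t)"
    and t: "t \<in> T"
  shows "Jside \<zeta> (S t) (A t) (B t) = Pside \<zeta> (S t) (A t) (B t)"
proof (rule analytic_continuation_open[of U T "\<lambda>t. Jside \<zeta> (S t) (A t) (B t)" "\<lambda>t. Pside \<zeta> (S t) (A t) (B t)"])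
  have "(\<lambda>t. Jcut (S t) (A t) (B t) \<zeta> e) holomorphic_on T" if e: "e \<in> {1, -1}" for e
    unfolding Jcut_def using cut_point(2,3)[OF z e] by (intro Jint_holomorphic_params[OF T(1) hol A B S])
  thus "(\<lambda>t. Jside \<zeta> (S t) (A t) (B t)) holomorphic_on T"
    unfolding Jside_def theta1_def by (intro holomorphic_intros hol) auto
  have sc: "sin \<zeta> > 0" "cos \<zeta> > 0" using z by (auto intro!: sin_gt_zero cos_gt_zero)
  have nX: "norm (complex_of_real ((sin \<zeta>)\<^sup>2)) < 1"
  proof -
    have "(sin \<zeta>)\<^sup>2 < 1" using sin_cos_squared_add[of \<zeta>] sc by (metis less_add_same_cancel1 zero_less_power)
    thus ?thesis unfolding norm_of_real by simp
  qed
  have re: "Re ((S t + A t - B t) / 2 + 1) > 0" "Re ((S t + A t + B t) / 2 + 1) > 0" if "t \<in> T" for t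
  proof -
    have H: "0 < Re (w / 2 + 1)" if "- 2 < Re w" for w
    proof -
      have "Re (w / 2 + 1) = Re w / 2 + 1" by simp
      thus ?thesis using that by linarith
    qed
    show "Re ((S t + A t - B t) / 2 + 1) > 0" "Re ((S t + A t + B t) / 2 + 1) > 0"
      by (rule H, use A[OF that] B[OF that] S[OF that] in \<open>simp add: abs_less_iff\<close>)+
  qed
  have "(\<lambda>t. Gamma ((S t + A t - B t) / 2 + 1)) holomorphic_on T" "(\<lambda>t. Gamma ((S t + A t + B t) / 2 + 1)) holomorphic_on T"
    using re by (intro holomorphic_Gamma' holomorphic_intros hol Re_pos_not_nonpos_Int; simp)+
  moreover have "(\<lambda>t. hypergeo_reg (- ((S t - A t - B t) / 2)) ((S t + A t + B t) / 2 + 1) (A t + 1) (of_real ((sin \<zeta>)\<^sup>2))) holomorphic_on T"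
    using re by (intro hypergeo_reg_holomorphic_params T nX holomorphic_intros hol) auto
  ultimately show "(\<lambda>t. Pside \<zeta> (S t) (A t) (B t)) holomorphic_on T"
    unfolding Pside_def by (intro holomorphic_on_mult holomorphic_cpow holomorphic_on_add holomorphic_on_const hol)
qed (use T U eq t in auto)

text \<open>Two continuations. In \<sigma>, with \<alpha> and \<beta> fixed in the narrow strip,
  from Re \<sigma> < Re (\<alpha> + \<beta>), which means Re \<nu> < 0, to Re \<sigma> > -1. Then,
  with \<sigma> fixed, along (t \<alpha>, t \<beta>) from a neighbourhood of t = 0 to t = 1.\<close>

theorem Jside_eq_Pside:
  assumes z: "0 < \<zeta>" "\<zeta> < pi / 2"
    and A: "\<bar>Re \<alpha>\<bar> < real M + 1/2" and B: "\<bar>Re \<beta>\<bar> < real M' + 1/2"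
    and S: "Re \<sigma> + 1 > real (M + M')"
  shows "Jside \<zeta> \<sigma> \<alpha> \<beta> = Pside \<zeta> \<sigma> \<alpha> \<beta>"
proof -
  have 1: "Jside \<zeta> \<sigma> \<alpha> \<beta> = Pside \<zeta> \<sigma> \<alpha> \<beta>" if "\<bar>Re \<alpha>\<bar> < 1/2" "\<bar>Re \<beta>\<bar> < 1/2" "Re \<sigma> > -1" for \<sigma> \<alpha> \<beta>
  proof (rule Jside_eq_Pside_continue[OF z, where T = "{\<sigma>. Re \<sigma> > -1}" and S = "\<lambda>\<sigma>. \<sigma>" and A = "\<lambda>_. \<alpha>" and B = "\<lambda>_. \<beta>" and M = 0 and M' = 0
        and U = "{\<sigma>. Re \<sigma> > -1} \<inter> {\<sigma>. Re \<sigma> < Re (\<alpha> + \<beta>)}"])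
    show "connected {\<sigma>. Re \<sigma> > -1}" by (intro convex_connected convex_halfspace_Re_gt)
    \<comment> \<open>The midpoint between -1 and Re (\<alpha> + \<beta>), which exceeds -1 because
      both real parts exceed -1/2.\<close>
    have "of_real ((Re (\<alpha> + \<beta>) - 1) / 2) \<in> {\<sigma>. Re \<sigma> > -1} \<inter> {\<sigma>. Re \<sigma> < Re (\<alpha> + \<beta>)}" using that by auto
    thus "{\<sigma>. Re \<sigma> > -1} \<inter> {\<sigma>. Re \<sigma> < Re (\<alpha> + \<beta>)} \<noteq> {}" by blast
    fix \<tau> assume \<tau>: "\<tau> \<in> {\<sigma>. Re \<sigma> > -1} \<inter> {\<sigma>. Re \<sigma> < Re (\<alpha> + \<beta>)}"
    define \<nu> where "\<nu> = (\<tau> - \<alpha> - \<beta>) / 2"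
    have e: "2 * \<nu> + \<alpha> + \<beta> = \<tau>" by (simp add: \<nu>_def field_simps)
    have "Re \<nu> < 0" using \<tau> by (simp add: \<nu>_def)
    with Jside_eq_Pside_base[OF z that(1,2), of \<nu>, unfolded e] \<tau>
    show "Jside \<zeta> \<tau> \<alpha> \<beta> = Pside \<zeta> \<tau> \<alpha> \<beta>" by simp
  qed (use that in \<open>auto intro!: holomorphic_intros open_Int open_halfspace_Re_gt open_halfspace_Re_lt\<close>)
  \<comment> \<open>An intersection of preimages of strips under multiplication, hence open and
    convex.\<close>
  define T where "T = (\<lambda>r s. {t. \<bar>Re (t * \<alpha>)\<bar> < r} \<inter> {t. \<bar>Re (t * \<beta>)\<bar> < s})"
  have cvx: "convex {t. \<bar>Re (t * c)\<bar> < r}" and op: "open {t. \<bar>Re (t * c)\<bar> < r}" for c r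
  proof -
    have eq: "{t. \<bar>Re (t * c)\<bar> < r} = (\<lambda>t. t * c) -` ({w. Re w < r} \<inter> {w. Re w > - r})" by (auto simp: abs_less_iff)
    show "convex {t. \<bar>Re (t * c)\<bar> < r}" unfolding eq
      by (intro convex_linear_vimage convex_Int convex_halfspace_Re_lt convex_halfspace_Re_gt)
         (simp add: bounded_linear.linear bounded_linear_mult_left)
    show "open {t. \<bar>Re (t * c)\<bar> < r}" unfolding eq
      by (intro open_vimage open_Int open_halfspace_Re_lt open_halfspace_Re_gt continuous_intros)
  qed
  have "Jside \<zeta> \<sigma> (1 * \<alpha>) (1 * \<beta>) = Pside \<zeta> \<sigma> (1 * \<alpha>) (1 * \<beta>)"
  proof (rule Jside_eq_Pside_continue[OF z, where T = "T (real M + 1/2) (real M' + 1/2)" and S = "\<lambda>_. \<sigma>" and A = "\<lambda>t. t * \<alpha>" and B = "\<lambda>t. t * \<beta>"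
        and M = M and M' = M' and U = "T (1/2) (1/2)"])
    show "open (T (real M + 1/2) (real M' + 1/2))" "open (T (1/2) (1/2))" unfolding T_def by (intro open_Int op)+
    show "connected (T (real M + 1/2) (real M' + 1/2))" unfolding T_def by (intro convex_connected convex_Int cvx)
    have "0 \<in> T (1/2) (1/2)" by (simp add: T_def)
    thus "T (1/2) (1/2) \<noteq> {}" by blast
    show "T (1/2) (1/2) \<subseteq> T (real M + 1/2) (real M' + 1/2)" by (auto simp: T_def)
    show "Jside \<zeta> \<sigma> (t * \<alpha>) (t * \<beta>) = Pside \<zeta> \<sigma> (t * \<alpha>) (t * \<beta>)" if "t \<in> T (1/2) (1/2)" for t
      using that S by (intro 1) (auto simp: T_def)
    show "1 \<in> T (real M + 1/2) (real M' + 1/2)" using A B by (simp add: T_def)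
  qed (use S in \<open>auto simp: T_def intro!: holomorphic_intros\<close>)
  thus ?thesis by simp
qed

section \<open>Remainder bounds\<close>

lemma rGamma_reflection_half_real:
  "cos (pi * x) = pi * (rGamma (1/2 + x) * rGamma (1/2 - x :: real))"
proof -
  have "complex_of_real (cos (pi * x)) = of_real (pi * (rGamma (1/2 + x) * rGamma (1/2 - x)))"
    using Gamma_half_reflection[of "of_real x"] rGamma_complex_of_real[of "1/2 + x"] rGamma_complex_of_real[of "1/2 - x"] cos_of_real[of "pi * x", where 'a = complex]
    by simp
  thus ?thesis by (simp only: of_real_eq_iff)
qed

text \<open>By reflection the cosine contains the Pochhammer product of a_n as a factor. After
  cancellation only gamma functions at n + 1/2 +- t remain, continuous for |t| < n + 1/2; this is
  why the limiting value at half-odd t exists.\<close>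

lemma acoeff_over_cos_regular:
  assumes "\<bar>t\<bar> < real n + 1/2" "cos (pi * t) \<noteq> 0"
  shows "acoeff n t / cos (pi * t) = Gamma (real n + 1/2 + t) * Gamma (real n + 1/2 - t) / (pi * ((- 2) ^ n * fact n))"
proof -
  define P where "P = pochhammer (1/2 + t) n * pochhammer (1/2 - t) n"
  have e: "1/2 + t + real n = real n + 1/2 + t" "1/2 - t + real n = real n + 1/2 - t" by simp_all
  have c: "cos (pi * t) = pi * P * (rGamma (real n + 1/2 + t) * rGamma (real n + 1/2 - t))"
    unfolding rGamma_reflection_half_real pochhammer_rGamma[of "1/2 + t" n] pochhammer_rGamma[of "1/2 - t" n] e P_def
    by (simp only: mult_ac)
  hence P: "P \<noteq> 0" using assms(2) by auto
  have G: "Gamma (real n + 1/2 + t) > 0" "Gamma (real n + 1/2 - t) > 0" using assms(1) by (auto intro!: Gamma_real_pos)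
  have a: "acoeff n t = P / ((- 2) ^ n * fact n)" unfolding acoeff_def P_def ..
  have H: "P / d / (pi * P * (inverse u * inverse v)) = u * v / (pi * d)" if "u > 0" "v > 0" "d \<noteq> 0" for u v d
    using that P by (simp add: field_simps)
  show ?thesis unfolding c a rGamma_inverse_Gamma by (rule H[OF G]) simp
qed

lemma cos_pi_eq_0_iff: "cos (pi * x) = 0 \<longleftrightarrow> (\<exists>k::int. odd k \<and> 2 * x = of_int k)"
proof -
  have "pi * x = of_int k * (pi / 2) \<longleftrightarrow> 2 * x = of_int k" for k by (simp add: field_simps)
  thus ?thesis unfolding cos_zero_iff_int by auto
qed

lemma acoeff_over_cos_eq:
  assumes x: "\<bar>x\<bar> < real n + 1/2"
  shows "acoeff_over_cos n x = Gamma (real n + 1/2 + x) * Gamma (real n + 1/2 - x) / (pi * ((- 2) ^ n * fact n))"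
proof (cases "cos (pi * x) = 0")
  case False
  hence "\<not> (\<exists>k::int. odd k \<and> 2 * x = of_int k)" using cos_pi_eq_0_iff by blast
  thus ?thesis unfolding acoeff_over_cos_def using acoeff_over_cos_regular[OF x False] by (simp only: if_False)
next
  case True
  then obtain k :: int where k: "odd k" "2 * x = of_int k" unfolding cos_pi_eq_0_iff by blast
  define g where "g = (\<lambda>t. Gamma (real n + 1/2 + t) * Gamma (real n + 1/2 - t) / (pi * ((- 2) ^ n * fact n)))"
  have "real n + 1/2 + x > 0" "real n + 1/2 - x > 0" using x by auto
  hence "isCont g x" unfolding g_def
    by (intro continuous_intros isCont_Gamma) (auto elim!: nonpos_Ints_cases)
  hence "(g \<longlongrightarrow> g x) (at x)" by (simp add: isCont_def)
  moreover have "\<forall>\<^sub>F t in at x. g t = acoeff n t / cos (pi * t)"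
  proof -
    \<comment> \<open>Distinct zeros of cos (\<pi> t) are at distance at least 1, so x is the only
      one in this ball; the second entry keeps |t| < n + 1/2.\<close>
    define r where "r = min (1/2) (real n + 1/2 - \<bar>x\<bar>)"
    have "r > 0" using x by (simp add: r_def)
    hence "\<forall>\<^sub>F t in at x. t \<in> ball x r - {x}" by (intro eventually_at_in_open) auto
    thus ?thesis
    proof eventually_elim
      case (elim t)
      hence t: "\<bar>x - t\<bar> < 1/2" "\<bar>x - t\<bar> < real n + 1/2 - \<bar>x\<bar>" "t \<noteq> x" by (auto simp: dist_real_def r_def)
      have "cos (pi * t) \<noteq> 0"
      proof
        assume "cos (pi * t) = 0"
        then obtain j :: int where j: "2 * t = of_int j" unfolding cos_pi_eq_0_iff by blast
        have "\<bar>of_int k - of_int j :: real\<bar> < 1" using t(1) k j by linarith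
        hence "k = j" by linarith
        thus False using k j t(3) by simp
      qed
      thus ?case unfolding g_def using acoeff_over_cos_regular[of t n] t by simp
    qed
  qed
  ultimately have "((\<lambda>t. acoeff n t / cos (pi * t)) \<longlongrightarrow> g x) (at x)" by (rule Lim_transform_eventually)
  hence "Lim (at x) (\<lambda>t. acoeff n t / cos (pi * t)) = g x" by (intro tendsto_Lim) auto
  thus ?thesis using k by (auto simp: acoeff_over_cos_def g_def)
qed

lemma ahat_eq_kbound:
  assumes "\<bar>Re \<mu>\<bar> < real n + 1/2"
  shows "ahat n \<mu> = kbound n \<mu>"
proof -
  have "Gamma (real n + 1/2 + Re \<mu>) \<ge> 0" "Gamma (real n + 1/2 - Re \<mu>) \<ge> 0"
    using assms by (auto intro!: Gamma_real_nonneg)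
  thus ?thesis unfolding ahat_def acoeff_over_cos_eq[OF assms] kbound_def
      norm_mult norm_of_real abs_mult abs_divide power_abs by simp
qed

lemma norm_Gamma_le:
  assumes "Re z > 0"
  shows "norm (Gamma z) \<le> Gamma (Re z)"
proof -
  have "norm (\<integral>x. cpow x (z - 1) * exp (- of_real (1 * x)) \<partial>lpos) \<le> (\<integral>x. norm (cpow x (z - 1) * exp (- of_real (1 * x))) \<partial>lpos)"
    by (rule integral_norm_bound)
  moreover have "cpow 1 u = 1" for u by (simp add: cpow_def)
  ultimately show ?thesis
    unfolding lpos_Gamma(2)[OF assms zero_less_one] lpos_Gamma_norm(2)[OF assms zero_less_one] by simp
qed

text \<open>A gamma function in the right half-plane is bounded by its value at the real part. This
  comparison is what weakens (i) to the symmetric bound (iii).\<close>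

lemma norm_acoeff_le:
  assumes m: "\<bar>Re \<mu>\<bar> < 1/2"
  shows "norm (acoeff n \<mu>) \<le> kbound n \<mu>"
proof -
  have "norm (Gamma (of_nat n + 1/2 + \<mu>)) \<le> Gamma (real n + 1/2 + Re \<mu>)"
    "norm (Gamma (of_nat n + 1/2 - \<mu>)) \<le> Gamma (real n + 1/2 - Re \<mu>)"
    using norm_Gamma_le[of "of_nat n + 1/2 + \<mu>"] norm_Gamma_le[of "of_nat n + 1/2 - \<mu>"] m by simp_all
  moreover have "Gamma (real n + 1/2 + Re \<mu>) \<ge> 0" using m by (intro Gamma_real_nonneg) auto
  ultimately have "norm (Gamma (of_nat n + 1/2 + \<mu>)) * norm (Gamma (of_nat n + 1/2 - \<mu>)) \<le> Gamma (real n + 1/2 + Re \<mu>) * Gamma (real n + 1/2 - Re \<mu>)"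
    by (intro mult_mono) auto
  hence "norm (cos (of_real pi * \<mu>)) / pi * (norm (Gamma (of_nat n + 1/2 + \<mu>)) * norm (Gamma (of_nat n + 1/2 - \<mu>))) / (2 ^ n * fact n) \<le> kbound n \<mu>"
    unfolding kbound_def by (intro divide_right_mono mult_left_mono) auto
  moreover have "norm (acoeff n \<mu>) = norm (cos (of_real pi * \<mu>)) / pi * (norm (Gamma (of_nat n + 1/2 + \<mu>)) * norm (Gamma (of_nat n + 1/2 - \<mu>))) / (2 ^ n * fact n)"
    unfolding acoeff_def pochhammer_half[OF m, symmetric] by (simp add: norm_mult norm_divide norm_power)
  ultimately show ?thesis by simp
qed

section \<open>The remainder of a product of two expansions\<close>

definition pcoeff :: "complex \<Rightarrow> complex \<Rightarrow> complex \<Rightarrow> complex \<Rightarrow> nat \<Rightarrow> complex" where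
  "pcoeff a b x y n = (\<Sum>l\<le>n. acoeff l a * acoeff (n - l) b / (x ^ l * y ^ (n - l)))"

text \<open>The bracket of bound (i) without its cosh factors; with the roles of the two factors
  exchanged it gives bound (ii).\<close>

definition pbound :: "nat \<Rightarrow> complex \<Rightarrow> complex \<Rightarrow> real \<Rightarrow> real \<Rightarrow> real" where
  "pbound N a b r s = kbound N a * kbound 0 b / r ^ N + (\<Sum>l<N. norm (acoeff l a) * kbound (N - l) b / (r ^ l * s ^ (N - l)))"

lemma kap_product_remainder:
  assumes a: "\<bar>Re a\<bar> < real N + 1/2" and b: "\<bar>Re b\<bar> < 1/2" and x: "Re x > 0" and y: "Re y > 0"
  shows "norm (kap a x * kap b y - (\<Sum>n<N. pcoeff a b x y n)) \<le> pbound N a b (norm x) (norm y)"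
proof -
  have b': "\<bar>Re b\<bar> < real m + 1/2" for m using b by simp
  have xy: "norm x > 0" "norm y > 0" using x y by auto
  \<comment> \<open>The partial sum of the Cauchy product runs over this triangle. Sliced by l, it
    contains the expansion of the second factor truncated at order N - l, which is then rewritten as
    function minus remainder.\<close>
  have set: "{(i, j). i + j < N} = (SIGMA i:{..<N}. {..<N - i})" by auto
  have "(\<Sum>n<N. pcoeff a b x y n) = (\<Sum>l<N. \<Sum>m<N - l. (acoeff l a / x ^ l) * (acoeff m b / y ^ m))"
  proof -
    have "(\<Sum>n<N. pcoeff a b x y n) = (\<Sum>n<N. \<Sum>l\<le>n. (acoeff l a / x ^ l) * (acoeff (n - l) b / y ^ (n - l)))"
      by (simp add: pcoeff_def)
    also have "\<dots> = (\<Sum>(l, m)\<in>{(i, j). i + j < N}. (acoeff l a / x ^ l) * (acoeff m b / y ^ m))"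
      by (rule sum.triangle_reindex[symmetric])
    also have "\<dots> = (\<Sum>l<N. \<Sum>m<N - l. (acoeff l a / x ^ l) * (acoeff m b / y ^ m))"
      unfolding set by (subst sum.Sigma) auto
    finally show ?thesis .
  qed
  also have "\<dots> = (\<Sum>l<N. (acoeff l a / x ^ l) * (kap b y - krem (N - l) b y))"
  proof (intro sum.cong refl)
    fix l
    have "kap b y - krem (N - l) b y = (\<Sum>m<N - l. acoeff m b / y ^ m)" using kap_expansion[OF b' y, of "N - l"] by simp
    thus "(\<Sum>m<N - l. (acoeff l a / x ^ l) * (acoeff m b / y ^ m)) = (acoeff l a / x ^ l) * (kap b y - krem (N - l) b y)"
      by (simp only: sum_distrib_left)
  qed
  finally have S: "(\<Sum>n<N. pcoeff a b x y n) = (\<Sum>l<N. acoeff l a / x ^ l) * kap b y - (\<Sum>l<N. (acoeff l a / x ^ l) * krem (N - l) b y)"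
    by (simp add: right_diff_distrib sum_subtractf sum_distrib_right)
  \<comment> \<open>Exact error formula: the remainder of the first factor meets the full second
    factor, and the l-th coefficient meets the remainder of order N - l.\<close>
  have "kap a x * kap b y - (\<Sum>n<N. pcoeff a b x y n) = krem N a x * kap b y + (\<Sum>l<N. (acoeff l a / x ^ l) * krem (N - l) b y)"
    unfolding S kap_expansion[OF a x] by (simp add: algebra_simps)
  also have "norm \<dots> \<le> norm (krem N a x) * norm (kap b y) + (\<Sum>l<N. norm ((acoeff l a / x ^ l) * krem (N - l) b y))"
    by (rule order_trans[OF norm_triangle_ineq]) (intro add_mono norm_sum, simp add: norm_mult)
  also have "\<dots> \<le> kbound N a / norm x ^ N * kbound 0 b + (\<Sum>l<N. norm (acoeff l a) * kbound (N - l) b / (norm x ^ l * norm y ^ (N - l)))"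
  proof (intro add_mono sum_mono mult_mono)
    show "norm (krem N a x) \<le> kbound N a / norm x ^ N" by (rule krem_bound[OF x a])
    show "norm (kap b y) \<le> kbound 0 b" using krem_bound[OF y b', of 0] kap_expansion[OF b' y, of 0] by simp
    show "0 \<le> kbound N a / norm x ^ N" using kbound_nonneg[OF a] by simp
    fix l assume "l \<in> {..<N}"
    have "norm (acoeff l a) / norm x ^ l * norm (krem (N - l) b y) \<le> norm (acoeff l a) / norm x ^ l * (kbound (N - l) b / norm y ^ (N - l))"
      by (intro mult_left_mono krem_bound[OF y b']) auto
    thus "norm ((acoeff l a / x ^ l) * krem (N - l) b y) \<le> norm (acoeff l a) * kbound (N - l) b / (norm x ^ l * norm y ^ (N - l))"
      by (simp add: norm_mult norm_divide norm_power)
  qed auto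
  finally show ?thesis by (simp add: pbound_def)
qed

lemma pcoeff_commute: "pcoeff a b x y n = pcoeff b a y x n"
  unfolding pcoeff_def
  by (rule sum.reindex_bij_witness[of _ "\<lambda>l. n - l" "\<lambda>l. n - l"]) (auto simp: mult_ac)

lemma pcoeff_scale:
  assumes "s > 0"
  shows "pcoeff a b (of_real s * x) (of_real s * y) n = pcoeff a b x y n / of_real s ^ n"
  unfolding pcoeff_def sum_divide_distrib
proof (intro sum.cong refl)
  fix l assume "l \<in> {..n}"
  hence "complex_of_real s ^ n = of_real s ^ l * of_real s ^ (n - l)" by (simp flip: power_add)
  thus "acoeff l a * acoeff (n - l) b / ((of_real s * x) ^ l * (of_real s * y) ^ (n - l)) =
     acoeff l a * acoeff (n - l) b / (x ^ l * y ^ (n - l)) / of_real s ^ n"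
    by (simp add: power_mult_distrib mult_ac)
qed

lemma pbound_scale:
  assumes "s > 0"
  shows "pbound N a b (s * r) (s * t) = pbound N a b r t / s ^ N"
proof -
  have "(\<Sum>l<N. norm (acoeff l a) * kbound (N - l) b / ((s * r) ^ l * (s * t) ^ (N - l))) =
     (\<Sum>l<N. norm (acoeff l a) * kbound (N - l) b / (r ^ l * t ^ (N - l)) / s ^ N)"
  proof (intro sum.cong refl)
    fix l assume "l \<in> {..<N}"
    hence "s ^ N = s ^ l * s ^ (N - l)" by (simp flip: power_add)
    thus "norm (acoeff l a) * kbound (N - l) b / ((s * r) ^ l * (s * t) ^ (N - l)) =
      norm (acoeff l a) * kbound (N - l) b / (r ^ l * t ^ (N - l)) / s ^ N"
      by (simp add: power_mult_distrib mult_ac)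
  qed
  thus ?thesis by (simp add: pbound_def power_mult_distrib add_divide_distrib sum_divide_distrib mult_ac)
qed

text \<open>Under the Laplace integral each term c n / s^n becomes c n Gamma (\<sigma> - n + 1), and
  the error D / s^N becomes the numerator of \<open>Gfactor\<close>.\<close>

lemma Jint_remainder:
  assumes p: "0 < Re p" "Re p < 1" and A: "\<bar>Re \<alpha>\<bar> < real M + 1/2" and B: "\<bar>Re \<beta>\<bar> < real M' + 1/2"
    and N: "N = M + M'" and S: "Re \<sigma> + 1 > real N"
    and bnd: "\<And>s. s > 0 \<Longrightarrow> norm (kap \<alpha> (of_real s * (1 - p)) * kap \<beta> (of_real s * p) - (\<Sum>n<N. c n / of_real s ^ n)) \<le> D / s ^ N"
  shows "norm (Jint \<sigma> \<alpha> \<beta> p - (\<Sum>n<N. c n * Gamma (\<sigma> - of_nat n + 1))) \<le> D * Gamma (Re \<sigma> - real N + 1)"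
proof -
  define g where "g = (\<lambda>n s. c n * (cpow s ((\<sigma> - of_nat n + 1) - 1) * exp (- of_real (1 * s))))"
  have Re: "Re (\<sigma> - of_nat n + 1) > 0" if "n < N" for n using S that by simp
  have gi: "integrable lpos (g n)" if "n < N" for n
    unfolding g_def using Re[OF that] by (intro integrable_mult_right lpos_Gamma) auto
  have gI: "integral\<^sup>L lpos (g n) = c n * Gamma (\<sigma> - of_nat n + 1)" if "n < N" for n
    unfolding g_def integral_mult_right_zero using lpos_Gamma(2)[OF Re[OF that], of 1] by (simp add: cpow_def)
  have Ji: "integrable lpos (Jfun \<sigma> \<alpha> \<beta> p)" using Jfun_integrable[OF p A B] S N by simp
  have si: "integrable lpos (\<lambda>s. \<Sum>n<N. g n s)" by (intro Bochner_Integration.integrable_sum gi) auto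
  have "Jint \<sigma> \<alpha> \<beta> p - (\<Sum>n<N. c n * Gamma (\<sigma> - of_nat n + 1)) = (\<integral>s. Jfun \<sigma> \<alpha> \<beta> p s - (\<Sum>n<N. g n s) \<partial>lpos)"
    using Ji si gi gI by (simp add: Jint_def Bochner_Integration.integral_diff Bochner_Integration.integral_sum)
  also have "norm \<dots> \<le> (\<integral>s. D * (s powr ((Re \<sigma> - real N + 1) - 1) * exp (- (1 * s))) \<partial>lpos)"
  proof (rule order_trans[OF integral_norm_bound integral_mono])
    show "integrable lpos (\<lambda>s. norm (Jfun \<sigma> \<alpha> \<beta> p s - (\<Sum>n<N. g n s)))"
      by (intro integrable_norm Bochner_Integration.integrable_diff Ji si)
    show "integrable lpos (\<lambda>s. D * (s powr ((Re \<sigma> - real N + 1) - 1) * exp (- (1 * s))))"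
      using S by (intro integrable_mult_right lpos_Gamma_real) auto
    fix s assume "s \<in> space lpos"
    hence s: "s > 0" by simp
    have gs: "g n s = cpow s \<sigma> * of_real (exp (- s)) * (c n / of_real s ^ n)" for n
    proof -
      have "cpow s ((\<sigma> - of_nat n + 1) - 1) = cpow s \<sigma> / of_real s ^ n" using s by (simp add: cpow_diff cpow_of_nat)
      thus ?thesis by (simp add: g_def exp_of_real[symmetric])
    qed
    have "Jfun \<sigma> \<alpha> \<beta> p s - (\<Sum>n<N. g n s) = cpow s \<sigma> * of_real (exp (- s)) *
       (kap \<alpha> (of_real s * (1 - p)) * kap \<beta> (of_real s * p) - (\<Sum>n<N. c n / of_real s ^ n))"
      unfolding gs sum_distrib_left[symmetric] right_diff_distrib Jfun_def by (simp only: mult_ac)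
    hence "norm (Jfun \<sigma> \<alpha> \<beta> p s - (\<Sum>n<N. g n s)) = s powr Re \<sigma> * exp (- s) *
       norm (kap \<alpha> (of_real s * (1 - p)) * kap \<beta> (of_real s * p) - (\<Sum>n<N. c n / of_real s ^ n))"
      using s by (simp add: norm_mult norm_cpow)
    also have "\<dots> \<le> s powr Re \<sigma> * exp (- s) * (D / s ^ N)" by (intro mult_left_mono bnd s) auto
    also have "\<dots> = D * (s powr ((Re \<sigma> - real N + 1) - 1) * exp (- (1 * s)))"
      using s by (simp add: powr_diff powr_realpow)
    finally show "norm (Jfun \<sigma> \<alpha> \<beta> p s - (\<Sum>n<N. g n s)) \<le> D * (s powr ((Re \<sigma> - real N + 1) - 1) * exp (- (1 * s)))" .
  qed
  also have "\<dots> = D * Gamma (Re \<sigma> - real N + 1)"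
    unfolding integral_mult_right_zero using lpos_Gamma_real(2)[of "Re \<sigma> - real N + 1" 1] S by simp
  finally show ?thesis .
qed

definition ccoeff :: "real \<Rightarrow> complex \<Rightarrow> complex \<Rightarrow> real \<Rightarrow> nat \<Rightarrow> complex" where
  "ccoeff \<zeta> \<alpha> \<beta> e n = pcoeff \<alpha> \<beta> (of_real (sin \<zeta>) * cis (e * (\<zeta> - pi / 2))) (of_real (cos \<zeta>) * cis (e * \<zeta>)) n"

definition Jrem :: "nat \<Rightarrow> real \<Rightarrow> complex \<Rightarrow> complex \<Rightarrow> complex \<Rightarrow> real \<Rightarrow> complex" where
  "Jrem N \<zeta> \<sigma> \<alpha> \<beta> e = Jcut \<sigma> \<alpha> \<beta> \<zeta> e - (\<Sum>n<N. ccoeff \<zeta> \<alpha> \<beta> e n * Gamma (\<sigma> - of_nat n + 1))"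

lemma Jrem_bound_i:
  assumes z: "0 < \<zeta>" "\<zeta> < pi / 2" and e: "e \<in> {1, -1 :: real}"
    and A: "\<bar>Re \<alpha>\<bar> < real N + 1/2" and B: "\<bar>Re \<beta>\<bar> < 1/2" and S: "Re \<sigma> + 1 > real N"
  shows "norm (Jrem N \<zeta> \<sigma> \<alpha> \<beta> e) \<le> pbound N \<alpha> \<beta> (sin \<zeta>) (cos \<zeta>) * Gamma (Re \<sigma> - real N + 1)"
proof -
  have sc: "sin \<zeta> > 0" "cos \<zeta> > 0" using z by (auto intro!: sin_gt_zero cos_gt_zero)
  define p where "p = of_real (cos \<zeta>) * cis (e * \<zeta>)"
  note cp = cut_point[OF z e, folded p_def]
  have B': "\<bar>Re \<beta>\<bar> < real 0 + 1/2" using B by simp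
  show ?thesis unfolding Jrem_def Jcut_def p_def[symmetric] ccoeff_def cp(1)[symmetric]
  proof (rule Jint_remainder[OF cp(2,3) A B' _ S])
    fix s :: real assume s: "s > 0"
    have n: "norm (of_real s * (1 - p)) = s * sin \<zeta>" "norm (of_real s * p) = s * cos \<zeta>"
      using s sc unfolding cp(1) by (simp_all add: p_def norm_mult)
    show "norm (kap \<alpha> (of_real s * (1 - p)) * kap \<beta> (of_real s * p) - (\<Sum>n<N. pcoeff \<alpha> \<beta> (1 - p) p n / of_real s ^ n)) \<le> pbound N \<alpha> \<beta> (sin \<zeta>) (cos \<zeta>) / s ^ N"
      using kap_product_remainder[OF A B, of "of_real s * (1 - p)" "of_real s * p"] s cp(2,3)
      unfolding n by (simp add: pcoeff_scale pbound_scale)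
  qed simp
qed

lemma Jrem_bound_ii:
  assumes z: "0 < \<zeta>" "\<zeta> < pi / 2" and e: "e \<in> {1, -1 :: real}"
    and A: "\<bar>Re \<alpha>\<bar> < 1/2" and B: "\<bar>Re \<beta>\<bar> < real N + 1/2" and S: "Re \<sigma> + 1 > real N"
  shows "norm (Jrem N \<zeta> \<sigma> \<alpha> \<beta> e) \<le> pbound N \<beta> \<alpha> (cos \<zeta>) (sin \<zeta>) * Gamma (Re \<sigma> - real N + 1)"
proof -
  have sc: "sin \<zeta> > 0" "cos \<zeta> > 0" using z by (auto intro!: sin_gt_zero cos_gt_zero)
  define p where "p = of_real (cos \<zeta>) * cis (e * \<zeta>)"
  note cp = cut_point[OF z e, folded p_def]
  have A': "\<bar>Re \<alpha>\<bar> < real 0 + 1/2" using A by simp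
  show ?thesis unfolding Jrem_def Jcut_def p_def[symmetric] ccoeff_def cp(1)[symmetric]
  proof (rule Jint_remainder[OF cp(2,3) A' B _ S])
    fix s :: real assume s: "s > 0"
    have n: "norm (of_real s * (1 - p)) = s * sin \<zeta>" "norm (of_real s * p) = s * cos \<zeta>"
      using s sc unfolding cp(1) by (simp_all add: p_def norm_mult)
    show "norm (kap \<alpha> (of_real s * (1 - p)) * kap \<beta> (of_real s * p) - (\<Sum>n<N. pcoeff \<alpha> \<beta> (1 - p) p n / of_real s ^ n)) \<le> pbound N \<beta> \<alpha> (cos \<zeta>) (sin \<zeta>) / s ^ N"
      using kap_product_remainder[OF B A, of "of_real s * p" "of_real s * (1 - p)"] s cp(2,3)
      unfolding n pcoeff_commute[of \<alpha> \<beta>] by (simp add: pcoeff_scale pbound_scale mult.commute[of "kap \<alpha> _"])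
  qed simp
qed

lemma norm_exp_i_combination:
  assumes "norm x \<le> D" "norm y \<le> D"
  shows "norm ((exp (\<i> * \<theta>) * x + exp (- (\<i> * \<theta>)) * y) / 2) \<le> cosh (Im \<theta>) * D"
proof -
  have "norm (exp (\<i> * \<theta>) * x + exp (- (\<i> * \<theta>)) * y) \<le> exp (- Im \<theta>) * norm x + exp (Im \<theta>) * norm y"
    by (rule order_trans[OF norm_triangle_ineq]) (simp add: norm_mult norm_exp_eq_Re)
  also have "\<dots> \<le> exp (- Im \<theta>) * D + exp (Im \<theta>) * D"
    using assms by (intro add_mono mult_left_mono) auto
  finally show ?thesis by (simp add: norm_divide cosh_def field_simps)
qed

section \<open>Phases and trigonometric main terms\<close>

text \<open>The l-th powers of 1 - p and the (n - l)-th powers of p in the denominator contribute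
  the angles -l (\<zeta> - \<pi>/2) and -(n - l) \<zeta>, in total l \<pi>/2 - n \<zeta>. This is
  the shift that leads from the angle at n = l = 0 to the general \<open>zeta1\<close> and
  \<open>zeta2\<close>.\<close>

lemma ccoeff_eq:
  assumes e: "e \<in> {1, -1 :: real}"
  shows "ccoeff \<zeta> \<alpha> \<beta> e n = (\<Sum>l\<le>n. acoeff l \<alpha> * acoeff (n - l) \<beta> / (of_real (sin \<zeta>) ^ l * of_real (cos \<zeta>) ^ (n - l)) *
     exp (\<i> * of_real e * (of_nat l * (of_real pi / 2) - of_nat n * of_real \<zeta>)))"
  unfolding ccoeff_def pcoeff_def
proof (intro sum.cong refl)
  fix l assume l: "l \<in> {..n}"
  have c: "cis t ^ m = exp (\<i> * of_real t * of_nat m)" for t m by (simp add: cis_conv_exp exp_of_nat_mult[symmetric] mult_ac)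
  have e': "cis (e * (\<zeta> - pi / 2)) ^ l * cis (e * \<zeta>) ^ (n - l) = exp (- (\<i> * of_real e * (of_nat l * (of_real pi / 2) - of_nat n * of_real \<zeta>)))"
    unfolding c exp_add[symmetric] using l by (intro arg_cong[of _ _ exp]) (simp add: of_nat_diff field_simps)
  have r: "(s * c) ^ m * (t * d) ^ k = s ^ m * t ^ k * (c ^ m * d ^ k)" for s c t d :: complex and m k
    by (simp only: power_mult_distrib mult_ac)
  have q: "a / (x * exp (- t)) = a / x * exp t" for a x t :: complex
    by (simp add: exp_minus divide_inverse)
  from e' have "(of_real (sin \<zeta>) * cis (e * (\<zeta> - pi / 2))) ^ l * (of_real (cos \<zeta>) * cis (e * \<zeta>)) ^ (n - l) =
     of_real (sin \<zeta>) ^ l * of_real (cos \<zeta>) ^ (n - l) * exp (- (\<i> * of_real e * (of_nat l * (of_real pi / 2) - of_nat n * of_real \<zeta>)))"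
    by (rule trans[OF r arg_cong[of _ _ "(*) _"]])
  thus "acoeff l \<alpha> * acoeff (n - l) \<beta> / ((of_real (sin \<zeta>) * cis (e * (\<zeta> - pi / 2))) ^ l * (of_real (cos \<zeta>) * cis (e * \<zeta>)) ^ (n - l)) =
     acoeff l \<alpha> * acoeff (n - l) \<beta> / (of_real (sin \<zeta>) ^ l * of_real (cos \<zeta>) ^ (n - l)) * exp (\<i> * of_real e * (of_nat l * (of_real pi / 2) - of_nat n * of_real \<zeta>))"
    by (simp only: q)
qed

lemma ccoeff_exp:
  assumes e: "e \<in> {1, -1 :: real}"
    and Z: "\<And>l. Z l = \<theta> + of_nat l * (of_real pi / 2) - of_nat n * of_real \<zeta>"
  shows "exp (\<i> * of_real e * \<theta>) * ccoeff \<zeta> \<alpha> \<beta> e n =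
     (\<Sum>l\<le>n. acoeff l \<alpha> * acoeff (n - l) \<beta> / (of_real (sin \<zeta>) ^ l * of_real (cos \<zeta>) ^ (n - l)) * exp (\<i> * of_real e * Z l))"
  unfolding ccoeff_eq[OF e] sum_distrib_left
proof (intro sum.cong refl)
  fix l
  have "exp (\<i> * of_real e * Z l) = exp (\<i> * of_real e * \<theta>) * exp (\<i> * of_real e * (of_nat l * (of_real pi / 2) - of_nat n * of_real \<zeta>))"
    unfolding exp_add[symmetric] by (rule arg_cong[of _ _ exp]) (simp add: Z algebra_simps)
  thus "exp (\<i> * of_real e * \<theta>) * (acoeff l \<alpha> * acoeff (n - l) \<beta> / (of_real (sin \<zeta>) ^ l * of_real (cos \<zeta>) ^ (n - l)) *
      exp (\<i> * of_real e * (of_nat l * (of_real pi / 2) - of_nat n * of_real \<zeta>))) =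
     acoeff l \<alpha> * acoeff (n - l) \<beta> / (of_real (sin \<zeta>) ^ l * of_real (cos \<zeta>) ^ (n - l)) * exp (\<i> * of_real e * Z l)"
    by (simp only: mult_ac)
qed

lemma expansion_cos:
  assumes Z: "\<And>n l. Z n l = \<theta> + of_nat l * (of_real pi / 2) - of_nat n * of_real \<zeta>"
  shows "(exp (\<i> * \<theta>) * Jcut \<sigma> \<alpha> \<beta> \<zeta> 1 + exp (- (\<i> * \<theta>)) * Jcut \<sigma> \<alpha> \<beta> \<zeta> (- 1)) / 2 =
     (\<Sum>n<N. (\<Sum>l\<le>n. acoeff l \<alpha> * acoeff (n - l) \<beta> / (of_real (sin \<zeta>) ^ l * of_real (cos \<zeta>) ^ (n - l)) * cos (Z n l)) * Gamma (\<sigma> - of_nat n + 1)) +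
     (exp (\<i> * \<theta>) * Jrem N \<zeta> \<sigma> \<alpha> \<beta> 1 + exp (- (\<i> * \<theta>)) * Jrem N \<zeta> \<sigma> \<alpha> \<beta> (- 1)) / 2"
proof -
  define k where "k = (\<lambda>n l. acoeff l \<alpha> * acoeff (n - l) \<beta> / (of_real (sin \<zeta>) ^ l * of_real (cos \<zeta>) ^ (n - l)))"
  have p: "exp (\<i> * \<theta>) * ccoeff \<zeta> \<alpha> \<beta> 1 n = (\<Sum>l\<le>n. k n l * exp (\<i> * Z n l))"
    "exp (- (\<i> * \<theta>)) * ccoeff \<zeta> \<alpha> \<beta> (- 1) n = (\<Sum>l\<le>n. k n l * exp (- (\<i> * Z n l)))" for n
    using ccoeff_exp[of 1 "Z n" \<theta> n \<zeta> \<alpha> \<beta>, OF _ Z] ccoeff_exp[of "- 1" "Z n" \<theta> n \<zeta> \<alpha> \<beta>, OF _ Z] unfolding k_def by simp_all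
  have g2: "(\<Sum>l\<le>n. k l * ((E l + F l) / 2)) = ((\<Sum>l\<le>n. k l * E l) + (\<Sum>l\<le>n. k l * F l)) / 2" for n and k E F :: "nat \<Rightarrow> complex"
    by (simp add: sum.distrib[symmetric] sum_divide_distrib distrib_left)
  have c: "(\<Sum>l\<le>n. acoeff l \<alpha> * acoeff (n - l) \<beta> / (of_real (sin \<zeta>) ^ l * of_real (cos \<zeta>) ^ (n - l)) * cos (Z n l)) =
     (exp (\<i> * \<theta>) * ccoeff \<zeta> \<alpha> \<beta> 1 n + exp (- (\<i> * \<theta>)) * ccoeff \<zeta> \<alpha> \<beta> (- 1) n) / 2" for n
    unfolding p cos_exp_eq k_def by (rule g2)
  have g: "(\<Sum>n<N. (a * f n + b * h n) / 2 * G n) = (a * (\<Sum>n<N. f n * G n) + b * (\<Sum>n<N. h n * G n)) / 2"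
    for a b :: complex and f h G
    unfolding sum_distrib_left sum.distrib[symmetric] sum_divide_distrib by (intro sum.cong refl) (simp add: algebra_simps add_divide_distrib)
  have "(\<Sum>n<N. (exp (\<i> * \<theta>) * ccoeff \<zeta> \<alpha> \<beta> 1 n + exp (- (\<i> * \<theta>)) * ccoeff \<zeta> \<alpha> \<beta> (- 1) n) / 2 * Gamma (\<sigma> - of_nat n + 1)) =
     (exp (\<i> * \<theta>) * (\<Sum>n<N. ccoeff \<zeta> \<alpha> \<beta> 1 n * Gamma (\<sigma> - of_nat n + 1)) + exp (- (\<i> * \<theta>)) * (\<Sum>n<N. ccoeff \<zeta> \<alpha> \<beta> (- 1) n * Gamma (\<sigma> - of_nat n + 1))) / 2"
    by (rule g)
  moreover have "(a * u + b * v) / 2 = (a * x + b * y) / 2 + (a * (u - x) + b * (v - y)) / 2" for a b u v x y :: complex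
    by (simp add: algebra_simps add_divide_distrib diff_divide_distrib)
  ultimately show ?thesis unfolding c Jrem_def by presburger
qed

lemma exp_times_ii:
  "exp x * \<i> = exp (x + \<i> * (of_real pi / 2))" "exp x * (- \<i>) = exp (x - \<i> * (of_real pi / 2))"
proof -
  have "exp (\<i> * (of_real pi / 2)) = \<i>"
    using cis_conv_exp[of "pi / 2"] by (simp add: cis.code complex_eq_iff)
  thus "exp x * \<i> = exp (x + \<i> * (of_real pi / 2))" "exp x * (- \<i>) = exp (x - \<i> * (of_real pi / 2))"
    by (simp_all only: exp_add exp_diff) (simp add: field_simps)
qed

text \<open>The factors -i and i amount to replacing \<theta> by \<theta> - \<pi>/2, which turns
  cosines into sines.\<close>

lemma expansion_sin:
  assumes Z: "\<And>n l. Z n l = \<theta> + of_nat l * (of_real pi / 2) - of_nat n * of_real \<zeta>"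
  shows "(exp (\<i> * \<theta>) * (- \<i> * Jcut \<sigma> \<alpha> \<beta> \<zeta> 1) + exp (- (\<i> * \<theta>)) * (\<i> * Jcut \<sigma> \<alpha> \<beta> \<zeta> (- 1))) / 2 =
     (\<Sum>n<N. (\<Sum>l\<le>n. acoeff l \<alpha> * acoeff (n - l) \<beta> / (of_real (sin \<zeta>) ^ l * of_real (cos \<zeta>) ^ (n - l)) * sin (Z n l)) * Gamma (\<sigma> - of_nat n + 1)) +
     (exp (\<i> * \<theta>) * (- \<i> * Jrem N \<zeta> \<sigma> \<alpha> \<beta> 1) + exp (- (\<i> * \<theta>)) * (\<i> * Jrem N \<zeta> \<sigma> \<alpha> \<beta> (- 1))) / 2"
proof -
  define \<theta>' where "\<theta>' = \<theta> - of_real pi / 2"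
  have e: "exp (\<i> * \<theta>') = exp (\<i> * \<theta>) * (- \<i>)" "exp (- (\<i> * \<theta>')) = exp (- (\<i> * \<theta>)) * \<i>"
    unfolding exp_times_ii by (rule arg_cong[of _ _ exp]; simp add: \<theta>'_def algebra_simps)+
  have s: "sin (Z n l) = cos (Z n l - of_real pi / 2)" for n l
    by (simp add: cos_diff cos_of_real[symmetric] sin_of_real[symmetric])
  have Z': "Z n l - of_real pi / 2 = \<theta>' + of_nat l * (of_real pi / 2) - of_nat n * of_real \<zeta>" for n l
    by (simp add: Z \<theta>'_def)
  show ?thesis using expansion_cos[of "\<lambda>n l. Z n l - of_real pi / 2", OF Z'] unfolding s[symmetric] e by (simp only: mult.assoc)
qed

lemma Jcut_representations:
  fixes \<nu> \<alpha> \<beta> :: complex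
  assumes z: "0 < \<zeta>" "\<zeta> < pi / 2"
    and A: "\<bar>Re \<alpha>\<bar> < real M + 1/2" and B: "\<bar>Re \<beta>\<bar> < real M' + 1/2"
    and S: "Re (2 * \<nu> + \<alpha> + \<beta>) + 1 > real (M + M')"
  defines "\<sigma> \<equiv> 2 * \<nu> + \<alpha> + \<beta>"
  defines "w \<equiv> of_real (sin \<zeta>) powr (\<alpha> + 1/2) * of_real (cos \<zeta>) powr (\<beta> + 1/2)"
  shows "2 powr \<sigma> * Beta (\<nu> + 1) (\<nu> + \<alpha> + \<beta> + 1) * jacobi_P \<nu> \<alpha> \<beta> (of_real (cos (2 * \<zeta>))) =
      1 / w * ((exp (\<i> * theta1 \<sigma> \<alpha> \<zeta>) * Jcut \<sigma> \<alpha> \<beta> \<zeta> 1 + exp (- (\<i> * theta1 \<sigma> \<alpha> \<zeta>)) * Jcut \<sigma> \<alpha> \<beta> \<zeta> (- 1)) / 2 / Gamma (\<sigma> + 2))" (is ?P)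
    and "2 powr (\<sigma> + 1) / of_real pi * Beta (\<nu> + 1) (\<nu> + \<alpha> + \<beta> + 1) * jacobi_Q_mean \<nu> \<alpha> \<beta> (cos (2 * \<zeta>)) =
      1 / w * ((exp (\<i> * theta2 \<sigma> \<alpha> \<zeta>) * Jcut \<sigma> \<alpha> \<beta> \<zeta> 1 + exp (- (\<i> * theta2 \<sigma> \<alpha> \<zeta>)) * Jcut \<sigma> \<alpha> \<beta> \<zeta> (- 1)) / 2 / Gamma (\<sigma> + 2))" (is ?Q)
    and "2 powr (\<sigma> + 1) / of_real pi * Beta (\<nu> + 1) (\<nu> + \<alpha> + \<beta> + 1) * jacobi_Q_cut \<nu> \<alpha> \<beta> (cos (2 * \<zeta>)) =
      (- 1) / w * ((exp (\<i> * theta1 \<sigma> \<alpha> \<zeta>) * (- \<i> * Jcut \<sigma> \<alpha> \<beta> \<zeta> 1) + exp (- (\<i> * theta1 \<sigma> \<alpha> \<zeta>)) * (\<i> * Jcut \<sigma> \<alpha> \<beta> \<zeta> (- 1))) / 2 / Gamma (\<sigma> + 2))" (is ?C)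
proof -
  note pos = params_pos[OF A B S]
  have sc: "sin \<zeta> > 0" "cos \<zeta> > 0" using z by (auto intro!: sin_gt_zero cos_gt_zero)
  have w: "w = cpow (sin \<zeta>) (\<alpha> + 1/2) * cpow (cos \<zeta>) (\<beta> + 1/2)" unfolding w_def using sc by (simp add: cpow_powr)
  have w0: "w \<noteq> 0" by (simp add: w)
  have two: "2 powr u = cpow 2 u" for u using cpow_powr[of 2 u] by simp
  have Beta: "Beta (\<nu> + 1) (\<nu> + \<alpha> + \<beta> + 1) = Gamma (\<nu> + 1) * Gamma (\<nu> + \<alpha> + \<beta> + 1) / Gamma (\<sigma> + 2)"
  proof -
    have "\<nu> + 1 + (\<nu> + \<alpha> + \<beta> + 1) = \<sigma> + 2" by (simp add: \<sigma>_def)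
    hence "Beta (\<nu> + 1) (\<nu> + \<alpha> + \<beta> + 1) = Gamma (\<nu> + 1) * Gamma (\<nu> + \<alpha> + \<beta> + 1) * rGamma (\<sigma> + 2)"
      unfolding Beta_altdef by (simp only:)
    thus ?thesis by (simp only: rGamma_inverse_Gamma divide_inverse)
  qed
  have G: "Gamma (\<nu> + 1) \<noteq> 0" "Gamma (\<nu> + \<alpha> + \<beta> + 1) \<noteq> 0" "Gamma (\<sigma> + 2) \<noteq> 0"
    using pos unfolding \<sigma>_def by (auto intro!: Gamma_Re_pos_nonzero)
  show ?P
  proof -
    have arg: "(1 - complex_of_real (cos (2 * \<zeta>))) / 2 = of_real ((sin \<zeta>)\<^sup>2)" by (simp add: cos_double_sin)
    have par: "(\<sigma> + \<alpha> - \<beta>) / 2 + 1 = \<nu> + \<alpha> + 1" "(\<sigma> + \<alpha> + \<beta>) / 2 + 1 = \<nu> + \<alpha> + \<beta> + 1" "(\<sigma> - \<alpha> - \<beta>) / 2 = \<nu>"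
      by (simp_all add: \<sigma>_def field_simps)
    have cancel: "a * b * p * h * s * t = n * b * p * (a * rGamma (\<nu> + 1) * h) * (s * t)" if "n * rGamma (\<nu> + 1) = 1" for a b p h s t n
    proof -
      have "n * b * p * (a * rGamma (\<nu> + 1) * h) * (s * t) = n * rGamma (\<nu> + 1) * (a * b * p * h * s * t)" by (simp only: mult_ac)
      thus ?thesis by (simp only: that mult_1)
    qed
    have "Pside \<zeta> \<sigma> \<alpha> \<beta> = Gamma (\<nu> + 1) * Gamma (\<nu> + \<alpha> + \<beta> + 1) * cpow 2 \<sigma> * jacobi_P \<nu> \<alpha> \<beta> (of_real (cos (2 * \<zeta>))) * w"
      unfolding Pside_def jacobi_P_def w par arg by (rule cancel) (simp add: rGamma_inverse_Gamma G)
    hence "2 powr \<sigma> * Beta (\<nu> + 1) (\<nu> + \<alpha> + \<beta> + 1) * jacobi_P \<nu> \<alpha> \<beta> (of_real (cos (2 * \<zeta>))) = 1 / w * (Pside \<zeta> \<sigma> \<alpha> \<beta> / Gamma (\<sigma> + 2))"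
      unfolding two Beta using w0 by (simp add: field_simps)
    thus ?thesis using Jside_eq_Pside[OF z A B S] unfolding Jside_def \<sigma>_def[symmetric] by simp
  qed
  define Q where "Q = (\<lambda>e. exp (- \<i> * of_real e * theta2 \<sigma> \<alpha> \<zeta>) * Jcut \<sigma> \<alpha> \<beta> \<zeta> (- e) / (2 * Jconst \<nu> \<alpha> \<beta> * w))"
  have lim: "((\<lambda>\<eta>. jacobi_Q \<nu> \<alpha> \<beta> (of_real (cos (2 * \<zeta>)) + \<i> * of_real \<eta>)) \<longlongrightarrow> Q 1) (at_right 0)"
    "((\<lambda>\<eta>. jacobi_Q \<nu> \<alpha> \<beta> (of_real (cos (2 * \<zeta>)) - \<i> * of_real \<eta>)) \<longlongrightarrow> Q (- 1)) (at_right 0)"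
    using jacobi_Q_limit[OF z _ A B S, of 1] jacobi_Q_limit[OF z _ A B S, of "- 1"]
    unfolding Q_def \<sigma>_def[symmetric] w by (simp_all add: mult.assoc)
  have J: "2 powr (\<sigma> + 1) / of_real pi * Beta (\<nu> + 1) (\<nu> + \<alpha> + \<beta> + 1) * (1 / 2 * (u / (2 * Jconst \<nu> \<alpha> \<beta> * w))) = 1 / w * (u / 2 / Gamma (\<sigma> + 2))" for u
  proof -
    have "2 powr (\<sigma> + 1) / of_real pi * Beta (\<nu> + 1) (\<nu> + \<alpha> + \<beta> + 1) = 2 * Jconst \<nu> \<alpha> \<beta> / Gamma (\<sigma> + 2)"
      unfolding two Beta Jconst_def \<sigma>_def[symmetric] cpow_add by simp
    thus ?thesis using Jconst_nonzero[OF pos(4,1)] by (simp add: field_simps)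
  qed
  have "jacobi_Q_mean \<nu> \<alpha> \<beta> (cos (2 * \<zeta>)) = 1 / 2 * (Q 1 + Q (- 1))"
    unfolding jacobi_Q_mean_def by (intro tendsto_Lim tendsto_mult tendsto_const tendsto_add lim) simp
  also have "Q 1 + Q (- 1) = (exp (\<i> * theta2 \<sigma> \<alpha> \<zeta>) * Jcut \<sigma> \<alpha> \<beta> \<zeta> 1 + exp (- (\<i> * theta2 \<sigma> \<alpha> \<zeta>)) * Jcut \<sigma> \<alpha> \<beta> \<zeta> (- 1)) / (2 * Jconst \<nu> \<alpha> \<beta> * w)"
    by (simp add: Q_def add_divide_distrib)
  finally show ?Q by (simp only: J)
  have "jacobi_Q_cut \<nu> \<alpha> \<beta> (cos (2 * \<zeta>)) = 1 / 2 * (exp (of_real pi * \<alpha> * \<i>) * Q 1 + exp (- (of_real pi * \<alpha> * \<i>)) * Q (- 1))"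
    unfolding jacobi_Q_cut_def by (intro tendsto_Lim tendsto_mult tendsto_const tendsto_add lim) simp
  also have "exp (of_real pi * \<alpha> * \<i>) * Q 1 = (exp (- (\<i> * theta1 \<sigma> \<alpha> \<zeta>)) * (- \<i> * Jcut \<sigma> \<alpha> \<beta> \<zeta> (- 1))) / (2 * Jconst \<nu> \<alpha> \<beta> * w)"
  proof -
    \<comment> \<open>Since \<open>theta2\<close> - \<open>theta1\<close> = (\<alpha> + 1/2) \<pi>,
      the weight e^(i \<pi> \<alpha>) converts one angle into the other up to a right angle. This
      explains why the two associated functions involve different angles.\<close>
    have "exp (of_real pi * \<alpha> * \<i>) * exp (- \<i> * of_real 1 * theta2 \<sigma> \<alpha> \<zeta>) = exp (- (\<i> * theta1 \<sigma> \<alpha> \<zeta>)) * (- \<i>)"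
      unfolding exp_times_ii exp_add[symmetric] by (rule arg_cong[of _ _ exp]) (simp add: theta1_def theta2_def field_simps)
    thus ?thesis unfolding Q_def times_divide_eq_right mult.assoc[symmetric] by simp
  qed
  also have "exp (- (of_real pi * \<alpha> * \<i>)) * Q (- 1) = (exp (\<i> * theta1 \<sigma> \<alpha> \<zeta>) * (\<i> * Jcut \<sigma> \<alpha> \<beta> \<zeta> 1)) / (2 * Jconst \<nu> \<alpha> \<beta> * w)"
  proof -
    have "exp (- (of_real pi * \<alpha> * \<i>)) * exp (- \<i> * of_real (- 1) * theta2 \<sigma> \<alpha> \<zeta>) = exp (\<i> * theta1 \<sigma> \<alpha> \<zeta>) * \<i>"
      unfolding exp_times_ii exp_add[symmetric] by (rule arg_cong[of _ _ exp]) (simp add: theta1_def theta2_def field_simps)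
    thus ?thesis unfolding Q_def times_divide_eq_right mult.assoc[symmetric] by simp
  qed
  finally have "jacobi_Q_cut \<nu> \<alpha> \<beta> (cos (2 * \<zeta>)) = 1 / 2 * ((exp (- (\<i> * theta1 \<sigma> \<alpha> \<zeta>)) * (- \<i> * Jcut \<sigma> \<alpha> \<beta> \<zeta> (- 1)) +
      exp (\<i> * theta1 \<sigma> \<alpha> \<zeta>) * (\<i> * Jcut \<sigma> \<alpha> \<beta> \<zeta> 1)) / (2 * Jconst \<nu> \<alpha> \<beta> * w))"
    by (simp only: add_divide_distrib)
  hence "2 powr (\<sigma> + 1) / of_real pi * Beta (\<nu> + 1) (\<nu> + \<alpha> + \<beta> + 1) * jacobi_Q_cut \<nu> \<alpha> \<beta> (cos (2 * \<zeta>)) =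
     1 / w * ((exp (- (\<i> * theta1 \<sigma> \<alpha> \<zeta>)) * (- \<i> * Jcut \<sigma> \<alpha> \<beta> \<zeta> (- 1)) + exp (\<i> * theta1 \<sigma> \<alpha> \<zeta>) * (\<i> * Jcut \<sigma> \<alpha> \<beta> \<zeta> 1)) / 2 / Gamma (\<sigma> + 2))"
    by (simp only: J)
  also have "1 / w * ((a * (- \<i> * x) + b * (\<i> * y)) / 2 / g) = (- 1) / w * ((b * (- \<i> * y) + a * (\<i> * x)) / 2 / g)" for a b x y g
  proof -
    have "b * (- \<i> * y) + a * (\<i> * x) = - (a * (- \<i> * x) + b * (\<i> * y))" by simp
    thus ?thesis by (simp only: minus_divide_left[symmetric] mult_minus_left mult_minus_right minus_minus)
  qed
  finally show ?C .
qed

section \<open>Assembly of the bounds\<close>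

lemma remainder_eq:
  fixes w g x y :: complex
  assumes "w \<noteq> 0" "c \<noteq> 0" "c / w * (x / g) = c / w * ((\<Sum>n<N. f n * (h n / g)) + R)" and "x = (\<Sum>n<N. f n * h n) + y"
  shows "R = y / g"
proof -
  have "c / w \<noteq> 0" using assms(1,2) by simp
  hence "x / g = (\<Sum>n<N. f n * (h n / g)) + R" using assms(3) by (rule iffD1[OF mult_left_cancel])
  moreover have "(\<Sum>n<N. f n * (h n / g)) = (\<Sum>n<N. f n * h n) / g" by (simp add: sum_divide_distrib)
  ultimately show ?thesis using assms(4) by (simp add: add_divide_distrib)
qed

lemma zeta1_theta: "zeta1 \<alpha> \<beta> \<zeta> \<nu> n l = theta1 (2 * \<nu> + \<alpha> + \<beta>) \<alpha> \<zeta> + of_nat l * (of_real pi / 2) - of_nat n * of_real \<zeta>"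
  by (simp add: zeta1_def theta1_def algebra_simps)

lemma zeta2_theta: "zeta2 \<alpha> \<beta> \<zeta> \<nu> n l = theta2 (2 * \<nu> + \<alpha> + \<beta>) \<alpha> \<zeta> + of_nat l * (of_real pi / 2) - of_nat n * of_real \<zeta>"
  by (simp add: zeta2_def theta2_def algebra_simps)

text \<open>The indices n and l shift the angles by real amounts only, so a single cosh factor can
  be taken out of each bound.\<close>

lemma Im_zeta:
  "Im (zeta1 \<alpha> \<beta> \<zeta> \<nu> n l) = Im (theta1 (2 * \<nu> + \<alpha> + \<beta>) \<alpha> \<zeta>)"
  "Im (zeta2 \<alpha> \<beta> \<zeta> \<nu> n l) = Im (theta2 (2 * \<nu> + \<alpha> + \<beta>) \<alpha> \<zeta>)"
  unfolding zeta1_theta zeta2_theta by simp_all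

lemma bound_i_eq:
  assumes A: "\<bar>Re \<alpha>\<bar> < real N + 1/2" and B: "\<bar>Re \<beta>\<bar> < 1/2" and Z: "\<And>l. Im (Z l) = t"
  shows "bound_i N \<nu> \<alpha> \<beta> \<zeta> Z = cosh t * (pbound N \<alpha> \<beta> (sin \<zeta>) (cos \<zeta>) * Gamma (Re (2 * \<nu> + \<alpha> + \<beta>) - real N + 1)) / norm (Gamma (2 * \<nu> + \<alpha> + \<beta> + 2))"
proof -
  have h: "ahat N \<alpha> = kbound N \<alpha>" "ahat m \<beta> = kbound m \<beta>" for m using A B by (simp_all add: ahat_eq_kbound)
  show ?thesis unfolding bound_i_def Gfactor_def pbound_def Z h sum_distrib_right[symmetric]
    by (simp add: ring_distribs add_divide_distrib mult_ac)
qed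

lemma bound_ii_eq:
  assumes A: "\<bar>Re \<alpha>\<bar> < 1/2" and B: "\<bar>Re \<beta>\<bar> < real N + 1/2" and Z: "\<And>l. Im (Z l) = t"
  shows "bound_ii N \<nu> \<alpha> \<beta> \<zeta> Z = cosh t * (pbound N \<beta> \<alpha> (cos \<zeta>) (sin \<zeta>) * Gamma (Re (2 * \<nu> + \<alpha> + \<beta>) - real N + 1)) / norm (Gamma (2 * \<nu> + \<alpha> + \<beta> + 2))"
proof -
  have h: "ahat N \<beta> = kbound N \<beta>" "ahat m \<alpha> = kbound m \<alpha>" for m using A B by (simp_all add: ahat_eq_kbound)
  have "(\<Sum>l=1..N. kbound l \<alpha> * norm (acoeff (N - l) \<beta>) / (sin \<zeta> ^ l * cos \<zeta> ^ (N - l))) =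
     (\<Sum>l<N. norm (acoeff l \<beta>) * kbound (N - l) \<alpha> / (cos \<zeta> ^ l * sin \<zeta> ^ (N - l)))"
    by (rule sum.reindex_bij_witness[of _ "\<lambda>l. N - l" "\<lambda>l. N - l"]) (auto simp: mult_ac)
  thus ?thesis unfolding bound_ii_def Gfactor_def pbound_def Z h sum_distrib_right[symmetric]
    by (simp add: ring_distribs add_divide_distrib mult_ac)
qed

lemma bound_i_le_bound_iii:
  assumes z: "0 < \<zeta>" "\<zeta> < pi / 2" and A: "\<bar>Re \<alpha>\<bar> < 1/2" and B: "\<bar>Re \<beta>\<bar> < 1/2"
    and S: "Re (2 * \<nu> + \<alpha> + \<beta> + 1) > real N"
  shows "bound_i N \<nu> \<alpha> \<beta> \<zeta> Z \<le> bound_iii N \<nu> \<alpha> \<beta> \<zeta> Z"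
proof -
  have sc: "sin \<zeta> > 0" "cos \<zeta> > 0" using z by (auto intro!: sin_gt_zero cos_gt_zero)
  have h: "ahat m \<alpha> = kbound m \<alpha>" "ahat m \<beta> = kbound m \<beta>" for m using A B by (simp_all add: ahat_eq_kbound)
  have k: "kbound m \<beta> \<ge> 0" for m using B by (intro kbound_nonneg) simp
  have "Gfactor N (2 * \<nu> + \<alpha> + \<beta>) \<ge> 0" unfolding Gfactor_def using S by (intro divide_nonneg_nonneg Gamma_real_nonneg) auto
  moreover have "(\<Sum>l\<le>N. ahat l \<alpha> * ahat (N - l) \<beta> / (sin \<zeta> ^ l * cos \<zeta> ^ (N - l)) * cosh (Im (Z l))) =
     ahat N \<alpha> * ahat 0 \<beta> / sin \<zeta> ^ N * cosh (Im (Z N)) + (\<Sum>l<N. ahat l \<alpha> * ahat (N - l) \<beta> / (sin \<zeta> ^ l * cos \<zeta> ^ (N - l)) * cosh (Im (Z l)))"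
    unfolding lessThan_Suc_atMost[symmetric] by simp
  moreover have "(\<Sum>l<N. norm (acoeff l \<alpha>) * ahat (N - l) \<beta> / (sin \<zeta> ^ l * cos \<zeta> ^ (N - l)) * cosh (Im (Z l))) \<le>
     (\<Sum>l<N. ahat l \<alpha> * ahat (N - l) \<beta> / (sin \<zeta> ^ l * cos \<zeta> ^ (N - l)) * cosh (Im (Z l)))"
    unfolding h using sc k A by (intro sum_mono mult_right_mono divide_right_mono norm_acoeff_le) auto
  ultimately show ?thesis unfolding bound_i_def bound_iii_def by (intro mult_right_mono) auto
qed

theorem theorem2p3:
  fixes \<zeta> :: real and N :: nat and \<nu> \<alpha> \<beta> \<sigma> RP RQmean RQcut :: complex
  assumes zeta: "0 < \<zeta>" "\<zeta> < pi / 2"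
    and re: "Re (2 * \<nu> + \<alpha> + \<beta> + 1) > real N"
    and sigma: "\<sigma> = 2 * \<nu> + \<alpha> + \<beta>"
    and RP: "2 powr \<sigma> * Beta (\<nu> + 1) (\<nu> + \<alpha> + \<beta> + 1) * jacobi_P \<nu> \<alpha> \<beta> (of_real (cos (2 * \<zeta>))) =
            1 / (of_real (sin \<zeta>) powr (\<alpha> + 1 / 2) * of_real (cos \<zeta>) powr (\<beta> + 1 / 2)) *
            ((\<Sum>n<N. (\<Sum>l\<le>n. acoeff l \<alpha> * acoeff (n - l) \<beta> /
                  (of_real (sin \<zeta>) ^ l * of_real (cos \<zeta>) ^ (n - l)) * cos (zeta1 \<alpha> \<beta> \<zeta> \<nu> n l)) *
                (Gamma (\<sigma> - of_nat n + 1) / Gamma (\<sigma> + 2))) + RP)"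
    and RQmean: "2 powr (\<sigma> + 1) / of_real pi * Beta (\<nu> + 1) (\<nu> + \<alpha> + \<beta> + 1) * jacobi_Q_mean \<nu> \<alpha> \<beta> (cos (2 * \<zeta>)) =
            1 / (of_real (sin \<zeta>) powr (\<alpha> + 1 / 2) * of_real (cos \<zeta>) powr (\<beta> + 1 / 2)) *
            ((\<Sum>n<N. (\<Sum>l\<le>n. acoeff l \<alpha> * acoeff (n - l) \<beta> /
                  (of_real (sin \<zeta>) ^ l * of_real (cos \<zeta>) ^ (n - l)) * cos (zeta2 \<alpha> \<beta> \<zeta> \<nu> n l)) *
                (Gamma (\<sigma> - of_nat n + 1) / Gamma (\<sigma> + 2))) + RQmean)"
    and RQcut: "2 powr (\<sigma> + 1) / of_real pi * Beta (\<nu> + 1) (\<nu> + \<alpha> + \<beta> + 1) * jacobi_Q_cut \<nu> \<alpha> \<beta> (cos (2 * \<zeta>)) =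
            (- 1) / (of_real (sin \<zeta>) powr (\<alpha> + 1 / 2) * of_real (cos \<zeta>) powr (\<beta> + 1 / 2)) *
            ((\<Sum>n<N. (\<Sum>l\<le>n. acoeff l \<alpha> * acoeff (n - l) \<beta> /
                  (of_real (sin \<zeta>) ^ l * of_real (cos \<zeta>) ^ (n - l)) * sin (zeta1 \<alpha> \<beta> \<zeta> \<nu> n l)) *
                (Gamma (\<sigma> - of_nat n + 1) / Gamma (\<sigma> + 2))) + RQcut)"
  shows
    "(\<bar>Re \<alpha>\<bar> < real N + 1 / 2 \<and> \<bar>Re \<beta>\<bar> < 1 / 2 \<longrightarrow>
         norm RP \<le> bound_i N \<nu> \<alpha> \<beta> \<zeta> (zeta1 \<alpha> \<beta> \<zeta> \<nu> N) \<and>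
         norm RQcut \<le> bound_i N \<nu> \<alpha> \<beta> \<zeta> (zeta1 \<alpha> \<beta> \<zeta> \<nu> N) \<and>
         norm RQmean \<le> bound_i N \<nu> \<alpha> \<beta> \<zeta> (zeta2 \<alpha> \<beta> \<zeta> \<nu> N)) \<and>
     (\<bar>Re \<alpha>\<bar> < 1 / 2 \<and> \<bar>Re \<beta>\<bar> < real N + 1 / 2 \<longrightarrow>
         norm RP \<le> bound_ii N \<nu> \<alpha> \<beta> \<zeta> (zeta1 \<alpha> \<beta> \<zeta> \<nu> N) \<and>
         norm RQcut \<le> bound_ii N \<nu> \<alpha> \<beta> \<zeta> (zeta1 \<alpha> \<beta> \<zeta> \<nu> N) \<and>
         norm RQmean \<le> bound_ii N \<nu> \<alpha> \<beta> \<zeta> (zeta2 \<alpha> \<beta> \<zeta> \<nu> N)) \<and>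
     (\<bar>Re \<alpha>\<bar> < 1 / 2 \<and> \<bar>Re \<beta>\<bar> < 1 / 2 \<longrightarrow>
         norm RP \<le> bound_iii N \<nu> \<alpha> \<beta> \<zeta> (zeta1 \<alpha> \<beta> \<zeta> \<nu> N) \<and>
         norm RQcut \<le> bound_iii N \<nu> \<alpha> \<beta> \<zeta> (zeta1 \<alpha> \<beta> \<zeta> \<nu> N) \<and>
         norm RQmean \<le> bound_iii N \<nu> \<alpha> \<beta> \<zeta> (zeta2 \<alpha> \<beta> \<zeta> \<nu> N))"
proof -
  have sc: "sin \<zeta> > 0" "cos \<zeta> > 0" using zeta by (auto intro!: sin_gt_zero cos_gt_zero)
  let ?w = "of_real (sin \<zeta>) powr (\<alpha> + 1/2) * of_real (cos \<zeta>) powr (\<beta> + 1/2)"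
  have w: "?w \<noteq> 0" using sc by (simp add: powr_def)
  let ?R = "\<lambda>\<theta> x y. (exp (\<i> * \<theta>) * x + exp (- (\<i> * \<theta>)) * y) / 2 / Gamma (\<sigma> + 2)"
  \<comment> \<open>Stated for any splitting N = M + M', so that (N, 0) serves case (i) and (0, N)
    case (ii). The remainders are determined by their defining equations because the trigonometric
    weight does not vanish.\<close>
  have R: "RP = ?R (theta1 \<sigma> \<alpha> \<zeta>) (Jrem N \<zeta> \<sigma> \<alpha> \<beta> 1) (Jrem N \<zeta> \<sigma> \<alpha> \<beta> (- 1))"
      "RQmean = ?R (theta2 \<sigma> \<alpha> \<zeta>) (Jrem N \<zeta> \<sigma> \<alpha> \<beta> 1) (Jrem N \<zeta> \<sigma> \<alpha> \<beta> (- 1))"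
      "RQcut = ?R (theta1 \<sigma> \<alpha> \<zeta>) (- \<i> * Jrem N \<zeta> \<sigma> \<alpha> \<beta> 1) (\<i> * Jrem N \<zeta> \<sigma> \<alpha> \<beta> (- 1))"
    if "\<bar>Re \<alpha>\<bar> < real M + 1/2" "\<bar>Re \<beta>\<bar> < real M' + 1/2" "M + M' = N" for M M'
  proof -
    have S: "Re (2 * \<nu> + \<alpha> + \<beta>) + 1 > real (M + M')" using re that(3) by simp
    note rep = Jcut_representations[OF zeta that(1,2) S, folded sigma]
    show "RP = ?R (theta1 \<sigma> \<alpha> \<zeta>) (Jrem N \<zeta> \<sigma> \<alpha> \<beta> 1) (Jrem N \<zeta> \<sigma> \<alpha> \<beta> (- 1))"
      by (rule remainder_eq[OF w one_neq_zero trans[OF rep(1)[symmetric] RP]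
            expansion_cos[OF zeta1_theta[of \<alpha> \<beta> \<zeta> \<nu>, folded sigma]]])
    show "RQmean = ?R (theta2 \<sigma> \<alpha> \<zeta>) (Jrem N \<zeta> \<sigma> \<alpha> \<beta> 1) (Jrem N \<zeta> \<sigma> \<alpha> \<beta> (- 1))"
      by (rule remainder_eq[OF w one_neq_zero trans[OF rep(2)[symmetric] RQmean]
            expansion_cos[OF zeta2_theta[of \<alpha> \<beta> \<zeta> \<nu>, folded sigma]]])
    show "RQcut = ?R (theta1 \<sigma> \<alpha> \<zeta>) (- \<i> * Jrem N \<zeta> \<sigma> \<alpha> \<beta> 1) (\<i> * Jrem N \<zeta> \<sigma> \<alpha> \<beta> (- 1))"
      by (rule remainder_eq[OF w _ trans[OF rep(3)[symmetric] RQcut]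
            expansion_sin[OF zeta1_theta[of \<alpha> \<beta> \<zeta> \<nu>, folded sigma]]]) simp
  qed
  have bnd: "norm (?R \<theta> x y) \<le> cosh (Im \<theta>) * D / norm (Gamma (\<sigma> + 2))" if "norm x \<le> D" "norm y \<le> D" for \<theta> x y D
    unfolding norm_divide[of _ "Gamma _"] using norm_exp_i_combination[OF that] by (rule divide_right_mono) simp
  have S: "Re \<sigma> + 1 > real N" using re by (simp add: sigma)
  have i: "norm RP \<le> bound_i N \<nu> \<alpha> \<beta> \<zeta> (zeta1 \<alpha> \<beta> \<zeta> \<nu> N) \<and>
         norm RQcut \<le> bound_i N \<nu> \<alpha> \<beta> \<zeta> (zeta1 \<alpha> \<beta> \<zeta> \<nu> N) \<and>
         norm RQmean \<le> bound_i N \<nu> \<alpha> \<beta> \<zeta> (zeta2 \<alpha> \<beta> \<zeta> \<nu> N)"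
    if A: "\<bar>Re \<alpha>\<bar> < real N + 1/2" and B: "\<bar>Re \<beta>\<bar> < 1/2"
  proof -
    have J: "norm (Jrem N \<zeta> \<sigma> \<alpha> \<beta> 1) \<le> pbound N \<alpha> \<beta> (sin \<zeta>) (cos \<zeta>) * Gamma (Re \<sigma> - real N + 1)"
      "norm (Jrem N \<zeta> \<sigma> \<alpha> \<beta> (- 1)) \<le> pbound N \<alpha> \<beta> (sin \<zeta>) (cos \<zeta>) * Gamma (Re \<sigma> - real N + 1)"
      by (intro Jrem_bound_i zeta A B S; simp)+
    have B0: "\<bar>Re \<beta>\<bar> < real 0 + 1/2" using B by simp
    show ?thesis
      unfolding bound_i_eq[OF A B Im_zeta(1)] bound_i_eq[OF A B Im_zeta(2)] R[OF A B0 add_0_right] sigma[symmetric]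
      by (intro conjI bnd J) (use J in \<open>simp_all add: norm_mult\<close>)
  qed
  have ii: "norm RP \<le> bound_ii N \<nu> \<alpha> \<beta> \<zeta> (zeta1 \<alpha> \<beta> \<zeta> \<nu> N) \<and>
         norm RQcut \<le> bound_ii N \<nu> \<alpha> \<beta> \<zeta> (zeta1 \<alpha> \<beta> \<zeta> \<nu> N) \<and>
         norm RQmean \<le> bound_ii N \<nu> \<alpha> \<beta> \<zeta> (zeta2 \<alpha> \<beta> \<zeta> \<nu> N)"
    if A: "\<bar>Re \<alpha>\<bar> < 1/2" and B: "\<bar>Re \<beta>\<bar> < real N + 1/2"
  proof -
    have J: "norm (Jrem N \<zeta> \<sigma> \<alpha> \<beta> 1) \<le> pbound N \<beta> \<alpha> (cos \<zeta>) (sin \<zeta>) * Gamma (Re \<sigma> - real N + 1)"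
      "norm (Jrem N \<zeta> \<sigma> \<alpha> \<beta> (- 1)) \<le> pbound N \<beta> \<alpha> (cos \<zeta>) (sin \<zeta>) * Gamma (Re \<sigma> - real N + 1)"
      by (intro Jrem_bound_ii zeta A B S; simp)+
    have A0: "\<bar>Re \<alpha>\<bar> < real 0 + 1/2" using A by simp
    show ?thesis
      unfolding bound_ii_eq[OF A B Im_zeta(1)] bound_ii_eq[OF A B Im_zeta(2)] R[OF A0 B add_0_left] sigma[symmetric]
      by (intro conjI bnd J) (use J in \<open>simp_all add: norm_mult\<close>)
  qed
  have iii: "norm RP \<le> bound_iii N \<nu> \<alpha> \<beta> \<zeta> (zeta1 \<alpha> \<beta> \<zeta> \<nu> N) \<and>
         norm RQcut \<le> bound_iii N \<nu> \<alpha> \<beta> \<zeta> (zeta1 \<alpha> \<beta> \<zeta> \<nu> N) \<and>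
         norm RQmean \<le> bound_iii N \<nu> \<alpha> \<beta> \<zeta> (zeta2 \<alpha> \<beta> \<zeta> \<nu> N)"
    if A: "\<bar>Re \<alpha>\<bar> < 1/2" and B: "\<bar>Re \<beta>\<bar> < 1/2"
  proof -
    have "\<bar>Re \<alpha>\<bar> < real N + 1/2" using A by simp
    from i[OF this B] show ?thesis
      using bound_i_le_bound_iii[OF zeta A B re, of "zeta1 \<alpha> \<beta> \<zeta> \<nu> N"] bound_i_le_bound_iii[OF zeta A B re, of "zeta2 \<alpha> \<beta> \<zeta> \<nu> N"]
      by linarith
  qed
  show ?thesis using i ii iii by blast
qed

end
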